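(* Let $\mathcal G$ be either of the two sets $\mathcal G^{(1)},\mathcal G^{(2)}$ defined in the context. For all $d,v\in\mathbb Z^n$, all $\sigma\in W$ and all $(m,\lambda)\in\mathbb Z^n\times\mathbb C^n$ such that $(v,m,\lambda)\in\mathcal G$, there exists an isomorphism of algebraic varieties $$\Phi^{d,v}_{\sigma,m,\lambda}: M_{m,\lambda}(d,v)\longrightarrow M_{\sigma m,\sigma\lambda}(\sigma(d,v)),$$ and these isomorphisms satisfy $$\Phi^{\sigma(d,v)}_{\tau,\sigma m,\sigma\lambda}\circ\Phi^{d,v}_{\sigma,m,\lambda}=\Phi^{d,v}_{\tau\sigma,m,\lambda}$$ for all $\sigma,\tau\in W$.
   Context: **Quiver.** $I=\{1,\dots,n\}$ is a finite set of vertices, $H$ a finite set of arrows, with source and target maps $h\mapsto h_0,h_1$ such that $h_0\ne h_1$; there is a fixed-point-free involution $h\mapsto\bar h$ of $H$ with $\bar h_0=h_1$, $\bar h_1=h_0$, and $\varepsilon:H\to\{\pm1\}$ with $\varepsilon(\bar h)=-\varepsilon(h)$. $a_{ij}=\#\{h:h_0=i,h_1=j\}$ and $C=(c_{ij})=2\,\mathrm{Id}-(a_{ij})$. **Root datum and Weyl group.** $X,X^\vee$ are free abelian groups of rank $2n-\mathrm{rank}\,C$ in perfect duality $\langle\,,\rangle$, with linearly independent sets $\{\alpha_i\}\subset X$, $\{\alpha_i^\vee\}\subset X^\vee$, $\{\omega_i\}\subset X$ ($i\in I$) with $\langle\alpha_i,\alpha_j^\vee\rangle=c_{ij}$, $\langle\omega_i,\alpha_j^\vee\rangle=\delta_{ij}$.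 $Q,Q^\vee$ are the spans of the $\alpha_i$, resp. $\alpha_i^\vee$. $W\subset \mathrm{Aut}(X)$ is generated by $s_i(x)=x-\langle x,\alpha_i^\vee\rangle\alpha_i$; the dual action is $s_i(y)=y-\langle\alpha_i,y\rangle\alpha_i^\vee$. $P=X/\{x:\langle x,Q^\vee\rangle=0\}$, with basis the images $\bar\omega_i$. Identify $m\in\mathbb Z^n$ with $\sum m_i\bar\omega_i\in P$ and $\lambda\in\mathbb C^n$ with $\sum\lambda_i\bar\omega_i\in P\otimes\mathbb C$; so $W$ acts on $m$ and $\lambda$, with $(s_i\lambda)_j=\lambda_j-c_{ij}\lambda_i$. Identify $d$ with $\sum d_i\omega_i\in X$, $v$ with $\sum v_i\alpha_i\in Q$, and put $\sigma\cdot v=\sigma(v-d)+d\in Q$, $\sigma(d,v)=(d,\sigma\cdot v)$. An element $u=(u_i)\in\mathbb Z^n$ is identified with $\sum u_i\alpha_i^\vee\in Q^\vee$, so $\langle\lambda,u\rangle=\sum\lambda_iu_i$. **Quiver varieties.** For $d,v\in\mathbb N^n$ fix complex vector spaces $D_i,V_i$ of dimensions $d_i,v_i$ and let $S(d,v)=\bigoplus_i\mathrm{Hom}(D_i,V_i)\oplus\bigoplus_i\mathrm{Hom}(V_i,D_i)\oplus\bigoplus_{h}\mathrm{Hom}(V_{h_0},V_{h_1})$, with elements $s=(B,\gamma,\delta)$. $G_v=\prod GL(V_i)$ acts by $g(B_h,\gamma_i,\delta_i)=(g_{h_1}B_hg_{h_0}^{-1},g_i\gamma_i,\delta_ig_i^{-1})$.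 Put $\mu_i(s)=\sum_{h_1=i}\varepsilon(h)B_hB_{\bar h}+\gamma_i\delta_i$ and $\Lambda_\lambda(d,v)=\{s:\mu_i(s)=\lambda_i\mathrm{Id}_{V_i}\ \forall i\}$. For $m\in\mathbb Z^n$ let $\chi_m=\prod\det_{GL(V_i)}^{m_i}$; $s\in\Lambda_\lambda$ is $\chi_m$-semistable if there are $k>0$ and a regular function $f$ on $\Lambda_\lambda$ with $f(gx)=\chi_m(g)^kf(x)$ for all $g,x$ and $f(s)\ne0$. $\Lambda_{m,\lambda}(d,v)$ is the set of $\chi_m$-semistable points of $\Lambda_\lambda(d,v)$ and $M_{m,\lambda}(d,v)=\Lambda_{m,\lambda}(d,v)/\!/G_v$ is the good quotient (the Proj of the graded ring of $\chi_m^k$-covariant functions on $\Lambda_\lambda$, $k\ge0$). If some $d_i<0$ or $v_i<0$, then $M_{m,\lambda}(d,v)=\varnothing$. **The sets $\mathcal G$.** For $A\subset Q^\vee$ let $H_A=\bigcup_{u\in A}\{(m,\lambda)\in\mathbb Z^n\times\mathbb C^n:\langle\lambda,u\rangle=\langle m,u\rangle=0\}$. Let $K=\max\{1,a_{ij}^2: i,j\in I\}$, $\tilde U_v=\{u\in\mathbb N^I\setminus\{0\}:0\le u_i\le Kv_i\ \forall i\}$, $\tilde H^v=H_{\tilde U_v}$, and $\mathcal G_v=\{(m,\lambda):\sigma(m,\lambda)\notin\tilde H^{\sigma\cdot v}\ \text{for all }\sigma\in W\}$. Let $U_\infty=\bigcup_iW\alpha_i^\vee$ and $H^\infty=H_{U_\infty}$.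 Then $\mathcal G^{(1)}=\{(v,m,\lambda):(m,\lambda)\in\mathcal G_v\}$ and $\mathcal G^{(2)}=\{(v,m,\lambda):(m,\lambda)\notin H^\infty\}$. *)

theory Defs
  imports
    "HOL-Analysis.Analysis"
    "Jordan_Normal_Form.Determinant"
    "Jordan_Normal_Form.Gauss_Jordan_Elimination"
begin

section \<open>Integer multiples in abelian groups\<close>

definition zmult :: "int \<Rightarrow> 'a::ab_group_add \<Rightarrow> 'a" where
  "zmult k x = (\<Sum>_<nat k. x) - (\<Sum>_<nat (- k). x)"

lemma zmult_diff: "zmult (int m - int n) x = (\<Sum>_<m. x) - (\<Sum>_<n. x)"
proof -
  have split: "(\<Sum>_<a + b. x) = (\<Sum>_<a. x) + (\<Sum>_<b. x)" for a b :: nat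
    by (induction b) (simp_all add: add.assoc)
  show ?thesis
  proof (cases "n \<le> m")
    case True
    then obtain k where "m = n + k" using le_Suc_ex by blast
    then show ?thesis by (simp add: zmult_def split)
  next
    case False
    then obtain k where "n = m + k" using le_Suc_ex nat_le_linear by blast
    then show ?thesis by (simp add: zmult_def split)
  qed
qed

lemma additive_zmult:
  assumes "Modules.additive f"
  shows "f (zmult k x) = zmult k (f x)"
proof -
  interpret Modules.additive f by fact
  show ?thesis by (simp add: zmult_def diff sum)
qed

lemma zmult_int: "zmult k (x::int) = k * x"
  by (cases "0 \<le> k") (simp_all add: zmult_def)

lemma zmult_add_left: "zmult (a + b) x = zmult a x + zmult b x"
proof -
  obtain m n where a: "a = int m - int n"
    by (cases a rule: int_cases2) (metis diff_zero of_nat_0, metis diff_0 of_nat_0)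
  obtain p q where b: "b = int p - int q"
    by (cases b rule: int_cases2) (metis diff_zero of_nat_0, metis diff_0 of_nat_0)
  have split: "(\<Sum>_<i + j. x) = (\<Sum>_<i. x) + (\<Sum>_<j. x)" for i j :: nat
    by (induction j) (simp_all add: add.assoc)
  have "a + b = int (m + p) - int (n + q)" by (simp add: a b)
  then show ?thesis unfolding a b
    by (simp only: zmult_diff split) (simp add: algebra_simps)
qed

lemma module_zmult: "Modules.module (zmult :: int \<Rightarrow> 'a::ab_group_add \<Rightarrow> 'a)"
proof
  fix a b :: int and x y :: 'a
  show "zmult a (x + y) = zmult a x + zmult a y"
    by (simp add: zmult_def sum.distrib)
  show "zmult (a + b) x = zmult a x + zmult b x"
    by (rule zmult_add_left)
  have add: "Modules.additive (\<lambda>c. zmult c x)"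
    by standard (rule zmult_add_left)
  show "zmult a (zmult b x) = zmult (a * b) x"
    using additive_zmult [OF add, of a b] by (simp add: zmult_int)
  show "zmult 1 x = x"
    by (simp add: zmult_def)
qed

interpretation zmod: Modules.module zmult
  by (rule module_zmult)

definition free_of_rank :: "'a::ab_group_add itself \<Rightarrow> nat \<Rightarrow> bool" where
  "free_of_rank _ r \<longleftrightarrow>
     (\<exists>B :: 'a set. finite B \<and> card B = r \<and> zmod.independent B \<and> zmod.span B = UNIV)"

definition linearly_independent_family :: "('i \<Rightarrow> 'a::ab_group_add) \<Rightarrow> bool" where
  "linearly_independent_family f \<longleftrightarrow> inj f \<and> zmod.independent (range f)"


section \<open>Doubled quivers\<close>

text \<open>
  The vertices are the elements of a finite type, so that dimension vectors, weights and
  parameters are functions on that type. The arrows form a set, which may be empty.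
\<close>

record ('i, 'h) quiver =
  arrows :: "'h set"
  src :: "'h \<Rightarrow> 'i"
  tgt :: "'h \<Rightarrow> 'i"
  bar :: "'h \<Rightarrow> 'h"
  eps :: "'h \<Rightarrow> int"

definition double_quiver :: "('i::finite, 'h) quiver \<Rightarrow> bool" where
  "double_quiver Q \<longleftrightarrow>
     finite (arrows Q) \<and>
     (\<forall>h\<in>arrows Q.
        src Q h \<noteq> tgt Q h \<and>
        bar Q h \<in> arrows Q \<and> bar Q h \<noteq> h \<and> bar Q (bar Q h) = h \<and>
        src Q (bar Q h) = tgt Q h \<and> tgt Q (bar Q h) = src Q h \<and>
        eps Q h \<in> {1, - 1} \<and> eps Q (bar Q h) = - eps Q h)"

definition adj :: "('i, 'h) quiver \<Rightarrow> 'i \<Rightarrow> 'i \<Rightarrow> nat" where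
  "adj Q i j = card {h \<in> arrows Q. src Q h = i \<and> tgt Q h = j}"

definition cartan :: "('i, 'h) quiver \<Rightarrow> 'i \<Rightarrow> 'i \<Rightarrow> int" where
  "cartan Q i j = (if i = j then 2 else 0) - int (adj Q i j)"


section \<open>Root datum and Weyl group\<close>

text \<open>
  The lattices \<open>X\<close> and \<open>X\<^sup>\<or>\<close> are the (universes of the) types \<open>'x\<close> and \<open>'y\<close>.
\<close>

record ('i, 'x, 'y) root_datum =
  pairing :: "'x \<Rightarrow> 'y \<Rightarrow> int"
  root :: "'i \<Rightarrow> 'x"
  coroot :: "'i \<Rightarrow> 'y"
  fweight :: "'i \<Rightarrow> 'x"

definition perfect_pairing :: "('x::ab_group_add \<Rightarrow> 'y::ab_group_add \<Rightarrow> int) \<Rightarrow> bool" where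
  "perfect_pairing p \<longleftrightarrow>
     (\<forall>x. Modules.additive (p x)) \<and> (\<forall>y. Modules.additive (\<lambda>x. p x y)) \<and>
     (\<forall>f. Modules.additive f \<longrightarrow> (\<exists>!x. p x = f)) \<and>
     (\<forall>f. Modules.additive f \<longrightarrow> (\<exists>!y. (\<lambda>x. p x y) = f))"

definition is_root_datum ::
    "('i::finite, 'h) quiver \<Rightarrow> ('i, 'x::ab_group_add, 'y::ab_group_add) root_datum \<Rightarrow> bool" where
  "is_root_datum Q R \<longleftrightarrow>
     (let r = 2 * CARD('i) - rank ((\<chi> i j. real_of_int (cartan Q i j)) :: real ^ 'i ^ 'i)
      in free_of_rank TYPE('x) r \<and> free_of_rank TYPE('y) r) \<and>
     perfect_pairing (pairing R) \<and>
     linearly_independent_family (root R) \<and>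
     linearly_independent_family (coroot R) \<and>
     linearly_independent_family (fweight R) \<and>
     (\<forall>i j. pairing R (root R i) (coroot R j) = cartan Q i j) \<and>
     (\<forall>i j. pairing R (fweight R i) (coroot R j) = (if i = j then 1 else 0))"

definition simple_reflection ::
    "('i, 'x::ab_group_add, 'y) root_datum \<Rightarrow> 'i \<Rightarrow> 'x \<Rightarrow> 'x" where
  "simple_reflection R i x = x - zmult (pairing R x (coroot R i)) (root R i)"

inductive_set weyl_group :: "('i, 'x::ab_group_add, 'y) root_datum \<Rightarrow> ('x \<Rightarrow> 'x) set"
  for R where
  id: "id \<in> weyl_group R"
| simple: "simple_reflection R i \<in> weyl_group R"
| comp: "\<sigma> \<in> weyl_group R \<Longrightarrow> \<tau> \<in> weyl_group R \<Longrightarrow> \<sigma> \<circ> \<tau> \<in> weyl_group R"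
| inverse: "\<sigma> \<in> weyl_group R \<Longrightarrow> inv_into UNIV \<sigma> \<in> weyl_group R"

text \<open>
  The contragredient action; on simple reflections it is given by \<open>dual_action_simple\<close> below.
\<close>

definition dual_action ::
    "('i, 'x, 'y) root_datum \<Rightarrow> ('x \<Rightarrow> 'x) \<Rightarrow> 'y \<Rightarrow> 'y" where
  "dual_action R \<sigma> y = (THE y'. \<forall>x. pairing R x y' = pairing R (inv_into UNIV \<sigma> x) y)"

definition root_comb ::
    "('i::finite, 'x::ab_group_add, 'y) root_datum \<Rightarrow> ('i \<Rightarrow> int) \<Rightarrow> 'x" where
  "root_comb R v = (\<Sum>i\<in>UNIV. zmult (v i) (root R i))"

definition coroot_comb ::
    "('i::finite, 'x, 'y::ab_group_add) root_datum \<Rightarrow> ('i \<Rightarrow> int) \<Rightarrow> 'y" where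
  "coroot_comb R u = (\<Sum>i\<in>UNIV. zmult (u i) (coroot R i))"

definition weight_comb ::
    "('i::finite, 'x::ab_group_add, 'y) root_datum \<Rightarrow> ('i \<Rightarrow> int) \<Rightarrow> 'x" where
  "weight_comb R d = (\<Sum>i\<in>UNIV. zmult (d i) (fweight R i))"

text \<open>
  The action of the Weyl group on \<open>P\<close> (and on \<open>P \<otimes> \<complex>\<close>), in coordinates with respect to the
  classes of the fundamental weights: \<open>P\<close> is the quotient of \<open>X\<close> by the annihilator of the
  coroots, and the \<open>j\<close>-th coordinate of the class of \<open>x\<close> is the pairing of \<open>x\<close> with the
  \<open>j\<close>-th coroot. See \<open>weight_action_class\<close> and \<open>weight_action_simple\<close> below.
\<close>

definition weight_action ::
    "('i::finite, 'x, 'y) root_datum \<Rightarrow> ('x \<Rightarrow> 'x) \<Rightarrow> ('i \<Rightarrow> 'c::comm_ring_1) \<Rightarrow> 'i \<Rightarrow> 'c" where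
  "weight_action R \<sigma> l j =
     (\<Sum>i\<in>UNIV. l i * of_int (pairing R (\<sigma> (fweight R i)) (coroot R j)))"

definition dot_action ::
    "('i::finite, 'x::ab_group_add, 'y) root_datum \<Rightarrow> ('x \<Rightarrow> 'x) \<Rightarrow>
     ('i \<Rightarrow> int) \<Rightarrow> ('i \<Rightarrow> int) \<Rightarrow> ('i \<Rightarrow> int)" where
  "dot_action R \<sigma> d v =
     (THE v'. root_comb R v' = \<sigma> (root_comb R v - weight_comb R d) + weight_comb R d)"

definition dim_action ::
    "('i::finite, 'x::ab_group_add, 'y) root_datum \<Rightarrow> ('x \<Rightarrow> 'x) \<Rightarrow>
     ('i \<Rightarrow> int) \<times> ('i \<Rightarrow> int) \<Rightarrow> ('i \<Rightarrow> int) \<times> ('i \<Rightarrow> int)" where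
  "dim_action R \<sigma> = (\<lambda>(d, v). (d, dot_action R \<sigma> d v))"


section \<open>Varieties over the complex numbers\<close>

text \<open>
  A classical variety is given by its Zariski topology on closed points and by the predicate
  saying which complex-valued functions are regular on an open set; the values of such a
  function outside the open set are irrelevant.
\<close>

record 'p variety =
  zariski :: "'p topology"
  regular_fun :: "'p set \<Rightarrow> ('p \<Rightarrow> complex) \<Rightarrow> bool"

definition empty_variety :: "'p variety" where
  "empty_variety = \<lparr>zariski = discrete_topology {}, regular_fun = (\<lambda>U f. True)\<rparr>"

definition variety_morphism :: "'p variety \<Rightarrow> 'q variety \<Rightarrow> ('p \<Rightarrow> 'q) \<Rightarrow> bool" where
  "variety_morphism X Y \<phi> \<longleftrightarrow>
     continuous_map (zariski X) (zariski Y) \<phi> \<and>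
     (\<forall>V f. openin (zariski Y) V \<and> regular_fun Y V f \<longrightarrow>
        regular_fun X {x \<in> topspace (zariski X). \<phi> x \<in> V} (f \<circ> \<phi>))"

definition variety_isomorphism :: "'p variety \<Rightarrow> 'q variety \<Rightarrow> ('p \<Rightarrow> 'q) \<Rightarrow> bool" where
  "variety_isomorphism X Y \<phi> \<longleftrightarrow>
     variety_morphism X Y \<phi> \<and>
     (\<exists>\<psi>. variety_morphism Y X \<psi> \<and>
        (\<forall>x\<in>topspace (zariski X). \<psi> (\<phi> x) = x) \<and>
        (\<forall>y\<in>topspace (zariski Y). \<phi> (\<psi> y) = y))"

text \<open>
  A graded algebra of functions is given by its homogeneous components \<open>R k\<close>, each consisting
  of complex-valued functions on a set. The algebra is the external direct sum of the \<open>R k\<close>: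
  equal functions in different degrees are different elements. Accordingly a homogeneous ideal
  is given by its homogeneous components.
\<close>

definition homogeneous_ideal ::
    "(nat \<Rightarrow> ('a \<Rightarrow> complex) set) \<Rightarrow> (nat \<Rightarrow> ('a \<Rightarrow> complex) set) \<Rightarrow> bool" where
  "homogeneous_ideal R I \<longleftrightarrow>
     (\<forall>k. I k \<subseteq> R k \<and> (\<lambda>_. 0) \<in> I k \<and>
        (\<forall>c. \<forall>f\<in>I k. \<forall>g\<in>I k. (\<lambda>x. c * f x + g x) \<in> I k) \<and>
        (\<forall>j. \<forall>a\<in>R j. \<forall>f\<in>I k. (\<lambda>x. a x * f x) \<in> I (j + k)))"

text \<open>Homogeneous prime ideals not containing the irrelevant ideal.\<close>

definition relevant_prime ::
    "(nat \<Rightarrow> ('a \<Rightarrow> complex) set) \<Rightarrow> (nat \<Rightarrow> ('a \<Rightarrow> complex) set) \<Rightarrow> bool" where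
  "relevant_prime R I \<longleftrightarrow>
     homogeneous_ideal R I \<and> (\<exists>k>0. I k \<noteq> R k) \<and>
     (\<forall>j k. \<forall>f\<in>R j. \<forall>g\<in>R k. (\<lambda>x. f x * g x) \<in> I (j + k) \<longrightarrow> f \<in> I j \<or> g \<in> I k)"

text \<open>The points of the variety \<open>Proj R\<close> are the closed points of the scheme.\<close>

definition proj_points ::
    "(nat \<Rightarrow> ('a \<Rightarrow> complex) set) \<Rightarrow> (nat \<Rightarrow> ('a \<Rightarrow> complex) set) set" where
  "proj_points R =
     {p. relevant_prime R p \<and> (\<forall>q. relevant_prime R q \<and> (\<forall>k. p k \<subseteq> q k) \<longrightarrow> q = p)}"

definition proj_zariski ::
    "(nat \<Rightarrow> ('a \<Rightarrow> complex) set) \<Rightarrow> (nat \<Rightarrow> ('a \<Rightarrow> complex) set) topology" where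
  "proj_zariski R = topology_generated_by
     {{p \<in> proj_points R. f \<notin> p k} | f k. 0 < k \<and> f \<in> R k}"

text \<open>
  The value at \<open>p\<close> of the fraction \<open>f / g\<close> of two elements of degree \<open>k\<close>, where
  \<open>g\<close> is not in \<open>p\<close>: the residue field at a closed point is the field of complex numbers.
\<close>

definition fraction_value ::
    "('a \<Rightarrow> complex) \<Rightarrow> ('a \<Rightarrow> complex) \<Rightarrow> nat \<Rightarrow> (nat \<Rightarrow> ('a \<Rightarrow> complex) set) \<Rightarrow> complex" where
  "fraction_value f g k p = (THE c. (\<lambda>x. f x - c * g x) \<in> p k)"

definition proj_regular_fun ::
    "(nat \<Rightarrow> ('a \<Rightarrow> complex) set) \<Rightarrow> (nat \<Rightarrow> ('a \<Rightarrow> complex) set) set \<Rightarrow>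
     ((nat \<Rightarrow> ('a \<Rightarrow> complex) set) \<Rightarrow> complex) \<Rightarrow> bool" where
  "proj_regular_fun R U \<phi> \<longleftrightarrow>
     (\<forall>p\<in>U. \<exists>W k. \<exists>f\<in>R k. \<exists>g\<in>R k.
        openin (proj_zariski R) W \<and> p \<in> W \<and> W \<subseteq> U \<and>
        (\<forall>q\<in>W. g \<notin> q k \<and> \<phi> q = fraction_value f g k q))"

definition proj_variety ::
    "(nat \<Rightarrow> ('a \<Rightarrow> complex) set) \<Rightarrow> (nat \<Rightarrow> ('a \<Rightarrow> complex) set) variety" where
  "proj_variety R = \<lparr>zariski = proj_zariski R, regular_fun = proj_regular_fun R\<rparr>"


section \<open>Quiver varieties\<close>

text \<open>
  We take \<open>D i\<close> and \<open>V i\<close> to be the coordinate spaces of dimensions \<open>d i\<close> and \<open>v i\<close>.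
  A representation is a triple \<open>(B, \<gamma>, \<delta>)\<close> of families of matrices.
\<close>

type_synonym ('i, 'h) rep =
  "('h \<Rightarrow> complex mat) \<times> ('i \<Rightarrow> complex mat) \<times> ('i \<Rightarrow> complex mat)"

definition rep_space ::
    "('i, 'h) quiver \<Rightarrow> ('i \<Rightarrow> nat) \<Rightarrow> ('i \<Rightarrow> nat) \<Rightarrow> ('i, 'h) rep set" where
  "rep_space Q d v =
     {(B, \<gamma>, \<delta>).
        B \<in> (\<Pi>\<^sub>E h\<in>arrows Q. carrier_mat (v (tgt Q h)) (v (src Q h))) \<and>
        (\<forall>i. \<gamma> i \<in> carrier_mat (v i) (d i)) \<and>
        (\<forall>i. \<delta> i \<in> carrier_mat (d i) (v i))}"

definition gauge_group :: "('i \<Rightarrow> nat) \<Rightarrow> ('i \<Rightarrow> complex mat) set" where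
  "gauge_group v = {g. \<forall>i. g i \<in> carrier_mat (v i) (v i) \<and> invertible_mat (g i)}"

abbreviation matrix_inverse :: "complex mat \<Rightarrow> complex mat" where
  "matrix_inverse A \<equiv> the (mat_inverse A)"

definition gauge_action ::
    "('i, 'h) quiver \<Rightarrow> ('i \<Rightarrow> complex mat) \<Rightarrow> ('i, 'h) rep \<Rightarrow> ('i, 'h) rep" where
  "gauge_action Q g = (\<lambda>(B, \<gamma>, \<delta>).
     (restrict (\<lambda>h. g (tgt Q h) * B h * matrix_inverse (g (src Q h))) (arrows Q),
      \<lambda>i. g i * \<gamma> i,
      \<lambda>i. \<delta> i * matrix_inverse (g i)))"

definition moment_map ::
    "('i, 'h) quiver \<Rightarrow> ('i \<Rightarrow> nat) \<Rightarrow> ('i, 'h) rep \<Rightarrow> 'i \<Rightarrow> complex mat" where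
  "moment_map Q v = (\<lambda>(B, \<gamma>, \<delta>) i.
     Matrix.mat (v i) (v i) (\<lambda>(a, b).
       (\<Sum>h | h \<in> arrows Q \<and> tgt Q h = i. of_int (eps Q h) * (B h * B (bar Q h)) $$ (a, b))
       + (\<gamma> i * \<delta> i) $$ (a, b)))"

definition moment_fibre ::
    "('i, 'h) quiver \<Rightarrow> ('i \<Rightarrow> complex) \<Rightarrow> ('i \<Rightarrow> nat) \<Rightarrow> ('i \<Rightarrow> nat) \<Rightarrow> ('i, 'h) rep set" where
  "moment_fibre Q l d v =
     {s \<in> rep_space Q d v. \<forall>i. moment_map Q v s i = l i \<cdot>\<^sub>m 1\<^sub>m (v i)}"

inductive_set polynomial_funs ::
    "('i, 'h) quiver \<Rightarrow> ('i \<Rightarrow> nat) \<Rightarrow> ('i \<Rightarrow> nat) \<Rightarrow> (('i, 'h) rep \<Rightarrow> complex) set"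
  for Q d v where
  const: "(\<lambda>s. c) \<in> polynomial_funs Q d v"
| coord_B: "h \<in> arrows Q \<Longrightarrow> a < v (tgt Q h) \<Longrightarrow> b < v (src Q h) \<Longrightarrow>
    (\<lambda>(B, \<gamma>, \<delta>). B h $$ (a, b)) \<in> polynomial_funs Q d v"
| coord_gamma: "a < v i \<Longrightarrow> b < d i \<Longrightarrow>
    (\<lambda>(B, \<gamma>, \<delta>). \<gamma> i $$ (a, b)) \<in> polynomial_funs Q d v"
| coord_delta: "a < d i \<Longrightarrow> b < v i \<Longrightarrow>
    (\<lambda>(B, \<gamma>, \<delta>). \<delta> i $$ (a, b)) \<in> polynomial_funs Q d v"
| add: "f \<in> polynomial_funs Q d v \<Longrightarrow> g \<in> polynomial_funs Q d v \<Longrightarrow>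
    (\<lambda>s. f s + g s) \<in> polynomial_funs Q d v"
| mult: "f \<in> polynomial_funs Q d v \<Longrightarrow> g \<in> polynomial_funs Q d v \<Longrightarrow>
    (\<lambda>s. f s * g s) \<in> polynomial_funs Q d v"

text \<open>
  Regular functions on the closed subvariety \<open>moment_fibre Q l d v\<close>, represented by their
  extensions by 0: polynomial functions that agree on the subvariety are identified.
\<close>

definition fibre_regular_funs ::
    "('i, 'h) quiver \<Rightarrow> ('i \<Rightarrow> complex) \<Rightarrow> ('i \<Rightarrow> nat) \<Rightarrow> ('i \<Rightarrow> nat) \<Rightarrow>
     (('i, 'h) rep \<Rightarrow> complex) set" where
  "fibre_regular_funs Q l d v =
     (\<lambda>f s. if s \<in> moment_fibre Q l d v then f s else 0) ` polynomial_funs Q d v"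

definition gauge_character :: "('i::finite \<Rightarrow> int) \<Rightarrow> ('i \<Rightarrow> complex mat) \<Rightarrow> complex" where
  "gauge_character m g = (\<Prod>i\<in>UNIV. Determinant.det (g i) powi m i)"

definition covariants ::
    "('i::finite, 'h) quiver \<Rightarrow> ('i \<Rightarrow> int) \<Rightarrow> ('i \<Rightarrow> complex) \<Rightarrow> ('i \<Rightarrow> nat) \<Rightarrow> ('i \<Rightarrow> nat) \<Rightarrow>
     nat \<Rightarrow> (('i, 'h) rep \<Rightarrow> complex) set" where
  "covariants Q m l d v k =
     {f \<in> fibre_regular_funs Q l d v. \<forall>g\<in>gauge_group v. \<forall>s\<in>moment_fibre Q l d v.
        f (gauge_action Q g s) = gauge_character m g ^ k * f s}"

definition semistable ::
    "('i::finite, 'h) quiver \<Rightarrow> ('i \<Rightarrow> int) \<Rightarrow> ('i \<Rightarrow> complex) \<Rightarrow> ('i \<Rightarrow> nat) \<Rightarrow> ('i \<Rightarrow> nat) \<Rightarrow>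
     ('i, 'h) rep set" where
  "semistable Q m l d v =
     {s \<in> moment_fibre Q l d v. \<exists>k>0. \<exists>f\<in>covariants Q m l d v k. f s \<noteq> 0}"

text \<open>
  The quotient of the semistable locus by the gauge group is the \<open>Proj\<close> of the graded ring of
  covariants; the quotient map sends \<open>s\<close> to the ideal of covariants vanishing at \<open>s\<close>
  (see \<open>quotient_map_semistable\<close> below).
\<close>

definition quotient_point ::
    "('i::finite, 'h) quiver \<Rightarrow> ('i \<Rightarrow> int) \<Rightarrow> ('i \<Rightarrow> complex) \<Rightarrow> ('i \<Rightarrow> nat) \<Rightarrow> ('i \<Rightarrow> nat) \<Rightarrow>
     ('i, 'h) rep \<Rightarrow> nat \<Rightarrow> (('i, 'h) rep \<Rightarrow> complex) set" where
  "quotient_point Q m l d v s k = {f \<in> covariants Q m l d v k. f s = 0}"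

definition quiver_variety ::
    "('i::finite, 'h) quiver \<Rightarrow> ('i \<Rightarrow> int) \<Rightarrow> ('i \<Rightarrow> complex) \<Rightarrow>
     ('i \<Rightarrow> int) \<times> ('i \<Rightarrow> int) \<Rightarrow> (nat \<Rightarrow> (('i, 'h) rep \<Rightarrow> complex) set) variety" where
  "quiver_variety Q m l = (\<lambda>(d, v).
     if \<exists>i. d i < 0 \<or> v i < 0 then empty_variety
     else proj_variety (covariants Q m l (\<lambda>i. nat (d i)) (\<lambda>i. nat (v i))))"


section \<open>Genericity conditions\<close>

definition hyperplanes ::
    "('i::finite \<Rightarrow> int) set \<Rightarrow> (('i \<Rightarrow> int) \<times> ('i \<Rightarrow> complex)) set" where
  "hyperplanes A =
     (\<Union>u\<in>A. {(m, l). (\<Sum>i\<in>UNIV. l i * of_int (u i)) = 0 \<and> (\<Sum>i\<in>UNIV. m i * u i) = 0})"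

definition K_const :: "('i::finite, 'h) quiver \<Rightarrow> nat" where
  "K_const Q = Max (insert 1 {(adj Q i j)\<^sup>2 | i j. True})"

definition U_tilde :: "('i::finite, 'h) quiver \<Rightarrow> ('i \<Rightarrow> int) \<Rightarrow> ('i \<Rightarrow> int) set" where
  "U_tilde Q v = {u. u \<noteq> (\<lambda>_. 0) \<and> (\<forall>i. 0 \<le> u i \<and> u i \<le> int (K_const Q) * v i)}"

definition generic_finite ::
    "('i::finite, 'h) quiver \<Rightarrow> ('i, 'x::ab_group_add, 'y) root_datum \<Rightarrow> ('i \<Rightarrow> int) \<Rightarrow>
     ('i \<Rightarrow> int) \<Rightarrow> (('i \<Rightarrow> int) \<times> ('i \<Rightarrow> complex)) set" where
  "generic_finite Q R d v =
     {(m, l). \<forall>\<sigma>\<in>weyl_group R.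
        (weight_action R \<sigma> m, weight_action R \<sigma> l) \<notin> hyperplanes (U_tilde Q (dot_action R \<sigma> d v))}"

definition U_infinity ::
    "('i::finite, 'x::ab_group_add, 'y::ab_group_add) root_datum \<Rightarrow> ('i \<Rightarrow> int) set" where
  "U_infinity R =
     {u. \<exists>i. \<exists>\<sigma>\<in>weyl_group R. coroot_comb R u = dual_action R \<sigma> (coroot R i)}"

definition G1 ::
    "('i::finite, 'h) quiver \<Rightarrow> ('i, 'x::ab_group_add, 'y) root_datum \<Rightarrow> ('i \<Rightarrow> int) \<Rightarrow>
     (('i \<Rightarrow> int) \<times> ('i \<Rightarrow> int) \<times> ('i \<Rightarrow> complex)) set" where
  "G1 Q R d = {(v, m, l). (m, l) \<in> generic_finite Q R d v}"

definition G2 ::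
    "('i::finite, 'x::ab_group_add, 'y::ab_group_add) root_datum \<Rightarrow>
     (('i \<Rightarrow> int) \<times> ('i \<Rightarrow> int) \<times> ('i \<Rightarrow> complex)) set" where
  "G2 R = {(v, m, l). (m, l) \<notin> hyperplanes (U_infinity R)}"


section \<open>Well-definedness\<close>

locale quiver_root_datum =
  fixes Q :: "('i::finite, 'h) quiver"
    and R :: "('i, 'x::ab_group_add, 'y::ab_group_add) root_datum"
  assumes root_datum: "is_root_datum Q R"
begin

lemma pairing_right: "Modules.additive (pairing R x)"
  and pairing_left: "Modules.additive (\<lambda>x. pairing R x y)"
  and pairing_nondeg: "(\<And>x. pairing R x y = pairing R x y') \<Longrightarrow> y = y'"
  and pairing_root: "pairing R (root R i) (coroot R j) = cartan Q i j"
  and pairing_fweight: "pairing R (fweight R i) (coroot R j) = (if i = j then 1 else 0)"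
  and root_indep: "linearly_independent_family (root R)"
proof -
  show right: "Modules.additive (pairing R x)" for x
    using root_datum by (auto simp: is_root_datum_def perfect_pairing_def)
  show left: "Modules.additive (\<lambda>x. pairing R x y)" for y
    using root_datum by (auto simp: is_root_datum_def perfect_pairing_def)
  show "y = y'" if "\<And>x. pairing R x y = pairing R x y'"
  proof -
    have "\<exists>!z. (\<lambda>x. pairing R x z) = (\<lambda>x. pairing R x y)"
      using root_datum left [of y] by (auto simp: is_root_datum_def perfect_pairing_def)
    moreover have "(\<lambda>x. pairing R x y') = (\<lambda>x. pairing R x y)"
      using that by auto
    ultimately show ?thesis by blast
  qed
  show "pairing R (root R i) (coroot R j) = cartan Q i j"
    "pairing R (fweight R i) (coroot R j) = (if i = j then 1 else 0)"
    "linearly_independent_family (root R)"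
    using root_datum by (simp_all add: is_root_datum_def)
qed

lemma pairing_zmult_left: "pairing R (zmult k x) y = k * pairing R x y"
  using additive_zmult [OF pairing_left, of k x] by (simp add: zmult_int)

lemma pairing_zmult_right: "pairing R x (zmult k y) = k * pairing R x y"
  using additive_zmult [OF pairing_right, of x k y] by (simp add: zmult_int)

lemma simple_additive: "Modules.additive (simple_reflection R i)"
  by standard
    (simp add: simple_reflection_def Modules.additive.add [OF pairing_left] zmult_add_left)

lemma cartan_diag: 
  assumes "double_quiver Q" shows "cartan Q i i = 2"
proof -
  have "{h \<in> arrows Q. src Q h = i \<and> tgt Q h = i} = {}"
    using assms by (auto simp: double_quiver_def)
  then show ?thesis by (simp only: cartan_def adj_def) simp
qed

lemma simple_involution:
  assumes "double_quiver Q"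
  shows "simple_reflection R i (simple_reflection R i x) = x"
  by (simp add: simple_reflection_def Modules.additive.diff [OF pairing_left] pairing_zmult_left
      pairing_root cartan_diag [OF assms] zmod.scale_left_diff_distrib)

lemma weyl_bij_additive:
  assumes "double_quiver Q" "\<sigma> \<in> weyl_group R"
  shows "bij \<sigma> \<and> Modules.additive \<sigma> \<and> (\<forall>x. \<exists>v. \<sigma> x - x = root_comb R v)"
  using assms(2)
proof induction
  case id
  have "root_comb R (\<lambda>_. 0) = 0" by (simp add: root_comb_def)
  then show ?case by (auto simp: Modules.additive_def bij_def intro!: exI [of _ "\<lambda>_. 0"])
next
  case (simple i)
  have "bij (simple_reflection R i)"
    by (rule o_bij [where g = "simple_reflection R i"])
       (auto simp: fun_eq_iff simple_involution [OF assms(1)])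
  moreover have "simple_reflection R i x - x
      = root_comb R (\<lambda>j. if j = i then - pairing R x (coroot R i) else 0)" for x
    by (simp add: simple_reflection_def root_comb_def if_distrib [of "\<lambda>k. zmult k _"]
        cong: if_cong)
  ultimately show ?case using simple_additive by blast
next
  case (comp \<sigma> \<tau>)
  have "\<exists>v. (\<sigma> \<circ> \<tau>) x - x = root_comb R v" for x
  proof -
    obtain v w where "\<sigma> (\<tau> x) - \<tau> x = root_comb R v" "\<tau> x - x = root_comb R w"
      using comp by blast
    then have "(\<sigma> \<circ> \<tau>) x - x = root_comb R (\<lambda>i. v i + w i)"
      by (simp add: root_comb_def zmult_add_left sum.distrib algebra_simps)
    then show ?thesis by blast
  qed
  moreover have "bij (\<sigma> \<circ> \<tau>)" using comp by (blast intro: bij_comp)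
  moreover have "Modules.additive (\<sigma> \<circ> \<tau>)" using comp by (simp add: Modules.additive_def)
  ultimately show ?case by blast
next
  case (inverse \<sigma>)
  have s: "\<sigma> (inv_into UNIV \<sigma> x) = x" for x
    using inverse by (simp add: bij_is_surj surj_f_inv_f)
  have i: "inv_into UNIV \<sigma> (\<sigma> x) = x" for x
    using inverse by (simp add: bij_is_inj)
  have "Modules.additive (inv_into UNIV \<sigma>)"
  proof
    fix x y
    have "\<sigma> (inv_into UNIV \<sigma> x + inv_into UNIV \<sigma> y) = x + y"
      using inverse by (simp add: Modules.additive.add s)
    then show "inv_into UNIV \<sigma> (x + y) = inv_into UNIV \<sigma> x + inv_into UNIV \<sigma> y" using i by metis
  qed
  moreover have "\<exists>v. inv_into UNIV \<sigma> x - x = root_comb R v" for x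
  proof -
    obtain v where "\<sigma> (inv_into UNIV \<sigma> x) - inv_into UNIV \<sigma> x = root_comb R v" using inverse by blast
    then have "inv_into UNIV \<sigma> x - x = root_comb R (\<lambda>i. - v i)"
      by (simp add: s root_comb_def zmod.scale_minus_left sum_negf) (metis minus_diff_eq)
    then show ?thesis by blast
  qed
  ultimately show ?case using inverse by (simp add: bij_imp_bij_inv)
qed

lemma root_comb_inject: "root_comb R v = root_comb R w \<Longrightarrow> v = w"
proof -
  assume eq: "root_comb R v = root_comb R w"
  have inj: "inj (root R)" and ind: "zmod.independent (range (root R))"
    using root_indep by (auto simp: linearly_independent_family_def)
  define c where "c = (\<lambda>x. v (inv_into UNIV (root R) x) - w (inv_into UNIV (root R) x))"
  have "(\<Sum>x\<in>range (root R). zmult (c x) x) = root_comb R v - root_comb R w"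
    by (simp add: sum.reindex [OF inj] c_def inj root_comb_def
        zmod.scale_left_diff_distrib sum_subtractf)
  then have "(\<Sum>x\<in>range (root R). zmult (c x) x) = 0" using eq by simp
  then have "\<forall>x\<in>range (root R). c x = 0"
    using ind by (auto simp: zmod.dependent_explicit)
  then show "v = w" by (auto simp: c_def inj fun_eq_iff)
qed

lemma dot_action:
  assumes "double_quiver Q" "\<sigma> \<in> weyl_group R"
  shows "root_comb R (dot_action R \<sigma> d v)
    = \<sigma> (root_comb R v - weight_comb R d) + weight_comb R d"
proof -
  let ?x = "root_comb R v - weight_comb R d"
  obtain w where w: "\<sigma> ?x - ?x = root_comb R w"
    using weyl_bij_additive [OF assms] by blast
  have eq: "root_comb R (\<lambda>i. v i + w i) = \<sigma> ?x + weight_comb R d"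
    using w by (simp add: root_comb_def zmult_add_left sum.distrib algebra_simps)
  have "dot_action R \<sigma> d v = (\<lambda>i. v i + w i)"
    unfolding dot_action_def by (rule the_equality) (auto intro: root_comb_inject simp: eq)
  then show ?thesis using eq by simp
qed

lemma dual_action_simple:
  assumes "double_quiver Q"
  shows "dual_action R (simple_reflection R i) y
    = y - zmult (pairing R (root R i) y) (coroot R i)"
proof -
  have "inv_into UNIV (simple_reflection R i) = simple_reflection R i"
    by (rule inv_unique_comp) (auto simp: fun_eq_iff simple_involution [OF assms])
  then show ?thesis
    unfolding dual_action_def
    by (intro the_equality)
       (auto intro!: pairing_nondeg simp: simple_reflection_def Modules.additive.diff [OF pairing_left]
         Modules.additive.diff [OF pairing_right] pairing_zmult_left pairing_zmult_right)
qed

lemma weight_action_simple: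
  fixes l :: "'i \<Rightarrow> 'c::comm_ring_1"
  shows "weight_action R (simple_reflection R i) l j = l j - of_int (cartan Q i j) * l i"
proof -
  have "weight_action R (simple_reflection R i) l j =
      (\<Sum>k\<in>UNIV. (if k = j then l k else 0) - (if k = i then of_int (cartan Q i j) * l k else 0))"
    unfolding weight_action_def
    by (rule sum.cong)
       (auto simp: simple_reflection_def Modules.additive.diff [OF pairing_left] pairing_zmult_left
         pairing_root pairing_fweight algebra_simps)
  then show ?thesis by (simp add: sum_subtractf)
qed

text \<open>
  The class in \<open>P\<close> of \<open>\<sigma>\<close> applied to the weight with coordinates \<open>m\<close> has
  coordinates \<open>weight_action R \<sigma> m\<close>.
\<close>

lemma weight_action_class:
  assumes "double_quiver Q" "\<sigma> \<in> weyl_group R"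
  shows "pairing R (\<sigma> (weight_comb R m) - weight_comb R (weight_action R \<sigma> m)) (coroot R j) = 0"
proof -
  have a: "Modules.additive \<sigma>" using weyl_bij_additive [OF assms] by blast
  show ?thesis
    by (simp add: weight_comb_def Modules.additive.diff [OF pairing_left] Modules.additive.sum [OF a]
        Modules.additive.sum [OF pairing_left] additive_zmult [OF a] pairing_zmult_left pairing_fweight
        weight_action_def if_distrib cong: if_cong)
qed

end

lemma vanishing_ideal_proj_point:
  fixes R :: "nat \<Rightarrow> ('a \<Rightarrow> complex) set"
  assumes zero: "\<And>k. (\<lambda>_. 0) \<in> R k"
    and lin: "\<And>k c f g. f \<in> R k \<Longrightarrow> g \<in> R k \<Longrightarrow> (\<lambda>x. c * f x + g x) \<in> R k"
    and mult: "\<And>j k f g. f \<in> R j \<Longrightarrow> g \<in> R k \<Longrightarrow> (\<lambda>x. f x * g x) \<in> R (j + k)"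
    and h: "0 < n" "h \<in> R n" "h s \<noteq> 0"
  shows "(\<lambda>k. {f \<in> R k. f s = 0}) \<in> proj_points R"
proof -
  define p where "p = (\<lambda>k. {f \<in> R k. f s = 0})"
  have p: "relevant_prime R p"
    unfolding relevant_prime_def homogeneous_ideal_def p_def
    using h zero lin mult by auto
  have "q = p" if q: "relevant_prime R q" and le: "\<And>k. p k \<subseteq> q k" for q
  proof (rule ccontr)
    assume "q \<noteq> p"
    have qR: "q k \<subseteq> R k" for k
      using q by (auto simp: relevant_prime_def homogeneous_ideal_def)
    have qlin: "(\<lambda>x. c * f x + g x) \<in> q k" if "f \<in> q k" "g \<in> q k" for c f g k
      using q that by (auto simp: relevant_prime_def homogeneous_ideal_def)
    have qmult: "(\<lambda>x. a x * f x) \<in> q (j + k)" if "a \<in> R j" "f \<in> q k" for a f j k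
      using q that by (auto simp: relevant_prime_def homogeneous_ideal_def)
    have qprime: "f \<in> q j \<or> g \<in> q k"
      if "f \<in> R j" "g \<in> R k" "(\<lambda>x. f x * g x) \<in> q (j + k)" for f g j k
      using q that by (auto simp: relevant_prime_def)
    have pow: "(\<lambda>x. f x ^ Suc i) \<in> R (k * Suc i)" if "f \<in> R k" for f i k
      using mult [OF that] that by (induction i) (simp_all add: mult)
    have qpow: "(\<lambda>x. f x ^ Suc i) \<in> q (k * Suc i)" if "f \<in> q k" for f i k
      using qmult [of f k] that qR by (induction i) (auto simp: subset_iff)
    have qroot: "f \<in> q k" if "f \<in> R k" "(\<lambda>x. f x ^ Suc i) \<in> q (k * Suc i)" for f i k
      using that(2)
    proof (induction i)
      case (Suc i)
      have "(\<lambda>x. f x * f x ^ Suc i) \<in> q (k + k * Suc i)" using Suc.prems by simp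
      then show ?case using qprime [OF that(1) pow [OF that(1)]] Suc.IH by blast
    qed simp
    obtain j0 f0 where f0: "f0 \<in> q j0" "f0 s \<noteq> 0"
    proof -
      obtain k where "q k \<noteq> p k" using \<open>q \<noteq> p\<close> by (meson ext)
      then obtain f where "f \<in> q k" "f \<notin> p k" using le by blast
      then show ?thesis using that qR by (auto simp: p_def)
    qed
    define j where "j = n + j0"
    define f where "f = (\<lambda>x. h x * f0 x)"
    have f: "f \<in> q j" "f s \<noteq> 0" "0 < j"
      using qmult [OF h(2) f0(1)] h f0 by (auto simp: j_def f_def)
    have "q k = R k" if k: "0 < k" for k
    proof (rule antisym)
      show "R k \<subseteq> q k"
      proof
        fix g assume g: "g \<in> R k"
        obtain j' k' where jk: "j = Suc j'" "k = Suc k'"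
          using f(3) k by (metis gr0_implies_Suc)
        define c where "c = g s ^ j / f s ^ k"
        have fk: "(\<lambda>x. f x ^ k) \<in> q (j * k)" using qpow [OF f(1), of k'] by (simp only: jk(2))
        have gj: "(\<lambda>x. g x ^ j) \<in> R (j * k)"
          using pow [OF g, of j'] by (simp only: jk(1) [symmetric] mult.commute [of k])
        have "(\<lambda>x. - c * f x ^ k + g x ^ j) \<in> R (j * k)"
          using lin [OF _ gj, of "\<lambda>x. f x ^ k" "- c"] fk qR by blast
        then have "(\<lambda>x. - c * f x ^ k + g x ^ j) \<in> q (j * k)"
          using le f(2) by (auto simp: p_def c_def subset_iff)
        from qlin [OF fk this, of c] have "(\<lambda>x. g x ^ j) \<in> q (k * j)"
          by (simp add: mult.commute [of k])
        then show "g \<in> q k" using qroot [OF g, of j'] by (simp only: jk(1) [symmetric])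
      qed
    qed (rule qR)
    then show False using q by (auto simp: relevant_prime_def)
  qed
  then show ?thesis using p unfolding proj_points_def p_def by blast
qed

lemma quotient_map_semistable:
  assumes "s \<in> semistable Q m l d v"
  shows "quotient_point Q m l d v s \<in> proj_points (covariants Q m l d v)"
proof -
  let ?F = "fibre_regular_funs Q l d v" and ?L = "moment_fibre Q l d v"
  have zero: "(\<lambda>_. 0) \<in> ?F"
    unfolding fibre_regular_funs_def
    by (rule image_eqI [OF _ polynomial_funs.const [of 0]]) auto
  have lin: "(\<lambda>x. c * f x + g x) \<in> ?F" if fg: "f \<in> ?F" "g \<in> ?F" for c f g
  proof -
    obtain f' g' where "f' \<in> polynomial_funs Q d v" "g' \<in> polynomial_funs Q d v"
      "f = (\<lambda>s. if s \<in> ?L then f' s else 0)" "g = (\<lambda>s. if s \<in> ?L then g' s else 0)"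
      using fg by (auto simp: fibre_regular_funs_def)
    then show ?thesis
      unfolding fibre_regular_funs_def
      by (intro image_eqI [of _ _ "\<lambda>x. c * f' x + g' x"])
         (auto intro!: polynomial_funs.add polynomial_funs.mult [OF polynomial_funs.const])
  qed
  have mult: "(\<lambda>x. f x * g x) \<in> ?F" if fg: "f \<in> ?F" "g \<in> ?F" for f g
  proof -
    obtain f' g' where "f' \<in> polynomial_funs Q d v" "g' \<in> polynomial_funs Q d v"
      "f = (\<lambda>s. if s \<in> ?L then f' s else 0)" "g = (\<lambda>s. if s \<in> ?L then g' s else 0)"
      using fg by (auto simp: fibre_regular_funs_def)
    then show ?thesis
      unfolding fibre_regular_funs_def
      by (intro image_eqI [of _ _ "\<lambda>x. f' x * g' x"])
         (auto intro: polynomial_funs.intros)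
  qed
  obtain n h where h: "0 < n" "h \<in> covariants Q m l d v n" "h s \<noteq> 0"
    using assms by (auto simp: semistable_def)
  have "(\<lambda>k. {f \<in> covariants Q m l d v k. f s = 0}) \<in> proj_points (covariants Q m l d v)"
  proof (rule vanishing_ideal_proj_point [OF _ _ _ h(1)])
    show "h \<in> covariants Q m l d v n" "h s \<noteq> 0" by (fact h)+
    show "(\<lambda>_. 0) \<in> covariants Q m l d v k" for k
      by (simp add: covariants_def zero)
    show "(\<lambda>x. c * f x + g x) \<in> covariants Q m l d v k"
      if "f \<in> covariants Q m l d v k" "g \<in> covariants Q m l d v k" for k c f g
      using that lin [of f g c] by (simp add: covariants_def distrib_left mult.left_commute)
    show "(\<lambda>x. f x * g x) \<in> covariants Q m l d v (j + k)"
      if "f \<in> covariants Q m l d v j" "g \<in> covariants Q m l d v k" for j k f g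
      using that mult [of f g] by (simp add: covariants_def power_add mult_ac)
  qed
  then show ?thesis by (simp add: quotient_point_def [abs_def])
qed

end

theory Submission imports Defs begin

text \<open>
  The isomorphisms \<open>\<Phi>\<close> are asked to form a functor on the groupoid of the action of \<open>W\<close> on
  parameters. As soon as all varieties in one orbit are isomorphic, such a functor exists: choose a
  base point in each orbit and an isomorphism \<open>\<theta> x\<close> from each variety of the orbit to the variety
  at the base point, and let \<open>\<Phi> \<sigma> x\<close> be \<open>\<theta> x\<close> followed by the inverse of \<open>\<theta> (\<sigma> x)\<close>
  (\<open>coherent_isomorphisms\<close>). The generic parameters are stable under \<open>W\<close>, so it suffices to find
  some isomorphism for each simple reflection \<open>s i\<close> and each generic parameter
  (\<open>quiver_variety_reflection\<close>).

  This isomorphism comes from Lusztig's and Maffei's construction. Let \<open>T\<close> be the sum of \<open>D i\<close> and of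
  the spaces at the sources of the arrows into \<open>i\<close>. A representation \<open>s\<close> gives maps
  \<open>out : V i \<rightarrow> T\<close> and \<open>inn : T \<rightarrow> V i\<close>, and its moment map at \<open>i\<close> is \<open>inn * out\<close>. A representation
  \<open>s'\<close> with a space \<open>V' i\<close> of dimension \<open>dim T - dim (V i)\<close>, and the other spaces unchanged, is related
  to \<open>s\<close> if both agree away from \<open>i\<close>, the sequence \<open>0 \<rightarrow> V' i \<rightarrow> T \<rightarrow> V i \<rightarrow> 0\<close> formed by \<open>out'\<close> and
  \<open>inn\<close> is exact, and \<open>out' * inn' = out * inn - l i\<close>. The last equation turns the moment values
  \<open>l\<close> into \<open>s i l\<close>. Every \<open>s\<close> with \<open>inn\<close> surjective and every \<open>s'\<close> with \<open>out'\<close> injective has a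
  partner (\<open>ex_linked_right\<close>, \<open>ex_linked_left\<close>).

  The varieties are compared through their graded algebras. In the case \<open>m i \<ge> 0\<close> with \<open>m i\<close> and
  \<open>l i\<close> not both zero, consider the pairs of covariants, one on each side, that correspond to each
  other on related points, up to a power of the determinant of a splitting of the exact sequence.
  They form a graded algebra that embeds into both algebras of covariants. By \<open>isomorphic_proj\<close>, it
  has the same Proj as each of them, provided that the following holds: for covariants \<open>f\<close> and
  \<open>h\<close> on one side, \<open>h\<close> of positive degree, some \<open>f * h ^ M\<close> must belong to a corresponding pair.

  The classical functions do: maximal minors of \<open>inn\<close> correspond to complementary minors of \<open>out'\<close>,
  the entries of \<open>out * inn\<close> correspond to entries of \<open>out' * inn'\<close>, and the remaining coordinates
  are shared (\<open>transfer_right\<close>, \<open>transfer_left\<close>). That every covariant for \<open>GL(V i)\<close> is a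
  polynomial in classical functions is the first fundamental theorem of invariant theory. The weaker
  absorption statement has an elementary proof, \<open>covariant_mult_power_semi\<close>. Where a minor does not
  vanish, translating a point by the group puts an identity block into its matrix, which shows that
  a high power of the minor times \<open>f\<close> is classical. Hence multiplication by a covariant preserves a
  module that is finitely generated over the classical functions, covariants satisfy integral
  equations with classical coefficients, and high powers of \<open>h\<close> lie deep enough in the ideal of the
  minors to absorb \<open>f\<close>. Points where all minors vanish do no harm, since covariants of positive weight
  vanish there by a one-parameter subgroup argument (\<open>covariant_vanishes\<close>). In the remaining case of
  weight zero, \<open>inn * out\<close> is an invertible scalar, and the Cauchy--Binet formula writes a non-zero
  constant as a combination of minors (\<open>covariant_semi_if_invertible\<close>).

  Finally, if \<open>V i\<close> is larger than \<open>T\<close>, no minor survives, all covariants of positive degree vanish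
  and the variety is empty, which matches the convention for negative dimensions. If \<open>m i = l i = 0\<close>,
  genericity forces \<open>V i\<close> and \<open>V' i\<close> to be zero or another dimension to be negative
  (\<open>G_generic\<close>), and nothing has to be shown.
\<close>

section \<open>Isomorphisms of varieties\<close>

lemma variety_morphism_comp:
  assumes "variety_morphism X Y \<phi>" "variety_morphism Y Z \<psi>"
  shows "variety_morphism X Z (\<psi> \<circ> \<phi>)"
proof -
  have c: "continuous_map (zariski X) (zariski Z) (\<psi> \<circ> \<phi>)"
    using assms continuous_map_compose by (auto simp: variety_morphism_def)
  have "regular_fun X {x \<in> topspace (zariski X). (\<psi> \<circ> \<phi>) x \<in> V} (f \<circ> (\<psi> \<circ> \<phi>))"
    if V: "openin (zariski Z) V" "regular_fun Z V f" for V f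
  proof -
    let ?W = "{y \<in> topspace (zariski Y). \<psi> y \<in> V}"
    have "regular_fun Y ?W (f \<circ> \<psi>)" "openin (zariski Y) ?W"
      using assms(2) V openin_continuous_map_preimage by (auto simp: variety_morphism_def)
    then have "regular_fun X {x \<in> topspace (zariski X). \<phi> x \<in> ?W} ((f \<circ> \<psi>) \<circ> \<phi>)"
      using assms(1) unfolding variety_morphism_def by blast
    moreover have "{x \<in> topspace (zariski X). \<phi> x \<in> ?W}
        = {x \<in> topspace (zariski X). (\<psi> \<circ> \<phi>) x \<in> V}"
      using assms(1) by (auto simp: variety_morphism_def continuous_map_def)
    ultimately show ?thesis by (simp add: o_assoc)
  qed
  then show ?thesis using c by (auto simp: variety_morphism_def)
qed

lemma variety_morphism_topspace:
  "variety_morphism X Y \<phi> \<Longrightarrow> x \<in> topspace (zariski X) \<Longrightarrow> \<phi> x \<in> topspace (zariski Y)"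
  by (auto simp: variety_morphism_def continuous_map_def)

lemma variety_isomorphism_comp:
  assumes "variety_isomorphism X Y \<phi>" "variety_isomorphism Y Z \<psi>"
  shows "variety_isomorphism X Z (\<psi> \<circ> \<phi>)"
proof -
  obtain \<phi>' where 1: "variety_morphism X Y \<phi>" "variety_morphism Y X \<phi>'"
    "\<And>x. x \<in> topspace (zariski X) \<Longrightarrow> \<phi>' (\<phi> x) = x" 
    "\<And>x. x \<in> topspace (zariski Y) \<Longrightarrow> \<phi> (\<phi>' x) = x"
    using assms(1) unfolding variety_isomorphism_def by blast
  obtain \<psi>' where 2: "variety_morphism Y Z \<psi>" "variety_morphism Z Y \<psi>'"
    "\<And>x. x \<in> topspace (zariski Y) \<Longrightarrow> \<psi>' (\<psi> x) = x" 
    "\<And>x. x \<in> topspace (zariski Z) \<Longrightarrow> \<psi> (\<psi>' x) = x"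
    using assms(2) unfolding variety_isomorphism_def by blast
  show ?thesis
    unfolding variety_isomorphism_def
    using variety_morphism_comp[OF 1(1) 2(1)] variety_morphism_comp[OF 2(2) 1(2)]
    by (intro conjI exI[of _ "\<phi>' \<circ> \<psi>'"])
       (simp_all add: 1(3,4) 2(3,4) variety_morphism_topspace[OF 1(1)] variety_morphism_topspace[OF 2(2)])
qed

definition isomorphic_varieties :: "'p variety \<Rightarrow> 'q variety \<Rightarrow> bool" where
  "isomorphic_varieties X Y \<longleftrightarrow> (\<exists>\<phi>. variety_isomorphism X Y \<phi>)"

lemma isomorphic_varieties_sym: "isomorphic_varieties X Y \<Longrightarrow> isomorphic_varieties Y X"
  unfolding isomorphic_varieties_def variety_isomorphism_def by blast

lemma isomorphic_varieties_trans:
  "isomorphic_varieties X Y \<Longrightarrow> isomorphic_varieties Y Z \<Longrightarrow> isomorphic_varieties X Z"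
  unfolding isomorphic_varieties_def using variety_isomorphism_comp by blast

lemma isomorphic_varieties_refl: "isomorphic_varieties X X"
proof -
  have "variety_morphism X X id" if "\<And>V f. openin (zariski X) V \<Longrightarrow> regular_fun X V f \<Longrightarrow>
     regular_fun X {x \<in> topspace (zariski X). x \<in> V} f"
    using that by (auto simp: variety_morphism_def)
  moreover have "{x \<in> topspace (zariski X). x \<in> V} = V" if "openin (zariski X) V" for V
    using openin_subset[OF that] by auto
  ultimately have "variety_morphism X X id" by simp
  then show ?thesis unfolding isomorphic_varieties_def variety_isomorphism_def by force
qed

section \<open>Comparing the Proj of graded algebras\<close>

definition graded_algebra :: "(nat \<Rightarrow> ('a \<Rightarrow> complex) set) \<Rightarrow> bool" where
  "graded_algebra R \<longleftrightarrow> (\<forall>k. (\<lambda>_. 0) \<in> R k) \<and>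
     (\<forall>k c. \<forall>f\<in>R k. \<forall>g\<in>R k. (\<lambda>x. c * f x + g x) \<in> R k) \<and>
     (\<forall>j k. \<forall>f\<in>R j. \<forall>g\<in>R k. (\<lambda>x. f x * g x) \<in> R (j + k))"

lemma graded_algebra_mult:
  "graded_algebra R \<Longrightarrow> f \<in> R j \<Longrightarrow> g \<in> R k \<Longrightarrow> (\<lambda>x. f x * g x) \<in> R (j + k)"
  unfolding graded_algebra_def by blast

lemma graded_algebra_mult_power:
  assumes "graded_algebra R" "f \<in> R j" "g \<in> R k"
  shows "(\<lambda>x. f x * g x ^ n) \<in> R (j + n * k)"
proof (induction n)
  case (Suc n)
  from graded_algebra_mult[OF assms(1) Suc assms(3)] show ?case by (simp add: ac_simps)
qed (use assms in simp)

lemma relevant_prime_subset: "relevant_prime R p \<Longrightarrow> p k \<subseteq> R k"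
  by (simp add: relevant_prime_def homogeneous_ideal_def)

lemma relevant_prime_witness:
  assumes "relevant_prime R p" obtains f k where "0 < k" "f \<in> R k" "f \<notin> p k"
proof -
  obtain k where "0 < k" "p k \<noteq> R k" using assms by (auto simp: relevant_prime_def)
  then show ?thesis using relevant_prime_subset[OF assms, of k] that by blast
qed

lemma topspace_proj_zariski: "topspace (proj_zariski R) = proj_points R"
proof -
  have "p \<in> \<Union> {{p \<in> proj_points R. f \<notin> p k} |f k. 0 < k \<and> f \<in> R k}" if p: "p \<in> proj_points R" for p
  proof -
    have "relevant_prime R p" using p by (simp add: proj_points_def)
    then obtain f k where k: "0 < k" "f \<in> R k" "f \<notin> p k" by (rule relevant_prime_witness)
    then show ?thesis using k(1) p by (intro UnionI[of "{p \<in> proj_points R. f \<notin> p k}"]) blast+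
  qed
  then have "proj_points R \<subseteq> \<Union> {{p \<in> proj_points R. f \<notin> p k} |f k. 0 < k \<and> f \<in> R k}" by blast
  then show ?thesis unfolding proj_zariski_def topology_generated_by_topspace by auto
qed

lemma openin_proj_zariski_nonvanishing:
  "0 < k \<Longrightarrow> f \<in> R k \<Longrightarrow> openin (proj_zariski R) {p \<in> proj_points R. f \<notin> p k}"
  unfolding proj_zariski_def openin_topology_generated_by_iff
  by (rule generate_topology_on.Basis) blast

lemma continuous_map_into_proj_zariski:
  assumes "\<And>x. x \<in> topspace X \<Longrightarrow> \<phi> x \<in> proj_points R"
    and "\<And>f k. 0 < k \<Longrightarrow> f \<in> R k \<Longrightarrow> openin X {x \<in> topspace X. f \<notin> \<phi> x k}"
  shows "continuous_map X (proj_zariski R) \<phi>"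
  unfolding proj_zariski_def
proof (rule continuous_on_generated_topo)
  fix U assume "U \<in> {{p \<in> proj_points R. f \<notin> p k} |f k. 0 < k \<and> f \<in> R k}"
  then obtain f k where U: "U = {p \<in> proj_points R. f \<notin> p k}" "0 < k" "f \<in> R k" by blast
  have "\<phi> -` U \<inter> topspace X = {x \<in> topspace X. f \<notin> \<phi> x k}" using U assms(1) by auto
  then show "openin X (\<phi> -` U \<inter> topspace X)" using assms(2) U by simp
next
  have eq: "\<Union> {{p \<in> proj_points R. f \<notin> p k} |f k. 0 < k \<and> f \<in> R k} = proj_points R"
    using topspace_proj_zariski[of R] unfolding proj_zariski_def topology_generated_by_topspace .
  show "\<phi> ` topspace X \<subseteq> \<Union> {{p \<in> proj_points R. f \<notin> p k} |f k. 0 < k \<and> f \<in> R k}"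
    unfolding eq using assms(1) by auto
qed

lemma proj_regular_funE:
  assumes "proj_regular_fun R U \<phi>" "p \<in> U"
  obtains W k f g where "f \<in> R k" "g \<in> R k" "openin (proj_zariski R) W" "p \<in> W" "W \<subseteq> U"
    "\<And>q. q \<in> W \<Longrightarrow> g \<notin> q k \<and> \<phi> q = fraction_value f g k q"
proof -
  from bspec[OF assms(1)[unfolded proj_regular_fun_def] assms(2)]
  obtain W k f g where *: "f \<in> R k" "g \<in> R k" "openin (proj_zariski R) W \<and> p \<in> W \<and> W \<subseteq> U \<and>
    (\<forall>q\<in>W. g \<notin> q k \<and> \<phi> q = fraction_value f g k q)"
    by (elim exE bexE)
  then show ?thesis by (intro that[of f k g W]) simp_all
qed

text \<open>
  The subalgebra \<open>T\<close> of \<open>R\<close> is presented as functions on a second set, pulled back along \<open>r\<close>. The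
  assumption \<open>absorb\<close> says that \<open>R\<close> and \<open>T\<close> agree after inverting any homogeneous element of positive
  degree, which is all that Proj depends on.
\<close>

locale proj_comparison =
  fixes R :: "nat \<Rightarrow> ('a \<Rightarrow> complex) set" and T :: "nat \<Rightarrow> ('b \<Rightarrow> complex) set"
    and r :: "'a \<Rightarrow> 'b"
  assumes R: "graded_algebra R" and T: "graded_algebra T"
    and pull: "t \<in> T k \<Longrightarrow> t \<circ> r \<in> R k"
    and inj: "t \<in> T k \<Longrightarrow> (\<And>x. t (r x) = 0) \<Longrightarrow> t = (\<lambda>_. 0)"
    and absorb: "f \<in> R k \<Longrightarrow> h \<in> R j \<Longrightarrow> 0 < j \<Longrightarrow>
        \<exists>M. \<exists>t\<in>T (k + M * j). \<forall>x. t (r x) = f x * h x ^ M"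
begin

text \<open>
  Contraction of ideals to \<open>T\<close>, and its inverse. The extension of \<open>q\<close> to \<open>R\<close> has to be saturated:
  \<open>f\<close> belongs to \<open>lift q\<close> if all its multiples that come from \<open>T\<close> belong to \<open>q\<close>. It suffices to test
  multiples by elements of positive degree, since \<open>q\<close> does not contain all of these.
\<close>

definition push :: "(nat \<Rightarrow> ('a \<Rightarrow> complex) set) \<Rightarrow> nat \<Rightarrow> ('b \<Rightarrow> complex) set" where
  "push p k = {t \<in> T k. t \<circ> r \<in> p k}"

definition lift :: "(nat \<Rightarrow> ('b \<Rightarrow> complex) set) \<Rightarrow> nat \<Rightarrow> ('a \<Rightarrow> complex) set" where
  "lift q k = {f \<in> R k. \<forall>j>0. \<forall>h\<in>R j. \<forall>t\<in>T (k + j). (\<forall>x. t (r x) = f x * h x) \<longrightarrow> t \<in> q (k + j)}"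

lemma liftD: "f \<in> lift q k \<Longrightarrow> 0 < j \<Longrightarrow> h \<in> R j \<Longrightarrow> t \<in> T (k + j) \<Longrightarrow>
    (\<And>x. t (r x) = f x * h x) \<Longrightarrow> t \<in> q (k + j)"
  by (auto simp: lift_def)

lemma Rlin: "f \<in> R k \<Longrightarrow> g \<in> R k \<Longrightarrow> (\<lambda>x. c * f x + g x) \<in> R k"
  and Rmult: "f \<in> R j \<Longrightarrow> g \<in> R k \<Longrightarrow> (\<lambda>x. f x * g x) \<in> R (j + k)"
  and Rzero: "(\<lambda>_. 0) \<in> R k"
  and Tlin: "t \<in> T k \<Longrightarrow> u \<in> T k \<Longrightarrow> (\<lambda>x. c * t x + u x) \<in> T k"
  and Tmult: "t \<in> T j \<Longrightarrow> u \<in> T k \<Longrightarrow> (\<lambda>x. t x * u x) \<in> T (j + k)"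
  and Tzero: "(\<lambda>_. 0) \<in> T k"
  using R T by (auto simp: graded_algebra_def)

lemma inj2: "t \<in> T k \<Longrightarrow> u \<in> T k \<Longrightarrow> (\<And>x. t (r x) = u (r x)) \<Longrightarrow> t = u"
  using inj[OF Tlin[of u k t "-1"]] by (simp add: fun_eq_iff)

lemma Rmultpow: "f \<in> R j \<Longrightarrow> g \<in> R k \<Longrightarrow> (\<lambda>x. f x * g x ^ n) \<in> R (j + n * k)"
  and Tmultpow: "t \<in> T j \<Longrightarrow> u \<in> T k \<Longrightarrow> (\<lambda>x. t x * u x ^ n) \<in> T (j + n * k)"
  by (rule graded_algebra_mult_power[OF R] graded_algebra_mult_power[OF T]; assumption)+

lemma absorb_ge:
  assumes "f \<in> R k" "t0 \<in> T j" "0 < j"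
  shows "\<exists>M. \<forall>n\<ge>M. \<exists>t\<in>T (k + n * j). \<forall>x. t (r x) = f x * t0 (r x) ^ n"
proof -
  obtain M t where t: "t\<in>T (k + M * j)" "\<And>x. t (r x) = f x * t0 (r x) ^ M"
    using absorb[OF assms(1) pull[OF assms(2)] assms(3)] by auto
  have "\<exists>t\<in>T (k + n * j). \<forall>x. t (r x) = f x * t0 (r x) ^ n" if n: "n \<ge> M" for n
  proof -
    obtain d where d: "n = M + d" using n le_Suc_ex by blast
    have "(\<lambda>x. t x * t0 x ^ d) \<in> T (k + n * j)"
      using Tmultpow[OF t(1) assms(2), of d] d by (simp add: algebra_simps)
    then show ?thesis
      by (rule bexI[rotated]) (simp add: t d power_add mult.assoc)
  qed
  then show ?thesis by blast
qed

end

locale relevant_prime_ideal =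
  fixes R :: "nat \<Rightarrow> ('a \<Rightarrow> complex) set" and p
  assumes p: "relevant_prime R p"
begin

lemma sub: "f \<in> p k \<Longrightarrow> f \<in> R k"
  and zero: "(\<lambda>_. 0) \<in> p k"
  and lin: "f \<in> p k \<Longrightarrow> g \<in> p k \<Longrightarrow> (\<lambda>x. c * f x + g x) \<in> p k"
  and mult: "a \<in> R j \<Longrightarrow> f \<in> p k \<Longrightarrow> (\<lambda>x. a x * f x) \<in> p (j + k)"
  and prime: "f \<in> R j \<Longrightarrow> g \<in> R k \<Longrightarrow> (\<lambda>x. f x * g x) \<in> p (j + k) \<Longrightarrow> f \<in> p j \<or> g \<in> p k"
  using p by (auto simp: relevant_prime_def homogeneous_ideal_def)

lemma relevant: obtains k h where "0 < k" "h \<in> R k" "h \<notin> p k"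
  using relevant_prime_witness[OF p] by metis

lemma multpow:
  assumes "f \<in> p k" "h \<in> R j"
  shows "(\<lambda>x. f x * h x ^ n) \<in> p (k + n * j)"
proof (induction n)
  case (Suc n)
  from mult[OF assms(2) this] show ?case by (simp add: ac_simps)
qed (use assms in simp)

lemma multpow_iff:
  assumes R: "graded_algebra R" and "f \<in> R k" "h \<in> R j" "h \<notin> p j"
  shows "(\<lambda>x. f x * h x ^ n) \<in> p (k + n * j) \<longleftrightarrow> f \<in> p k"
proof (induction n)
  case (Suc n)
  have fn: "(\<lambda>x. f x * h x ^ n) \<in> R (k + n * j)" for n
    by (rule graded_algebra_mult_power[OF assms(1-3)])
  have "(\<lambda>x. f x * h x ^ Suc n) \<in> p (k + Suc n * j) \<longleftrightarrow> (\<lambda>x. (f x * h x ^ n) * h x) \<in> p (k + n * j + j)"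
    by (simp add: ac_simps)
  also have "\<dots> \<longleftrightarrow> (\<lambda>x. f x * h x ^ n) \<in> p (k + n * j)"
    using prime[OF fn assms(3), of n] assms(4) mult[OF assms(3), of "\<lambda>x. f x * h x ^ n" "k + n * j"]
    by (simp add: mult.commute[of "h _"] add.commute[of j]) blast
  finally show ?case using Suc by simp
qed simp

end

context proj_comparison begin

lemma push_relevant_prime:
  assumes "relevant_prime R p" shows "relevant_prime T (push p)"
proof -
  interpret p: relevant_prime_ideal R p by standard fact
  have "homogeneous_ideal T (push p)"
    unfolding homogeneous_ideal_def push_def
    by (intro allI conjI ballI CollectI)
       (auto simp: o_def p.zero Tzero Tlin Tmult dest: p.lin p.mult[OF pull[unfolded o_def]])
  moreover have "t \<in> push p j \<or> u \<in> push p k"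
    if "t \<in> T j" "u \<in> T k" "(\<lambda>x. t x * u x) \<in> push p (j + k)" for t u j k
    using that p.prime[OF pull pull] by (auto simp: push_def o_def)
  moreover have "\<exists>k>0. push p k \<noteq> T k"
  proof -
    obtain j h where h: "0 < j" "h \<in> R j" "h \<notin> p j" by (rule p.relevant)
    obtain M t where t: "t \<in> T (j + M * j)" "\<And>x. t (r x) = h x * h x ^ M"
      using absorb[OF h(2) h(2) h(1)] by blast
    have "t \<circ> r \<notin> p (j + M * j)"
      using p.multpow_iff[OF R h(2) h(2) h(3), of M] h(3) by (simp add: o_def t(2))
    then show ?thesis using t(1) h(1) by (intro exI[of _ "j + M * j"]) (auto simp: push_def)
  qed
  ultimately show ?thesis unfolding relevant_prime_def by blast
qed

lemma lift_relevant_prime: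
  assumes "relevant_prime T q" shows "relevant_prime R (lift q)"
proof -
  interpret q: relevant_prime_ideal T q by standard fact
  obtain j0 t0 where t0: "0 < j0" "t0 \<in> T j0" "t0 \<notin> q j0" by (rule q.relevant)
  have "homogeneous_ideal R (lift q)"
    unfolding homogeneous_ideal_def
  proof (intro allI conjI ballI)
    fix k
    show "lift q k \<subseteq> R k" by (auto simp: lift_def)
    have "t \<in> q k" if "t \<in> T k" "\<forall>x. t (r x) = 0" for t k
      using inj[OF that(1)] that(2) q.zero by simp
    then show "(\<lambda>_. 0) \<in> lift q k" using Rzero by (auto simp: lift_def)
  next
    fix k c f g assume f: "f \<in> lift q k" and g: "g \<in> lift q k"
    have "t \<in> q (k + j)" if h: "0 < j" "h \<in> R j" "t \<in> T (k + j)" "\<forall>x. t (r x) = (c * f x + g x) * h x"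
      for j h t
    proof -
      have fR: "f \<in> R k" and gR: "g \<in> R k" using f g by (auto simp: lift_def)
      obtain M1 where M1: "\<And>n. n \<ge> M1 \<Longrightarrow> \<exists>t\<in>T (k + j + n * j0). \<forall>x. t (r x) = (f x * h x) * t0 (r x) ^ n"
        using absorb_ge[OF Rmult[OF fR h(2)] t0(2,1)] by blast
      obtain M2 where M2: "\<And>n. n \<ge> M2 \<Longrightarrow> \<exists>t\<in>T (k + j + n * j0). \<forall>x. t (r x) = (g x * h x) * t0 (r x) ^ n"
        using absorb_ge[OF Rmult[OF gR h(2)] t0(2,1)] by blast
      \<comment> \<open>A common power of \<open>t0\<close> brings both products into \<open>T\<close>, and \<open>t0\<close> can be cancelled because it is not in \<open>q\<close>.\<close>
      define M where "M = max M1 M2"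
      obtain u1 where u1: "u1 \<in> T (k + j + M * j0)" "\<And>x. u1 (r x) = (f x * h x) * t0 (r x) ^ M"
        using M1[of M] by (auto simp: M_def)
      obtain u2 where u2: "u2 \<in> T (k + j + M * j0)" "\<And>x. u2 (r x) = (g x * h x) * t0 (r x) ^ M"
        using M2[of M] by (auto simp: M_def)
      have hM: "(\<lambda>x. h x * t0 (r x) ^ M) \<in> R (j + M * j0)"
        using Rmultpow[OF h(2) pull[OF t0(2)], of M] by simp
      have "u1 \<in> q (k + (j + M * j0))" "u2 \<in> q (k + (j + M * j0))"
        using liftD[OF f _ hM, of u1] liftD[OF g _ hM, of u2] u1 u2 h(1) 
        by (simp_all add: add.assoc mult.assoc)
      then have "(\<lambda>x. c * u1 x + u2 x) \<in> q (k + j + M * j0)"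
        by (simp add: q.lin add.assoc)
      moreover have "(\<lambda>x. t x * t0 x ^ M) = (\<lambda>x. c * u1 x + u2 x)"
        by (rule inj2[OF Tmultpow[OF h(3) t0(2)] Tlin[OF u1(1) u2(1)]])
           (simp add: u1 u2 h(4) algebra_simps)
      ultimately show ?thesis using q.multpow_iff[OF T h(3) t0(2,3), of M] by simp
    qed
    then show "(\<lambda>x. c * f x + g x) \<in> lift q k"
      using f g Rlin by (auto simp: lift_def)
  next
    fix k j a f assume a: "a \<in> R j" and f: "f \<in> lift q k"
    have "t \<in> q (j + k + j')" if h: "0 < j'" "h \<in> R j'" "t \<in> T (j + k + j')"
      "\<forall>x. t (r x) = (a x * f x) * h x" for j' h t
    proof -
      have "(\<lambda>x. a x * h x) \<in> R (j + j')" using Rmult a h by blast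
      then have "t \<in> q (k + (j + j'))"
        using liftD[OF f, of "j + j'" "\<lambda>x. a x * h x" t] h by (simp add: ac_simps)
      then show ?thesis by (simp add: ac_simps)
    qed
    then show "(\<lambda>x. a x * f x) \<in> lift q (j + k)"
      using a f Rmult by (auto simp: lift_def)
  qed
  moreover have "f \<in> lift q j \<or> g \<in> lift q k"
    if fg: "f \<in> R j" "g \<in> R k" "(\<lambda>x. f x * g x) \<in> lift q (j + k)" for f g j k
  proof (rule ccontr)
    assume "\<not> ?thesis"
    then obtain j1 h1 t1 j2 h2 t2 where
      1: "0 < j1" "h1 \<in> R j1" "t1 \<in> T (j + j1)" "\<And>x. t1 (r x) = f x * h1 x" "t1 \<notin> q (j + j1)" and
      2: "0 < j2" "h2 \<in> R j2" "t2 \<in> T (k + j2)" "\<And>x. t2 (r x) = g x * h2 x" "t2 \<notin> q (k + j2)"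
      using fg unfolding lift_def by blast
    have "(\<lambda>x. t1 x * t2 x) \<in> T (j + k + (j1 + j2))"
      using Tmult[OF 1(3) 2(3)] by (simp add: ac_simps)
    moreover have "(\<lambda>x. h1 x * h2 x) \<in> R (j1 + j2)" using Rmult 1 2 by blast
    ultimately have "(\<lambda>x. t1 x * t2 x) \<in> q (j + k + (j1 + j2))"
      using liftD[OF fg(3), of "j1 + j2" "\<lambda>x. h1 x * h2 x" "\<lambda>x. t1 x * t2 x"] 1 2 by (simp add: ac_simps)
    then show False using q.prime[OF 1(3) 2(3)] 1(5) 2(5) by (simp add: ac_simps)
  qed
  moreover have "\<exists>k>0. lift q k \<noteq> R k"
  proof -
    have "t0 \<circ> r \<notin> lift q j0"
    proof
      assume "t0 \<circ> r \<in> lift q j0"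
      from liftD[OF this t0(1) pull[OF t0(2)] Tmult[OF t0(2) t0(2)]]
      have "(\<lambda>x. t0 x * t0 x) \<in> q (j0 + j0)" by simp
      then show False using q.prime[OF t0(2) t0(2)] t0(3) by blast
    qed
    then show ?thesis using pull[OF t0(2)] t0(1) by blast
  qed
  ultimately show ?thesis unfolding relevant_prime_def by blast
qed

lemma push_lift:
  assumes "relevant_prime T q" shows "push (lift q) = q"
proof -
  interpret q: relevant_prime_ideal T q by standard fact
  obtain j0 t0 where t0: "0 < j0" "t0 \<in> T j0" "t0 \<notin> q j0" by (rule q.relevant)
  have "t \<in> push (lift q) k \<longleftrightarrow> t \<in> q k" for t k
  proof
    assume t: "t \<in> push (lift q) k"
    then have t': "t \<in> T k" "t \<circ> r \<in> lift q k" by (auto simp: push_def)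
    from liftD[OF t'(2) t0(1) pull[OF t0(2)] Tmult[OF t'(1) t0(2)]]
    have "(\<lambda>x. t x * t0 x) \<in> q (k + j0)" by simp
    then show "t \<in> q k" using q.prime[OF _ t0(2)] t t0(3) by (auto simp: push_def)
  next
    assume t: "t \<in> q k"
    have "t1 \<in> q (k + j)" if h: "0 < j" "h \<in> R j" "t1 \<in> T (k + j)" "\<forall>x. t1 (r x) = t (r x) * h x" for j h t1
    proof -
      obtain M u where u: "u \<in> T (j + M * j0)" "\<And>x. u (r x) = h x * t0 (r x) ^ M"
        using absorb[OF h(2) pull[OF t0(2)] t0(1)] by auto
      have "(\<lambda>x. u x * t x) \<in> q (j + M * j0 + k)" using q.mult[OF u(1) t] .
      moreover have "(\<lambda>x. t1 x * t0 x ^ M) = (\<lambda>x. u x * t x)"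
        by (rule inj2[OF Tmultpow[OF h(3) t0(2)]])
           (use Tmult[OF u(1) q.sub[OF t]] in \<open>simp_all add: u h(4) ac_simps\<close>)
      ultimately show ?thesis 
        using q.multpow_iff[OF T h(3) t0(2,3), of M] by (simp add: ac_simps)
    qed
    then show "t \<in> push (lift q) k"
      using q.sub[OF t] pull[OF q.sub[OF t]] by (auto simp: push_def lift_def)
  qed
  then show ?thesis by (simp add: fun_eq_iff set_eq_iff)
qed

lemma lift_push:
  assumes "relevant_prime R p" shows "lift (push p) = p"
proof -
  interpret p: relevant_prime_ideal R p by standard fact
  obtain j h where h: "0 < j" "h \<in> R j" "h \<notin> p j" by (rule p.relevant)
  have "f \<in> lift (push p) k \<longleftrightarrow> f \<in> p k" for f k
  proof
    assume f: "f \<in> lift (push p) k"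
    then have fR: "f \<in> R k" by (auto simp: lift_def)
    obtain M t where t: "t \<in> T (k + j + M * j)" "\<And>x. t (r x) = (f x * h x) * h x ^ M"
      using absorb[OF Rmult[OF fR h(2)] h(2,1)] by blast
    have "t \<in> push p (k + (j + M * j))"
      using liftD[OF f _ Rmultpow[OF h(2) h(2), of M], of t] t h(1) by (simp add: ac_simps)
    then have "(\<lambda>x. f x * h x ^ Suc M) \<in> p (k + Suc M * j)"
      by (simp add: push_def o_def t(2) ac_simps)
    then show "f \<in> p k" using p.multpow_iff[OF R fR h(2,3), of "Suc M"] by blast
  next
    assume f: "f \<in> p k"
    have "t \<in> push p (k + j)" if "h \<in> R j" "t \<in> T (k + j)" "\<forall>x. t (r x) = f x * h x" for j h t
    proof -
      have "t \<circ> r = (\<lambda>x. h x * f x)" using that by (auto simp: mult.commute)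
      then show ?thesis using p.mult[OF that(1) f] that by (simp add: push_def add.commute)
    qed
    then show "f \<in> lift (push p) k" using p.sub[OF f] by (auto simp: lift_def)
  qed
  then show ?thesis by (simp add: fun_eq_iff set_eq_iff)
qed

lemma push_mono: "(\<And>k. p k \<subseteq> p' k) \<Longrightarrow> push p k \<subseteq> push p' k"
  and lift_mono: "(\<And>k. q k \<subseteq> q' k) \<Longrightarrow> lift q k \<subseteq> lift q' k"
  unfolding push_def lift_def by blast+

lemma push_proj_points: 
  assumes "p \<in> proj_points R" shows "push p \<in> proj_points T"
proof -
  have p: "relevant_prime R p" using assms by (simp add: proj_points_def)
  have "q = push p" if "relevant_prime T q" "\<And>k. push p k \<subseteq> q k" for q
  proof -
    have "\<And>k. p k \<subseteq> lift q k" using lift_mono[of "push p" q, OF that(2)] lift_push[OF p] by simp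
    then have "lift q = p" using assms lift_relevant_prime[OF that(1)] by (auto simp: proj_points_def)
    then show ?thesis using push_lift[OF that(1)] by metis
  qed
  then show ?thesis using push_relevant_prime[OF p] by (auto simp: proj_points_def)
qed

lemma lift_proj_points: 
  assumes "q \<in> proj_points T" shows "lift q \<in> proj_points R"
proof -
  have q: "relevant_prime T q" using assms by (simp add: proj_points_def)
  have "p = lift q" if "relevant_prime R p" "\<And>k. lift q k \<subseteq> p k" for p
  proof -
    have "\<And>k. q k \<subseteq> push p k" using push_mono[of "lift q" p, OF that(2)] push_lift[OF q] by simp
    then have "push p = q" using assms push_relevant_prime[OF that(1)] by (auto simp: proj_points_def)
    then show ?thesis using lift_push[OF that(1)] by metis
  qed
  then show ?thesis using lift_relevant_prime[OF q] by (auto simp: proj_points_def)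
qed

lemma proj_points_prime: "p \<in> proj_points R \<Longrightarrow> relevant_prime R p"
  "q \<in> proj_points T \<Longrightarrow> relevant_prime T q"
  by (simp_all add: proj_points_def)

lemma push_morphism: "variety_morphism (proj_variety R) (proj_variety T) push"
proof -
  have cont: "continuous_map (proj_zariski R) (proj_zariski T) push"
  proof (rule continuous_map_into_proj_zariski)
    fix t k assume t: "0 < k" "t \<in> T k"
    have "{p \<in> topspace (proj_zariski R). t \<notin> push p k} = {p \<in> proj_points R. t \<circ> r \<notin> p k}"
      using t by (auto simp: topspace_proj_zariski push_def)
    then show "openin (proj_zariski R) {p \<in> topspace (proj_zariski R). t \<notin> push p k}"
      using openin_proj_zariski_nonvanishing[of k "t \<circ> r" R] t pull by simp
  qed (simp add: topspace_proj_zariski push_proj_points)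
  have "proj_regular_fun R {p \<in> proj_points R. push p \<in> V} (\<phi> \<circ> push)"
    if V: "openin (proj_zariski T) V" "proj_regular_fun T V \<phi>" for V \<phi>
    unfolding proj_regular_fun_def
  proof
    fix p assume p: "p \<in> {p \<in> proj_points R. push p \<in> V}"
    then have "push p \<in> V" by simp
    with V(2) obtain W k f g where W: "f \<in> T k" "g \<in> T k" "openin (proj_zariski T) W" "push p \<in> W" "W \<subseteq> V"
      "\<And>q. q \<in> W \<Longrightarrow> g \<notin> q k \<and> \<phi> q = fraction_value f g k q"
      by (rule proj_regular_funE) blast
    let ?W = "{p \<in> proj_points R. push p \<in> W}"
    have op: "openin (proj_zariski R) ?W"
      using openin_continuous_map_preimage[OF cont W(3)] by (simp add: topspace_proj_zariski)
    have eq: "fraction_value (f \<circ> r) (g \<circ> r) k q = fraction_value f g k (push q)" for q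
    proof -
      have "(\<lambda>x. f x - c * g x) \<in> T k" for c using Tlin[OF W(2) W(1), of "- c"] by simp
      then show ?thesis by (simp add: fraction_value_def push_def o_def)
    qed
    have "g \<circ> r \<notin> q k \<and> (\<phi> \<circ> push) q = fraction_value (f \<circ> r) (g \<circ> r) k q" if "q \<in> ?W" for q
      using W(6)[of "push q"] that W(2) by (auto simp: eq push_def)
    then show "\<exists>W k. \<exists>f\<in>R k. \<exists>g\<in>R k. openin (proj_zariski R) W \<and> p \<in> W \<and>
         W \<subseteq> {p \<in> proj_points R. push p \<in> V} \<and>
         (\<forall>q\<in>W. g \<notin> q k \<and> (\<phi> \<circ> push) q = fraction_value f g k q)"
      using op p W(4,5) pull[OF W(1)] pull[OF W(2)]
      by (intro exI[of _ ?W] exI[of _ k] bexI[of _ "f \<circ> r"] bexI[of _ "g \<circ> r"]) auto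
  qed
  then show ?thesis using cont 
    by (simp add: variety_morphism_def proj_variety_def topspace_proj_zariski)
qed

text \<open>
  Membership in the prime ideal \<open>lift q\<close> can be tested in \<open>T\<close> after multiplication by any power of an
  element outside \<open>q\<close>. Regular functions on the two sides are compared with it.
\<close>

lemma lift_iff:
  assumes q: "q \<in> proj_points T" and f: "f \<in> R k" and t0: "t0 \<in> T j" "t0 \<notin> q j"
    and t: "t \<in> T (k + n * j)" "\<And>x. t (r x) = f x * t0 (r x) ^ n"
  shows "t \<in> q (k + n * j) \<longleftrightarrow> f \<in> lift q k"
proof -
  interpret p: relevant_prime_ideal R "lift q" 
    by standard (rule lift_relevant_prime[OF proj_points_prime(2)[OF q]])
  have e: "u \<in> q i \<longleftrightarrow> u \<circ> r \<in> lift q i" if "u \<in> T i" for u i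
    using that push_lift[OF proj_points_prime(2)[OF q]] by (auto simp: push_def fun_eq_iff)
  show ?thesis
    unfolding e[OF t(1)] using p.multpow_iff[OF R f pull[OF t0(1)], of n] e[OF t0(1)] t0(2)
    by (simp add: o_def t(2))
qed

lemma lift_morphism: "variety_morphism (proj_variety T) (proj_variety R) lift"
proof -
  have cont: "continuous_map (proj_zariski T) (proj_zariski R) lift"
  proof (rule continuous_map_into_proj_zariski)
    fix f k assume f: "0 < k" "f \<in> R k"
    obtain M t where t: "t \<in> T (k + M * k)" "\<And>x. t (r x) = f x * f x ^ M"
      using absorb[OF f(2) f(2) f(1)] by blast
    have "f \<in> lift q k \<longleftrightarrow> t \<in> q (k + M * k)" if q: "q \<in> proj_points T" for q
    proof -
      interpret p: relevant_prime_ideal R "lift q" 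
        by standard (rule lift_relevant_prime[OF proj_points_prime(2)[OF q]])
      have "t \<in> q (k + M * k) \<longleftrightarrow> t \<circ> r \<in> lift q (k + M * k)"
        using t push_lift[OF proj_points_prime(2)[OF q]] by (auto simp: push_def fun_eq_iff)
      also have "\<dots> \<longleftrightarrow> f \<in> lift q k"
      proof (cases "f \<in> lift q k")
        case True
        then show ?thesis using p.multpow[OF True f(2), of M] by (simp add: o_def t(2))
      next
        case False
        then show ?thesis using p.multpow_iff[OF R f(2) f(2) False, of M] by (simp add: o_def t(2))
      qed
      finally show ?thesis by blast
    qed
    then have "{q \<in> topspace (proj_zariski T). f \<notin> lift q k} = {q \<in> proj_points T. t \<notin> q (k + M * k)}"
      by (auto simp: topspace_proj_zariski)
    then show "openin (proj_zariski T) {q \<in> topspace (proj_zariski T). f \<notin> lift q k}"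
      using openin_proj_zariski_nonvanishing[of "k + M * k" t T] t f(1) by simp
  qed (simp add: topspace_proj_zariski lift_proj_points)
  have "proj_regular_fun T {q \<in> proj_points T. lift q \<in> V} (\<phi> \<circ> lift)"
    if V: "openin (proj_zariski R) V" "proj_regular_fun R V \<phi>" for V \<phi>
    unfolding proj_regular_fun_def
  proof
    fix q assume q: "q \<in> {q \<in> proj_points T. lift q \<in> V}"
    then have "lift q \<in> V" by simp
    with V(2) obtain W k f g where W: "f \<in> R k" "g \<in> R k" "openin (proj_zariski R) W" "lift q \<in> W" "W \<subseteq> V"
      "\<And>p. p \<in> W \<Longrightarrow> g \<notin> p k \<and> \<phi> p = fraction_value f g k p"
      by (rule proj_regular_funE) blast
    interpret q: relevant_prime_ideal T q using q by unfold_locales (simp add: proj_points_def)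
    obtain j t0 where t0: "0 < j" "t0 \<in> T j" "t0 \<notin> q j" by (rule q.relevant)
    obtain M1 where M1: "\<And>n. n \<ge> M1 \<Longrightarrow> \<exists>t\<in>T (k + n * j). \<forall>x. t (r x) = f x * t0 (r x) ^ n"
      using absorb_ge[OF W(1) t0(2,1)] by blast
    obtain M2 where M2: "\<And>n. n \<ge> M2 \<Longrightarrow> \<exists>t\<in>T (k + n * j). \<forall>x. t (r x) = g x * t0 (r x) ^ n"
      using absorb_ge[OF W(2) t0(2,1)] by blast
    define n where "n = max M1 M2"
    obtain t1 where t1: "t1 \<in> T (k + n * j)" "\<And>x. t1 (r x) = f x * t0 (r x) ^ n"
      using M1[of n] by (auto simp: n_def)
    obtain t2 where t2: "t2 \<in> T (k + n * j)" "\<And>x. t2 (r x) = g x * t0 (r x) ^ n"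
      using M2[of n] by (auto simp: n_def)
    let ?W = "{q \<in> proj_points T. lift q \<in> W} \<inter> {q \<in> proj_points T. t0 \<notin> q j}"
    have op: "openin (proj_zariski T) ?W"
      using openin_continuous_map_preimage[OF cont W(3)] openin_proj_zariski_nonvanishing[of j t0 T] t0(1,2)
      by (intro openin_Int) (simp_all add: topspace_proj_zariski)
    have "t2 \<notin> q' (k + n * j) \<and> (\<phi> \<circ> lift) q' = fraction_value t1 t2 (k + n * j) q'" if q': "q' \<in> ?W" for q'
    proof -
      have q'p: "q' \<in> proj_points T" and n0: "t0 \<notin> q' j" using q' by auto
      have "(\<lambda>x. t1 x - c * t2 x) \<in> q' (k + n * j) \<longleftrightarrow> (\<lambda>x. f x - c * g x) \<in> lift q' k" for c
        using Rlin[OF W(2,1), of "- c"] Tlin[OF t2(1) t1(1), of "- c"]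
        by (intro lift_iff[OF q'p _ t0(2) n0]) (simp_all add: t1 t2 algebra_simps)
      moreover have "t2 \<notin> q' (k + n * j)"
        using W(6)[of "lift q'"] q' lift_iff[OF q'p W(2) t0(2) n0 t2] by auto
      moreover have "\<phi> (lift q') = fraction_value f g k (lift q')" using W(6) q' by auto
      ultimately show ?thesis by (simp add: fraction_value_def)
    qed
    then show "\<exists>W k. \<exists>f\<in>T k. \<exists>g\<in>T k. openin (proj_zariski T) W \<and> q \<in> W \<and>
         W \<subseteq> {q \<in> proj_points T. lift q \<in> V} \<and>
         (\<forall>q\<in>W. g \<notin> q k \<and> (\<phi> \<circ> lift) q = fraction_value f g k q)"
      using op q W(4,5) t1(1) t2(1) t0
      by (intro exI[of _ ?W] exI[of _ "k + n * j"] bexI[of _ t1] bexI[of _ t2]) auto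
  qed
  then show ?thesis using cont 
    by (simp add: variety_morphism_def proj_variety_def topspace_proj_zariski)
qed

theorem isomorphic_proj: "isomorphic_varieties (proj_variety R) (proj_variety T)"
  unfolding isomorphic_varieties_def variety_isomorphism_def
  using push_morphism lift_morphism lift_push push_lift proj_points_prime
  by (intro exI[of _ push] conjI exI[of _ lift] ballI)
     (auto simp: proj_variety_def topspace_proj_zariski)

end

lemma proj_points_empty:
  assumes "\<And>k f. 0 < k \<Longrightarrow> f \<in> R k \<Longrightarrow> f = (\<lambda>_. 0)"
  shows "proj_points R = {}"
proof -
  have "\<not> relevant_prime R p" for p
  proof
    assume p: "relevant_prime R p"
    then obtain f k where "0 < k" "f \<in> R k" "f \<notin> p k" by (rule relevant_prime_witness)
    moreover have "(\<lambda>_. 0) \<in> p k" for k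
      using p by (simp add: relevant_prime_def homogeneous_ideal_def)
    ultimately show False using assms by blast
  qed
  then show ?thesis by (simp add: proj_points_def)
qed

lemma isomorphic_empty_proj:
  assumes "\<And>k f. 0 < k \<Longrightarrow> f \<in> R k \<Longrightarrow> f = (\<lambda>_. 0)"
  shows "isomorphic_varieties (proj_variety R) empty_variety"
proof -
  have top: "topspace (proj_zariski R) = {}"
    using proj_points_empty[of R] assms by (simp add: topspace_proj_zariski)
  have "continuous_map (proj_zariski R) (discrete_topology {}) undefined"
     "continuous_map (discrete_topology {}) (proj_zariski R) undefined"
    using top by (auto simp: continuous_map_def)
  then show ?thesis
    unfolding isomorphic_varieties_def variety_isomorphism_def variety_morphism_def
    by (intro exI[of _ undefined]) (auto simp: proj_variety_def empty_variety_def top proj_regular_fun_def)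
qed

section \<open>Determinantal identities\<close>

lemma prod_permuted_ones_eq_0:
  fixes A :: "complex mat"
  assumes r0: "r0 < n" and p: "p permutes {0..<n}" "p \<noteq> id"
    and A: "\<And>i j. i < n \<Longrightarrow> j < n \<Longrightarrow> i \<noteq> r0 \<Longrightarrow> A $$ (i, j) = (if i = j then 1 else 0)"
  shows "(\<Prod>i = 0..<n. A $$ (i, p i)) = 0"
proof -
  have "\<exists>i<n. i \<noteq> r0 \<and> p i \<noteq> i"
  proof (rule ccontr)
    assume "\<not> ?thesis"
    then have fixes_others: "p i = i" if "i \<noteq> r0" for i
      using that p(1) by (cases "i < n") (auto simp: permutes_def)
    then have "p r0 = r0" using permutes_inj[OF p(1)] by (metis injD)
    then have "p = id" using fixes_others by (metis eq_id_iff)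
    then show False using p(2) by simp
  qed
  then obtain i where i: "i < n" "i \<noteq> r0" "p i \<noteq> i" by blast
  have "p i < n" using permutes_in_image[OF p(1), of i] i(1) by auto
  then show ?thesis using i A[of i "p i"] by (intro prod_zero) auto
qed

lemma det_identity_except_row:
  fixes A :: "complex mat"
  assumes A: "A \<in> carrier_mat n n" and r0: "r0 < n"
    and rows: "\<And>i j. i < n \<Longrightarrow> j < n \<Longrightarrow> i \<noteq> r0 \<Longrightarrow> A $$ (i, j) = (if i = j then 1 else 0)"
  shows "Determinant.det A = A $$ (r0, r0)"
proof -
  have "Determinant.det A = (\<Sum>p | p permutes {0..<n}. signof p * (\<Prod>i = 0..<n. A $$ (i, p i)))"
    by (rule det_def'[OF A])
  also have "\<dots> = (\<Sum>p\<in>{id}. signof p * (\<Prod>i = 0..<n. A $$ (i, p i)))"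
    using prod_permuted_ones_eq_0[OF r0 _ _ rows]
    by (intro sum.mono_neutral_right) (auto simp: finite_permutations permutes_id)
  also have "\<dots> = (\<Prod>i = 0..<n. A $$ (i, i))" by (simp add: id_def[symmetric] sign_id)
  also have "\<dots> = A $$ (r0, r0) * (\<Prod>i \<in> {0..<n} - {r0}. A $$ (i, i))"
    using r0 by (simp add: prod.remove)
  also have "(\<Prod>i \<in> {0..<n} - {r0}. A $$ (i, i)) = 1" using rows by (intro prod.neutral) auto
  finally show ?thesis by simp
qed

text \<open>
  By induction on the number of rows: border a non-zero minor by the new row and by an arbitrary column
  \<open>c\<close>. The cofactors \<open>u\<close> of the new column do not depend on \<open>c\<close>, and their combination with the entries
  of column \<open>c\<close> is the bordered minor. So if no bordered minor is non-zero, \<open>u\<close> is a dependency; it is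
  not trivial since its last entry is the old minor.
\<close>

lemma nonzero_minor_or_dependent_rows:
  fixes \<beta> :: "nat \<Rightarrow> nat \<Rightarrow> complex"
  shows "(\<exists>J \<in> {0..<n} \<rightarrow>\<^sub>E {0..<N}. Determinant.det (Matrix.mat n n (\<lambda>(r, k). \<beta> r (J k))) \<noteq> 0) \<or>
    (\<exists>u. (\<exists>r<n. u r \<noteq> 0) \<and> (\<forall>c<N. (\<Sum>r<n. u r * \<beta> r c) = 0))"
proof (induction n)
  case 0
  have "Determinant.det (Matrix.mat 0 0 (\<lambda>(r, k). \<beta> r (undefined k))) \<noteq> 0"
    by (subst det_dim_zero) auto
  then show ?case by (intro disjI1 bexI[of _ "\<lambda>_. undefined"]) auto
next
  case (Suc n)
  then show ?case
  proof
    assume "\<exists>u. (\<exists>r<n. u r \<noteq> 0) \<and> (\<forall>c<N. (\<Sum>r<n. u r * \<beta> r c) = 0)"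
    then obtain u where u: "\<exists>r<n. u r \<noteq> 0" "\<forall>c<N. (\<Sum>r<n. u r * \<beta> r c) = 0" by blast
    have "\<exists>r<Suc n. (u(n := 0)) r \<noteq> 0" using u(1) by auto
    moreover have "\<forall>c<N. (\<Sum>r<Suc n. (u(n := 0)) r * \<beta> r c) = 0" using u(2) by simp
    ultimately show ?thesis by blast
  next
    assume "\<exists>J \<in> {0..<n} \<rightarrow>\<^sub>E {0..<N}. Determinant.det (Matrix.mat n n (\<lambda>(r, k). \<beta> r (J k))) \<noteq> 0"
    then obtain J where J: "J \<in> {0..<n} \<rightarrow>\<^sub>E {0..<N}"
      "Determinant.det (Matrix.mat n n (\<lambda>(r, k). \<beta> r (J k))) \<noteq> 0" by blast
    define A where "A = (\<lambda>c. Matrix.mat (Suc n) (Suc n) (\<lambda>(r, k). \<beta> r ((J(n := c)) k)))"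
    define u where "u = (\<lambda>r. cofactor (A 0) r n)"
    have cof: "cofactor (A c) r n = u r" if "r < Suc n" for c r
    proof -
      have "mat_delete (A c) r n = mat_delete (A 0) r n"
        using that by (intro eq_matI) (auto simp: A_def mat_delete_def)
      then show ?thesis by (simp add: u_def cofactor_def)
    qed
    have det: "Determinant.det (A c) = (\<Sum>r<Suc n. u r * \<beta> r c)" for c
    proof -
      have "Determinant.det (A c) = (\<Sum>r<Suc n. A c $$ (r, n) * cofactor (A c) r n)"
        by (rule laplace_expansion_column) (auto simp: A_def)
      also have "\<dots> = (\<Sum>r<Suc n. u r * \<beta> r c)"
        by (intro sum.cong refl) (simp add: cof, simp add: A_def)
      finally show ?thesis .
    qed
    have "mat_delete (A 0) n n = Matrix.mat n n (\<lambda>(r, k). \<beta> r (J k))"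
      by (intro eq_matI) (auto simp: A_def mat_delete_def)
    then have un: "u n \<noteq> 0" using J(2) by (simp add: u_def cofactor_def)
    show ?thesis
    proof (cases "\<exists>c<N. Determinant.det (A c) \<noteq> 0")
      case True
      then obtain c where c: "c < N" "Determinant.det (A c) \<noteq> 0" by blast
      have "J(n := c) \<in> {0..<Suc n} \<rightarrow>\<^sub>E {0..<N}"
        using J(1) c(1) by (auto simp: PiE_iff extensional_def)
      then show ?thesis using c(2) unfolding A_def by blast
    next
      case False
      then show ?thesis using un det by (intro disjI2 exI[of _ u]) auto
    qed
  qed
qed

text \<open>
  The Cauchy--Binet formula. The sum runs over all tuples of indices instead of increasing ones, so that
  each \<open>n\<close>-element set is counted \<open>n!\<close> times, with equal signs, while tuples with a repetition
  contribute nothing.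
\<close>

lemma det_mult_times_fact_eq_sum_minors:
  fixes A B :: "complex mat"
  assumes A: "A \<in> carrier_mat N n" and B: "B \<in> carrier_mat n N"
  shows "of_nat (fact n) * Determinant.det (B * A) =
    (\<Sum>J \<in> {0..<n} \<rightarrow>\<^sub>E {0..<N}. Determinant.det (Matrix.mat n n (\<lambda>(k, c). A $$ (J k, c))) *
       Determinant.det (Matrix.mat n n (\<lambda>(r, k). B $$ (r, J k))))"
proof -
  let ?JJ = "{0..<n} \<rightarrow>\<^sub>E {0..<N}" and ?S = "{p. p permutes {0..<n}}"
  let ?a = "\<lambda>J. Determinant.det (Matrix.mat n n (\<lambda>(k, c). A $$ (J k, c)))"
  let ?b = "\<lambda>J. Determinant.det (Matrix.mat n n (\<lambda>(r, k). B $$ (r, J k)))"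
  have expand: "Determinant.det (B * A) = (\<Sum>J\<in>?JJ. (\<Prod>r=0..<n. B $$ (r, J r)) * ?a J)"
  proof -
    have "Determinant.det (B * A) = (\<Sum>p\<in>?S. signof p * (\<Prod>r = 0..<n. (B * A) $$ (r, p r)))"
      using A B by (intro det_def') auto
    also have "\<dots> = (\<Sum>p\<in>?S. signof p * (\<Prod>r = 0..<n. \<Sum>t\<in>{0..<N}. B $$ (r, t) * A $$ (t, p r)))"
    proof (intro sum.cong arg_cong2[where f="(*)"] prod.cong refl)
      fix p r assume "p \<in> ?S" "r \<in> {0..<n}"
      then show "(B * A) $$ (r, p r) = (\<Sum>t\<in>{0..<N}. B $$ (r, t) * A $$ (t, p r))"
        using A B permutes_in_image[of p "{0..<n}" r] by (auto simp: scalar_prod_def)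
    qed
    also have "\<dots> = (\<Sum>p\<in>?S. signof p * (\<Sum>J\<in>?JJ. \<Prod>r = 0..<n. B $$ (r, J r) * A $$ (J r, p r)))"
      by (intro sum.cong arg_cong2[where f="(*)"] refl prod_sum_PiE) auto
    also have "\<dots> = (\<Sum>J\<in>?JJ. (\<Prod>r=0..<n. B $$ (r, J r)) * (\<Sum>p\<in>?S. signof p * (\<Prod>r = 0..<n. A $$ (J r, p r))))"
      by (simp add: sum_distrib_left prod.distrib mult_ac) (rule sum.swap)
    also have "\<dots> = (\<Sum>J\<in>?JJ. (\<Prod>r=0..<n. B $$ (r, J r)) * ?a J)"
    proof (intro sum.cong arg_cong2[where f="(*)"] refl)
      fix J
      have "?a J = (\<Sum>p\<in>?S. signof p * (\<Prod>r = 0..<n. Matrix.mat n n (\<lambda>(k, c). A $$ (J k, c)) $$ (r, p r)))"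
        by (intro det_def') auto
      also have "\<dots> = (\<Sum>p\<in>?S. signof p * (\<Prod>r = 0..<n. A $$ (J r, p r)))"
        by (intro sum.cong arg_cong2[where f="(*)"] prod.cong refl)
           (use permutes_in_image in \<open>fastforce\<close>)
      finally show "(\<Sum>p\<in>?S. signof p * (\<Prod>r = 0..<n. A $$ (J r, p r))) = ?a J" by simp
    qed
    finally show ?thesis .
  qed
  \<comment> \<open>Averaging \<open>expand\<close> over all permutations of the summation index completes the second factor to a determinant.\<close>
  have twist: "Determinant.det (B * A) = (\<Sum>J\<in>?JJ. (signof q * (\<Prod>r=0..<n. B $$ (r, J (q r)))) * ?a J)"
    if q: "q permutes {0..<n}" for q
  proof -
    have bij: "bij_betw (\<lambda>J. restrict (J \<circ> q) {0..<n}) ?JJ ?JJ"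
    proof (rule bij_betw_byWitness[where f' = "\<lambda>J. restrict (J \<circ> inv_into UNIV q) {0..<n}"])
      have 1: "\<And>k. q k < n \<longleftrightarrow> k < n" "\<And>k. inv_into UNIV q k < n \<longleftrightarrow> k < n"
        using permutes_in_image[OF q] permutes_in_image[OF permutes_inv[OF q]] by auto
      show "\<forall>J\<in>?JJ. restrict (restrict (J \<circ> q) {0..<n} \<circ> inv_into UNIV q) {0..<n} = J"
        "\<forall>J\<in>?JJ. restrict (restrict (J \<circ> inv_into UNIV q) {0..<n} \<circ> q) {0..<n} = J"
        using 1 permutes_inverses[OF q]
        by (auto simp: fun_eq_iff restrict_def PiE_iff extensional_def)
      show "(\<lambda>J. restrict (J \<circ> q) {0..<n}) ` ?JJ \<subseteq> ?JJ"
        "(\<lambda>J. restrict (J \<circ> inv_into UNIV q) {0..<n}) ` ?JJ \<subseteq> ?JJ"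
        using 1 by (auto simp: PiE_iff)
    qed
    have "Determinant.det (B * A) = (\<Sum>J\<in>?JJ. (\<Prod>r=0..<n. B $$ (r, restrict (J \<circ> q) {0..<n} r)) *
        ?a (restrict (J \<circ> q) {0..<n}))"
      unfolding expand by (rule sum.reindex_bij_betw[OF bij, symmetric])
    also have "\<dots> = (\<Sum>J\<in>?JJ. (signof q * (\<Prod>r=0..<n. B $$ (r, J (q r)))) * ?a J)"
    proof (rule sum.cong[OF refl])
      fix J
      have "Matrix.mat n n (\<lambda>(k, c). A $$ (restrict (J \<circ> q) {0..<n} k, c)) =
         Matrix.mat n n (\<lambda>(i, j). Matrix.mat n n (\<lambda>(k, c). A $$ (J k, c)) $$ (q i, j))"
        using permutes_in_image[OF q] by (intro eq_matI) auto
      then have "?a (restrict (J \<circ> q) {0..<n}) = signof q * ?a J"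
        by (simp add: det_permute_rows[OF _ q])
      then show "(\<Prod>r=0..<n. B $$ (r, restrict (J \<circ> q) {0..<n} r)) * ?a (restrict (J \<circ> q) {0..<n})
         = (signof q * (\<Prod>r=0..<n. B $$ (r, J (q r)))) * ?a J"
        by (simp add: mult_ac)
    qed
    finally show ?thesis .
  qed
  have "of_nat (fact n) * Determinant.det (B * A) = (\<Sum>q\<in>?S. Determinant.det (B * A))"
    by (simp add: card_permutations)
  also have "\<dots> = (\<Sum>q\<in>?S. \<Sum>J\<in>?JJ. (signof q * (\<Prod>r=0..<n. B $$ (r, J (q r)))) * ?a J)"
    using twist by (intro sum.cong refl) auto
  also have "\<dots> = (\<Sum>J\<in>?JJ. ?a J * (\<Sum>q\<in>?S. signof q * (\<Prod>r=0..<n. B $$ (r, J (q r)))))"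
    by (subst sum.swap) (simp add: sum_distrib_left mult_ac)
  also have "\<dots> = (\<Sum>J\<in>?JJ. ?a J * ?b J)"
  proof (intro sum.cong arg_cong2[where f="(*)"] refl)
    fix J
    have "?b J = (\<Sum>p\<in>?S. signof p * (\<Prod>r = 0..<n. Matrix.mat n n (\<lambda>(r, k). B $$ (r, J k)) $$ (r, p r)))"
      by (intro det_def') auto
    also have "\<dots> = (\<Sum>p\<in>?S. signof p * (\<Prod>r = 0..<n. B $$ (r, J (p r))))"
      by (intro sum.cong arg_cong2[where f="(*)"] prod.cong refl)
         (use permutes_in_image in \<open>fastforce\<close>)
    finally show "(\<Sum>q\<in>?S. signof q * (\<Prod>r=0..<n. B $$ (r, J (q r)))) = ?b J" by simp
  qed
  finally show ?thesis .
qed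

text \<open>
  Cramer's rule for the columns of \<open>B\<close>: the matrix \<open>g\<close> inverts the block of \<open>B\<close> with columns \<open>J\<close>, so the
  entries of \<open>g * B\<close> are quotients of maximal minors of \<open>B\<close>.
\<close>

lemma det_replaced_column_minor:
  fixes B g h :: "complex mat"
  assumes B: "B \<in> carrier_mat n N" and g: "g \<in> carrier_mat n n" and h: "h \<in> carrier_mat n n" "h * g = 1\<^sub>m n"
    and hJ: "h = Matrix.mat n n (\<lambda>(r, k). B $$ (r, J k))" and rc: "r < n" "c < N"
  shows "Determinant.det (Matrix.mat n n (\<lambda>(i, k). B $$ (i, (J(r := c)) k))) = (g * B) $$ (r, c) * Determinant.det h"
proof -
  let ?x = "Matrix.col (g * B) c"
  have x: "?x \<in> carrier_vec n" using g B rc by auto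
  have "h *\<^sub>v ?x = Matrix.col (h * (g * B)) c" using g h B rc by (intro eq_vecI) auto
  also have "h * (g * B) = B" using g h B by (simp flip: assoc_mult_mat[of h n n g n B N])
  finally have "replace_col h (h *\<^sub>v ?x) r = Matrix.mat n n (\<lambda>(i, k). B $$ (i, (J(r := c)) k))"
    using B h rc by (intro eq_matI) (auto simp: replace_col_def hJ)
  then show ?thesis using cramer_lemma_mat[OF h(1) x rc(1)] g B rc by simp
qed

section \<open>Algebras generated by functions\<close>

inductive_set generated_algebra :: "('s \<Rightarrow> complex) set \<Rightarrow> ('s \<Rightarrow> complex) set" for G where
  const: "(\<lambda>s. c) \<in> generated_algebra G"
| gen: "f \<in> G \<Longrightarrow> f \<in> generated_algebra G"
| add: "f \<in> generated_algebra G \<Longrightarrow> g \<in> generated_algebra G \<Longrightarrow> (\<lambda>s. f s + g s) \<in> generated_algebra G"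
| mult: "f \<in> generated_algebra G \<Longrightarrow> g \<in> generated_algebra G \<Longrightarrow> (\<lambda>s. f s * g s) \<in> generated_algebra G"

text \<open>
  The homogeneous component of degree \<open>w\<close> of the algebra generated by \<open>E0\<close> in degree 0 and \<open>E1\<close> in
  degree 1. It is a predicate on functions: a function may be homogeneous of several degrees.
\<close>

inductive weighted :: "('s \<Rightarrow> complex) set \<Rightarrow> ('s \<Rightarrow> complex) set \<Rightarrow> nat \<Rightarrow> ('s \<Rightarrow> complex) \<Rightarrow> bool"
  for E0 E1 where
  zero: "weighted E0 E1 w (\<lambda>s. 0)"
| const: "weighted E0 E1 0 (\<lambda>s. c)"
| gen0: "f \<in> E0 \<Longrightarrow> weighted E0 E1 0 f"
| gen1: "f \<in> E1 \<Longrightarrow> weighted E0 E1 1 f"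
| add: "weighted E0 E1 w f \<Longrightarrow> weighted E0 E1 w g \<Longrightarrow> weighted E0 E1 w (\<lambda>s. f s + g s)"
| mult: "weighted E0 E1 w f \<Longrightarrow> weighted E0 E1 v g \<Longrightarrow> weighted E0 E1 (w + v) (\<lambda>s. f s * g s)"

lemma weighted_cmult: "weighted E0 E1 w f \<Longrightarrow> weighted E0 E1 w (\<lambda>s. c * f s)"
  using weighted.mult[OF weighted.const[of E0 E1 c], of w f] by simp

lemma weighted_sum:
  "(\<And>i. i \<in> I \<Longrightarrow> weighted E0 E1 w (f i)) \<Longrightarrow> weighted E0 E1 w (\<lambda>s. \<Sum>i\<in>I. f i s)"
  by (induction I rule: infinite_finite_induct) (auto intro: weighted.intros)

lemma weighted_prod:
  "(\<And>i. i \<in> I \<Longrightarrow> weighted E0 E1 (w i) (f i)) \<Longrightarrow> weighted E0 E1 (\<Sum>i\<in>I. w i) (\<lambda>s. \<Prod>i\<in>I. f i s)"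
  by (induction I rule: infinite_finite_induct) (auto intro: weighted.intros)

lemma weighted_power: "weighted E0 E1 w f \<Longrightarrow> weighted E0 E1 (k * w) (\<lambda>s. f s ^ k)"
  by (induction k) (auto intro: weighted.intros)

lemma generated_algebra_sum:
  "(\<And>i. i \<in> I \<Longrightarrow> f i \<in> generated_algebra G) \<Longrightarrow> (\<lambda>s. \<Sum>i\<in>I. f i s) \<in> generated_algebra G"
  by (induction I rule: infinite_finite_induct) (auto intro: generated_algebra.intros)

lemma generated_algebra_prod:
  "(\<And>i. i \<in> I \<Longrightarrow> f i \<in> generated_algebra G) \<Longrightarrow> (\<lambda>s. \<Prod>i\<in>I. f i s) \<in> generated_algebra G"
  by (induction I rule: infinite_finite_induct) (auto intro: generated_algebra.intros)

lemma weighted_det: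
  assumes "\<And>i j. i < n \<Longrightarrow> j < n \<Longrightarrow> weighted E0 E1 0 (f i j)"
  shows "weighted E0 E1 0 (\<lambda>s. Determinant.det (Matrix.mat n n (\<lambda>(i, j). f i j s)))"
proof -
  have eq: "Determinant.det (Matrix.mat n n (\<lambda>(i, j). f i j s)) =
    (\<Sum>p | p permutes {0..<n}. signof p * (\<Prod>i = 0..<n. f i (p i) s))" for s
    unfolding det_def'[OF mat_carrier]
    by (intro sum.cong arg_cong2[where f="(*)"] prod.cong refl) (use permutes_in_image in \<open>fastforce\<close>)
  have "weighted E0 E1 (\<Sum>i=0..<n. 0) (\<lambda>s. \<Prod>i = 0..<n. f i (p i) s)" if "p permutes {0..<n}" for p
    using permutes_in_image[OF that] assms by (intro weighted_prod) auto
  then show ?thesis unfolding eq by (intro weighted_sum weighted_cmult) auto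
qed

lemma generated_algebra_det:
  assumes "\<And>i j. i < n \<Longrightarrow> j < n \<Longrightarrow> f i j \<in> generated_algebra G"
  shows "(\<lambda>s. Determinant.det (Matrix.mat n n (\<lambda>(i, j). f i j s))) \<in> generated_algebra G"
proof -
  have eq: "Determinant.det (Matrix.mat n n (\<lambda>(i, j). f i j s)) =
    (\<Sum>p | p permutes {0..<n}. signof p * (\<Prod>i = 0..<n. f i (p i) s))" for s
    unfolding det_def'[OF mat_carrier]
    by (intro sum.cong arg_cong2[where f="(*)"] prod.cong refl) (use permutes_in_image in \<open>fastforce\<close>)
  have "(\<lambda>s. \<Prod>i = 0..<n. f i (p i) s) \<in> generated_algebra G" if "p permutes {0..<n}" for p
    using permutes_in_image[OF that] assms by (intro generated_algebra_prod) auto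
  then show ?thesis unfolding eq
    by (intro generated_algebra_sum generated_algebra.mult[OF generated_algebra.const]) auto
qed

section \<open>Covariants of the general linear group\<close>

definition mutually_inverse :: "nat \<Rightarrow> complex mat \<Rightarrow> complex mat \<Rightarrow> bool" where
  "mutually_inverse n g h \<longleftrightarrow>
     g \<in> carrier_mat n n \<and> h \<in> carrier_mat n n \<and> g * h = 1\<^sub>m n \<and> h * g = 1\<^sub>m n"

lemma mutually_inverse_sym: "mutually_inverse n g h \<Longrightarrow> mutually_inverse n h g"
  by (auto simp: mutually_inverse_def)

lemma det_mutually_inverse:
  "mutually_inverse n g h \<Longrightarrow> Determinant.det g * Determinant.det h = 1"
  unfolding mutually_inverse_def by (metis det_mult det_one)

lemma det_nonzero_obtains_inverse:
  assumes "(h :: complex mat) \<in> carrier_mat n n" "Determinant.det h \<noteq> 0"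
  obtains g where "mutually_inverse n g h"
  using det_non_zero_imp_unit[OF assms, of "()"] assms(1)
  by (auto simp: Units_def ring_mat_def mutually_inverse_def)

lemma mutually_inverse_transpose:
  assumes "mutually_inverse n g h" shows "mutually_inverse n g\<^sup>T h\<^sup>T"
proof -
  have g: "g \<in> carrier_mat n n" "h \<in> carrier_mat n n" "g * h = 1\<^sub>m n" "h * g = 1\<^sub>m n"
    using assms by (auto simp: mutually_inverse_def)
  have "h\<^sup>T * g\<^sup>T = 1\<^sub>m n" "g\<^sup>T * h\<^sup>T = 1\<^sub>m n"
    unfolding transpose_mult[OF g(1,2), symmetric] transpose_mult[OF g(2,1), symmetric] g(3,4) by simp_all
  then show ?thesis using g by (simp add: mutually_inverse_def)
qed

text \<open>
  The identity plus \<open>(t - 1) / u r0\<close> times the matrix with row \<open>u\<close> at position \<open>r0\<close>. As \<open>t\<close> varies these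
  matrices form a one-parameter group: the row vector \<open>u\<close> is scaled by \<open>t\<close>, and column vectors killed
  by \<open>u\<close> are fixed.
\<close>

definition scaling :: "nat \<Rightarrow> nat \<Rightarrow> (nat \<Rightarrow> complex) \<Rightarrow> complex \<Rightarrow> complex mat" where
  "scaling n r0 u t = Matrix.mat n n (\<lambda>(r, c). (if r = c then 1 else 0) + (if r = r0 then (t - 1) * u c / u r0 else 0))"

lemma det_scaling: 
  assumes "r0 < n" "u r0 \<noteq> 0" shows "Determinant.det (scaling n r0 u t) = t"
  by (subst det_identity_except_row[of _ n r0]) (auto simp: scaling_def assms)

lemma scaling_mult:
  assumes "r0 < n" "u r0 \<noteq> 0" "t \<noteq> 0" shows "scaling n r0 u t * scaling n r0 u (1 / t) = 1\<^sub>m n"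
proof (rule eq_matI)
  fix r c assume rc: "r < dim_row (1\<^sub>m n :: complex mat)" "c < dim_col (1\<^sub>m n :: complex mat)"
  have "(scaling n r0 u t * scaling n r0 u (1 / t)) $$ (r, c) = 
     (\<Sum>k\<in>{0..<n}. ((if r = k then 1 else 0) + (if r = r0 then (t - 1) * u k / u r0 else 0)) *
        ((if k = c then 1 else 0) + (if k = r0 then (1 / t - 1) * u c / u r0 else 0)))"
    using rc by (simp add: scaling_def scalar_prod_def)
  also have "\<dots> = (\<Sum>k\<in>{0..<n}. (if k = r then (if k = c then 1 else 0) + (if k = r0 then (1 / t - 1) * u c / u r0 else 0) else 0))
     + (\<Sum>k\<in>{0..<n}. (if k = c then (if r = r0 then (t - 1) * u k / u r0 else 0) else 0))
     + (\<Sum>k\<in>{0..<n}. (if k = r0 then (if r = r0 then (t - 1) * u k / u r0 else 0) * ((1 / t - 1) * u c / u r0) else 0))"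
    unfolding sum.distrib[symmetric] by (intro sum.cong refl) (auto simp: algebra_simps)
  also have "\<dots> = 1\<^sub>m n $$ (r, c)"
    using rc assms by (auto simp: field_simps)
  finally show "(scaling n r0 u t * scaling n r0 u (1 / t)) $$ (r, c) = 1\<^sub>m n $$ (r, c)" .
qed (auto simp: scaling_def)

lemma mutually_inverse_scaling:
  assumes "r0 < n" "u r0 \<noteq> 0" "t \<noteq> 0" 
  shows "mutually_inverse n (scaling n r0 u t) (scaling n r0 u (1 / t))"
  using scaling_mult[of r0 n u t] scaling_mult[of r0 n u "1 / t"] assms
  by (auto simp: mutually_inverse_def scaling_def)

lemma scaling_fixes:
  assumes u: "r0 < n" "\<And>c. c < N \<Longrightarrow> (\<Sum>r<n. u r * B $$ (r, c)) = 0" and B: "B \<in> carrier_mat n N"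
  shows "scaling n r0 u t * B = B"
proof (rule eq_matI)
  fix r c assume rc: "r < dim_row B" "c < dim_col B"
  have "(scaling n r0 u t * B) $$ (r, c) = (\<Sum>k\<in>{0..<n}. (if k = r then B $$ (k, c) else 0) + 
     (if r = r0 then (t - 1) / u r0 * (u k * B $$ (k, c)) else 0))"
    using rc B by (auto simp: scaling_def scalar_prod_def algebra_simps intro!: sum.cong)
  also have "\<dots> = B $$ (r, c) + (if r = r0 then (t - 1) / u r0 * (\<Sum>k\<in>{0..<n}. u k * B $$ (k, c)) else 0)"
    using rc B by (auto simp: sum.distrib sum_distrib_left)
  also have "\<dots> = B $$ (r, c)" using u(2)[of c] rc B by (simp add: atLeast0LessThan)
  finally show "(scaling n r0 u t * B) $$ (r, c) = B $$ (r, c)" .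
qed (use B in \<open>auto simp: scaling_def\<close>)

text \<open>
  A set \<open>X\<close> with an action of \<open>GL n\<close> and equivariant maps to \<open>n\<close>-by-\<open>N\<close> matrices (\<open>b\<close>, acted on from the
  left) and \<open>N\<close>-by-\<open>n\<close> matrices (\<open>a\<close>, acted on from the right by the inverse), together with invariant
  functions \<open>rest\<close>. For quiver representations \<open>b\<close> and \<open>a\<close> are the maps into and out of one vertex.
\<close>

locale gl_functions =
  fixes X :: "'s set" and n N :: nat and b a :: "'s \<Rightarrow> complex mat"
    and rest :: "('s \<Rightarrow> complex) set" and act :: "complex mat \<Rightarrow> 's \<Rightarrow> 's"
  assumes b_carrier [simp]: "b s \<in> carrier_mat n N" and a_carrier [simp]: "a s \<in> carrier_mat N n"
    and act_X: "s \<in> X \<Longrightarrow> mutually_inverse n g h \<Longrightarrow> act g s \<in> X"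
    and b_act: "s \<in> X \<Longrightarrow> mutually_inverse n g h \<Longrightarrow> b (act g s) = g * b s"
    and a_act: "s \<in> X \<Longrightarrow> mutually_inverse n g h \<Longrightarrow> a (act g s) = a s * h"
    and rest_act: "s \<in> X \<Longrightarrow> mutually_inverse n g h \<Longrightarrow> x \<in> rest \<Longrightarrow> x (act g s) = x s"
begin

lemma dims [simp]: "dim_row (b s) = n" "dim_col (b s) = N" "dim_row (a s) = N" "dim_col (a s) = n"
  using b_carrier[of s] a_carrier[of s] by (auto simp del: b_carrier a_carrier)

abbreviation "tuples \<equiv> {0..<n} \<rightarrow>\<^sub>E {0..<N}"

lemma finite_tuples: "finite tuples" by (intro finite_PiE) auto

definition minor :: "(nat \<Rightarrow> nat) \<Rightarrow> 's \<Rightarrow> complex" where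
  "minor J s = Determinant.det (Matrix.mat n n (\<lambda>(r, k). b s $$ (r, J k)))"

definition coordinates :: "('s \<Rightarrow> complex) set" where
  "coordinates = rest \<union> {\<lambda>s. a s $$ (t, k) | t k. t < N \<and> k < n} \<union> {\<lambda>s. b s $$ (k, t) | t k. t < N \<and> k < n}"

abbreviation "polys \<equiv> generated_algebra coordinates"

text \<open>
  The classical semi-invariants: polynomials in the invariants \<open>rest\<close> and the entries of \<open>a * b\<close> and in
  the maximal minors of \<open>b\<close>, of degree \<open>w\<close> in the minors. By the first fundamental theorem of invariant
  theory all covariants of weight \<open>w\<close> are restrictions of such functions. What is proved below is
  weaker, but strong enough to compare Proj constructions.
\<close>

definition semi :: "nat \<Rightarrow> ('s \<Rightarrow> complex) \<Rightarrow> bool" where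
  "semi = weighted (rest \<union> {\<lambda>s. (a s * b s) $$ (t, t') | t t'. t < N \<and> t' < N}) (minor ` tuples)"

text \<open>
  Equality is required on \<open>X\<close> only, whereas \<open>semi\<close> speaks of functions on the whole type: the arguments by
  induction over \<open>semi\<close> need identities of functions.
\<close>

definition semi_on :: "nat \<Rightarrow> ('s \<Rightarrow> complex) \<Rightarrow> bool" where
  "semi_on w f \<longleftrightarrow> (\<exists>F. semi w F \<and> (\<forall>s\<in>X. f s = F s))"

lemma semi_zero: "semi w (\<lambda>_. 0)" and semi_const: "semi 0 (\<lambda>_. c)"
  and semi_rest: "x \<in> rest \<Longrightarrow> semi 0 x"
  and semi_ab: "t < N \<Longrightarrow> t' < N \<Longrightarrow> semi 0 (\<lambda>s. (a s * b s) $$ (t, t'))"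
  and semi_minor: "J \<in> tuples \<Longrightarrow> semi 1 (minor J)"
  and semi_add: "semi w f \<Longrightarrow> semi w g \<Longrightarrow> semi w (\<lambda>s. f s + g s)"
  and semi_mult: "semi w f \<Longrightarrow> semi v g \<Longrightarrow> semi (w + v) (\<lambda>s. f s * g s)"
  and semi_power: "semi w f \<Longrightarrow> semi (k * w) (\<lambda>s. f s ^ k)"
  and semi_sum: "(\<And>i. i \<in> I \<Longrightarrow> semi w (\<phi> i)) \<Longrightarrow> semi w (\<lambda>s. \<Sum>i\<in>I. \<phi> i s)"
  and semi_prod: "(\<And>i. i \<in> I \<Longrightarrow> semi (ws i) (\<phi> i)) \<Longrightarrow> semi (\<Sum>i\<in>I. ws i) (\<lambda>s. \<Prod>i\<in>I. \<phi> i s)"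
  unfolding semi_def
  by (blast intro: weighted.zero weighted.const weighted.gen0 weighted.gen1 weighted.add weighted.mult
     weighted_power weighted_sum weighted_prod)+

lemma semi_onI: "semi w f \<Longrightarrow> semi_on w f"
  by (auto simp: semi_on_def)

lemma semi_on_cong: "semi_on w f \<Longrightarrow> (\<And>s. s \<in> X \<Longrightarrow> g s = f s) \<Longrightarrow> semi_on w g"
  unfolding semi_on_def by auto

lemma semi_on_add: "semi_on w f \<Longrightarrow> semi_on w g \<Longrightarrow> semi_on w (\<lambda>s. f s + g s)"
  unfolding semi_on_def by (elim exE conjE, rule exI, rule conjI, erule (1) semi_add) simp

lemma semi_on_mult: "semi_on w f \<Longrightarrow> semi_on v g \<Longrightarrow> semi_on (w + v) (\<lambda>s. f s * g s)"
  unfolding semi_on_def by (elim exE conjE, rule exI, rule conjI, erule (1) semi_mult) simp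

lemma semi_on_sum: "(\<And>i. i \<in> I \<Longrightarrow> semi_on w (\<phi> i)) \<Longrightarrow> semi_on w (\<lambda>s. \<Sum>i\<in>I. \<phi> i s)"
  by (induction I rule: infinite_finite_induct) (auto intro: semi_on_add semi_onI[OF semi_zero])

definition covariant :: "nat \<Rightarrow> ('s \<Rightarrow> complex) \<Rightarrow> bool" where
  "covariant p f \<longleftrightarrow> f \<in> polys \<and> (\<forall>s\<in>X. \<forall>g h. mutually_inverse n g h \<longrightarrow> f (act g s) = Determinant.det g ^ p * f s)"

lemma covariantD:
  "covariant p f \<Longrightarrow> s \<in> X \<Longrightarrow> mutually_inverse n g h \<Longrightarrow> f (act g s) = Determinant.det g ^ p * f s"
  by (auto simp: covariant_def)

lemma minor_update:
  assumes "mutually_inverse n g h" "h = Matrix.mat n n (\<lambda>(r, k). b s $$ (r, J k))" "r < n" "c < N"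
  shows "minor (J(r := c)) s = (g * b s) $$ (r, c) * Determinant.det h"
  unfolding minor_def using assms
  by (intro det_replaced_column_minor[of _ n N]) (auto simp: mutually_inverse_def)

text \<open>
  Translating \<open>s\<close> by the inverse \<open>g\<close> of its block \<open>h\<close> with columns \<open>J\<close> makes this block the identity.
  Then the entries of \<open>b\<close> become quotients of minors by \<open>det h\<close> and those of \<open>a\<close> become entries of
  \<open>a * b\<close>, so any polynomial at the translated point is classical up to a power of \<open>det h\<close>.
\<close>

lemma local_formula:
  assumes J: "J \<in> tuples" and "f \<in> polys"
  shows "\<exists>L F. semi L F \<and> (\<forall>s\<in>X. \<forall>g h. mutually_inverse n g h \<longrightarrow> h = Matrix.mat n n (\<lambda>(r, k). b s $$ (r, J k))
     \<longrightarrow> F s = Determinant.det h ^ L * f (act g s))"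
  using assms(2)
proof induction
  case (const c)
  then show ?case using semi_const[of c] by (intro exI[of _ 0] exI[of _ "\<lambda>_. c"]) simp
next
  case (gen f)
  then consider "f \<in> rest" | t k where "f = (\<lambda>s. a s $$ (t, k))" "t < N" "k < n" 
    | t k where "f = (\<lambda>s. b s $$ (k, t))" "t < N" "k < n" unfolding coordinates_def by blast
  then show ?case
  proof cases
    case 1
    then show ?thesis using semi_rest[OF 1] rest_act[OF _ _ 1] by (intro exI[of _ 0] exI[of _ f]) simp
  next
    case 2
    have Jk: "J k < N" using J 2 by (auto simp: PiE_iff)
    have "(a s * b s) $$ (t, J k) = a (act g s) $$ (t, k)"
      if "s \<in> X" "mutually_inverse n g h" "h = Matrix.mat n n (\<lambda>(r, k). b s $$ (r, J k))" for s g h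
      using that 2 Jk by (auto simp: a_act[OF that(1,2)] mutually_inverse_def scalar_prod_def intro!: sum.cong)
    then show ?thesis using semi_ab[OF 2(2) Jk] 2(1) 
      by (intro exI[of _ 0] exI[of _ "\<lambda>s. (a s * b s) $$ (t, J k)"]) simp
  next
    case 3
    have "J(k := t) \<in> tuples" using J 3 by (auto simp: PiE_iff extensional_def)
    then show ?thesis using semi_minor[of "J(k := t)"] 3 minor_update b_act
      by (intro exI[of _ 1] exI[of _ "minor (J(k := t))"]) (auto simp: mult.commute)
  qed
next
  case (add f1 f2)
  then obtain L1 F1 L2 F2 where *:
    "semi L1 F1" "\<forall>s\<in>X. \<forall>g h. mutually_inverse n g h \<longrightarrow> h = Matrix.mat n n (\<lambda>(r, k). b s $$ (r, J k)) 
      \<longrightarrow> F1 s = Determinant.det h ^ L1 * f1 (act g s)"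
    "semi L2 F2" "\<forall>s\<in>X. \<forall>g h. mutually_inverse n g h \<longrightarrow> h = Matrix.mat n n (\<lambda>(r, k). b s $$ (r, J k)) 
      \<longrightarrow> F2 s = Determinant.det h ^ L2 * f2 (act g s)" by blast
  let ?F = "\<lambda>s. minor J s ^ L2 * F1 s + minor J s ^ L1 * F2 s"
  have "semi (L1 + L2) ?F"
    using semi_mult[OF semi_power[OF semi_minor[OF J], of L2] *(1)]
      semi_mult[OF semi_power[OF semi_minor[OF J], of L1] *(3)] by (simp add: semi_add add.commute)
  moreover have "?F s = Determinant.det h ^ (L1 + L2) * (f1 (act g s) + f2 (act g s))"
    if "s \<in> X" "mutually_inverse n g h" "h = Matrix.mat n n (\<lambda>(r, k). b s $$ (r, J k))" for s g h
    using *(2,4) that by (simp add: minor_def power_add algebra_simps)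
  ultimately show ?case by blast
next
  case (mult f1 f2)
  then obtain L1 F1 L2 F2 where *:
    "semi L1 F1" "\<forall>s\<in>X. \<forall>g h. mutually_inverse n g h \<longrightarrow> h = Matrix.mat n n (\<lambda>(r, k). b s $$ (r, J k)) 
      \<longrightarrow> F1 s = Determinant.det h ^ L1 * f1 (act g s)"
    "semi L2 F2" "\<forall>s\<in>X. \<forall>g h. mutually_inverse n g h \<longrightarrow> h = Matrix.mat n n (\<lambda>(r, k). b s $$ (r, J k)) 
      \<longrightarrow> F2 s = Determinant.det h ^ L2 * f2 (act g s)" by blast
  let ?F = "\<lambda>s. F1 s * F2 s"
  have "semi (L1 + L2) ?F" using semi_mult[OF *(1,3)] .
  moreover have "?F s = Determinant.det h ^ (L1 + L2) * (f1 (act g s) * f2 (act g s))"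
    if "s \<in> X" "mutually_inverse n g h" "h = Matrix.mat n n (\<lambda>(r, k). b s $$ (r, J k))" for s g h
    using *(2,4) that by (simp add: power_add algebra_simps)
  ultimately show ?case by blast
qed

text \<open>
  For a covariant, \<open>local_formula\<close> recovers the value at \<open>s\<close> from that at the translated point. The
  strict inequality \<open>L < e\<close> is arranged so that both sides also agree where the minor vanishes.
\<close>

lemma minor_power_mult_covariant:
  assumes J: "J \<in> tuples" and f: "covariant p f"
  shows "\<exists>L. \<forall>e\<ge>L. semi_on (p + e) (\<lambda>s. minor J s ^ e * f s)"
proof -
  have "f \<in> polys" using f by (simp add: covariant_def)
  from local_formula[OF J this] obtain L F where F: "semi L F" 
    "\<And>s g h. s \<in> X \<Longrightarrow> mutually_inverse n g h \<Longrightarrow> h = Matrix.mat n n (\<lambda>(r, k). b s $$ (r, J k))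
     \<Longrightarrow> F s = Determinant.det h ^ L * f (act g s)" by blast
  have "semi_on (p + e) (\<lambda>s. minor J s ^ e * f s)" if e: "e \<ge> Suc L" for e
  proof -
    have "semi (p + e) (\<lambda>s. minor J s ^ (p + (e - L)) * F s)"
      using semi_mult[OF semi_power[OF semi_minor[OF J], of "p + (e - L)"] F(1)] e by simp
    moreover have "minor J s ^ e * f s = minor J s ^ (p + (e - L)) * F s" if s: "s \<in> X" for s
    proof (cases "minor J s = 0")
      case True
      then show ?thesis using e by (simp add: power_0_left)
    next
      case False
      define h where "h = Matrix.mat n n (\<lambda>(r, k). b s $$ (r, J k))"
      have h: "h \<in> carrier_mat n n" "Determinant.det h \<noteq> 0"
        using False by (auto simp: h_def minor_def)
      then obtain g where g: "mutually_inverse n g h" by (rule det_nonzero_obtains_inverse)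
      have gh: "Determinant.det h * Determinant.det g = 1"
        using det_mutually_inverse[OF mutually_inverse_sym[OF g]] .
      have "f (act g s) = Determinant.det g ^ p * f s" using f s g by (auto simp: covariant_def)
      then have "F s = Determinant.det h ^ L * (Determinant.det g ^ p * f s)"
        using F(2)[OF s g] h_def by simp
      then have "minor J s ^ (p + (e - L)) * F s =
         (Determinant.det h ^ (e - L) * Determinant.det h ^ L) * (Determinant.det h ^ p * Determinant.det g ^ p) * f s"
        by (simp add: minor_def h_def[symmetric] power_add mult_ac)
      also have "\<dots> = minor J s ^ e * f s"
        using e by (simp add: minor_def h_def[symmetric] gh flip: power_add power_mult_distrib)
      finally show ?thesis by simp
    qed
    ultimately show ?thesis unfolding semi_on_def by blast
  qed
  then show ?thesis by blast
qed

section \<open>Points where all minors vanish\<close>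

text \<open>
  Equivalently, \<open>b s\<close> is not surjective.
\<close>

definition dependent_rows_at :: "'s \<Rightarrow> bool" where
  "dependent_rows_at s \<longleftrightarrow> (\<exists>u. (\<exists>r<n. u r \<noteq> 0) \<and> (\<forall>c<N. (\<Sum>r<n. u r * b s $$ (r, c)) = 0))"

lemma minor_or_dependent: "(\<exists>J\<in>tuples. minor J s \<noteq> 0) \<or> dependent_rows_at s"
  unfolding minor_def dependent_rows_at_def by (rule nonzero_minor_or_dependent_rows)

text \<open>
  The one-parameter group of a linear form \<open>u\<close> with \<open>u * b s = 0\<close> fixes \<open>b s\<close>, and multiplies \<open>a s\<close> by the
  inverse matrix, whose entries stay bounded as \<open>t\<close> tends to infinity.
\<close>

lemma covariant_bounded:
  assumes s: "s \<in> X" and u: "r0 < n" "u r0 \<noteq> 0" "\<And>c. c < N \<Longrightarrow> (\<Sum>r<n. u r * b s $$ (r, c)) = 0"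
    and f: "f \<in> polys"
  shows "\<exists>C. \<forall>t::real. 1 \<le> t \<longrightarrow> cmod (f (act (scaling n r0 u (of_real t)) s)) \<le> C"
  using f
proof induction
  case (const c) then show ?case by auto
next
  case (gen f)
  have inv: "mutually_inverse n (scaling n r0 u (of_real t)) (scaling n r0 u (1 / of_real t))" if "1 \<le> t" for t :: real
    using that u by (intro mutually_inverse_scaling) auto
  consider "f \<in> rest" | t k where "f = (\<lambda>s. a s $$ (t, k))" "t < N" "k < n" 
    | t k where "f = (\<lambda>s. b s $$ (k, t))" "t < N" "k < n" using gen unfolding coordinates_def by blast
  then show ?case
  proof cases
    case 1
    then show ?thesis using rest_act[OF s inv 1] by (intro exI[of _ "cmod (f s)"]) simp
  next
    case 2
    let ?C = "\<Sum>r\<in>{0..<n}. cmod (a s $$ (t, r)) * (1 + cmod (u k / u r0))"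
    have "cmod (f (act (scaling n r0 u (of_real x)) s)) \<le> ?C" if x: "1 \<le> x" for x :: real
    proof -
      have "f (act (scaling n r0 u (of_real x)) s) = (\<Sum>r\<in>{0..<n}. a s $$ (t, r) * scaling n r0 u (1 / of_real x) $$ (r, k))"
        using 2 a_act[OF s inv[OF x]] by (simp add: scalar_prod_def scaling_def)
      also have "cmod \<dots> \<le> ?C"
      proof (intro sum_norm_le)
        fix r assume r: "r \<in> {0..<n}"
        have "cmod (1 / of_real x - 1) = \<bar>1 / x - 1\<bar>" 
          by (metis norm_of_real of_real_1 of_real_diff of_real_divide)
        also have "\<dots> \<le> 1" using x by (simp add: abs_le_iff field_simps)
        finally have "cmod ((1 / of_real x - 1) * (u k / u r0)) \<le> 1 * cmod (u k / u r0)"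
          unfolding norm_mult by (intro mult_right_mono) auto
        then have "cmod ((if r = k then 1 else 0) + (if r = r0 then (1 / of_real x - 1) * u k / u r0 else 0)) \<le> 1 + cmod (u k / u r0)"
          by (intro order.trans[OF norm_triangle_ineq] add_mono) auto
        then show "cmod (a s $$ (t, r) * scaling n r0 u (1 / of_real x) $$ (r, k)) \<le> cmod (a s $$ (t, r)) * (1 + cmod (u k / u r0))"
          using r 2 unfolding norm_mult by (intro mult_left_mono) (auto simp: scaling_def)
      qed
      finally show ?thesis .
    qed
    then show ?thesis by blast
  next
    case 3
    have "b (act (scaling n r0 u (of_real x)) s) = b s" if x: "1 \<le> x" for x :: real
      unfolding b_act[OF s inv[OF x]] by (rule scaling_fixes[of _ _ N]) (use u in auto)
    then show ?thesis using 3 by (intro exI[of _ "cmod (f s)"]) simp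
  qed
next
  case (add f g)
  then obtain C D where "\<forall>t::real. 1 \<le> t \<longrightarrow> cmod (f (act (scaling n r0 u (of_real t)) s)) \<le> C"
    "\<forall>t::real. 1 \<le> t \<longrightarrow> cmod (g (act (scaling n r0 u (of_real t)) s)) \<le> D" by blast
  then show ?case by (intro exI[of _ "C + D"]) (auto intro!: order.trans[OF norm_triangle_ineq] add_mono)
next
  case (mult f g)
  then obtain C D where "\<forall>t::real. 1 \<le> t \<longrightarrow> cmod (f (act (scaling n r0 u (of_real t)) s)) \<le> C"
    "\<forall>t::real. 1 \<le> t \<longrightarrow> cmod (g (act (scaling n r0 u (of_real t)) s)) \<le> D" by blast
  then show ?case 
    by (intro exI[of _ "C * D"]) (auto simp: norm_mult intro!: mult_mono intro: order.trans[OF norm_ge_zero])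
qed

text \<open>
  The Hilbert--Mumford argument: along the one-parameter group of \<open>covariant_bounded\<close>, the values of \<open>f\<close>
  are \<open>t ^ q * f s\<close>, and they stay bounded.
\<close>

lemma covariant_vanishes:
  assumes "covariant q f" "0 < q" "s \<in> X" "dependent_rows_at s" shows "f s = 0"
proof (rule ccontr)
  assume f0: "f s \<noteq> 0"
  obtain u r0 where u: "r0 < n" "u r0 \<noteq> 0" "\<And>c. c < N \<Longrightarrow> (\<Sum>r<n. u r * b s $$ (r, c)) = 0"
    using assms(4) by (auto simp: dependent_rows_at_def)
  have "f \<in> polys" using assms(1) by (simp add: covariant_def)
  from covariant_bounded[OF assms(3) u this] obtain C where
    C: "\<And>t::real. 1 \<le> t \<Longrightarrow> cmod (f (act (scaling n r0 u (of_real t)) s)) \<le> C" by blast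
  have le: "t * cmod (f s) \<le> C" if t: "1 \<le> t" for t :: real
  proof -
    have "mutually_inverse n (scaling n r0 u (of_real t)) (scaling n r0 u (1 / of_real t))"
      using t u by (intro mutually_inverse_scaling) auto
    from covariantD[OF assms(1,3) this]
    have "f (act (scaling n r0 u (of_real t)) s) = of_real t ^ q * f s"
      using det_scaling[of r0 n u] u(1,2) by simp
    then have "t ^ q * cmod (f s) \<le> C" using C[OF t] t by (simp add: norm_mult norm_power)
    moreover have "t \<le> t ^ q" using t assms(2) by (simp add: self_le_power)
    ultimately show ?thesis by (meson mult_right_mono norm_ge_zero order.trans)
  qed
  have "0 \<le> C" using le[of 1] f0 norm_ge_zero[of "f s"] by linarith
  then have "(C / cmod (f s) + 1) * cmod (f s) \<le> C" by (intro le) (simp add: f0)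
  then show False using f0 by (simp add: distrib_right)
qed

lemma dependent_rows_iff:
  "dependent_rows_at s \<longleftrightarrow> (\<exists>u\<in>carrier_vec n. u \<noteq> 0\<^sub>v n \<and> (b s)\<^sup>T *\<^sub>v u = 0\<^sub>v N)"
proof
  assume "dependent_rows_at s"
  then obtain u where u: "\<exists>r<n. u r \<noteq> 0" "\<forall>c<N. (\<Sum>r<n. u r * b s $$ (r, c)) = 0" by (auto simp: dependent_rows_at_def)
  have "(b s)\<^sup>T *\<^sub>v Matrix.vec n u = 0\<^sub>v N"
    using u(2) by (intro eq_vecI) (auto simp: scalar_prod_def atLeast0LessThan mult.commute)
  moreover have "Matrix.vec n u \<noteq> 0\<^sub>v n" using u(1) by (auto simp: vec_eq_iff)
  ultimately show "\<exists>u\<in>carrier_vec n. u \<noteq> 0\<^sub>v n \<and> (b s)\<^sup>T *\<^sub>v u = 0\<^sub>v N" by (intro bexI[of _ "Matrix.vec n u"]) auto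
next
  assume "\<exists>u\<in>carrier_vec n. u \<noteq> 0\<^sub>v n \<and> (b s)\<^sup>T *\<^sub>v u = 0\<^sub>v N"
  then obtain u where u: "u \<in> carrier_vec n" "u \<noteq> 0\<^sub>v n" "(b s)\<^sup>T *\<^sub>v u = 0\<^sub>v N" by blast
  have "(\<Sum>r<n. Matrix.vec_index u r * b s $$ (r, c)) = 0" if "c < N" for c
  proof -
    have "Matrix.vec_index ((b s)\<^sup>T *\<^sub>v u) c = 0" using u(3) that by simp
    then show ?thesis using that u(1) by (simp add: scalar_prod_def atLeast0LessThan mult.commute)
  qed
  moreover have "\<exists>r<n. Matrix.vec_index u r \<noteq> 0" using u(1,2) by (auto simp: vec_eq_iff)
  ultimately show "dependent_rows_at s" unfolding dependent_rows_at_def by (intro exI[of _ "Matrix.vec_index u"]) auto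
qed

lemma invertible_independent:
  assumes "b s * a s = l \<cdot>\<^sub>m 1\<^sub>m n" "l \<noteq> 0" shows "\<not> dependent_rows_at s"
proof
  assume "dependent_rows_at s"
  then obtain u where u: "u \<in> carrier_vec n" "u \<noteq> 0\<^sub>v n" "(b s)\<^sup>T *\<^sub>v u = 0\<^sub>v N"
    unfolding dependent_rows_iff by blast
  have "l \<cdot>\<^sub>v u = (b s * a s)\<^sup>T *\<^sub>v u" unfolding assms(1) using u(1) by (intro eq_vecI) (auto simp: scalar_prod_def if_distrib[of "\<lambda>x. x * _"] if_distrib[of "\<lambda>x. _ * x"] cong: if_cong)
  also have "(b s * a s)\<^sup>T = (a s)\<^sup>T * (b s)\<^sup>T" by (rule transpose_mult[OF b_carrier a_carrier])
  also have "(a s)\<^sup>T * (b s)\<^sup>T *\<^sub>v u = (a s)\<^sup>T *\<^sub>v ((b s)\<^sup>T *\<^sub>v u)"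
    by (rule assoc_mult_mat_vec[of _ n N _ n]) (use u in auto)
  also have "\<dots> = 0\<^sub>v n" unfolding u(3) by (intro eq_vecI) auto
  finally have "l \<cdot>\<^sub>v u = 0\<^sub>v n" .
  then have "Matrix.vec_index u r = 0" if "r < n" for r
  proof -
    have "Matrix.vec_index (l \<cdot>\<^sub>v u) r = 0" using \<open>l \<cdot>\<^sub>v u = 0\<^sub>v n\<close> that by simp
    then show ?thesis using u(1) that assms(2) by simp
  qed
  then show False using u(1,2) by (auto simp: vec_eq_iff)
qed

lemma too_many_rows_dependent:
  assumes "N < n" shows "dependent_rows_at s"
proof -
  have "minor J s = 0" if J: "J \<in> tuples" for J
  proof -
    have "\<not> inj_on J {0..<n}"
    proof
      assume "inj_on J {0..<n}"
      then have "n = card (J ` {0..<n})" by (simp add: card_image)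
      also have "\<dots> \<le> card {0..<N}" using J by (intro card_mono) auto
      finally show False using assms by simp
    qed
    then obtain x y where "x < n" "y < n" "x \<noteq> y" "J x = J y" by (auto simp: inj_on_def)
    then show ?thesis unfolding minor_def
      by (intro det_identical_columns[of _ n x y]) (auto intro!: eq_vecI)
  qed
  then show ?thesis using minor_or_dependent[of s] by blast
qed

section \<open>Absorption of covariants by classical functions\<close>

definition monomial :: "((nat \<Rightarrow> nat) \<Rightarrow> nat) \<Rightarrow> 's \<Rightarrow> complex" where
  "monomial \<nu> s = (\<Prod>J\<in>tuples. minor J s ^ \<nu> J)"

definition exponents :: "nat \<Rightarrow> ((nat \<Rightarrow> nat) \<Rightarrow> nat) set" where
  "exponents D = {\<nu> \<in> tuples \<rightarrow>\<^sub>E {..D}. (\<Sum>J\<in>tuples. \<nu> J) = D}"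

lemma finite_exponents: "finite (exponents D)"
  unfolding exponents_def by (rule finite_subset[of _ "tuples \<rightarrow>\<^sub>E {..D}"]) (auto intro!: finite_PiE finite_tuples)

lemma semi_split:
  assumes "semi v f"
  shows "v = Suc w \<Longrightarrow> \<exists>c. (\<forall>J\<in>tuples. semi w (c J)) \<and> f = (\<lambda>s. \<Sum>J\<in>tuples. c J s * minor J s)"
  using assms unfolding semi_def
proof (induction arbitrary: w)
  case (zero v)
  then show ?case using semi_zero by (intro exI[of _ "\<lambda>_ _. 0"]) (simp add: semi_def)
next
  case (gen1 f)
  then obtain J where J: "J \<in> tuples" "f = minor J" by blast
  let ?c = "\<lambda>J' s. if J' = J then 1 else (0::complex)"
  have "f = (\<lambda>s. \<Sum>J'\<in>tuples. ?c J' s * minor J' s)"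
    using J finite_tuples by (simp add: if_distrib[of "\<lambda>x. x * _"] cong: if_cong)
  moreover have "semi w (?c J')" for J' using gen1 semi_const by (cases "J' = J") simp_all
  ultimately show ?case unfolding semi_def[symmetric] by (intro exI[of _ ?c] conjI ballI)
next
  case (add v f g)
  obtain c where c: "\<forall>J\<in>tuples. semi w (c J)" "f = (\<lambda>s. \<Sum>J\<in>tuples. c J s * minor J s)"
    using add.IH(1)[OF add.prems] unfolding semi_def by blast
  obtain d where d: "\<forall>J\<in>tuples. semi w (d J)" "g = (\<lambda>s. \<Sum>J\<in>tuples. d J s * minor J s)"
    using add.IH(2)[OF add.prems] unfolding semi_def by blast
  show ?case using c d semi_add unfolding semi_def[symmetric]
    by (intro exI[of _ "\<lambda>J s. c J s + d J s"]) (simp add: distrib_right sum.distrib)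
next
  case (mult v1 f v2 g)
  have f: "semi v1 f" and g: "semi v2 g" using mult.hyps unfolding semi_def .
  show ?case
  proof (cases v1)
    case (Suc w1)
    obtain c where c: "\<forall>J\<in>tuples. semi w1 (c J)" "f = (\<lambda>s. \<Sum>J\<in>tuples. c J s * minor J s)"
      using mult.IH(1)[OF Suc] unfolding semi_def by blast
    have "semi w (\<lambda>s. c J s * g s)" if "J \<in> tuples" for J
      using semi_mult[OF bspec[OF c(1) that] g] Suc mult.prems by simp
    then show ?thesis unfolding semi_def[symmetric]
      by (intro exI[of _ "\<lambda>J s. c J s * g s"]) (simp add: c(2) sum_distrib_left mult_ac)
  next
    case 0
    then obtain d where d: "\<forall>J\<in>tuples. semi w (d J)" "g = (\<lambda>s. \<Sum>J\<in>tuples. d J s * minor J s)"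
      using mult.IH(2)[of w] mult.prems unfolding semi_def by auto
    have "semi w (\<lambda>s. f s * d J s)" if "J \<in> tuples" for J
      using semi_mult[OF f bspec[OF d(1) that]] 0 by simp
    then show ?thesis unfolding semi_def[symmetric]
      by (intro exI[of _ "\<lambda>J s. f s * d J s"]) (simp add: d(2) sum_distrib_left mult_ac)
  qed
qed auto

text \<open>
  A classical function of weight \<open>w + D\<close> lies in the \<open>D\<close>-th power of the ideal generated by the minors,
  with classical coefficients.
\<close>

lemma semi_monomial_split:
  assumes "semi (w + D) f"
  shows "\<exists>c. (\<forall>\<nu>\<in>exponents D. semi w (c \<nu>)) \<and> f = (\<lambda>s. \<Sum>\<nu>\<in>exponents D. c \<nu> s * monomial \<nu> s)"
  using assms
proof (induction D arbitrary: f)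
  case 0
  define z :: "(nat \<Rightarrow> nat) \<Rightarrow> nat" where "z = restrict (\<lambda>_. 0) tuples"
  have "exponents 0 = {z}" using finite_tuples
    by (auto simp: exponents_def PiE_iff extensional_def fun_eq_iff z_def)
  moreover have "monomial z s = 1" for s by (simp add: monomial_def z_def)
  ultimately show ?case using 0 by (intro exI[of _ "\<lambda>_. f"]) simp
next
  case (Suc D)
  let ?G = "\<lambda>f. \<exists>c. (\<forall>\<nu>\<in>exponents (Suc D). semi w (c \<nu>)) \<and>
      f = (\<lambda>s. \<Sum>\<nu>\<in>exponents (Suc D). c \<nu> s * monomial \<nu> s)"
  have G0: "?G (\<lambda>_. 0)" using semi_zero by (intro exI[of _ "\<lambda>_ _. 0"]) simp
  have Gadd: "?G (\<lambda>s. f s + g s)" if "?G f" "?G g" for f g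
  proof -
    from that(1) obtain c where c: "(\<forall>\<nu>\<in>exponents (Suc D). semi w (c \<nu>)) \<and>
      f = (\<lambda>s. \<Sum>\<nu>\<in>exponents (Suc D). c \<nu> s * monomial \<nu> s)" by (rule exE)
    from that(2) obtain d where d: "(\<forall>\<nu>\<in>exponents (Suc D). semi w (d \<nu>)) \<and>
      g = (\<lambda>s. \<Sum>\<nu>\<in>exponents (Suc D). d \<nu> s * monomial \<nu> s)" by (rule exE)
    show ?thesis using c d semi_add
      by (intro exI[of _ "\<lambda>\<nu> s. c \<nu> s + d \<nu> s"]) (simp add: distrib_right sum.distrib)
  qed
  have Gsum: "?G (\<lambda>s. \<Sum>i\<in>I. h i s)" if "finite I" "\<And>i. i \<in> I \<Longrightarrow> ?G (h i)" for I :: "'z set" and h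
    using that
  proof (induction I)
    case (insert i I)
    have "?G (\<lambda>s. h i s + (\<Sum>i\<in>I. h i s))" using insert by (intro Gadd) auto
    then show ?case using insert.hyps by simp
  qed (use G0 in simp)
  have Gmon: "?G (\<lambda>s. c s * monomial \<nu> s)" if "\<nu> \<in> exponents (Suc D)" "semi w c" for c \<nu>
  proof -
    let ?d = "\<lambda>\<nu>' s. if \<nu>' = \<nu> then c s else 0"
    have "semi w (?d \<nu>')" for \<nu>' using that(2) semi_zero by (cases "\<nu>' = \<nu>") simp_all
    moreover have "(\<lambda>s. c s * monomial \<nu> s) = (\<lambda>s. \<Sum>\<nu>'\<in>exponents (Suc D). ?d \<nu>' s * monomial \<nu>' s)"
      using that(1) finite_exponents by (simp add: if_distrib[of "\<lambda>x. x * _"] cong: if_cong)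
    ultimately show ?thesis by (intro exI[of _ ?d] conjI ballI)
  qed
  have "semi (Suc (w + D)) f" using Suc.prems by simp
  from semi_split[OF this refl] obtain c where c: "\<forall>J\<in>tuples. semi (w + D) (c J)"
    "f = (\<lambda>s. \<Sum>J\<in>tuples. c J s * minor J s)" by blast
  have "?G (\<lambda>s. c J s * minor J s)" if J: "J \<in> tuples" for J
  proof -
    obtain d where d: "\<forall>\<nu>\<in>exponents D. semi w (d \<nu>)" "c J = (\<lambda>s. \<Sum>\<nu>\<in>exponents D. d \<nu> s * monomial \<nu> s)"
      using Suc.IH[OF bspec[OF c(1) J]] by blast
    have eq: "(\<lambda>s. c J s * minor J s) = (\<lambda>s. \<Sum>\<nu>\<in>exponents D. d \<nu> s * monomial (\<nu>(J := Suc (\<nu> J))) s)"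
    proof
      fix s
      have "monomial (\<nu>(J := Suc (\<nu> J))) s = monomial \<nu> s * minor J s" for \<nu>
        using J finite_tuples by (simp add: monomial_def prod.remove[of tuples J])
      then show "c J s * minor J s = (\<Sum>\<nu>\<in>exponents D. d \<nu> s * monomial (\<nu>(J := Suc (\<nu> J))) s)"
        by (simp add: d(2) sum_distrib_left mult_ac)
    qed
    show ?thesis unfolding eq
    proof (rule Gsum[OF finite_exponents Gmon])
      fix \<nu> assume \<nu>: "\<nu> \<in> exponents D"
      then show "semi w (d \<nu>)" using d by blast
      have "(\<Sum>J'\<in>tuples. (\<nu>(J := Suc (\<nu> J))) J') = Suc (\<Sum>J'\<in>tuples. \<nu> J')"
        using J finite_tuples by (simp add: sum.remove[of tuples J])
      then show "\<nu>(J := Suc (\<nu> J)) \<in> exponents (Suc D)"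
        using \<nu> J by (auto simp: exponents_def PiE_iff extensional_def le_SucI)
    qed
  qed
  then show ?case unfolding c(2) by (intro Gsum finite_tuples)
qed

text \<open>
  A monomial in the minors of large degree contains a high power of one of them, by the pigeonhole
  principle, and \<open>minor_power_mult_covariant\<close> applies to that factor.
\<close>

lemma saturation_degree:
  assumes f: "covariant p f"
  shows "\<exists>D. \<forall>\<nu>\<in>exponents D. semi_on (p + D) (\<lambda>s. monomial \<nu> s * f s)"
proof -
  obtain L where L: "\<And>J e. J \<in> tuples \<Longrightarrow> L J \<le> e \<Longrightarrow> semi_on (p + e) (\<lambda>s. minor J s ^ e * f s)"
    using minor_power_mult_covariant[OF _ f] by metis
  define D where "D = Suc (\<Sum>J\<in>tuples. L J)"
  have "semi_on (p + D) (\<lambda>s. monomial \<nu> s * f s)" if \<nu>: "\<nu> \<in> exponents D" for \<nu>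
  proof -
    have deg: "(\<Sum>J\<in>tuples. \<nu> J) = D" using \<nu> by (simp add: exponents_def)
    have "\<exists>J\<in>tuples. L J \<le> \<nu> J"
    proof (rule ccontr)
      assume "\<not> ?thesis"
      then have "(\<Sum>J\<in>tuples. \<nu> J) \<le> (\<Sum>J\<in>tuples. L J)" by (intro sum_mono) (auto simp: not_le)
      then show False using deg by (simp add: D_def)
    qed
    then obtain J where J: "J \<in> tuples" "L J \<le> \<nu> J" by blast
    have "semi_on ((\<Sum>J'\<in>tuples - {J}. \<nu> J' * 1) + (p + \<nu> J))
       (\<lambda>s. (\<Prod>J'\<in>tuples - {J}. minor J' s ^ \<nu> J') * (minor J s ^ \<nu> J * f s))"
      by (rule semi_on_mult[OF semi_onI L[OF J]], intro semi_prod semi_power semi_minor) auto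
    moreover have "(\<Sum>J'\<in>tuples - {J}. \<nu> J' * 1) + (p + \<nu> J) = p + D"
      using sum.remove[OF finite_tuples J(1), of \<nu>] deg by simp
    moreover have "(\<lambda>s. (\<Prod>J'\<in>tuples - {J}. minor J' s ^ \<nu> J') * (minor J s ^ \<nu> J * f s)) = (\<lambda>s. monomial \<nu> s * f s)"
    proof
      fix s
      show "(\<Prod>J'\<in>tuples - {J}. minor J' s ^ \<nu> J') * (minor J s ^ \<nu> J * f s) = monomial \<nu> s * f s"
        using prod.remove[OF finite_tuples J(1), of "\<lambda>J. minor J s ^ \<nu> J"]
        by (simp add: monomial_def)
    qed
    ultimately show ?thesis by (simp only:)
  qed
  then show ?thesis by blast
qed

lemma semi_mult_covariant:
  assumes "\<forall>\<nu>\<in>exponents D. semi_on (p + D) (\<lambda>s. monomial \<nu> s * f s)" "semi w d" "D \<le> w"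
  shows "semi_on (w + p) (\<lambda>s. d s * f s)"
proof -
  have "semi ((w - D) + D) d" using assms by simp
  from semi_monomial_split[OF this] obtain c where c: "\<forall>\<nu>\<in>exponents D. semi (w - D) (c \<nu>)"
    "d = (\<lambda>s. \<Sum>\<nu>\<in>exponents D. c \<nu> s * monomial \<nu> s)" by blast
  have "semi_on ((w - D) + (p + D)) (\<lambda>s. c \<nu> s * (monomial \<nu> s * f s))" if "\<nu> \<in> exponents D" for \<nu>
    by (rule semi_on_mult[OF semi_onI]) (use assms(1) c(1) that in auto)
  then have "semi_on ((w - D) + (p + D)) (\<lambda>s. \<Sum>\<nu>\<in>exponents D. c \<nu> s * (monomial \<nu> s * f s))"
    by (intro semi_on_sum)
  then show ?thesis using assms(3) by (simp add: c(2) sum_distrib_left mult_ac)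
qed

text \<open>
  The possible lower-order parts of a monic polynomial equation of degree \<open>R\<close> for \<open>f\<close>: the coefficient of
  \<open>f ^ (R - k)\<close> is classical of weight \<open>k * p\<close>.
\<close>

inductive lower :: "nat \<Rightarrow> ('s \<Rightarrow> complex) \<Rightarrow> nat \<Rightarrow> ('s \<Rightarrow> complex) \<Rightarrow> bool" for p f where
  zero: "lower p f R (\<lambda>_. 0)"
| monom: "semi (k * p) c \<Longrightarrow> 1 \<le> k \<Longrightarrow> k \<le> R \<Longrightarrow> lower p f R (\<lambda>s. c s * f s ^ (R - k))"
| add: "lower p f R \<phi> \<Longrightarrow> lower p f R \<psi> \<Longrightarrow> lower p f R (\<lambda>s. \<phi> s + \<psi> s)"

lemma lower_mult_f: "lower p f R \<phi> \<Longrightarrow> lower p f (Suc R) (\<lambda>s. f s * \<phi> s)"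
proof (induction rule: lower.induct)
  case (monom k c R)
  then have "lower p f (Suc R) (\<lambda>s. c s * f s ^ (Suc R - k))" by (intro lower.monom) auto
  then show ?case using monom by (simp add: Suc_diff_le mult_ac)
qed (auto intro: lower.intros simp: distrib_left)

lemma lower_mult_semi: "lower p f R \<phi> \<Longrightarrow> semi p d \<Longrightarrow> lower p f (Suc R) (\<lambda>s. d s * \<phi> s)"
proof (induction rule: lower.induct)
  case (monom k c R)
  have "semi (Suc k * p) (\<lambda>s. d s * c s)" using semi_mult[OF monom.prems monom.hyps(1)] by simp
  then have "lower p f (Suc R) (\<lambda>s. (d s * c s) * f s ^ (Suc R - Suc k))"
    by (rule lower.monom) (use monom in auto)
  then show ?case using monom by (simp add: mult_ac)
qed (auto intro: lower.intros simp: distrib_left)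

lemma lower_cmult: "lower p f R \<phi> \<Longrightarrow> lower p f R (\<lambda>s. x * \<phi> s)"
proof (induction rule: lower.induct)
  case (monom k c R)
  have "semi (k * p) (\<lambda>s. x * c s)" using semi_mult[OF semi_const monom.hyps(1)] by simp
  then have "lower p f R (\<lambda>s. (x * c s) * f s ^ (R - k))"
    by (rule lower.monom) (use monom in auto)
  then show ?case by (simp add: mult_ac)
qed (auto intro: lower.intros simp: distrib_left)

lemma lower_sum: "(\<And>i. i \<in> I \<Longrightarrow> lower p f R (\<phi> i)) \<Longrightarrow> lower p f R (\<lambda>s. \<Sum>i\<in>I. \<phi> i s)"
  by (induction I rule: infinite_finite_induct) (auto intro: lower.intros)

text \<open>
  A summand in the expansion of the determinant of \<open>f\<close> times the identity minus \<open>C\<close>: only the identity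
  permutation contributes \<open>f ^ m\<close>, and everything else is of lower order.
\<close>

lemma lower_prod:
  assumes C: "\<And>i. i < m \<Longrightarrow> semi p (C i (\<pi> i))"
  shows "lower p f m (\<lambda>s. (\<Prod>i=0..<m. (if i = \<pi> i then f s else 0) - C i (\<pi> i) s) - (if \<forall>i<m. i = \<pi> i then f s ^ m else 0))"
  using C
proof (induction m)
  case 0
  show ?case using lower.zero by simp
next
  case (Suc m)
  let ?P = "\<lambda>s. \<Prod>i=0..<m. (if i = \<pi> i then f s else 0) - C i (\<pi> i) s"
  define a where "a \<longleftrightarrow> (\<forall>i<m. i = \<pi> i)"
  let ?E = "\<lambda>s. if a then f s ^ m else 0"
  let ?l = "\<lambda>s. ?P s - ?E s"
  have l: "lower p f m ?l" using Suc by (simp add: a_def)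
  have C: "semi p (C m (\<pi> m))" using Suc.prems by simp
  have 1: "lower p f (Suc m) (\<lambda>s. if m = \<pi> m then f s * ?l s else 0)"
    using lower_mult_f[OF l] lower.zero by (cases "m = \<pi> m") simp_all
  have 2: "lower p f (Suc m) (\<lambda>s. (-1) * (C m (\<pi> m) s * ?l s))"
    using lower_cmult[OF lower_mult_semi[OF l C]] .
  have 3: "lower p f (Suc m) (\<lambda>s. (-1) * (if a then C m (\<pi> m) s * f s ^ m else 0))"
    by (intro lower_cmult, cases a)
       (use lower.monom[of 1 p "C m (\<pi> m)" "Suc m" f] C lower.zero in simp_all)
  have "lower p f (Suc m) (\<lambda>s. (if m = \<pi> m then f s * ?l s else 0) + ((-1) * (C m (\<pi> m) s * ?l s) + 
     (-1) * (if a then C m (\<pi> m) s * f s ^ m else 0)))"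
    by (intro lower.add 1 2 3)
  moreover have "(\<forall>i<Suc m. i = \<pi> i) \<longleftrightarrow> a \<and> m = \<pi> m" by (auto simp: less_Suc_eq a_def)
  ultimately show ?case
    by (elim back_subst[of "lower p f (Suc m)"]) (auto simp: fun_eq_iff algebra_simps)
qed

text \<open>
  The determinant trick. Multiplication by \<open>f\<close> acts on the functions \<open>e i\<close> by the matrix \<open>C\<close>, so the
  characteristic polynomial of \<open>C\<close> kills \<open>f\<close> at each point where some \<open>e i\<close> does not vanish.
\<close>

lemma integral_relation:
  assumes C: "\<And>i j. i < R \<Longrightarrow> j < R \<Longrightarrow> semi p (C i j)"
    and rel: "\<And>s i. s \<in> X \<Longrightarrow> i < R \<Longrightarrow> f s * e i s = (\<Sum>j<R. C i j s * e j s)"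
  shows "\<exists>\<phi>. lower p f R \<phi> \<and> (\<forall>s\<in>X. (\<exists>i<R. e i s \<noteq> 0) \<longrightarrow> f s ^ R = \<phi> s)"
proof -
  define M where "M = (\<lambda>s. Matrix.mat R R (\<lambda>(i, j). (if i = j then f s else 0) - C i j s))"
  let ?S = "{\<pi>. \<pi> permutes {0..<R}}"
  define P where "P = (\<lambda>\<pi> s. \<Prod>i=0..<R. (if i = \<pi> i then f s else 0) - C i (\<pi> i) s)"
  define E where "E = (\<lambda>\<pi> s. if \<forall>i<R. i = \<pi> i then f s ^ R else 0)"
  have det: "Determinant.det (M s) = (\<Sum>\<pi>\<in>?S. signof \<pi> * P \<pi> s)" for s
    unfolding M_def P_def det_def'[OF mat_carrier]
    by (intro sum.cong arg_cong2[where f="(*)"] prod.cong refl) (use permutes_in_image in \<open>fastforce\<close>)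
  have E: "(\<Sum>\<pi>\<in>?S. signof \<pi> * E \<pi> s) = f s ^ R" for s
  proof -
    have "(\<forall>i<R. i = \<pi> i) \<longleftrightarrow> \<pi> = id" if "\<pi> permutes {0..<R}" for \<pi>
      using that by (auto simp: permutes_def fun_eq_iff)
    then have "(\<Sum>\<pi>\<in>?S. signof \<pi> * E \<pi> s) = (\<Sum>\<pi>\<in>?S. if \<pi> = id then f s ^ R else 0)"
      by (intro sum.cong refl) (auto simp: E_def sign_id)
    then show ?thesis by (simp add: finite_permutations permutes_id)
  qed
  define \<phi> where "\<phi> = (\<lambda>s. \<Sum>\<pi>\<in>?S. (- signof \<pi>) * (P \<pi> s - E \<pi> s))"
  have "lower p f R \<phi>"
    unfolding \<phi>_def P_def E_def
  proof (intro lower_sum lower_cmult lower_prod)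
    fix \<pi> i assume "\<pi> \<in> ?S" "i < R"
    then show "semi p (C i (\<pi> i))" using C permutes_in_image[of \<pi> "{0..<R}" i] by auto
  qed
  moreover have "f s ^ R = \<phi> s" if s: "s \<in> X" "i < R" "e i s \<noteq> 0" for s i
  proof -
    define v where "v = Matrix.vec R (\<lambda>i. e i s)"
    have "v \<in> carrier_vec R" by (simp add: v_def)
    moreover have "v \<noteq> 0\<^sub>v R" using s(2,3) by (auto simp: v_def vec_eq_iff)
    moreover have "M s *\<^sub>v v = 0\<^sub>v R"
    proof (rule eq_vecI)
      fix i assume "i < dim_vec (0\<^sub>v R :: complex Matrix.vec)"
      then have i: "i < R" by simp
      have "Matrix.vec_index (M s *\<^sub>v v) i = (\<Sum>j\<in>{0..<R}. ((if i = j then f s else 0) - C i j s) * e j s)"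
        using i by (simp add: M_def v_def scalar_prod_def)
      also have "\<dots> = (\<Sum>j\<in>{0..<R}. if j = i then f s * e j s else 0) - (\<Sum>j<R. C i j s * e j s)"
        unfolding atLeast0LessThan sum_subtractf[symmetric] by (intro sum.cong refl) (auto simp: algebra_simps)
      also have "\<dots> = 0" using i rel[OF s(1) i] by simp
      finally show "Matrix.vec_index (M s *\<^sub>v v) i = Matrix.vec_index (0\<^sub>v R) i" using i by simp
    qed (simp add: M_def)
    ultimately have "Determinant.det (M s) = 0"
      using det_0_iff_vec_prod_zero_field[of "M s" R] by (auto simp: M_def)
    then show ?thesis using det[of s] E[of s]
      by (simp add: \<phi>_def right_diff_distrib sum_subtractf sum_negf)
  qed
  ultimately show ?thesis by blast
qed

text \<open>
  \<open>integral_relation\<close> is applied to the monomials of degree \<open>D\<close> in the minors, whose span over the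
  classical functions is stable under \<open>f\<close> by \<open>saturation_degree\<close>. Points where all these monomials vanish are covered by one more factor
  \<open>f\<close>, which is zero there by \<open>covariant_vanishes\<close>.
\<close>

lemma covariant_integral:
  assumes f: "covariant q f" and q: "0 < q"
    and D: "\<forall>\<nu>\<in>exponents D. semi_on (q + D) (\<lambda>s. monomial \<nu> s * f s)"
  shows "\<exists>R \<phi>. lower q f R \<phi> \<and> 1 \<le> R \<and> (\<forall>s\<in>X. f s ^ R = \<phi> s)"
proof -
  obtain n0 :: nat and \<mu> where \<mu>: "exponents D = \<mu> ` {i. i < n0}" "inj_on \<mu> {i. i < n0}"
    using finite_imp_nat_seg_image_inj_on[OF finite_exponents] by blast
  have reindex: "(\<Sum>\<nu>\<in>exponents D. h \<nu>) = (\<Sum>j<n0. h (\<mu> j))" for h :: "_ \<Rightarrow> complex"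
    unfolding \<mu>(1) by (subst sum.reindex[OF \<mu>(2)]) (simp add: lessThan_def)
  have "\<exists>c. (\<forall>j<n0. semi q (c j)) \<and> (\<forall>s\<in>X. f s * monomial (\<mu> i) s = (\<Sum>j<n0. c j s * monomial (\<mu> j) s))"
    if i: "i < n0" for i
  proof -
    obtain F where F: "semi (q + D) F" "\<forall>s\<in>X. monomial (\<mu> i) s * f s = F s"
      using D \<mu>(1) i unfolding semi_on_def by blast
    from semi_monomial_split[OF F(1)] obtain c where c: "\<forall>\<nu>\<in>exponents D. semi q (c \<nu>)"
       "F = (\<lambda>s. \<Sum>\<nu>\<in>exponents D. c \<nu> s * monomial \<nu> s)" by blast
    have "\<forall>j<n0. semi q (c (\<mu> j))" using c(1) \<mu>(1) by blast
    moreover have "\<forall>s\<in>X. f s * monomial (\<mu> i) s = (\<Sum>j<n0. c (\<mu> j) s * monomial (\<mu> j) s)"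
      using F(2) unfolding c(2) reindex by (simp add: mult.commute)
    ultimately show ?thesis by (intro exI[of _ "\<lambda>j. c (\<mu> j)"]) blast
  qed
  then obtain C where C: "\<And>i j. i < n0 \<Longrightarrow> j < n0 \<Longrightarrow> semi q (C i j)"
    "\<And>i s. i < n0 \<Longrightarrow> s \<in> X \<Longrightarrow> f s * monomial (\<mu> i) s = (\<Sum>j<n0. C i j s * monomial (\<mu> j) s)"
    by metis
  from integral_relation[of n0 q C f "\<lambda>i. monomial (\<mu> i)"] C obtain \<phi> where
    \<phi>: "lower q f n0 \<phi>" "\<And>s i. s \<in> X \<Longrightarrow> i < n0 \<Longrightarrow> monomial (\<mu> i) s \<noteq> 0 \<Longrightarrow> f s ^ n0 = \<phi> s" by blast
  have "f s ^ Suc n0 = f s * \<phi> s" if s: "s \<in> X" for s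
  proof (cases "\<exists>J\<in>tuples. minor J s \<noteq> 0")
    case True
    then obtain J where J: "J \<in> tuples" "minor J s \<noteq> 0" by blast
    let ?\<nu> = "\<lambda>J'\<in>tuples. if J' = J then D else 0"
    have "(\<Sum>J'\<in>tuples. ?\<nu> J') = D" using J(1) finite_tuples by simp
    then have "?\<nu> \<in> exponents D" unfolding exponents_def by auto
    moreover have "monomial ?\<nu> s = minor J s ^ D"
      using J(1) finite_tuples by (simp add: monomial_def prod.remove[of tuples J])
    ultimately obtain i where "i < n0" "monomial (\<mu> i) s \<noteq> 0" using J(2) \<mu>(1) by force
    then show ?thesis using \<phi>(2)[OF s] by simp
  next
    case False
    then have "dependent_rows_at s" using minor_or_dependent[of s] by blast
    then show ?thesis using covariant_vanishes[OF f q s] by simp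
  qed
  then show ?thesis using lower_mult_f[OF \<phi>(1)]
    by (intro exI[of _ "Suc n0"] exI[of _ "\<lambda>s. f s * \<phi> s"]) auto
qed

text \<open>
  The integral equation rewrites \<open>d * f ^ M\<close> as a sum of terms in which the exponent of \<open>f\<close> has dropped
  and the weight of the classical factor has grown by the same amount. Once this weight exceeds the
  saturation degree \<open>D\<close>, the remaining factors \<open>f\<close> are absorbed one by one.
\<close>

lemma covariant_power_semi:
  assumes f: "covariant q f" and q: "0 < q"
  shows "\<exists>M0. \<forall>M\<ge>M0. semi_on (M * q) (\<lambda>s. f s ^ M)"
proof -
  obtain D where D: "\<forall>\<nu>\<in>exponents D. semi_on (q + D) (\<lambda>s. monomial \<nu> s * f s)"
    using saturation_degree[OF f] by blast
  obtain R \<phi> where R: "lower q f R \<phi>" "1 \<le> R" "\<And>s. s \<in> X \<Longrightarrow> f s ^ R = \<phi> s"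
    using covariant_integral[OF f q D] by blast
  have key: "semi_on (w + M * q) (\<lambda>s. d s * f s ^ M)" if "semi w d" "D + R * q \<le> w + M * q" for M w d
    using that
  proof (induction M arbitrary: w d rule: less_induct)
    case (less M)
    show ?case
    proof (cases "D \<le> w")
      case True
      have "semi_on (w + k * q) (\<lambda>s. d s * f s ^ k)" for k
      proof (induction k)
        case 0
        then show ?case using semi_onI[OF less.prems(1)] by simp
      next
        case (Suc k)
        then obtain F where F: "semi (w + k * q) F" "\<forall>s\<in>X. d s * f s ^ k = F s" by (auto simp: semi_on_def)
        have "semi_on (w + k * q + q) (\<lambda>s. F s * f s)"
          using semi_mult_covariant[OF D F(1)] True by simp
        then have "semi_on (w + k * q + q) (\<lambda>s. d s * f s ^ Suc k)"
          by (rule semi_on_cong) (simp add: F(2)[rule_format, symmetric] mult_ac)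
        then show ?case by (simp add: ac_simps)
      qed
      then show ?thesis .
    next
      case False
      then have "R * q < M * q" using less.prems(2) by linarith
      then have RM: "R < M" by simp
      have "semi_on (w + M * q) (\<lambda>s. d s * (f s ^ (M - R) * \<psi> s))" if "lower q f R' \<psi>" "R' = R" for \<psi> R'
        using that
      proof (induction rule: lower.induct)
        case (zero R')
        then show ?case using semi_onI[OF semi_zero] by simp
      next
        case (add R' \<phi> \<psi>)
        then have "semi_on (w + M * q) (\<lambda>s. d s * (f s ^ (M - R) * \<phi> s) + d s * (f s ^ (M - R) * \<psi> s))"
          by (intro semi_on_add) auto
        then show ?case by (simp add: distrib_left)
      next
        case (monom k c R')
        have k: "1 \<le> k" "k \<le> R" using monom by auto
        have c: "semi (w + k * q) (\<lambda>s. d s * c s)" using semi_mult[OF less.prems(1) monom(1)] .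
        have w: "w + k * q + (M - k) * q = w + M * q" 
          using k RM by (simp add: add.assoc flip: add_mult_distrib)
        have "semi_on (w + k * q + (M - k) * q) (\<lambda>s. (d s * c s) * f s ^ (M - k))"
          by (rule less.IH[OF _ c]) (use k RM less.prems(2) w in auto)
        moreover have "M - k = M - R + (R - k)" using k RM by simp
        ultimately show ?case unfolding w using monom.prems by (simp add: power_add mult_ac)
      qed
      from this[OF R(1) refl] show ?thesis
        by (rule semi_on_cong) (use RM in \<open>simp add: R(3)[symmetric] flip: power_add\<close>)
    qed
  qed
  have "semi_on (M * q) (\<lambda>s. f s ^ M)" if M: "M \<ge> D + R" for M
  proof -
    have "D + R * q \<le> (D + R) * q" using q by (simp add: add_mult_distrib)
    also have "\<dots> \<le> M * q" using M by simp
    finally show ?thesis using key[OF semi_const[of 1], of M] by simp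
  qed
  then show ?thesis by blast
qed

text \<open>
  A high power of \<open>h\<close> is classical of weight at least the saturation degree of \<open>f\<close>, so it absorbs \<open>f\<close>.
\<close>

lemma covariant_mult_power_semi:
  assumes f: "covariant p f" and h: "covariant q h" and q: "0 < q"
  shows "\<exists>M\<ge>1. semi_on (p + M * q) (\<lambda>s. f s * h s ^ M)"
proof -
  obtain D where D: "\<forall>\<nu>\<in>exponents D. semi_on (p + D) (\<lambda>s. monomial \<nu> s * f s)"
    using saturation_degree[OF f] by blast
  obtain M0 where M0: "\<And>M. M0 \<le> M \<Longrightarrow> semi_on (M * q) (\<lambda>s. h s ^ M)"
    using covariant_power_semi[OF h q] by blast
  define M where "M = Suc (M0 + D)"
  obtain F where F: "semi (M * q) F" "\<forall>s\<in>X. h s ^ M = F s"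
    using M0[of M] by (auto simp: semi_on_def M_def)
  have "M0 + D \<le> (M0 + D) * q" using mult_le_mono2[of 1 q "M0 + D"] q by simp
  then have "D \<le> M * q" unfolding M_def mult_Suc by linarith
  from semi_mult_covariant[OF D F(1) this]
  have "semi_on (M * q + p) (\<lambda>s. F s * f s)" .
  then have "semi_on (p + M * q) (\<lambda>s. f s * h s ^ M)"
    unfolding add.commute[of p] by (rule semi_on_cong) (simp add: F(2)[rule_format, symmetric] mult.commute)
  then show ?thesis by (intro exI[of _ M]) (simp add: M_def)
qed

section \<open>Covariants where the product of the two maps is an invertible scalar\<close>

definition cominor :: "(nat \<Rightarrow> nat) \<Rightarrow> 's \<Rightarrow> complex" where
  "cominor J s = Determinant.det (Matrix.mat n n (\<lambda>(k, c). a s $$ (J k, c)))"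

lemma semi_cominor_minor:
  assumes "J \<in> tuples" "K \<in> tuples" shows "semi 0 (\<lambda>s. cominor K s * minor J s)"
proof -
  have "cominor K s * minor J s = Determinant.det (Matrix.mat n n (\<lambda>(k, k'). (a s * b s) $$ (K k, J k')))" for s
  proof -
    have "Matrix.mat n n (\<lambda>(k, k'). (a s * b s) $$ (K k, J k')) =
       Matrix.mat n n (\<lambda>(k, c). a s $$ (K k, c)) * Matrix.mat n n (\<lambda>(r, k). b s $$ (r, J k))"
      using assms by (intro eq_matI) (auto simp: PiE_iff scalar_prod_def intro!: sum.cong)
    then show ?thesis by (simp add: cominor_def minor_def det_mult[of _ n])
  qed
  moreover have "semi 0 (\<lambda>s. Determinant.det (Matrix.mat n n (\<lambda>(k, k'). (a s * b s) $$ (K k, J k'))))"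
    unfolding semi_def by (rule weighted_det) (use semi_ab assms in \<open>auto simp: PiE_iff semi_def\<close>)
  ultimately show ?thesis by simp
qed

lemma cominor_lowers:
  assumes "K \<in> tuples" "semi (w + D) f" shows "semi w (\<lambda>s. cominor K s ^ D * f s)"
  using assms(2)
proof (induction D arbitrary: f)
  case (Suc D)
  have "semi (Suc (w + D)) f" using Suc.prems by simp
  from semi_split[OF this refl] obtain c where c: "\<forall>J\<in>tuples. semi (w + D) (c J)"
    "f = (\<lambda>s. \<Sum>J\<in>tuples. c J s * minor J s)" by blast
  have "semi (w + D + 0) (\<lambda>s. \<Sum>J\<in>tuples. c J s * (cominor K s * minor J s))"
    using c(1) semi_cominor_minor[OF _ assms(1)] by (intro semi_sum semi_mult) auto
  then have "semi w (\<lambda>s. cominor K s ^ D * (\<Sum>J\<in>tuples. c J s * (cominor K s * minor J s)))"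
    by (intro Suc.IH) simp
  moreover have "(\<lambda>s. cominor K s ^ D * (\<Sum>J\<in>tuples. c J s * (cominor K s * minor J s))) = (\<lambda>s. cominor K s ^ Suc D * f s)"
    by (simp add: c(2) sum_distrib_left mult_ac)
  ultimately show ?case by simp
qed simp

text \<open>
  In a large power of a sum, each term of the binomial expansion contains a large power of one of the
  two summands.
\<close>

lemma semi_on_power_sum:
  assumes "finite I" "\<And>i. i \<in> I \<Longrightarrow> semi 0 (x i)" "\<And>i. i \<in> I \<Longrightarrow> \<exists>L. \<forall>e\<ge>L. semi_on p (\<lambda>s. x i s ^ e * f s)"
  shows "\<exists>L. \<forall>e\<ge>L. semi_on p (\<lambda>s. (\<Sum>i\<in>I. x i s) ^ e * f s)"
  using assms
proof (induction I)
  case empty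
  have "semi_on p (\<lambda>s. (\<Sum>i\<in>{}. x i s) ^ e * f s)" if "1 \<le> e" for e
    using that semi_onI[OF semi_zero] by (simp add: power_0_left)
  then show ?case by blast
next
  case (insert i I)
  obtain L1 where L1: "\<And>e. e \<ge> L1 \<Longrightarrow> semi_on p (\<lambda>s. x i s ^ e * f s)" using insert.prems(2)[of i] by blast
  obtain L2 where L2: "\<And>e. e \<ge> L2 \<Longrightarrow> semi_on p (\<lambda>s. (\<Sum>i\<in>I. x i s) ^ e * f s)" using insert by auto
  have "semi_on p (\<lambda>s. (\<Sum>i\<in>insert i I. x i s) ^ e * f s)" if e: "e \<ge> L1 + L2" for e
  proof -
    have x: "semi 0 (\<lambda>s. x i s ^ k)" for k using semi_power[OF insert.prems(1)[of i], of k] by simp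
    have y: "semi 0 (\<lambda>s. (\<Sum>i\<in>I. x i s) ^ k)" for k 
      using semi_power[OF semi_sum, of I 0 x k] insert.prems(1) by simp
    have t: "semi_on p (\<lambda>s. of_nat (e choose k) * (x i s ^ k * ((\<Sum>i\<in>I. x i s) ^ (e - k) * f s)))" if k: "k \<le> e" for k
    proof -
      have "semi_on p (\<lambda>s. x i s ^ k * ((\<Sum>i\<in>I. x i s) ^ (e - k) * f s))"
      proof (cases "L1 \<le> k")
        case True
        have "semi_on (0 + p) (\<lambda>s. (\<Sum>i\<in>I. x i s) ^ (e - k) * (x i s ^ k * f s))"
          using semi_on_mult[OF semi_onI[OF y] L1[OF True]] .
        then show ?thesis by (simp add: mult_ac)
      next
        case False
        then have "L2 \<le> e - k" using e by simp
        then have "semi_on (0 + p) (\<lambda>s. x i s ^ k * ((\<Sum>i\<in>I. x i s) ^ (e - k) * f s))"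
          using semi_on_mult[OF semi_onI[OF x] L2] by blast
        then show ?thesis by simp
      qed
      then have "semi_on (0 + p) (\<lambda>s. of_nat (e choose k) * (x i s ^ k * ((\<Sum>i\<in>I. x i s) ^ (e - k) * f s)))"
        by (intro semi_on_mult semi_onI[OF semi_const])
      then show ?thesis by simp
    qed
    have "semi_on p (\<lambda>s. \<Sum>k\<le>e. of_nat (e choose k) * (x i s ^ k * ((\<Sum>i\<in>I. x i s) ^ (e - k) * f s)))"
      using t by (intro semi_on_sum) auto
    then show ?thesis
      using insert.hyps by (simp add: binomial_ring sum_distrib_right mult.assoc)
  qed
  then show ?case by blast
qed

text \<open>
  By the Cauchy--Binet formula, the sum of the products \<open>cominor J * minor J\<close> is \<open>n! * l ^ n\<close>, a non-zero
  constant. A high power of each of these products makes \<open>f\<close> classical of weight \<open>p\<close>: the factor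
  \<open>minor J ^ e\<close> turns it into a classical function of weight \<open>p + e\<close>, and \<open>cominor J ^ e\<close> lowers the
  weight again.
\<close>

lemma covariant_semi_if_invertible:
  assumes f: "covariant p f" and l: "l \<noteq> 0" "\<And>s. s \<in> X \<Longrightarrow> b s * a s = l \<cdot>\<^sub>m 1\<^sub>m n"
  shows "semi_on p f"
proof -
  have "\<exists>L. \<forall>e\<ge>L. semi_on p (\<lambda>s. (\<Sum>J\<in>tuples. cominor J s * minor J s) ^ e * f s)"
  proof (rule semi_on_power_sum[OF finite_tuples semi_cominor_minor])
    fix J assume J: "J \<in> tuples"
    obtain L where L: "\<And>e. e \<ge> L \<Longrightarrow> semi_on (p + e) (\<lambda>s. minor J s ^ e * f s)"
      using minor_power_mult_covariant[OF J f] by blast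
    have "semi_on p (\<lambda>s. (cominor J s * minor J s) ^ e * f s)" if e: "e \<ge> L" for e
    proof -
      obtain F where F: "semi (p + e) F" "\<forall>s\<in>X. minor J s ^ e * f s = F s"
        using L[OF e] by (auto simp: semi_on_def)
      show ?thesis
        by (rule semi_on_cong[OF semi_onI[OF cominor_lowers[OF J F(1)]]])
           (simp add: F(2)[rule_format, symmetric] power_mult_distrib mult_ac)
    qed
    then show "\<exists>L. \<forall>e\<ge>L. semi_on p (\<lambda>s. (cominor J s * minor J s) ^ e * f s)" by blast
  qed
  then obtain e where e: "semi_on p (\<lambda>s. (\<Sum>J\<in>tuples. cominor J s * minor J s) ^ e * f s)" by blast
  define c where "c = (of_nat (fact n) * l ^ n) ^ e"
  have c: "c \<noteq> 0" using l(1) by (simp add: c_def)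
  have "(\<Sum>J\<in>tuples. cominor J s * minor J s) = of_nat (fact n) * l ^ n" if "s \<in> X" for s
    using det_mult_times_fact_eq_sum_minors[OF a_carrier b_carrier, of s s] l(2)[OF that]
    by (simp add: cominor_def minor_def)
  then have "semi_on p (\<lambda>s. c * f s)" using e by (elim semi_on_cong) (simp add: c_def)
  then have "semi_on (0 + p) (\<lambda>s. (1 / c) * (c * f s))"
    by (intro semi_on_mult semi_onI[OF semi_const])
  then show ?thesis using c by simp
qed

end

section \<open>Split exact sequences of coordinate spaces\<close>

text \<open>
  The map \<open>b\<close> is onto with kernel the image of the injective map \<open>a\<close>; \<open>\<sigma>\<close> is a section of \<open>b\<close> and \<open>\<pi>\<close> the
  retraction of \<open>a\<close> along it.
\<close>

definition splitting :: "nat \<Rightarrow> nat \<Rightarrow> complex mat \<Rightarrow> complex mat \<Rightarrow> complex mat \<Rightarrow> complex mat \<Rightarrow> bool" where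
  "splitting n n' b \<sigma> a \<pi> \<longleftrightarrow>
     b \<in> carrier_mat n (n + n') \<and> \<sigma> \<in> carrier_mat (n + n') n \<and>
     a \<in> carrier_mat (n + n') n' \<and> \<pi> \<in> carrier_mat n' (n + n') \<and>
     b * \<sigma> = 1\<^sub>m n \<and> b * a = 0\<^sub>m n n' \<and> \<pi> * \<sigma> = 0\<^sub>m n' n \<and> \<pi> * a = 1\<^sub>m n' \<and>
     \<sigma> * b + a * \<pi> = 1\<^sub>m (n + n')"

definition hcat :: "nat \<Rightarrow> nat \<Rightarrow> complex mat \<Rightarrow> complex mat \<Rightarrow> complex mat" where
  "hcat n n' \<sigma> a = Matrix.mat (n + n') (n + n') (\<lambda>(t, c). if c < n then \<sigma> $$ (t, c) else a $$ (t, c - n))"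

definition vcat :: "nat \<Rightarrow> nat \<Rightarrow> complex mat \<Rightarrow> complex mat \<Rightarrow> complex mat" where
  "vcat n n' b \<pi> = Matrix.mat (n + n') (n + n') (\<lambda>(r, t). if r < n then b $$ (r, t) else \<pi> $$ (r - n, t))"

lemma hcat_carrier [simp]: "hcat n n' \<sigma> a \<in> carrier_mat (n + n') (n + n')"
  and vcat_carrier [simp]: "vcat n n' b \<pi> \<in> carrier_mat (n + n') (n + n')"
  by (auto simp: hcat_def vcat_def)

lemma vcat_mult_hcat:
  assumes "b \<in> carrier_mat n (n + n')" "\<pi> \<in> carrier_mat n' (n + n')"
    "\<sigma> \<in> carrier_mat (n + n') n" "a \<in> carrier_mat (n + n') n'"
  shows "vcat n n' b \<pi> * hcat n n' \<sigma> a = four_block_mat (b * \<sigma>) (b * a) (\<pi> * \<sigma>) (\<pi> * a)"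
  using assms by (intro eq_matI) (auto simp: hcat_def vcat_def scalar_prod_def)

lemma hcat_mult_vcat:
  assumes "b \<in> carrier_mat n (n + n')" "\<pi> \<in> carrier_mat n' (n + n')"
    "\<sigma> \<in> carrier_mat (n + n') n" "a \<in> carrier_mat (n + n') n'"
  shows "hcat n n' \<sigma> a * vcat n n' b \<pi> = \<sigma> * b + a * \<pi>"
proof (rule eq_matI)
  fix t t' assume t: "t < dim_row (\<sigma> * b + a * \<pi>)" "t' < dim_col (\<sigma> * b + a * \<pi>)"
  have "(hcat n n' \<sigma> a * vcat n n' b \<pi>) $$ (t, t') = 
    (\<Sum>c\<in>{0..<n + n'}. if c < n then \<sigma> $$ (t, c) * b $$ (c, t') else a $$ (t, c - n) * \<pi> $$ (c - n, t'))"
    using t assms by (auto simp: hcat_def vcat_def scalar_prod_def intro!: sum.cong)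
  also have "\<dots> = (\<Sum>c\<in>{0..<n}. \<sigma> $$ (t, c) * b $$ (c, t')) + (\<Sum>c\<in>{n..<n + n'}. a $$ (t, c - n) * \<pi> $$ (c - n, t'))"
    by (subst sum.atLeastLessThan_concat[of 0 n "n + n'", symmetric]) auto
  also have "(\<Sum>c\<in>{n..<n + n'}. a $$ (t, c - n) * \<pi> $$ (c - n, t')) = (\<Sum>c\<in>{0..<n'}. a $$ (t, c) * \<pi> $$ (c, t'))"
    using sum.shift_bounds_nat_ivl[of "\<lambda>c. a $$ (t, c - n) * \<pi> $$ (c - n, t')" 0 n n'] by (simp add: add.commute)
  finally show "(hcat n n' \<sigma> a * vcat n n' b \<pi>) $$ (t, t') = (\<sigma> * b + a * \<pi>) $$ (t, t')"
    using t assms by (simp add: scalar_prod_def)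
qed (use assms in \<open>auto simp: hcat_def vcat_def\<close>)

lemma splittingI:
  assumes "b \<in> carrier_mat n (n + n')" "\<sigma> \<in> carrier_mat (n + n') n"
    "a \<in> carrier_mat (n + n') n'" "\<pi> \<in> carrier_mat n' (n + n')"
    and eqs: "b * \<sigma> = 1\<^sub>m n" "b * a = 0\<^sub>m n n'" "\<pi> * \<sigma> = 0\<^sub>m n' n" "\<pi> * a = 1\<^sub>m n'"
  shows "splitting n n' b \<sigma> a \<pi>"
proof -
  have "vcat n n' b \<pi> * hcat n n' \<sigma> a = 1\<^sub>m (n + n')"
    unfolding vcat_mult_hcat[OF assms(1,4,2,3)] eqs by (rule four_block_one_mat)
  then have "hcat n n' \<sigma> a * vcat n n' b \<pi> = 1\<^sub>m (n + n')"
    by (rule mat_mult_left_right_inverse[OF vcat_carrier hcat_carrier])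
  then show ?thesis unfolding hcat_mult_vcat[OF assms(1,4,2,3)] splitting_def using assms by blast
qed

lemma splittingD:
  assumes "splitting n n' b \<sigma> a \<pi>"
  shows "b \<in> carrier_mat n (n + n')" "\<sigma> \<in> carrier_mat (n + n') n"
    "a \<in> carrier_mat (n + n') n'" "\<pi> \<in> carrier_mat n' (n + n')"
    "b * \<sigma> = 1\<^sub>m n" "b * a = 0\<^sub>m n n'" "\<pi> * \<sigma> = 0\<^sub>m n' n" "\<pi> * a = 1\<^sub>m n'" "\<sigma> * b + a * \<pi> = 1\<^sub>m (n + n')"
  using assms by (auto simp: splitting_def)

lemma det_hcat_vcat:
  assumes "splitting n n' b \<sigma> a \<pi>"
  shows "Determinant.det (hcat n n' \<sigma> a) * Determinant.det (vcat n n' b \<pi>) = 1"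
proof -
  note s = splittingD[OF assms]
  have "hcat n n' \<sigma> a * vcat n n' b \<pi> = 1\<^sub>m (n + n')"
    using hcat_mult_vcat[OF s(1,4,2,3)] s(9) by simp
  then show ?thesis using det_mult[OF hcat_carrier vcat_carrier, of n n' \<sigma> a b \<pi>] by simp
qed

text \<open>
  The left-hand side depends on \<open>a\<close> only. So a maximal minor of \<open>b\<close> equals, up to the factor
  \<open>det (hcat \<sigma> a)\<close> common to all minors, a polynomial in the entries of \<open>a\<close>: up to sign, the
  complementary minor, or 0 if \<open>J\<close> has a repetition.
\<close>

lemma det_hcat_coordinates:
  assumes "splitting n n' b \<sigma> a \<pi>" and J: "J \<in> {0..<n} \<rightarrow>\<^sub>E {0..<n + n'}"
  shows "Determinant.det (hcat n n' (Matrix.mat (n + n') n (\<lambda>(t, c). if t = J c then 1 else 0)) a) =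
    Determinant.det (hcat n n' \<sigma> a) * Determinant.det (Matrix.mat n n (\<lambda>(r, k). b $$ (r, J k)))"
proof -
  note s = splittingD[OF assms(1)]
  let ?\<iota> = "Matrix.mat (n + n') n (\<lambda>(t, c). if t = J c then 1 else (0::complex))"
  have \<iota>: "?\<iota> \<in> carrier_mat (n + n') n" by simp
  have b\<iota>: "b * ?\<iota> = Matrix.mat n n (\<lambda>(r, k). b $$ (r, J k))"
    using s(1) J by (intro eq_matI) (auto simp: scalar_prod_def PiE_iff if_distrib cong: if_cong)
  have "vcat n n' b \<pi> * hcat n n' ?\<iota> a = four_block_mat (b * ?\<iota>) (0\<^sub>m n n') (\<pi> * ?\<iota>) (1\<^sub>m n')"
    using vcat_mult_hcat[OF s(1,4) \<iota> s(3)] s by simp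
  also have "Determinant.det \<dots> = Determinant.det (b * ?\<iota>)"
    using det_four_block_mat_upper_right_zero[of "b * ?\<iota>" n "0\<^sub>m n n'" n' "\<pi> * ?\<iota>" "1\<^sub>m n'"] s by simp
  finally have "Determinant.det (vcat n n' b \<pi>) * Determinant.det (hcat n n' ?\<iota> a) = Determinant.det (b * ?\<iota>)"
    using det_mult[OF vcat_carrier hcat_carrier, of n n' b \<pi> ?\<iota> a] by simp
  then have "Determinant.det (hcat n n' \<sigma> a) * (Determinant.det (vcat n n' b \<pi>) * Determinant.det (hcat n n' ?\<iota> a))
    = Determinant.det (hcat n n' \<sigma> a) * Determinant.det (b * ?\<iota>)" by simp
  then show ?thesis unfolding mult.assoc[symmetric] det_hcat_vcat[OF assms(1)] b\<iota> by simp
qed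

text \<open>
  The counterpart of \<open>det_hcat_coordinates\<close> that expresses the maximal minors of \<open>a\<close> through \<open>b\<close>, with the
  same factor.
\<close>

lemma det_vcat_coordinates:
  assumes "splitting n n' b \<sigma> a \<pi>" and K: "K \<in> {0..<n'} \<rightarrow>\<^sub>E {0..<n + n'}"
  shows "Determinant.det (hcat n n' \<sigma> a) *
      Determinant.det (vcat n n' b (Matrix.mat n' (n + n') (\<lambda>(r, t). if t = K r then 1 else 0))) =
    Determinant.det (Matrix.mat n' n' (\<lambda>(k, c). a $$ (K k, c)))"
proof -
  note s = splittingD[OF assms(1)]
  let ?\<kappa> = "Matrix.mat n' (n + n') (\<lambda>(r, t). if t = K r then 1 else (0::complex))"
  have \<kappa>: "?\<kappa> \<in> carrier_mat n' (n + n')" by simp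
  have \<kappa>a: "?\<kappa> * a = Matrix.mat n' n' (\<lambda>(k, c). a $$ (K k, c))"
    using s(3) K by (intro eq_matI) (auto simp: scalar_prod_def PiE_iff if_distrib[of "\<lambda>x. x * _"] cong: if_cong)
  have "vcat n n' b ?\<kappa> * hcat n n' \<sigma> a = four_block_mat (1\<^sub>m n) (0\<^sub>m n n') (?\<kappa> * \<sigma>) (?\<kappa> * a)"
    using vcat_mult_hcat[OF s(1) \<kappa> s(2,3)] s by simp
  also have "Determinant.det \<dots> = Determinant.det (?\<kappa> * a)"
    using det_four_block_mat_upper_right_zero[of "1\<^sub>m n" n "0\<^sub>m n n'" n' "?\<kappa> * \<sigma>" "?\<kappa> * a"]
      mult_carrier_mat[OF \<kappa> s(2)] mult_carrier_mat[OF \<kappa> s(3)] by simp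
  finally show ?thesis
    using det_mult[OF vcat_carrier hcat_carrier, of n n' b ?\<kappa> \<sigma> a] by (simp add: \<kappa>a mult.commute)
qed

lemma splitting_transpose:
  assumes "splitting n n' b \<sigma> a \<pi>"
  shows "splitting n' n a\<^sup>T \<pi>\<^sup>T b\<^sup>T \<sigma>\<^sup>T"
proof -
  note s = splittingD[OF assms]
  note t = transpose_mult[symmetric]
  show ?thesis
    using s t[OF s(4,3)] t[OF s(1,3)] t[OF s(4,2)] t[OF s(1,2)]
    by (intro splittingI) (simp_all add: add.commute[of n' n])
qed

lemma splitting_conjugate:
  assumes "splitting n n' b \<sigma> a \<pi>"
    and T: "T \<in> carrier_mat (n + n') (n + n')" "T' \<in> carrier_mat (n + n') (n + n')" "T' * T = 1\<^sub>m (n + n')"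
    and g: "g \<in> carrier_mat n n" "h \<in> carrier_mat n n" "g * h = 1\<^sub>m n"
    and g': "g' \<in> carrier_mat n' n'" "h' \<in> carrier_mat n' n'" "g' * h' = 1\<^sub>m n'"
  shows "splitting n n' (g * b * T') (T * \<sigma> * h) (T * a * h') (g' * \<pi> * T')"
    and "Determinant.det (hcat n n' (T * \<sigma> * h) (T * a * h')) =
      Determinant.det T * Determinant.det (hcat n n' \<sigma> a) * (Determinant.det h * Determinant.det h')"
proof -
  note s = splittingD[OF assms(1)]
  have mid: "(x * y * T') * (T * z * w) = x * (y * z) * w"
    if "x \<in> carrier_mat p p" "y \<in> carrier_mat p (n + n')" "z \<in> carrier_mat (n + n') q" "w \<in> carrier_mat q q"
    for x y z w p q
  proof -
    have xy: "x * y \<in> carrier_mat p (n + n')" and zw: "z * w \<in> carrier_mat (n + n') q"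
      and yz: "y * z \<in> carrier_mat p q" using that by auto
    have "(x * y * T') * (T * z * w) = x * y * (T' * (T * (z * w)))"
      unfolding assoc_mult_mat[OF T(1) that(3,4)]
      by (rule assoc_mult_mat[OF xy T(2) mult_carrier_mat[OF T(1) zw]])
    also have "T' * (T * (z * w)) = (T' * T) * (z * w)"
      using that T by (intro assoc_mult_mat[symmetric]) auto
    also have "\<dots> = z * w" unfolding T(3) by (rule left_mult_one_mat[OF zw])
    also have "x * y * (z * w) = x * (y * z) * w"
      unfolding assoc_mult_mat[OF that(1,2) zw] assoc_mult_mat[OF that(1) yz that(4)]
        assoc_mult_mat[OF that(2,3,4)] ..
    finally show ?thesis .
  qed
  show "splitting n n' (g * b * T') (T * \<sigma> * h) (T * a * h') (g' * \<pi> * T')"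
  proof (rule splittingI)
    show "g * b * T' * (T * \<sigma> * h) = 1\<^sub>m n"
      unfolding mid[OF g(1) s(1,2) g(2)] s(5) using g by simp
    show "g * b * T' * (T * a * h') = 0\<^sub>m n n'"
      unfolding mid[OF g(1) s(1,3) g'(2)] s(6) using g g' by simp
    show "g' * \<pi> * T' * (T * \<sigma> * h) = 0\<^sub>m n' n"
      unfolding mid[OF g'(1) s(4,2) g(2)] s(7) using g g' by simp
    show "g' * \<pi> * T' * (T * a * h') = 1\<^sub>m n'"
      unfolding mid[OF g'(1) s(4,3) g'(2)] s(8) using g' by simp
  qed (use s T g g' in auto)
  have "hcat n n' (T * \<sigma> * h) (T * a * h') = T * hcat n n' \<sigma> a * four_block_mat h (0\<^sub>m n n') (0\<^sub>m n' n) h'"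
  proof -
    have 1: "hcat n n' (T * \<sigma>) (T * a) = T * hcat n n' \<sigma> a"
      using s T by (intro eq_matI) (auto simp: hcat_def scalar_prod_def)
    have 2: "hcat n n' (u * h) (w * h') = hcat n n' u w * four_block_mat h (0\<^sub>m n n') (0\<^sub>m n' n) h'"
      if u: "u \<in> carrier_mat (n + n') n" "w \<in> carrier_mat (n + n') n'" for u w
    proof (rule eq_matI)
      fix t c assume tc: "t < dim_row (hcat n n' u w * four_block_mat h (0\<^sub>m n n') (0\<^sub>m n' n) h')"
        "c < dim_col (hcat n n' u w * four_block_mat h (0\<^sub>m n n') (0\<^sub>m n' n) h')"
      then have t: "t < n + n'" "c < n + n'" using g g' by (auto simp: hcat_def)
      have "(hcat n n' u w * four_block_mat h (0\<^sub>m n n') (0\<^sub>m n' n) h') $$ (t, c) = 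
        (\<Sum>k\<in>{0..<n + n'}. (if k < n then u $$ (t, k) else w $$ (t, k - n)) * 
           four_block_mat h (0\<^sub>m n n') (0\<^sub>m n' n) h' $$ (k, c))"
        using t g g' by (simp add: hcat_def scalar_prod_def)
      also have "\<dots> = (\<Sum>k\<in>{0..<n}. u $$ (t, k) * (if c < n then h $$ (k, c) else 0)) + 
        (\<Sum>k\<in>{n..<n + n'}. w $$ (t, k - n) * (if c < n then 0 else h' $$ (k - n, c - n)))"
        using t g g' by (subst sum.atLeastLessThan_concat[of 0 n "n + n'", symmetric])
          (auto intro!: arg_cong2[where f="(+)"] sum.cong)
      also have "(\<Sum>k\<in>{n..<n + n'}. w $$ (t, k - n) * (if c < n then 0 else h' $$ (k - n, c - n))) = 
        (\<Sum>k\<in>{0..<n'}. w $$ (t, k) * (if c < n then 0 else h' $$ (k, c - n)))"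
        using sum.shift_bounds_nat_ivl[of "\<lambda>k. w $$ (t, k - n) * (if c < n then 0 else h' $$ (k - n, c - n))" 0 n n']
        by (cases "c < n") (simp_all add: add.commute)
      finally show "hcat n n' (u * h) (w * h') $$ (t, c) = (hcat n n' u w * four_block_mat h (0\<^sub>m n n') (0\<^sub>m n' n) h') $$ (t, c)"
        using t u g g' by (cases "c < n") (auto simp: hcat_def scalar_prod_def)
    qed (use g g' in \<open>auto simp: hcat_def\<close>)
    show ?thesis using 2[of "T * \<sigma>" "T * a"] 1 s T by simp
  qed
  moreover have "Determinant.det (four_block_mat h (0\<^sub>m n n') (0\<^sub>m n' n) h') = Determinant.det h * Determinant.det h'"
    using g g' by (intro det_four_block_mat_upper_right_zero) auto
  ultimately show "Determinant.det (hcat n n' (T * \<sigma> * h) (T * a * h')) =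
      Determinant.det T * Determinant.det (hcat n n' \<sigma> a) * (Determinant.det h * Determinant.det h')"
    using T g g' by (simp add: det_mult[of _ "n + n'"] four_block_carrier_mat)
qed

text \<open>
  Invert the block of \<open>b\<close> with columns \<open>J\<close> to get the section \<open>\<sigma>\<close>. The coordinate vectors outside of \<open>J\<close>,
  corrected by \<open>\<sigma>\<close> so that \<open>b\<close> kills them, are a basis of the kernel.
\<close>

lemma ex_splitting:
  assumes b: "b \<in> carrier_mat n (n + n')" and J: "J \<in> {0..<n} \<rightarrow>\<^sub>E {0..<n + n'}"
    and det: "Determinant.det (Matrix.mat n n (\<lambda>(r, k). b $$ (r, J k))) \<noteq> 0"
  shows "\<exists>\<sigma> a \<pi>. splitting n n' b \<sigma> a \<pi>"
proof -
  let ?N = "n + n'"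
  define \<iota> where "\<iota> = Matrix.mat ?N n (\<lambda>(t, c). if t = J c then 1 else (0::complex))"
  define h where "h = Matrix.mat n n (\<lambda>(r, k). b $$ (r, J k))"
  have Jlt: "J k < ?N" if "k < n" for k using J that by (auto simp: PiE_iff)
  have b\<iota>: "b * \<iota> = h"
    using b Jlt by (intro eq_matI) (auto simp: h_def \<iota>_def scalar_prod_def if_distrib cong: if_cong)
  obtain g where g: "g \<in> carrier_mat n n" "h * g = 1\<^sub>m n"
    using det_non_zero_imp_unit[of h n "()"] det by (auto simp: h_def Units_def ring_mat_def)
  have inj: "inj_on J {0..<n}"
  proof (rule inj_onI, rule ccontr)
    fix x y assume xy: "x \<in> {0..<n}" "y \<in> {0..<n}" "J x = J y" "x \<noteq> y"
    have "Determinant.det h = 0"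
      using xy by (intro det_identical_columns[of h n x y]) (auto simp: h_def intro!: eq_vecI)
    then show False using det by (simp add: h_def)
  qed
  have "card ({0..<?N} - J ` {0..<n}) = n'"
    using Jlt card_image[OF inj] by (subst card_Diff_subset) auto
  then obtain K where K: "bij_betw K {0..<n'} ({0..<?N} - J ` {0..<n})"
    using ex_bij_betw_nat_finite[of "{0..<?N} - J ` {0..<n}"] by auto
  have Klt: "K k < ?N" and KJ: "c < n \<Longrightarrow> K k \<noteq> J c" if "k < n'" for k c
    using bij_betwE[OF K] that by force+
  have Kinj: "K k = K k' \<longleftrightarrow> k = k'" if "k < n'" "k' < n'" for k k'
    using bij_betw_imp_inj_on[OF K] that by (auto simp: inj_on_def)
  define \<kappa> where "\<kappa> = Matrix.mat ?N n' (\<lambda>(t, c). if t = K c then 1 else (0::complex))"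
  define \<pi> where "\<pi> = Matrix.mat n' ?N (\<lambda>(r, t). if t = K r then 1 else (0::complex))"
  define \<sigma> where "\<sigma> = \<iota> * g"
  define a where "a = \<kappa> - \<sigma> * (b * \<kappa>)"
  have c: "\<iota> \<in> carrier_mat ?N n" "\<kappa> \<in> carrier_mat ?N n'" "\<pi> \<in> carrier_mat n' ?N" "\<sigma> \<in> carrier_mat ?N n"
    "a \<in> carrier_mat ?N n'" "b * \<kappa> \<in> carrier_mat n n'"
    using g b by (auto simp: \<iota>_def \<kappa>_def \<pi>_def \<sigma>_def a_def)
  have \<pi>\<iota>: "\<pi> * \<iota> = 0\<^sub>m n' n"
    using KJ Klt by (intro eq_matI) (auto simp: \<pi>_def \<iota>_def scalar_prod_def if_distrib[of "\<lambda>x. x * _"] cong: if_cong)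
  have \<pi>\<kappa>: "\<pi> * \<kappa> = 1\<^sub>m n'"
    using Kinj Klt by (intro eq_matI) (auto simp: \<pi>_def \<kappa>_def scalar_prod_def if_distrib[of "\<lambda>x. x * _"] cong: if_cong)
  have b\<sigma>: "b * \<sigma> = 1\<^sub>m n"
    using g b\<iota> assoc_mult_mat[OF b c(1) g(1)] by (simp add: \<sigma>_def)
  have \<pi>\<sigma>: "\<pi> * \<sigma> = 0\<^sub>m n' n"
    using g \<pi>\<iota> assoc_mult_mat[OF c(3,1) g(1)] by (simp add: \<sigma>_def)
  have "b * (\<sigma> * (b * \<kappa>)) = b * \<kappa>"
    unfolding assoc_mult_mat[OF b c(4,6), symmetric] b\<sigma> by (rule left_mult_one_mat[OF c(6)])
  then have "b * a = 0\<^sub>m n n'"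
    using mult_minus_distrib_mat[OF b c(2), of "\<sigma> * (b * \<kappa>)"] c by (simp add: a_def)
  moreover have z: "1\<^sub>m n' - 0\<^sub>m n' n' = (1\<^sub>m n' :: complex mat)" by (intro eq_matI) auto
  have "\<pi> * (\<sigma> * (b * \<kappa>)) = 0\<^sub>m n' n'"
    unfolding assoc_mult_mat[OF c(3,4,6), symmetric] \<pi>\<sigma> by (rule left_mult_zero_mat[OF c(6)])
  then have "\<pi> * a = 1\<^sub>m n'"
    using mult_minus_distrib_mat[OF c(3,2), of "\<sigma> * (b * \<kappa>)"] c \<pi>\<kappa> z by (simp add: a_def)
  ultimately have "splitting n n' b \<sigma> a \<pi>" using c b b\<sigma> \<pi>\<sigma> by (intro splittingI) auto
  then show ?thesis by blast
qed

text \<open>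
  Since \<open>b\<close> kills \<open>A * b - l\<close>, this endomorphism factors through the kernel of \<open>b\<close>, which is the image
  of \<open>a\<close>. The new pair \<open>(a, b')\<close> has the scalar \<open>- l\<close> in the place of \<open>l\<close>: this is the reflection
  of a representation at a vertex.
\<close>

lemma splitting_reflect_left:
  assumes "splitting n n' b \<sigma> a \<pi>" and A: "A \<in> carrier_mat (n + n') n" "b * A = l \<cdot>\<^sub>m 1\<^sub>m n"
  defines "b' \<equiv> \<pi> * (A * b - l \<cdot>\<^sub>m 1\<^sub>m (n + n'))"
  shows "b' \<in> carrier_mat n' (n + n')" "a * b' = A * b - l \<cdot>\<^sub>m 1\<^sub>m (n + n')" "b' * a = (- l) \<cdot>\<^sub>m 1\<^sub>m n'"
proof -
  note s = splittingD[OF assms(1)]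
  let ?E = "A * b - l \<cdot>\<^sub>m 1\<^sub>m (n + n')"
  have E: "?E \<in> carrier_mat (n + n') (n + n')" using A s by auto
  show "b' \<in> carrier_mat n' (n + n')" using E s by (simp add: b'_def)
  have bE: "b * ?E = 0\<^sub>m n (n + n')"
  proof -
    have "b * (A * b) = l \<cdot>\<^sub>m b" 
      unfolding assoc_mult_mat[OF s(1) A(1) s(1), symmetric] A(2)
        mult_smult_assoc_mat[OF one_carrier_mat s(1)] left_mult_one_mat[OF s(1)] ..
    moreover have "b * (l \<cdot>\<^sub>m 1\<^sub>m (n + n')) = l \<cdot>\<^sub>m b"
      unfolding mult_smult_distrib[OF s(1) one_carrier_mat] right_mult_one_mat[OF s(1)] ..
    ultimately show ?thesis 
      using mult_minus_distrib_mat[OF s(1), of "A * b" "n + n'" "l \<cdot>\<^sub>m 1\<^sub>m (n + n')"] A s(1) by (simp add: minus_r_inv_mat)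
  qed
  have "?E = (\<sigma> * b + a * \<pi>) * ?E" using s(9) E by simp
  also have "\<dots> = \<sigma> * b * ?E + a * \<pi> * ?E" using s E by (intro add_mult_distrib_mat) auto
  also have "\<sigma> * b * ?E = 0\<^sub>m (n + n') (n + n')" using assoc_mult_mat[OF s(2,1) E] bE s by simp
  also have "a * \<pi> * ?E = a * b'" using assoc_mult_mat[OF s(3,4) E] by (simp add: b'_def)
  finally show "a * b' = ?E" using s E by (simp add: b'_def)
  have "?E * a = (- l) \<cdot>\<^sub>m a"
  proof -
    have "A * b * a = 0\<^sub>m (n + n') n'" using assoc_mult_mat[OF A(1) s(1,3)] s A by simp
    moreover have "l \<cdot>\<^sub>m 1\<^sub>m (n + n') * a = l \<cdot>\<^sub>m a" using s(3) by (simp add: mult_smult_assoc_mat[of _ "n + n'" "n + n'"])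
    ultimately show ?thesis using minus_mult_distrib_mat[of "A * b" "n + n'" "n + n'" "l \<cdot>\<^sub>m 1\<^sub>m (n + n')" a n'] A s
      by (intro eq_matI) auto
  qed
  then show "b' * a = (- l) \<cdot>\<^sub>m 1\<^sub>m n'"
    using assoc_mult_mat[OF s(4) E s(3)] s by (simp add: b'_def mult_smult_distrib[of _ n' "n + n'"])
qed

lemma splitting_reflect_right:
  assumes "splitting n n' b \<sigma> a \<pi>" and B: "B \<in> carrier_mat n' (n + n')" "B * a = (- l) \<cdot>\<^sub>m 1\<^sub>m n'"
  shows "\<exists>A \<in> carrier_mat (n + n') n. A * b = a * B + l \<cdot>\<^sub>m 1\<^sub>m (n + n') \<and> b * A = l \<cdot>\<^sub>m 1\<^sub>m n"
proof -
  note s = splittingD[OF assms(1)]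
  have "a\<^sup>T * B\<^sup>T = (- l) \<cdot>\<^sub>m 1\<^sub>m n'" 
  proof -
    have "a\<^sup>T * B\<^sup>T = ((- l) \<cdot>\<^sub>m 1\<^sub>m n')\<^sup>T" unfolding B(2)[symmetric] by (rule transpose_mult[OF B(1) s(3), symmetric])
    also have "\<dots> = (- l) \<cdot>\<^sub>m 1\<^sub>m n'" by (intro eq_matI) auto
    finally show ?thesis .
  qed
  moreover have "B\<^sup>T \<in> carrier_mat (n' + n) n'" using B by (simp add: add.commute)
  ultimately have *: "\<sigma>\<^sup>T * (B\<^sup>T * a\<^sup>T - (- l) \<cdot>\<^sub>m 1\<^sub>m (n' + n)) \<in> carrier_mat n (n' + n)"
     "b\<^sup>T * (\<sigma>\<^sup>T * (B\<^sup>T * a\<^sup>T - (- l) \<cdot>\<^sub>m 1\<^sub>m (n' + n))) = B\<^sup>T * a\<^sup>T - (- l) \<cdot>\<^sub>m 1\<^sub>m (n' + n)"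
     "(\<sigma>\<^sup>T * (B\<^sup>T * a\<^sup>T - (- l) \<cdot>\<^sub>m 1\<^sub>m (n' + n))) * b\<^sup>T = l \<cdot>\<^sub>m 1\<^sub>m n"
    using splitting_reflect_left[OF splitting_transpose[OF assms(1)], of "B\<^sup>T" "- l"] by simp_all
  define C where "C = \<sigma>\<^sup>T * (B\<^sup>T * a\<^sup>T - (- l) \<cdot>\<^sub>m 1\<^sub>m (n' + n))"
  have C: "C \<in> carrier_mat n (n + n')" "b\<^sup>T * C = B\<^sup>T * a\<^sup>T - (- l) \<cdot>\<^sub>m 1\<^sub>m (n + n')" "C * b\<^sup>T = l \<cdot>\<^sub>m 1\<^sub>m n"
    using * by (simp_all add: C_def add.commute[of n'])
  have bT: "b\<^sup>T \<in> carrier_mat (n + n') n" using s by simp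
  have "C\<^sup>T * b = (b\<^sup>T * C)\<^sup>T" using transpose_mult[OF bT C(1)] by simp
  also have "\<dots> = a * B + l \<cdot>\<^sub>m 1\<^sub>m (n + n')"
    unfolding C(2) transpose_mult[OF s(3) B(1), symmetric] using s B by (intro eq_matI) auto
  finally have 1: "C\<^sup>T * b = a * B + l \<cdot>\<^sub>m 1\<^sub>m (n + n')" .
  have "b * C\<^sup>T = (C * b\<^sup>T)\<^sup>T" using transpose_mult[OF C(1) bT] by simp
  also have "\<dots> = l \<cdot>\<^sub>m 1\<^sub>m n" unfolding C(3) by (intro eq_matI) auto
  finally show ?thesis using 1 C(1) by (intro bexI[of _ "C\<^sup>T"]) auto
qed

text \<open>
  A kernel vector of \<open>a\<close> extends by zero to one of the square matrix.
\<close>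

lemma det_hcat_eq_0:
  assumes a: "a \<in> carrier_mat (n + n') n'" and u: "u \<in> carrier_vec n'" "u \<noteq> 0\<^sub>v n'" "a *\<^sub>v u = 0\<^sub>v (n + n')"
  shows "Determinant.det (hcat n n' \<sigma> a) = 0"
proof -
  let ?w = "0\<^sub>v n @\<^sub>v u"
  have "hcat n n' \<sigma> a *\<^sub>v ?w = 0\<^sub>v (n + n')"
  proof (rule eq_vecI)
    fix t assume "t < dim_vec (0\<^sub>v (n + n') :: complex Matrix.vec)"
    then have t: "t < n + n'" by simp
    have "Matrix.vec_index (hcat n n' \<sigma> a *\<^sub>v ?w) t = (\<Sum>c\<in>{0..<n + n'}. if c < n then 0 else a $$ (t, c - n) * Matrix.vec_index u (c - n))"
      using t u(1) by (auto simp: hcat_def scalar_prod_def intro!: sum.cong)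
    also have "\<dots> = (\<Sum>c\<in>{n..<n + n'}. a $$ (t, c - n) * Matrix.vec_index u (c - n))"
      by (subst sum.atLeastLessThan_concat[of 0 n "n + n'", symmetric]) auto
    also have "\<dots> = (\<Sum>c\<in>{0..<n'}. a $$ (t, c) * Matrix.vec_index u c)"
      using sum.shift_bounds_nat_ivl[of "\<lambda>c. a $$ (t, c - n) * Matrix.vec_index u (c - n)" 0 n n'] by (simp add: add.commute)
    also have "\<dots> = Matrix.vec_index (a *\<^sub>v u) t" using t a u(1) by (simp add: scalar_prod_def)
    finally show "Matrix.vec_index (hcat n n' \<sigma> a *\<^sub>v ?w) t = Matrix.vec_index (0\<^sub>v (n + n')) t" using u(3) t by simp
  qed (simp add: hcat_def)
  moreover have "?w \<noteq> 0\<^sub>v (n + n')"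
  proof
    assume eq: "?w = 0\<^sub>v (n + n')"
    have "Matrix.vec_index u r = 0" if "r < n'" for r
      using arg_cong[OF eq, of "\<lambda>w. Matrix.vec_index w (n + r)"] that u(1) by simp
    then show False using u(1,2) by (auto simp: vec_eq_iff)
  qed
  moreover have "?w \<in> carrier_vec (n + n')" using u(1) by simp
  ultimately show ?thesis using det_0_iff_vec_prod_zero_field[OF hcat_carrier] by blast
qed

lemma det_vcat_eq_0:
  assumes b: "b \<in> carrier_mat n (n + n')" and u: "u \<in> carrier_vec n" "u \<noteq> 0\<^sub>v n" "b\<^sup>T *\<^sub>v u = 0\<^sub>v (n + n')"
  shows "Determinant.det (vcat n n' b \<pi>) = 0"
proof -
  let ?w = "u @\<^sub>v 0\<^sub>v n'"
  have "(vcat n n' b \<pi>)\<^sup>T *\<^sub>v ?w = 0\<^sub>v (n + n')"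
  proof (rule eq_vecI)
    fix t assume "t < dim_vec (0\<^sub>v (n + n') :: complex Matrix.vec)"
    then have t: "t < n + n'" by simp
    have "Matrix.vec_index ((vcat n n' b \<pi>)\<^sup>T *\<^sub>v ?w) t = (\<Sum>c\<in>{0..<n + n'}. if c < n then b $$ (c, t) * Matrix.vec_index u c else 0)"
      using t u(1) by (auto simp: vcat_def scalar_prod_def intro!: sum.cong)
    also have "\<dots> = (\<Sum>c\<in>{0..<n}. b $$ (c, t) * Matrix.vec_index u c)"
      by (subst sum.atLeastLessThan_concat[of 0 n "n + n'", symmetric]) auto
    also have "\<dots> = Matrix.vec_index (b\<^sup>T *\<^sub>v u) t" using t b u(1) by (simp add: scalar_prod_def)
    finally show "Matrix.vec_index ((vcat n n' b \<pi>)\<^sup>T *\<^sub>v ?w) t = Matrix.vec_index (0\<^sub>v (n + n')) t" using u(3) t by simp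
  qed (simp add: vcat_def)
  moreover have "?w \<noteq> 0\<^sub>v (n + n')"
  proof
    assume eq: "?w = 0\<^sub>v (n + n')"
    have "Matrix.vec_index u r = 0" if "r < n" for r
      using arg_cong[OF eq, of "\<lambda>w. Matrix.vec_index w r"] that u(1) by simp
    then show False using u(1,2) by (auto simp: vec_eq_iff)
  qed
  moreover have "?w \<in> carrier_vec (n + n')" using u(1) by simp
  ultimately have "Determinant.det (vcat n n' b \<pi>)\<^sup>T = 0"
    using det_0_iff_vec_prod_zero_field[of "(vcat n n' b \<pi>)\<^sup>T" "n + n'"] by auto
  then show ?thesis by (simp add: det_transpose[OF vcat_carrier])
qed

lemma smult_one_add: "x \<cdot>\<^sub>m 1\<^sub>m n + y \<cdot>\<^sub>m 1\<^sub>m n = (x + y) \<cdot>\<^sub>m (1\<^sub>m n :: complex mat)"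
  by (intro eq_matI) auto

section \<open>Block matrices indexed by lists\<close>

definition block_index :: "('k \<Rightarrow> nat) \<Rightarrow> 'k list \<Rightarrow> ('k \<times> nat) list" where
  "block_index sz ks = concat (map (\<lambda>k. map (Pair k) [0..<sz k]) ks)"

lemma block_index_simps [simp]:
  "block_index sz [] = []"
  "block_index sz (k # ks) = map (Pair k) [0..<sz k] @ block_index sz ks"
  by (simp_all add: block_index_def)

lemma set_block_index: "set (block_index sz ks) = {(k, c). k \<in> set ks \<and> c < sz k}"
  by (induction ks) auto

lemma distinct_block_index: "distinct ks \<Longrightarrow> distinct (block_index sz ks)"
  by (induction ks) (auto simp: distinct_map inj_on_def set_block_index)

lemma sum_block_index:
  fixes F :: "'k \<times> nat \<Rightarrow> 'c::comm_monoid_add"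
  assumes "distinct ks"
  shows "(\<Sum>t<length (block_index sz ks). F (block_index sz ks ! t)) = (\<Sum>k\<in>set ks. \<Sum>c<sz k. F (k, c))"
proof -
  let ?l = "block_index sz ks"
  have "(\<Sum>t<length ?l. F (?l ! t)) = sum_list (map F ?l)"
    by (simp add: sum_list_sum_nth atLeast0LessThan)
  also have "\<dots> = sum F (set ?l)"
    by (rule sum_list_distinct_conv_sum_set[OF distinct_block_index[OF assms]])
  also have "\<dots> = sum F (Sigma (set ks) (\<lambda>k. {..<sz k}))"
    by (rule arg_cong[of _ _ "sum F"]) (auto simp: set_block_index)
  also have "\<dots> = (\<Sum>k\<in>set ks. \<Sum>c<sz k. F (k, c))"
    by (subst sum.Sigma) auto
  finally show ?thesis .
qed

text \<open>
  The blocks are arranged along the index list instead of nested, so that entries are accessible by key.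
\<close>

definition block_diag :: "('k \<Rightarrow> nat) \<Rightarrow> 'k list \<Rightarrow> ('k \<Rightarrow> complex mat) \<Rightarrow> complex mat" where
  "block_diag sz ks G = (let l = block_index sz ks in Matrix.mat (length l) (length l)
     (\<lambda>(t, t'). if fst (l ! t) = fst (l ! t') then G (fst (l ! t)) $$ (snd (l ! t), snd (l ! t')) else 0))"

lemma block_diag_carrier [simp]:
  "block_diag sz ks G \<in> carrier_mat (length (block_index sz ks)) (length (block_index sz ks))"
  by (simp add: block_diag_def Let_def)

lemma det_block_diag:
  assumes "distinct ks" "\<And>k. k \<in> set ks \<Longrightarrow> G k \<in> carrier_mat (sz k) (sz k)"
  shows "Determinant.det (block_diag sz ks G) = (\<Prod>k\<in>set ks. Determinant.det (G k))"
  using assms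
proof (induction ks)
  case Nil
  then show ?case by (simp add: block_diag_def)
next
  case (Cons k ks)
  let ?l = "block_index sz ks" and ?n = "sz k"
  have G: "G k \<in> carrier_mat ?n ?n" using Cons.prems by simp
  have mem: "fst (?l ! t) \<in> set ks" if "t < length ?l" for t
    using nth_mem[OF that] by (auto simp: set_block_index)
  have "block_diag sz (k # ks) G = four_block_mat (G k) (0\<^sub>m ?n (length ?l)) (0\<^sub>m (length ?l) ?n) (block_diag sz ks G)"
  proof (rule eq_matI)
    fix t t' assume "t < dim_row (four_block_mat (G k) (0\<^sub>m ?n (length ?l)) (0\<^sub>m (length ?l) ?n) (block_diag sz ks G))"
      "t' < dim_col (four_block_mat (G k) (0\<^sub>m ?n (length ?l)) (0\<^sub>m (length ?l) ?n) (block_diag sz ks G))"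
    then have t: "t < ?n + length ?l" "t' < ?n + length ?l" using G by (auto simp: block_diag_def Let_def)
    have ne: "fst (?l ! (x - ?n)) \<noteq> k" if "\<not> x < ?n" "x < ?n + length ?l" for x
    proof -
      have "x - ?n < length ?l" using that by linarith
      then show ?thesis using mem Cons.prems(1) by fastforce
    qed
    show "block_diag sz (k # ks) G $$ (t, t') =
      four_block_mat (G k) (0\<^sub>m ?n (length ?l)) (0\<^sub>m (length ?l) ?n) (block_diag sz ks G) $$ (t, t')"
      using t G ne[of t] ne[of t'] by (cases "t < ?n"; cases "t' < ?n") (auto simp: block_diag_def Let_def nth_append)
  qed (use G in \<open>auto simp: block_diag_def Let_def\<close>)
  also have "Determinant.det \<dots> = Determinant.det (G k) * Determinant.det (block_diag sz ks G)"
    using G by (intro det_four_block_mat_upper_right_zero) auto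
  finally show ?case using Cons by simp
qed

section \<open>The star of a vertex\<close>

text \<open>
  Any enumeration of the arrows will do; it fixes the coordinates on the space \<open>T\<close>.
\<close>

definition incoming :: "('i, 'h) quiver \<Rightarrow> 'i \<Rightarrow> 'h list" where
  "incoming Q i = (SOME hs. set hs = {h \<in> arrows Q. tgt Q h = i} \<and> distinct hs)"

text \<open>
  The summands of the space \<open>T\<close> at the vertex \<open>i\<close>: the key \<open>None\<close> stands for \<open>D i\<close>, and \<open>Some h\<close> for the
  space at the source of the arrow \<open>h\<close> into \<open>i\<close>.
\<close>

definition star_keys :: "('i, 'h) quiver \<Rightarrow> 'i \<Rightarrow> 'h option list" where
  "star_keys Q i = None # map Some (incoming Q i)"

definition star_dim :: "('i, 'h) quiver \<Rightarrow> ('i \<Rightarrow> nat) \<Rightarrow> ('i \<Rightarrow> nat) \<Rightarrow> 'i \<Rightarrow> 'h option \<Rightarrow> nat" where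
  "star_dim Q d v i k = (case k of None \<Rightarrow> d i | Some h \<Rightarrow> v (src Q h))"

definition star_index :: "('i, 'h) quiver \<Rightarrow> ('i \<Rightarrow> nat) \<Rightarrow> ('i \<Rightarrow> nat) \<Rightarrow> 'i \<Rightarrow> ('h option \<times> nat) list" where
  "star_index Q d v i = block_index (star_dim Q d v i) (star_keys Q i)"

abbreviation star_size :: "('i, 'h) quiver \<Rightarrow> ('i \<Rightarrow> nat) \<Rightarrow> ('i \<Rightarrow> nat) \<Rightarrow> 'i \<Rightarrow> nat" where
  "star_size Q d v i \<equiv> length (star_index Q d v i)"

text \<open>
  The sign \<open>eps\<close> is put into the maps towards \<open>i\<close>, so that the moment map at \<open>i\<close> becomes the product of
  the two maps without further signs.
\<close>

definition out_entry :: "('i, 'h) quiver \<Rightarrow> 'i \<Rightarrow> ('i, 'h) rep \<Rightarrow> 'h option \<Rightarrow> nat \<Rightarrow> nat \<Rightarrow> complex" where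
  "out_entry Q i = (\<lambda>(B, \<gamma>, \<delta>) k r c. case k of None \<Rightarrow> \<delta> i $$ (r, c) | Some h \<Rightarrow> B (bar Q h) $$ (r, c))"

definition in_entry :: "('i, 'h) quiver \<Rightarrow> 'i \<Rightarrow> ('i, 'h) rep \<Rightarrow> nat \<Rightarrow> 'h option \<Rightarrow> nat \<Rightarrow> complex" where
  "in_entry Q i = (\<lambda>(B, \<gamma>, \<delta>) c k r. case k of None \<Rightarrow> \<gamma> i $$ (c, r) | Some h \<Rightarrow> of_int (eps Q h) * B h $$ (c, r))"

definition star_out :: "('i, 'h) quiver \<Rightarrow> ('i \<Rightarrow> nat) \<Rightarrow> ('i \<Rightarrow> nat) \<Rightarrow> 'i \<Rightarrow> ('i, 'h) rep \<Rightarrow> complex mat" where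
  "star_out Q d v i s = Matrix.mat (star_size Q d v i) (v i)
     (\<lambda>(t, c). out_entry Q i s (fst (star_index Q d v i ! t)) (snd (star_index Q d v i ! t)) c)"

definition star_in :: "('i, 'h) quiver \<Rightarrow> ('i \<Rightarrow> nat) \<Rightarrow> ('i \<Rightarrow> nat) \<Rightarrow> 'i \<Rightarrow> ('i, 'h) rep \<Rightarrow> complex mat" where
  "star_in Q d v i s = Matrix.mat (v i) (star_size Q d v i)
     (\<lambda>(c, t). in_entry Q i s c (fst (star_index Q d v i ! t)) (snd (star_index Q d v i ! t)))"

lemma star_carrier [simp]:
  "star_out Q d v i s \<in> carrier_mat (star_size Q d v i) (v i)"
  "star_in Q d v i s \<in> carrier_mat (v i) (star_size Q d v i)"
  by (simp_all add: star_out_def star_in_def)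

text \<open>
  The action of a gauge transformation on \<open>T\<close>.
\<close>

definition star_gauge :: "('i, 'h) quiver \<Rightarrow> ('i \<Rightarrow> nat) \<Rightarrow> ('i \<Rightarrow> nat) \<Rightarrow> 'i \<Rightarrow> ('i \<Rightarrow> complex mat) \<Rightarrow> complex mat" where
  "star_gauge Q d v i g = block_diag (star_dim Q d v i) (star_keys Q i)
     (\<lambda>k. case k of None \<Rightarrow> 1\<^sub>m (d i) | Some h \<Rightarrow> g (src Q h))"

locale quiver_double =
  fixes Q :: "('i::finite, 'h) quiver"
  assumes Q: "double_quiver Q"
begin

lemma finite_arrows: "finite (arrows Q)" using Q by (simp add: double_quiver_def)

lemma arrow_props:
  assumes "h \<in> arrows Q"
  shows "src Q h \<noteq> tgt Q h" "bar Q h \<in> arrows Q" "bar Q (bar Q h) = h"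
    "src Q (bar Q h) = tgt Q h" "tgt Q (bar Q h) = src Q h"
    "eps Q h * eps Q h = 1" "eps Q (bar Q h) = - eps Q h"
  using Q assms by (auto simp: double_quiver_def)

lemma cartan_diagonal: "cartan Q i i = 2"
proof -
  have "{h \<in> arrows Q. src Q h = i \<and> tgt Q h = i} = {}" by (auto dest: arrow_props(1))
  then show ?thesis by (simp only: cartan_def adj_def) simp
qed

lemma incoming: "set (incoming Q i) = {h \<in> arrows Q. tgt Q h = i}" "distinct (incoming Q i)"
proof -
  have "finite {h \<in> arrows Q. tgt Q h = i}" using finite_arrows by simp
  from finite_distinct_list[OF this]
  have "set (incoming Q i) = {h \<in> arrows Q. tgt Q h = i} \<and> distinct (incoming Q i)"
    unfolding incoming_def by (rule someI_ex)
  then show "set (incoming Q i) = {h \<in> arrows Q. tgt Q h = i}" "distinct (incoming Q i)" by auto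
qed

lemma star_keys: "set (star_keys Q i) = insert None (Some ` {h \<in> arrows Q. tgt Q h = i})" "distinct (star_keys Q i)"
  using incoming[of i] by (auto simp: star_keys_def distinct_map)

lemma star_index_None: 
  assumes "r < d i" obtains t where "t < star_size Q d v i" "star_index Q d v i ! t = (None, r)"
proof -
  have "(None, r) \<in> set (star_index Q d v i)"
    using assms star_keys by (auto simp: star_index_def set_block_index star_dim_def)
  then show ?thesis using that by (auto simp: in_set_conv_nth)
qed

lemma star_index_Some: 
  assumes "h \<in> arrows Q" "tgt Q h = i" "r < v (src Q h)"
  obtains t where "t < star_size Q d v i" "star_index Q d v i ! t = (Some h, r)"
proof -
  have "(Some h, r) \<in> set (star_index Q d v i)"
    using assms star_keys by (auto simp: star_index_def set_block_index star_dim_def)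
  then show ?thesis using that by (auto simp: in_set_conv_nth)
qed

lemma star_index_nth:
  assumes "t < star_size Q d v i"
  obtains r where "star_index Q d v i ! t = (None, r)" "r < d i"
  | h r where "star_index Q d v i ! t = (Some h, r)" "h \<in> arrows Q" "tgt Q h = i" "r < v (src Q h)"
proof -
  have "star_index Q d v i ! t \<in> set (star_index Q d v i)" using assms by simp
  then show ?thesis using that star_keys
    by (auto simp: star_index_def set_block_index star_dim_def)
qed

lemma sum_star:
  "(\<Sum>t<star_size Q d v i. F (star_index Q d v i ! t)) =
    (\<Sum>r<d i. F (None, r)) + (\<Sum>h | h \<in> arrows Q \<and> tgt Q h = i. \<Sum>r<v (src Q h). F (Some h, r))"
  (is "?l = _") for F :: "_ \<Rightarrow> complex"
proof -
  have "?l = (\<Sum>k\<in>set (star_keys Q i). \<Sum>c<star_dim Q d v i k. F (k, c))"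
    unfolding star_index_def by (rule sum_block_index[OF star_keys(2)])
  also have "\<dots> = (\<Sum>c<star_dim Q d v i None. F (None, c)) + 
      (\<Sum>k\<in>Some ` {h \<in> arrows Q. tgt Q h = i}. \<Sum>c<star_dim Q d v i k. F (k, c))"
    using finite_arrows by (simp add: star_keys)
  finally show ?thesis by (simp add: sum.reindex star_dim_def)
qed

lemma star_size: "star_size Q d v i = d i + (\<Sum>h | h \<in> arrows Q \<and> tgt Q h = i. v (src Q h))"
proof -
  have "(of_nat (star_size Q d v i) :: complex) = of_nat (d i + (\<Sum>h | h \<in> arrows Q \<and> tgt Q h = i. v (src Q h)))"
    using sum_star[where F = "\<lambda>_. 1" and d = d and v = v and i = i] by simp
  then show ?thesis by (simp only: of_nat_eq_iff)
qed

lemma star_index_cong: 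
  assumes "\<And>j. j \<noteq> i \<Longrightarrow> v' j = v j" shows "star_index Q d v' i = star_index Q d v i"
proof -
  have "star_dim Q d v' i k = star_dim Q d v i k" if "k \<in> set (star_keys Q i)" for k
    using that assms arrow_props(1) by (auto simp: star_keys star_dim_def)
  then show ?thesis unfolding star_index_def block_index_def
    by (intro arg_cong[of _ _ concat] map_cong) auto
qed

lemma rep_space_carrier:
  assumes "(B, \<gamma>, \<delta>) \<in> rep_space Q d v"
  shows "h \<in> arrows Q \<Longrightarrow> B h \<in> carrier_mat (v (tgt Q h)) (v (src Q h))"
    "\<gamma> i \<in> carrier_mat (v i) (d i)" "\<delta> i \<in> carrier_mat (d i) (v i)"
  using assms by (auto simp: rep_space_def)

lemma moment_map_star:
  assumes s: "s \<in> rep_space Q d v"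
  shows "moment_map Q v s i = star_in Q d v i s * star_out Q d v i s"
proof -
  obtain B \<gamma> \<delta> where s_eq: "s = (B, \<gamma>, \<delta>)" by (cases s)
  note car = rep_space_carrier[OF s[unfolded s_eq]]
  show ?thesis
  proof (rule eq_matI)
    fix x y assume "x < dim_row (star_in Q d v i s * star_out Q d v i s)" "y < dim_col (star_in Q d v i s * star_out Q d v i s)"
    then have xy: "x < v i" "y < v i" by (auto simp: star_in_def star_out_def)
    have "(star_in Q d v i s * star_out Q d v i s) $$ (x, y) =
      (\<Sum>t<star_size Q d v i. (\<lambda>(k, r). in_entry Q i s x k r * out_entry Q i s k r y) (star_index Q d v i ! t))"
      using xy by (simp add: star_in_def star_out_def scalar_prod_def atLeast0LessThan case_prod_beta)
    also have "\<dots> = (\<Sum>r<d i. \<gamma> i $$ (x, r) * \<delta> i $$ (r, y)) +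
      (\<Sum>h | h \<in> arrows Q \<and> tgt Q h = i. \<Sum>r<v (src Q h). of_int (eps Q h) * B h $$ (x, r) * B (bar Q h) $$ (r, y))"
      unfolding sum_star by (simp add: in_entry_def out_entry_def s_eq)
    also have "(\<Sum>r<d i. \<gamma> i $$ (x, r) * \<delta> i $$ (r, y)) = (\<gamma> i * \<delta> i) $$ (x, y)"
      using car(2,3)[of i] xy by (simp add: scalar_prod_def atLeast0LessThan)
    also have "(\<Sum>h | h \<in> arrows Q \<and> tgt Q h = i. \<Sum>r<v (src Q h). of_int (eps Q h) * B h $$ (x, r) * B (bar Q h) $$ (r, y))
      = (\<Sum>h | h \<in> arrows Q \<and> tgt Q h = i. of_int (eps Q h) * (B h * B (bar Q h)) $$ (x, y))"
    proof (rule sum.cong[OF refl])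
      fix h assume "h \<in> {h. h \<in> arrows Q \<and> tgt Q h = i}"
      then have h: "h \<in> arrows Q" "tgt Q h = i" by auto
      have "(B h * B (bar Q h)) $$ (x, y) = (\<Sum>r<v (src Q h). B h $$ (x, r) * B (bar Q h) $$ (r, y))"
        using car(1)[OF h(1)] car(1)[OF arrow_props(2)[OF h(1)]] arrow_props(4,5)[OF h(1)] h xy
        by (simp add: scalar_prod_def atLeast0LessThan)
      then show "(\<Sum>r<v (src Q h). of_int (eps Q h) * B h $$ (x, r) * B (bar Q h) $$ (r, y)) =
         of_int (eps Q h) * (B h * B (bar Q h)) $$ (x, y)"
        by (simp add: sum_distrib_left mult.assoc)
    qed
    finally show "moment_map Q v s i $$ (x, y) = (star_in Q d v i s * star_out Q d v i s) $$ (x, y)"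
      using xy by (simp add: moment_map_def s_eq)
  qed (auto simp: moment_map_def s_eq star_in_def star_out_def)
qed

lemma moment_fibre_iff:
  "s \<in> moment_fibre Q l d v \<longleftrightarrow> s \<in> rep_space Q d v \<and> (\<forall>i. star_in Q d v i s * star_out Q d v i s = l i \<cdot>\<^sub>m 1\<^sub>m (v i))"
  by (simp add: moment_fibre_def moment_map_star cong: conj_cong)

lemma gauge_group_inverse:
  assumes "g \<in> gauge_group v" shows "mutually_inverse (v j) (g j) (matrix_inverse (g j))"
proof -
  have g: "g j \<in> carrier_mat (v j) (v j)" "invertible_mat (g j)" using assms by (auto simp: gauge_group_def)
  obtain B where "inverts_mat (g j) B" "inverts_mat B (g j)" using g(2) by (auto simp: invertible_mat_def)
  then have B: "g j * B = 1\<^sub>m (v j)" "B * g j = 1\<^sub>m (dim_row B)" using g(1) by (auto simp: inverts_mat_def)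
  then have Bc: "B \<in> carrier_mat (v j) (v j)"
    by (metis carrier_matI g(1) carrier_matD(2) index_mult_mat(3) index_one_mat(3))
  have "g j \<in> Units (ring_mat TYPE(complex) (v j) ())"
    using B Bc g(1) by (auto simp: Units_def ring_mat_def)
  then obtain C where "mat_inverse (g j) = Some C" using mat_inverse(1)[OF g(1), of "()"] by (cases "mat_inverse (g j)") auto
  then show ?thesis using mat_inverse(2)[OF g(1)] g(1) by (auto simp: mutually_inverse_def)
qed

lemma matrix_inverse_unique:
  assumes "mutually_inverse n g h" shows "matrix_inverse g = h"
proof -
  have gh: "g \<in> carrier_mat n n" "h \<in> carrier_mat n n" "g * h = 1\<^sub>m n" "h * g = 1\<^sub>m n" 
    using assms by (auto simp: mutually_inverse_def)
  have "g \<in> Units (ring_mat TYPE(complex) n ())" using gh by (auto simp: Units_def ring_mat_def)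
  then obtain C where C: "mat_inverse g = Some C" using mat_inverse(1)[OF gh(1), of "()"] by (cases "mat_inverse g") auto
  have c: "C \<in> carrier_mat n n" "g * C = 1\<^sub>m n" using mat_inverse(2)[OF gh(1) C] by auto
  have "h = h * (g * C)" using c gh by simp
  also have "\<dots> = C" using assoc_mult_mat[OF gh(2,1) c(1)] gh c by simp
  finally show ?thesis using C by simp
qed

lemma gauge_action_rep_space:
  assumes g: "g \<in> gauge_group v" and s: "s \<in> rep_space Q d v"
  shows "gauge_action Q g s \<in> rep_space Q d v"
proof -
  obtain B \<gamma> \<delta> where s_eq: "s = (B, \<gamma>, \<delta>)" by (cases s)
  note car = rep_space_carrier[OF s[unfolded s_eq]]
  have gi: "g j \<in> carrier_mat (v j) (v j)" "matrix_inverse (g j) \<in> carrier_mat (v j) (v j)" for j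
    using gauge_group_inverse[OF g, of j] by (auto simp: mutually_inverse_def)
  have "g (tgt Q h) * B h * matrix_inverse (g (src Q h)) \<in> carrier_mat (v (tgt Q h)) (v (src Q h))" if "h \<in> arrows Q" for h
    by (intro mult_carrier_mat[OF mult_carrier_mat[OF gi(1) car(1)[OF that]] gi(2)])
  then show ?thesis unfolding s_eq gauge_action_def rep_space_def
    using mult_carrier_mat[OF gi(1) car(2)] mult_carrier_mat[OF car(3) gi(2)] by auto
qed

lemma star_gauge_carrier [simp]: "star_gauge Q d v i g \<in> carrier_mat (star_size Q d v i) (star_size Q d v i)"
  unfolding star_gauge_def star_index_def by simp

lemma star_gauge_dims [simp]:
  "dim_row (star_gauge Q d v i g) = star_size Q d v i" "dim_col (star_gauge Q d v i g) = star_size Q d v i"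
  using star_gauge_carrier[of d v i g] by (auto simp del: star_gauge_carrier)

lemma star_gauge_entry:
  assumes "t < star_size Q d v i" "t' < star_size Q d v i"
  shows "star_gauge Q d v i g $$ (t, t') = (let (k, r) = star_index Q d v i ! t; (k', r') = star_index Q d v i ! t' in
    if k = k' then (case k of None \<Rightarrow> 1\<^sub>m (d i) | Some h \<Rightarrow> g (src Q h)) $$ (r, r') else 0)"
  using assms unfolding star_gauge_def star_index_def block_diag_def Let_def by (simp add: case_prod_beta)

lemma sum_star_gauge_left:
  assumes t: "t < star_size Q d v i" and g: "\<And>j. g j \<in> carrier_mat (v j) (v j)"
  shows "(\<Sum>t'<star_size Q d v i. star_gauge Q d v i g $$ (t, t') * F (star_index Q d v i ! t')) =
    (case star_index Q d v i ! t of (None, r) \<Rightarrow> F (None, r) |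
       (Some h, r) \<Rightarrow> \<Sum>r'<v (src Q h). g (src Q h) $$ (r, r') * F (Some h, r'))" (is "?l = ?r")
proof -
  obtain k r\<^sub>0 where kr: "star_index Q d v i ! t = (k, r\<^sub>0)" by fastforce
  have "?l = (\<Sum>t'<star_size Q d v i. (\<lambda>(k', r'). (if k = k' then (case k of None \<Rightarrow> 1\<^sub>m (d i) | Some h \<Rightarrow> g (src Q h)) $$ (r\<^sub>0, r') else 0)
       * F (k', r')) (star_index Q d v i ! t'))"
    using t by (intro sum.cong refl) (simp add: star_gauge_entry kr case_prod_beta)
  also have "\<dots> = ?r"
    using t
  proof (cases rule: star_index_nth)
    case (1 r)
    then show ?thesis unfolding sum_star using kr by (simp add: if_distrib[of "\<lambda>x. x * _"] if_distrib[of "\<lambda>x. _ * x"] cong: if_cong)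
  next
    case (2 h r)
    have "(\<Sum>h' | h' \<in> arrows Q \<and> tgt Q h' = i. \<Sum>r'<v (src Q h').
         (if Some h = Some h' then g (src Q h) $$ (r, r') else 0) * F (Some h', r')) =
      (\<Sum>h' | h' \<in> arrows Q \<and> tgt Q h' = i. if h' = h then \<Sum>r'<v (src Q h). g (src Q h) $$ (r, r') * F (Some h, r') else 0)"
      by (intro sum.cong refl) auto
    moreover have "k = Some h" "r\<^sub>0 = r" using 2 kr by auto
    ultimately show ?thesis unfolding sum_star using 2 finite_arrows by (simp cong: if_cong)
  qed
  finally show ?thesis .
qed

lemma sum_star_gauge_right:
  assumes t: "t < star_size Q d v i" and g: "\<And>j. g j \<in> carrier_mat (v j) (v j)"
  shows "(\<Sum>t'<star_size Q d v i. F (star_index Q d v i ! t') * star_gauge Q d v i g $$ (t', t)) =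
    (case star_index Q d v i ! t of (None, r) \<Rightarrow> F (None, r) |
       (Some h, r) \<Rightarrow> \<Sum>r'<v (src Q h). F (Some h, r') * g (src Q h) $$ (r', r))" (is "?l = ?r")
proof -
  obtain k r\<^sub>0 where kr: "star_index Q d v i ! t = (k, r\<^sub>0)" by fastforce
  have "?l = (\<Sum>t'<star_size Q d v i. (\<lambda>(k', r'). F (k', r') * (if k' = k then (case k' of None \<Rightarrow> 1\<^sub>m (d i) | Some h \<Rightarrow> g (src Q h)) $$ (r', r\<^sub>0) else 0))
        (star_index Q d v i ! t'))"
    using t by (intro sum.cong refl) (simp add: star_gauge_entry kr case_prod_beta)
  also have "\<dots> = ?r"
    using t
  proof (cases rule: star_index_nth)
    case (1 r)
    then show ?thesis unfolding sum_star using kr by (simp add: if_distrib[of "\<lambda>x. x * _"] if_distrib[of "\<lambda>x. _ * x"] cong: if_cong)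
  next
    case (2 h r)
    have "(\<Sum>h' | h' \<in> arrows Q \<and> tgt Q h' = i. \<Sum>r'<v (src Q h').
         F (Some h', r') * (if h' = h then g (src Q h') $$ (r', r) else 0)) =
      (\<Sum>h' | h' \<in> arrows Q \<and> tgt Q h' = i. if h' = h then \<Sum>r'<v (src Q h). F (Some h, r') * g (src Q h) $$ (r', r) else 0)"
      by (intro sum.cong refl) auto
    moreover have "k = Some h" "r\<^sub>0 = r" using 2 kr by auto
    ultimately show ?thesis unfolding sum_star using 2 finite_arrows by (simp cong: if_cong)
  qed
  finally show ?thesis .
qed


lemma
  assumes g: "g \<in> gauge_group v" and s: "s \<in> rep_space Q d v"
  shows star_out_gauge: "star_out Q d v i (gauge_action Q g s) =
      star_gauge Q d v i g * star_out Q d v i s * matrix_inverse (g i)"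
    and star_in_gauge: "star_in Q d v i (gauge_action Q g s) =
      g i * star_in Q d v i s * star_gauge Q d v i (\<lambda>j. matrix_inverse (g j))"
proof -
  obtain B \<gamma> \<delta> where s_eq: "s = (B, \<gamma>, \<delta>)" by (cases s)
  note car = rep_space_carrier[OF s[unfolded s_eq]]
  have gi: "g j \<in> carrier_mat (v j) (v j)" "matrix_inverse (g j) \<in> carrier_mat (v j) (v j)" for j
    using gauge_group_inverse[OF g, of j] by (auto simp: mutually_inverse_def)
  define G where "G = star_gauge Q d v i g"
  define G' where "G' = star_gauge Q d v i (\<lambda>j. matrix_inverse (g j))"
  have Gc: "G \<in> carrier_mat (star_size Q d v i) (star_size Q d v i)" "G' \<in> carrier_mat (star_size Q d v i) (star_size Q d v i)"
    by (simp_all add: G_def G'_def)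
  show "star_out Q d v i (gauge_action Q g s) = star_gauge Q d v i g * star_out Q d v i s * matrix_inverse (g i)"
    unfolding G_def[symmetric]
  proof (rule eq_matI)
    fix t c assume "t < dim_row (G * star_out Q d v i s * matrix_inverse (g i))"
      "c < dim_col (G * star_out Q d v i s * matrix_inverse (g i))"
    then have t: "t < star_size Q d v i" "c < v i" using Gc gi(2)[of i] by auto
    have E: "(G * star_out Q d v i s) $$ (t, x) = (case star_index Q d v i ! t of (None, r) \<Rightarrow> out_entry Q i s None r x |
       (Some h, r) \<Rightarrow> \<Sum>r'<v (src Q h). g (src Q h) $$ (r, r') * out_entry Q i s (Some h) r' x)" if x: "x < v i" for x
    proof -
      have "(G * star_out Q d v i s) $$ (t, x) = (\<Sum>t'<star_size Q d v i. G $$ (t, t') *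
         (\<lambda>(k, r). out_entry Q i s k r x) (star_index Q d v i ! t'))"
        using t x Gc by (simp add: star_out_def scalar_prod_def atLeast0LessThan case_prod_beta)
      then show ?thesis unfolding G_def sum_star_gauge_left[OF t(1) gi(1)] by (simp split: prod.split option.split)
    qed
    have "(G * star_out Q d v i s * matrix_inverse (g i)) $$ (t, c) =
      (\<Sum>x<v i. (G * star_out Q d v i s) $$ (t, x) * matrix_inverse (g i) $$ (x, c))"
      using t gi(2)[of i] Gc by (simp add: scalar_prod_def atLeast0LessThan star_out_def)
    also have "\<dots> = out_entry Q i (gauge_action Q g s) (fst (star_index Q d v i ! t)) (snd (star_index Q d v i ! t)) c"
      using t(1)
    proof (cases rule: star_index_nth)
      case (1 r)
      then show ?thesis using E t car(3)[of i] gi(2)[of i]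
        by (simp add: out_entry_def s_eq gauge_action_def scalar_prod_def atLeast0LessThan)
    next
      case (2 h r)
      have b: "B (bar Q h) \<in> carrier_mat (v (src Q h)) (v i)" "bar Q h \<in> arrows Q" "tgt Q (bar Q h) = src Q h" "src Q (bar Q h) = i"
        using car(1)[OF arrow_props(2)[OF 2(2)]] arrow_props[OF 2(2)] 2(3) by auto
      have "(g (src Q h) * B (bar Q h) * matrix_inverse (g i)) $$ (r, c) = 
        (\<Sum>x<v i. (\<Sum>r'<v (src Q h). g (src Q h) $$ (r, r') * B (bar Q h) $$ (r', x)) * matrix_inverse (g i) $$ (x, c))"
        using b(1) gi(1)[of "src Q h"] gi(2)[of i] t 2 by (simp add: scalar_prod_def atLeast0LessThan del: assoc_mult_mat)
      then show ?thesis using 2 E b by (simp add: out_entry_def s_eq gauge_action_def)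
    qed
    finally show "star_out Q d v i (gauge_action Q g s) $$ (t, c) = (G * star_out Q d v i s * matrix_inverse (g i)) $$ (t, c)"
      using t by (simp add: star_out_def)
  qed (use Gc gi(2)[of i] in \<open>auto simp: star_out_def\<close>)
  show "star_in Q d v i (gauge_action Q g s) = g i * star_in Q d v i s * star_gauge Q d v i (\<lambda>j. matrix_inverse (g j))"
    unfolding G'_def[symmetric]
  proof (rule eq_matI)
    fix c t assume "c < dim_row (g i * star_in Q d v i s * G')" "t < dim_col (g i * star_in Q d v i s * G')"
    then have t: "t < star_size Q d v i" "c < v i" using Gc gi(1)[of i] by auto
    define F where "F = (\<lambda>(k, r). \<Sum>x<v i. g i $$ (c, x) * in_entry Q i s x k r)"
    have "(g i * star_in Q d v i s * G') $$ (c, t) = (\<Sum>t'<star_size Q d v i. F (star_index Q d v i ! t') * G' $$ (t', t))"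
      using t gi(1)[of i] Gc by (simp add: scalar_prod_def atLeast0LessThan star_in_def F_def case_prod_beta)
    also have "\<dots> = (case star_index Q d v i ! t of (None, r) \<Rightarrow> F (None, r) |
       (Some h, r) \<Rightarrow> \<Sum>r'<v (src Q h). F (Some h, r') * matrix_inverse (g (src Q h)) $$ (r', r))"
      unfolding G'_def by (rule sum_star_gauge_right[OF t(1) gi(2)])
    also have "\<dots> = in_entry Q i (gauge_action Q g s) c (fst (star_index Q d v i ! t)) (snd (star_index Q d v i ! t))"
      using t(1)
    proof (cases rule: star_index_nth)
      case (1 r)
      then show ?thesis using t car(2)[of i] gi(1)[of i]
        by (simp add: in_entry_def F_def s_eq gauge_action_def scalar_prod_def atLeast0LessThan)
    next
      case (2 h r)
      have b: "B h \<in> carrier_mat (v i) (v (src Q h))" using car(1)[OF 2(2)] 2(3) by auto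
      have "(g i * B h * matrix_inverse (g (src Q h))) $$ (c, r) = 
        (\<Sum>r'<v (src Q h). (\<Sum>x<v i. g i $$ (c, x) * B h $$ (x, r')) * matrix_inverse (g (src Q h)) $$ (r', r))"
        using b gi(1)[of i] gi(2)[of "src Q h"] t 2 by (simp add: scalar_prod_def atLeast0LessThan del: assoc_mult_mat)
      moreover have "F (Some h, r') = of_int (eps Q h) * (\<Sum>x<v i. g i $$ (c, x) * B h $$ (x, r'))" for r'
        by (simp add: F_def in_entry_def s_eq sum_distrib_left mult_ac)
      ultimately show ?thesis using 2 
        by (simp add: in_entry_def s_eq gauge_action_def sum_distrib_left[symmetric] mult.assoc)
    qed
    finally show "star_in Q d v i (gauge_action Q g s) $$ (c, t) = (g i * star_in Q d v i s * G') $$ (c, t)"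
      using t by (simp add: star_in_def)
  qed (use Gc gi(1)[of i] in \<open>auto simp: star_in_def\<close>)
qed

lemma star_gauge_inverse:
  assumes g: "\<And>j. mutually_inverse (v j) (g j) (h j)"
  shows "mutually_inverse (star_size Q d v i) (star_gauge Q d v i g) (star_gauge Q d v i h)"
proof -
  have one: "star_gauge Q d v i g * star_gauge Q d v i h = 1\<^sub>m (star_size Q d v i)"
    if g: "\<And>j. mutually_inverse (v j) (g j) (h j)" for g h
  proof (rule eq_matI)
    fix t u assume "t < dim_row (1\<^sub>m (star_size Q d v i) :: complex mat)" "u < dim_col (1\<^sub>m (star_size Q d v i) :: complex mat)"
    then have tu: "t < star_size Q d v i" "u < star_size Q d v i" by auto
    have gc: "g j \<in> carrier_mat (v j) (v j)" "h j \<in> carrier_mat (v j) (v j)" "g j * h j = 1\<^sub>m (v j)" for j 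
      using g[of j] by (auto simp: mutually_inverse_def)
    obtain k c where kc: "star_index Q d v i ! u = (k, c)" by fastforce
    define F where "F = (\<lambda>(k', r'). if k' = k then (case k' of None \<Rightarrow> 1\<^sub>m (d i) | Some x \<Rightarrow> h (src Q x)) $$ (r', c) else (0::complex))"
    have inj: "star_index Q d v i ! t = star_index Q d v i ! u \<longleftrightarrow> t = u"
      using distinct_block_index[OF star_keys(2)] tu by (simp add: star_index_def nth_eq_iff_index_eq)
    have "(star_gauge Q d v i g * star_gauge Q d v i h) $$ (t, u) = 
      (\<Sum>t'<star_size Q d v i. star_gauge Q d v i g $$ (t, t') * star_gauge Q d v i h $$ (t', u))"
      using tu by (simp add: scalar_prod_def atLeast0LessThan)
    also have "\<dots> = (\<Sum>t'<star_size Q d v i. star_gauge Q d v i g $$ (t, t') * F (star_index Q d v i ! t'))"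
      using tu(2) by (intro sum.cong refl) (simp add: star_gauge_entry kc F_def case_prod_beta)
    also have "\<dots> = (case star_index Q d v i ! t of (None, r) \<Rightarrow> F (None, r) |
       (Some h, r) \<Rightarrow> \<Sum>r'<v (src Q h). g (src Q h) $$ (r, r') * F (Some h, r'))"
      by (rule sum_star_gauge_left[OF tu(1) gc(1)])
    also have "\<dots> = (if star_index Q d v i ! t = star_index Q d v i ! u then 1 else 0)"
      using tu(1)
    proof (cases rule: star_index_nth)
      case (1 r)
      have "k = None \<Longrightarrow> c < d i" using tu(2) kc by (cases rule: star_index_nth) auto
      then show ?thesis using 1 kc by (auto simp: F_def)
    next
      case (2 x r)
      show ?thesis
      proof (cases "k = Some x")
        case True
        from tu(2) have c: "c < v (src Q x)" by (cases rule: star_index_nth) (use kc True in auto)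
        have "(\<Sum>r'<v (src Q x). g (src Q x) $$ (r, r') * h (src Q x) $$ (r', c)) = (g (src Q x) * h (src Q x)) $$ (r, c)"
          using gc(1,2)[of "src Q x"] c 2(4) by (simp add: scalar_prod_def atLeast0LessThan)
        then show ?thesis using 2 kc True c gc(3) by (simp add: F_def)
      qed (use 2 kc in \<open>auto simp: F_def\<close>)
    qed
    finally show "(star_gauge Q d v i g * star_gauge Q d v i h) $$ (t, u) = 1\<^sub>m (star_size Q d v i) $$ (t, u)"
      using tu inj by simp
  qed auto
  show ?thesis using one[OF g] one[OF mutually_inverse_sym[OF g]] by (simp add: mutually_inverse_def)
qed

lemma det_star_gauge:
  assumes "\<And>j. g j \<in> carrier_mat (v j) (v j)"
  shows "Determinant.det (star_gauge Q d v i g) = (\<Prod>j\<in>UNIV. Determinant.det (g j) ^ adj Q j i)"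
proof -
  let ?A = "{h \<in> arrows Q. tgt Q h = i}"
  have "Determinant.det (star_gauge Q d v i g) = (\<Prod>k\<in>set (star_keys Q i). Determinant.det (case k of None \<Rightarrow> 1\<^sub>m (d i) | Some h \<Rightarrow> g (src Q h)))"
    unfolding star_gauge_def
    by (rule det_block_diag[OF star_keys(2)]) (use assms in \<open>auto simp: star_dim_def split: option.split\<close>)
  also have "\<dots> = (\<Prod>h\<in>?A. Determinant.det (g (src Q h)))"
    using finite_arrows by (simp add: star_keys prod.reindex)
  also have "\<dots> = (\<Prod>j\<in>UNIV. \<Prod>h\<in>{h \<in> ?A. src Q h = j}. Determinant.det (g (src Q h)))"
    using finite_arrows by (subst prod.group) auto
  also have "\<dots> = (\<Prod>j\<in>UNIV. Determinant.det (g j) ^ adj Q j i)"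
  proof (rule prod.cong[OF refl])
    fix j
    have "{h \<in> ?A. src Q h = j} = {h \<in> arrows Q. src Q h = j \<and> tgt Q h = i}" by auto
    then show "(\<Prod>h\<in>{h \<in> ?A. src Q h = j}. Determinant.det (g (src Q h))) = Determinant.det (g j) ^ adj Q j i"
      by (simp add: adj_def)
  qed
  finally show ?thesis .
qed

lemma adj_sym: "adj Q i j = adj Q j i"
proof -
  have "bij_betw (bar Q) {h \<in> arrows Q. src Q h = i \<and> tgt Q h = j} {h \<in> arrows Q. src Q h = j \<and> tgt Q h = i}"
    by (rule bij_betw_byWitness[where f' = "bar Q"]) (auto simp: arrow_props)
  then show ?thesis unfolding adj_def by (rule bij_betw_same_card)
qed

lemma gauge_action_moment_fibre:
  assumes g: "g \<in> gauge_group v" and s: "s \<in> moment_fibre Q l d v"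
  shows "gauge_action Q g s \<in> moment_fibre Q l d v"
proof -
  have s': "s \<in> rep_space Q d v" using s by (simp add: moment_fibre_iff)
  have "star_in Q d v i (gauge_action Q g s) * star_out Q d v i (gauge_action Q g s) = l i \<cdot>\<^sub>m 1\<^sub>m (v i)" for i
  proof -
    let ?N = "star_size Q d v i"
    define G where "G = star_gauge Q d v i g"
    define G' where "G' = star_gauge Q d v i (\<lambda>j. matrix_inverse (g j))"
    have G: "G \<in> carrier_mat ?N ?N" "G' \<in> carrier_mat ?N ?N" "G' * G = 1\<^sub>m ?N"
      using star_gauge_inverse[of v g "\<lambda>j. matrix_inverse (g j)" d i, OF gauge_group_inverse[OF g]]
      by (auto simp: G_def G'_def mutually_inverse_def)
    have gi: "g i \<in> carrier_mat (v i) (v i)" "matrix_inverse (g i) \<in> carrier_mat (v i) (v i)"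
      "g i * matrix_inverse (g i) = 1\<^sub>m (v i)"
      using gauge_group_inverse[OF g, of i] by (auto simp: mutually_inverse_def)
    let ?b = "star_in Q d v i s" and ?a = "star_out Q d v i s"
    note b = star_carrier(2)[of Q d v i s] and a = star_carrier(1)[of Q d v i s]
    have Gah: "?a * matrix_inverse (g i) \<in> carrier_mat ?N (v i)" by (rule mult_carrier_mat[OF a gi(2)])
    have "g i * ?b * G' * (G * ?a * matrix_inverse (g i)) = g i * ?b * (G' * (G * (?a * matrix_inverse (g i))))"
      unfolding assoc_mult_mat[OF G(1) a gi(2)]
      by (rule assoc_mult_mat[OF mult_carrier_mat[OF gi(1) b] G(2) mult_carrier_mat[OF G(1) Gah]])
    also have "G' * (G * (?a * matrix_inverse (g i))) = ?a * matrix_inverse (g i)"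
      unfolding assoc_mult_mat[OF G(2,1) Gah, symmetric] G(3) by (rule left_mult_one_mat[OF Gah])
    also have "g i * ?b * (?a * matrix_inverse (g i)) = g i * ((?b * ?a) * matrix_inverse (g i))"
      unfolding assoc_mult_mat[OF gi(1) b Gah] assoc_mult_mat[OF b a gi(2)] ..
    also have "?b * ?a = l i \<cdot>\<^sub>m 1\<^sub>m (v i)" using s by (simp add: moment_fibre_iff)
    also have "l i \<cdot>\<^sub>m 1\<^sub>m (v i) * matrix_inverse (g i) = l i \<cdot>\<^sub>m matrix_inverse (g i)"
      unfolding mult_smult_assoc_mat[OF one_carrier_mat gi(2)] left_mult_one_mat[OF gi(2)] ..
    also have "g i * (l i \<cdot>\<^sub>m matrix_inverse (g i)) = l i \<cdot>\<^sub>m 1\<^sub>m (v i)"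
      unfolding mult_smult_distrib[OF gi(1,2)] gi(3) ..
    finally show ?thesis
      unfolding star_in_gauge[OF g s'] star_out_gauge[OF g s'] G_def G'_def .
  qed
  then show ?thesis using gauge_action_rep_space[OF g s'] by (simp add: moment_fibre_iff)
qed

text \<open>
  The factor \<open>GL (V i)\<close> inside the gauge group. It acts trivially on \<open>T\<close> because the quiver has no loops.
\<close>

definition gauge_at :: "('i \<Rightarrow> nat) \<Rightarrow> 'i \<Rightarrow> complex mat \<Rightarrow> 'i \<Rightarrow> complex mat" where
  "gauge_at v i g j = (if j = i then g else 1\<^sub>m (v j))"

lemma mutually_inverse_one: "mutually_inverse n (1\<^sub>m n) (1\<^sub>m n)"
  by (simp add: mutually_inverse_def)

lemma gauge_group_iff: "g \<in> gauge_group v \<longleftrightarrow> (\<exists>h. \<forall>j. mutually_inverse (v j) (g j) (h j))"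
proof
  assume "g \<in> gauge_group v"
  then show "\<exists>h. \<forall>j. mutually_inverse (v j) (g j) (h j)" by (intro exI[of _ "\<lambda>j. matrix_inverse (g j)"] allI gauge_group_inverse)
next
  assume "\<exists>h. \<forall>j. mutually_inverse (v j) (g j) (h j)"
  then obtain h where h: "\<And>j. mutually_inverse (v j) (g j) (h j)" by blast
  have "invertible_mat (g j)" for j
    using h[of j] unfolding mutually_inverse_def invertible_mat_def inverts_mat_def by auto
  then show "g \<in> gauge_group v" using h by (auto simp: gauge_group_def mutually_inverse_def)
qed

lemma gauge_at_gauge_group: "mutually_inverse (v i) g h \<Longrightarrow> gauge_at v i g \<in> gauge_group v"
  unfolding gauge_group_iff
  by (rule exI[of _ "gauge_at v i h"]) (simp add: gauge_at_def mutually_inverse_one)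

lemma matrix_inverse_gauge_at: "mutually_inverse (v i) g h \<Longrightarrow> matrix_inverse (gauge_at v i g j) = gauge_at v i h j"
  using matrix_inverse_unique[of "v i" g h] matrix_inverse_unique[OF mutually_inverse_one, of "v j"]
  by (simp add: gauge_at_def)

lemma star_gauge_gauge_at: "star_gauge Q d v i (gauge_at v i g) = 1\<^sub>m (star_size Q d v i)"
proof (rule eq_matI)
  fix t u assume "t < dim_row (1\<^sub>m (star_size Q d v i) :: complex mat)" "u < dim_col (1\<^sub>m (star_size Q d v i) :: complex mat)"
  then have tu: "t < star_size Q d v i" "u < star_size Q d v i" by auto
  have inj: "star_index Q d v i ! t = star_index Q d v i ! u \<longleftrightarrow> t = u"
    using distinct_block_index[OF star_keys(2)] tu by (simp add: star_index_def nth_eq_iff_index_eq)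
  show "star_gauge Q d v i (gauge_at v i g) $$ (t, u) = 1\<^sub>m (star_size Q d v i) $$ (t, u)"
    using tu(1)
  proof (cases rule: star_index_nth)
    case (1 r)
    from tu(2) show ?thesis by (cases rule: star_index_nth) (use tu inj 1 in \<open>auto simp: star_gauge_entry\<close>)
  next
    case (2 h r)
    then have ne: "src Q h \<noteq> i" using arrow_props(1) by auto
    from tu(2) show ?thesis by (cases rule: star_index_nth) (use tu inj 2 ne in \<open>auto simp: star_gauge_entry gauge_at_def\<close>)
  qed
qed auto

lemma
  assumes g: "mutually_inverse (v i) g h" and s: "s \<in> rep_space Q d v"
  shows star_out_gauge_at: "star_out Q d v i (gauge_action Q (gauge_at v i g) s) = star_out Q d v i s * h"
    and star_in_gauge_at: "star_in Q d v i (gauge_action Q (gauge_at v i g) s) = g * star_in Q d v i s"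
proof -
  have gh: "g \<in> carrier_mat (v i) (v i)" "h \<in> carrier_mat (v i) (v i)" using g by (auto simp: mutually_inverse_def)
  have i: "gauge_at v i g i = g" "gauge_at v i h i = h" by (simp_all add: gauge_at_def)
  show "star_out Q d v i (gauge_action Q (gauge_at v i g) s) = star_out Q d v i s * h"
    unfolding star_out_gauge[OF gauge_at_gauge_group[where v = v and i = i and g = g, OF g] s] star_gauge_gauge_at matrix_inverse_gauge_at[where v = v and i = i and g = g, OF g]
    unfolding i
    by (simp only: left_mult_one_mat[OF star_carrier(1)[of Q d v i s]])
  show "star_in Q d v i (gauge_action Q (gauge_at v i g) s) = g * star_in Q d v i s"
    unfolding star_in_gauge[OF gauge_at_gauge_group[where v = v and i = i and g = g, OF g] s] matrix_inverse_gauge_at[where v = v and i = i and g = g, OF g] star_gauge_gauge_at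
    unfolding i
    by (simp only: right_mult_one_mat[OF mult_carrier_mat[OF gh(1) star_carrier(2)[of Q d v i s]]])
qed

lemma star_gauge_cong:
  assumes "\<And>j. j \<noteq> i \<Longrightarrow> v' j = v j" "\<And>j. j \<noteq> i \<Longrightarrow> g' j = g j"
  shows "star_gauge Q d v' i g' = star_gauge Q d v i g"
proof -
  have idx: "star_index Q d v' i = star_index Q d v i" by (rule star_index_cong[OF assms(1)])
  show ?thesis
  proof (rule eq_matI)
    fix t u assume "t < dim_row (star_gauge Q d v i g)" "u < dim_col (star_gauge Q d v i g)"
    then have tu: "t < star_size Q d v i" "u < star_size Q d v i" by auto
    have g: "g' (src Q h) = g (src Q h)" if "fst (star_index Q d v i ! t) = Some h" for h
      using tu(1) by (cases rule: star_index_nth) (use that assms(2) arrow_props(1) in auto)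
    show "star_gauge Q d v' i g' $$ (t, u) = star_gauge Q d v i g $$ (t, u)"
      using tu g by (auto simp: star_gauge_entry idx split: prod.split option.split)
  qed (simp_all add: idx)
qed

lemma gauge_character_at: "gauge_character m (gauge_at v i g) = Determinant.det g powi m i"
proof -
  have "gauge_character m (gauge_at v i g) = (\<Prod>j\<in>UNIV. if j = i then Determinant.det g powi m i else 1)"
    unfolding gauge_character_def by (intro prod.cong refl) (auto simp: gauge_at_def)
  then show ?thesis by simp
qed

section \<open>Coordinates away from a vertex\<close>

definition rest_coordinates :: "('i \<Rightarrow> nat) \<Rightarrow> ('i \<Rightarrow> nat) \<Rightarrow> 'i \<Rightarrow> (('i, 'h) rep \<Rightarrow> complex) set" where
  "rest_coordinates d v i =
     {\<lambda>(B, \<gamma>, \<delta>). B h $$ (x, y) | h x y. h \<in> arrows Q \<and> src Q h \<noteq> i \<and> tgt Q h \<noteq> i \<and> x < v (tgt Q h) \<and> y < v (src Q h)} \<union>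
     {\<lambda>(B, \<gamma>, \<delta>). \<gamma> j $$ (x, y) | j x y. j \<noteq> i \<and> x < v j \<and> y < d j} \<union>
     {\<lambda>(B, \<gamma>, \<delta>). \<delta> j $$ (x, y) | j x y. j \<noteq> i \<and> x < d j \<and> y < v j}"

definition agree_off :: "'i \<Rightarrow> ('i, 'h) rep \<Rightarrow> ('i, 'h) rep \<Rightarrow> bool" where
  "agree_off i = (\<lambda>(B, \<gamma>, \<delta>) (B', \<gamma>', \<delta>').
     (\<forall>h\<in>arrows Q. src Q h \<noteq> i \<longrightarrow> tgt Q h \<noteq> i \<longrightarrow> B h = B' h) \<and> (\<forall>j. j \<noteq> i \<longrightarrow> \<gamma> j = \<gamma>' j \<and> \<delta> j = \<delta>' j))"

lemma agree_off_sym: "agree_off i s s' \<Longrightarrow> agree_off i s' s"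
  by (auto simp: agree_off_def)

lemma rest_coordinates_agree: "x \<in> rest_coordinates d v i \<Longrightarrow> agree_off i s s' \<Longrightarrow> x s = x s'"
  by (auto simp: rest_coordinates_def agree_off_def split: prod.splits)

lemma rest_coordinates_cong:
  assumes "\<And>j. j \<noteq> i \<Longrightarrow> v' j = v j" shows "rest_coordinates d v' i = rest_coordinates d v i"
  by (simp add: rest_coordinates_def assms cong: conj_cong)

lemma agree_off_gauge_at:
  assumes "mutually_inverse (v i) g h" "s \<in> rep_space Q d v"
  shows "agree_off i s (gauge_action Q (gauge_at v i g) s)"
proof -
  obtain B \<gamma> \<delta> where s_eq: "s = (B, \<gamma>, \<delta>)" by (cases s)
  note car = rep_space_carrier[OF assms(2)[unfolded s_eq]]
  have e: "gauge_at v i x j = 1\<^sub>m (v j)" if "j \<noteq> i" for x j using that by (simp add: gauge_at_def)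
  have 1: "1\<^sub>m (v (tgt Q a)) * B a * 1\<^sub>m (v (src Q a)) = B a" if "a \<in> arrows Q" for a
    using left_mult_one_mat[OF car(1)[OF that]] right_mult_one_mat[OF car(1)[OF that]] by simp
  show ?thesis
    unfolding agree_off_def gauge_action_def s_eq
    by (auto simp: matrix_inverse_gauge_at[where v = v and i = i and g = g, OF assms(1)] e 1
        left_mult_one_mat[OF car(2)] right_mult_one_mat[OF car(3)])
qed

lemma agree_off_gauge:
  assumes "agree_off i s s'" "\<And>j. j \<noteq> i \<Longrightarrow> g j = g' j"
  shows "agree_off i (gauge_action Q g s) (gauge_action Q g' s')"
  using assms by (auto simp: agree_off_def gauge_action_def split: prod.splits)

lemma rest_coordinates_polynomial: "x \<in> rest_coordinates d v i \<Longrightarrow> x \<in> polynomial_funs Q d v"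
  unfolding rest_coordinates_def
  by (elim UnE CollectE exE conjE)
     (simp_all only: polynomial_funs.coord_B polynomial_funs.coord_gamma polynomial_funs.coord_delta)

lemma polynomial_funs_generated: "polynomial_funs Q d v = generated_algebra (polynomial_funs Q d v)"
proof
  show "polynomial_funs Q d v \<subseteq> generated_algebra (polynomial_funs Q d v)" by (auto intro: generated_algebra.gen)
  have "f \<in> polynomial_funs Q d v" if "f \<in> generated_algebra (polynomial_funs Q d v)" for f
    using that by induction (auto intro: polynomial_funs.intros)
  then show "generated_algebra (polynomial_funs Q d v) \<subseteq> polynomial_funs Q d v" by blast
qed

lemma polynomial_funs_sum:
  "(\<And>i. i \<in> I \<Longrightarrow> f i \<in> polynomial_funs Q d v) \<Longrightarrow> (\<lambda>s. \<Sum>i\<in>I. f i s) \<in> polynomial_funs Q d v"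
  by (subst polynomial_funs_generated) (rule generated_algebra_sum, rule generated_algebra.gen, blast)

lemma polynomial_funs_det:
  "(\<And>i j. i < n \<Longrightarrow> j < n \<Longrightarrow> f i j \<in> polynomial_funs Q d v) \<Longrightarrow>
    (\<lambda>s. Determinant.det (Matrix.mat n n (\<lambda>(i, j). f i j s))) \<in> polynomial_funs Q d v"
  by (subst polynomial_funs_generated) (rule generated_algebra_det, rule generated_algebra.gen, blast)

lemma star_out_polynomial:
  assumes "t < star_size Q d v i" "c < v i"
  shows "(\<lambda>s. star_out Q d v i s $$ (t, c)) \<in> polynomial_funs Q d v"
  using assms(1)
proof (cases rule: star_index_nth)
  case (1 r)
  then have "(\<lambda>s. star_out Q d v i s $$ (t, c)) = (\<lambda>(B, \<gamma>, \<delta>). \<delta> i $$ (r, c))"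
    using assms by (auto simp: star_out_def out_entry_def)
  then show ?thesis using 1 assms polynomial_funs.coord_delta by simp
next
  case (2 h r)
  then have "(\<lambda>s. star_out Q d v i s $$ (t, c)) = (\<lambda>(B, \<gamma>, \<delta>). B (bar Q h) $$ (r, c))"
    using assms by (auto simp: star_out_def out_entry_def)
  then show ?thesis using 2 assms polynomial_funs.coord_B[of "bar Q h" Q r v c d] by (simp add: arrow_props)
qed

lemma star_in_polynomial:
  assumes "t < star_size Q d v i" "c < v i"
  shows "(\<lambda>s. star_in Q d v i s $$ (c, t)) \<in> polynomial_funs Q d v"
  using assms(1)
proof (cases rule: star_index_nth)
  case (1 r)
  then have "(\<lambda>s. star_in Q d v i s $$ (c, t)) = (\<lambda>(B, \<gamma>, \<delta>). \<gamma> i $$ (c, r))"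
    using assms by (auto simp: star_in_def in_entry_def)
  then show ?thesis using 1 assms polynomial_funs.coord_gamma by simp
next
  case (2 h r)
  then have eq: "(\<lambda>s. star_in Q d v i s $$ (c, t)) = (\<lambda>s. of_int (eps Q h) * (\<lambda>(B, \<gamma>, \<delta>). B h $$ (c, r)) s)"
    using assms by (auto simp: star_in_def in_entry_def)
  show ?thesis unfolding eq
    by (rule polynomial_funs.mult[OF polynomial_funs.const polynomial_funs.coord_B]) (use 2 assms in auto)
qed

lemma polynomial_funs_star:
  assumes "rest_coordinates d v i \<subseteq> G"
    and "\<And>t c. t < star_size Q d v i \<Longrightarrow> c < v i \<Longrightarrow> (\<lambda>s. star_out Q d v i s $$ (t, c)) \<in> G"
    and "\<And>t c. t < star_size Q d v i \<Longrightarrow> c < v i \<Longrightarrow> (\<lambda>s. star_in Q d v i s $$ (c, t)) \<in> G"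
    and "f \<in> polynomial_funs Q d v"
  shows "f \<in> generated_algebra G"
  using assms(4)
proof induction
  case (coord_B h x y)
  let ?f = "\<lambda>(B, \<gamma>, \<delta>). B h $$ (x, y)"
  consider "tgt Q h = i" | "src Q h = i" | "src Q h \<noteq> i" "tgt Q h \<noteq> i" by blast
  then show ?case
  proof cases
    case 1
    obtain t where t: "t < star_size Q d v i" "star_index Q d v i ! t = (Some h, y)"
      using star_index_Some[where h = h and i = i and r = y and v = v and d = d] coord_B 1 by blast
    have "?f = (\<lambda>s. of_int (eps Q h) * star_in Q d v i s $$ (x, t))"
    proof
      fix s :: "('i, 'h) rep"
      have "(of_int (eps Q h) :: complex) * of_int (eps Q h) = 1"
        using arrow_props(6)[OF coord_B(1)] by (metis of_int_1 of_int_mult)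
      then have "of_int (eps Q h) * (of_int (eps Q h) * z) = z" for z :: complex by (simp flip: mult.assoc)
      then show "?f s = of_int (eps Q h) * star_in Q d v i s $$ (x, t)"
        using t coord_B 1 by (auto simp: star_in_def in_entry_def split: prod.split)
    qed
    then show ?thesis
      using generated_algebra.mult[OF generated_algebra.const generated_algebra.gen[OF assms(3)[OF t(1), of x]]] coord_B 1
      by simp
  next
    case 2
    obtain t where t: "t < star_size Q d v i" "star_index Q d v i ! t = (Some (bar Q h), x)"
      using star_index_Some[where h = "bar Q h" and i = i and r = x and v = v and d = d] coord_B 2 by (auto simp: arrow_props)
    have "?f = (\<lambda>s. star_out Q d v i s $$ (t, y))"
      using t coord_B 2 by (auto simp: star_out_def out_entry_def arrow_props)
    then show ?thesis using generated_algebra.gen[OF assms(2)[OF t(1), of y]] coord_B 2 by simp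
  next
    case 3
    then have "?f \<in> rest_coordinates d v i" using coord_B unfolding rest_coordinates_def by blast
    then show ?thesis using assms(1) by (blast intro: generated_algebra.gen)
  qed
next
  case (coord_gamma x j y)
  let ?f = "\<lambda>(B, \<gamma>, \<delta>). \<gamma> j $$ (x, y)"
  show ?case
  proof (cases "j = i")
    case True
    obtain t where t: "t < star_size Q d v i" "star_index Q d v i ! t = (None, y)"
      using star_index_None[where i = i and r = y and v = v and d = d] coord_gamma True by blast
    have "?f = (\<lambda>s. star_in Q d v i s $$ (x, t))"
      using t coord_gamma True by (auto simp: star_in_def in_entry_def)
    then show ?thesis using generated_algebra.gen[OF assms(3)[OF t(1), of x]] coord_gamma True by simp
  next
    case False
    then have "?f \<in> rest_coordinates d v i" using coord_gamma unfolding rest_coordinates_def by blast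
    then show ?thesis using assms(1) by (blast intro: generated_algebra.gen)
  qed
next
  case (coord_delta x j y)
  let ?f = "\<lambda>(B, \<gamma>, \<delta>). \<delta> j $$ (x, y)"
  show ?case
  proof (cases "j = i")
    case True
    obtain t where t: "t < star_size Q d v i" "star_index Q d v i ! t = (None, x)"
      using star_index_None[where i = i and r = x and v = v and d = d] coord_delta True by blast
    have "?f = (\<lambda>s. star_out Q d v i s $$ (t, y))"
      using t coord_delta True by (auto simp: star_out_def out_entry_def)
    then show ?thesis using generated_algebra.gen[OF assms(2)[OF t(1), of y]] coord_delta True by simp
  next
    case False
    then have "?f \<in> rest_coordinates d v i" using coord_delta unfolding rest_coordinates_def by blast
    then show ?thesis using assms(1) by (blast intro: generated_algebra.gen)
  qed
qed (auto intro: generated_algebra.intros)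

section \<open>Replacing the maps at a vertex\<close>

definition star_position :: "('i \<Rightarrow> nat) \<Rightarrow> ('i \<Rightarrow> nat) \<Rightarrow> 'i \<Rightarrow> 'h option \<Rightarrow> nat \<Rightarrow> nat" where
  "star_position d v i k r = (SOME t. t < star_size Q d v i \<and> star_index Q d v i ! t = (k, r))"

definition replace_star :: "('i \<Rightarrow> nat) \<Rightarrow> ('i \<Rightarrow> nat) \<Rightarrow> 'i \<Rightarrow> complex mat \<Rightarrow> complex mat \<Rightarrow> ('i, 'h) rep \<Rightarrow> ('i, 'h) rep" where
  "replace_star d v i A M = (\<lambda>(B, \<gamma>, \<delta>).
     (restrict (\<lambda>h.
        if tgt Q h = i then Matrix.mat (v i) (v (src Q h)) (\<lambda>(c, r). of_int (eps Q h) * M $$ (c, star_position d v i (Some h) r))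
        else if src Q h = i then Matrix.mat (v (tgt Q h)) (v i) (\<lambda>(r, c). A $$ (star_position d v i (Some (bar Q h)) r, c))
        else B h) (arrows Q),
      \<gamma>(i := Matrix.mat (v i) (d i) (\<lambda>(c, r). M $$ (c, star_position d v i None r))),
      \<delta>(i := Matrix.mat (d i) (v i) (\<lambda>(r, c). A $$ (star_position d v i None r, c)))))"

lemma star_position:
  assumes "t < star_size Q d v i" "star_index Q d v i ! t = (k, r)"
  shows "star_position d v i k r = t"
proof -
  let ?P = "\<lambda>t. t < star_size Q d v i \<and> star_index Q d v i ! t = (k, r)"
  have P: "?P (star_position d v i k r)" unfolding star_position_def using assms by (intro someI[of ?P t]) auto
  have "distinct (star_index Q d v i)"
    using distinct_block_index[OF star_keys(2)] by (simp add: star_index_def)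
  from nth_eq_iff_index_eq[OF this, of "star_position d v i k r" t] show ?thesis using P assms by simp
qed

lemma replace_star_rep_space:
  assumes s: "s \<in> rep_space Q d v" and v': "\<And>j. j \<noteq> i \<Longrightarrow> v' j = v j"
  shows "replace_star d v' i A M s \<in> rep_space Q d v'"
proof -
  obtain B \<gamma> \<delta> where s_eq: "s = (B, \<gamma>, \<delta>)" by (cases s)
  note car = rep_space_carrier[OF s[unfolded s_eq]]
  show ?thesis unfolding s_eq replace_star_def rep_space_def using car v' by auto
qed

lemma replace_star_agree: "agree_off i s (replace_star d v i A M s)"
  by (auto simp: agree_off_def replace_star_def split: prod.split)

lemma replace_star_star:
  assumes A: "A \<in> carrier_mat (star_size Q d v i) (v i)" and M: "M \<in> carrier_mat (v i) (star_size Q d v i)"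
  shows "star_out Q d v i (replace_star d v i A M s) = A" "star_in Q d v i (replace_star d v i A M s) = M"
proof -
  obtain B \<gamma> \<delta> where s_eq: "s = (B, \<gamma>, \<delta>)" by (cases s)
  let ?s' = "replace_star d v i A M s"
  have out: "out_entry Q i ?s' (fst (star_index Q d v i ! t)) (snd (star_index Q d v i ! t)) c = A $$ (t, c)"
    if t: "t < star_size Q d v i" "c < v i" for t c
    using t(1)
  proof (cases rule: star_index_nth)
    case (1 r)
    then show ?thesis using star_position[OF t(1) 1(1)] t by (simp add: out_entry_def replace_star_def s_eq)
  next
    case (2 h r)
    note h = arrow_props[OF 2(2)]
    then show ?thesis using star_position[OF t(1) 2(1)] t 2 by (auto simp: out_entry_def replace_star_def s_eq)
  qed
  have inn: "in_entry Q i ?s' c (fst (star_index Q d v i ! t)) (snd (star_index Q d v i ! t)) = M $$ (c, t)"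
    if t: "t < star_size Q d v i" "c < v i" for t c
    using t(1)
  proof (cases rule: star_index_nth)
    case (1 r)
    then show ?thesis using star_position[OF t(1) 1(1)] t by (simp add: in_entry_def replace_star_def s_eq)
  next
    case (2 h r)
    have "(of_int (eps Q h) :: complex) * of_int (eps Q h) = 1"
      using arrow_props(6)[OF 2(2)] by (metis of_int_1 of_int_mult)
    then have "of_int (eps Q h) * (of_int (eps Q h) * z) = z" for z :: complex by (simp flip: mult.assoc)
    then show ?thesis using star_position[OF t(1) 2(1)] t 2 by (simp add: in_entry_def replace_star_def s_eq)
  qed
  show "star_out Q d v i ?s' = A" using A out by (intro eq_matI) (auto simp: star_out_def)
  show "star_in Q d v i ?s' = M" using M inn by (intro eq_matI) (auto simp: star_in_def)
qed

text \<open>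
  At a neighbour \<open>j\<close> of \<open>i\<close>, each arrow \<open>h\<close> from \<open>i\<close> to \<open>j\<close> contributes to the moment map minus the diagonal
  block of \<open>out * inn\<close> at the summand of \<open>T\<close> that belongs to \<open>bar h\<close>. Subtracting a scalar \<open>c\<close> from
  \<open>out * inn\<close> therefore adds \<open>c\<close> for each such arrow, which is the effect of a simple reflection on the
  moment values.
\<close>

lemma moment_map_off:
  assumes v': "\<And>j. j \<noteq> i \<Longrightarrow> v' j = v j"
    and s: "s \<in> rep_space Q d v" "s' \<in> rep_space Q d v'" "agree_off i s s'"
    and N: "star_out Q d v' i s' * star_in Q d v' i s' = star_out Q d v i s * star_in Q d v i s - c \<cdot>\<^sub>m 1\<^sub>m (star_size Q d v i)"
    and j: "j \<noteq> i"
  shows "moment_map Q v' s' j = moment_map Q v s j + (of_nat (adj Q i j) * c) \<cdot>\<^sub>m 1\<^sub>m (v j)"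
proof -
  obtain B \<gamma> \<delta> where s_eq: "s = (B, \<gamma>, \<delta>)" by (cases s)
  obtain B' \<gamma>' \<delta>' where s'_eq: "s' = (B', \<gamma>', \<delta>')" by (cases s')
  note car = rep_space_carrier[OF s(1)[unfolded s_eq]]
  note car' = rep_space_carrier[OF s(2)[unfolded s'_eq]]
  have idx: "star_index Q d v' i = star_index Q d v i" by (rule star_index_cong[OF v'])
  let ?A = "{h. h \<in> arrows Q \<and> tgt Q h = j}"
  have summand: "of_int (eps Q h) * (B' h * B' (bar Q h)) $$ (x, y) = 
     of_int (eps Q h) * (B h * B (bar Q h)) $$ (x, y) + (if src Q h = i \<and> x = y then c else 0)"
    if h: "h \<in> arrows Q" "tgt Q h = j" and xy: "x < v j" "y < v j" for h x y
  proof (cases "src Q h = i")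
    case False
    have "B' h = B h" "B' (bar Q h) = B (bar Q h)"
      using s(3) h False j arrow_props[OF h(1)] by (auto simp: agree_off_def s_eq s'_eq)
    then show ?thesis using False by simp
  next
    case True
    note ap = arrow_props[OF h(1)]
    have bh: "bar Q h \<in> arrows Q" "tgt Q (bar Q h) = i" "src Q (bar Q h) = j" using ap True h by auto
    obtain t where t: "t < star_size Q d v i" "star_index Q d v i ! t = (Some (bar Q h), x)"
      by (rule star_index_Some[where h = "bar Q h" and i = i and r = x and v = v and d = d]) (use bh xy in auto)
    obtain u where u: "u < star_size Q d v i" "star_index Q d v i ! u = (Some (bar Q h), y)"
      by (rule star_index_Some[where h = "bar Q h" and i = i and r = y and v = v and d = d]) (use bh xy in auto)
    have tu: "t = u \<longleftrightarrow> x = y"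
    proof
      assume "t = u" then show "x = y" using t(2) u(2) by simp
    next
      assume "x = y" then show "t = u" using star_position[OF t] star_position[OF u] by metis
    qed
    \<comment> \<open>One computation covers both representations: \<open>z\<close> is instantiated with \<open>s\<close> and with \<open>s'\<close>.\<close>
    have e: "(star_out Q d w i z * star_in Q d w i z) $$ (t, u) = - (of_int (eps Q h) * (C h * C (bar Q h)) $$ (x, y))"
      if z: "z = (C, x1, x2)" "z \<in> rep_space Q d w" and w: "w j = v j" "star_index Q d w i = star_index Q d v i" for w z C x1 x2
    proof -
      note cz = rep_space_carrier(1)[OF z(2)[unfolded z(1)]]
      have "(star_out Q d w i z * star_in Q d w i z) $$ (t, u) = (\<Sum>r<w i. C h $$ (x, r) * (- of_int (eps Q h) * C (bar Q h) $$ (r, y)))"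
        using t u w ap by (simp add: star_out_def star_in_def scalar_prod_def atLeast0LessThan out_entry_def in_entry_def z)
      also have "\<dots> = - (of_int (eps Q h) * (\<Sum>r<w i. C h $$ (x, r) * C (bar Q h) $$ (r, y)))"
        by (simp add: sum_distrib_left sum_negf mult_ac)
      also have "(\<Sum>r<w i. C h $$ (x, r) * C (bar Q h) $$ (r, y)) = (C h * C (bar Q h)) $$ (x, y)"
        using cz[OF h(1)] cz[OF bh(1)] True h bh xy w by (simp add: scalar_prod_def atLeast0LessThan)
      finally show ?thesis .
    qed
    have "(star_out Q d v' i s' * star_in Q d v' i s') $$ (t, u) = (star_out Q d v i s * star_in Q d v i s) $$ (t, u) - (if x = y then c else 0)"
      unfolding N using t u tu by (simp add: star_out_def star_in_def)
    then have "- (of_int (eps Q h) * (B' h * B' (bar Q h)) $$ (x, y)) =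
       - (of_int (eps Q h) * (B h * B (bar Q h)) $$ (x, y)) - (if x = y then c else 0)"
      using e[OF s'_eq s(2)] e[OF s_eq s(1)] v'[OF j] idx True by simp
    from arg_cong[OF this, of uminus] have "of_int (eps Q h) * (B' h * B' (bar Q h)) $$ (x, y) =
       of_int (eps Q h) * (B h * B (bar Q h)) $$ (x, y) + (if x = y then c else 0)"
      by (simp only: minus_minus minus_diff_eq diff_minus_eq_add add.commute)
    then show ?thesis using True by simp
  qed
  have gd: "(\<gamma>' j * \<delta>' j) = (\<gamma> j * \<delta> j)" using s(3) j by (auto simp: agree_off_def s_eq s'_eq)
  show ?thesis
  proof (rule eq_matI)
    fix x y assume "x < dim_row (moment_map Q v s j + (of_nat (adj Q i j) * c) \<cdot>\<^sub>m 1\<^sub>m (v j))"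
      "y < dim_col (moment_map Q v s j + (of_nat (adj Q i j) * c) \<cdot>\<^sub>m 1\<^sub>m (v j))"
    then have xy: "x < v j" "y < v j" by auto
    have "(\<Sum>h\<in>?A. of_int (eps Q h) * (B' h * B' (bar Q h)) $$ (x, y)) =
      (\<Sum>h\<in>?A. of_int (eps Q h) * (B h * B (bar Q h)) $$ (x, y)) + (\<Sum>h\<in>?A. if src Q h = i \<and> x = y then c else 0)"
      unfolding sum.distrib[symmetric] using summand xy by (intro sum.cong refl) auto
    also have "(\<Sum>h\<in>?A. if src Q h = i \<and> x = y then c else 0) = (if x = y then of_nat (adj Q i j) * c else 0)"
    proof (cases "x = y")
      case True
      have "(\<Sum>h\<in>?A. if src Q h = i \<and> x = y then c else 0) = (\<Sum>h\<in>{h \<in> arrows Q. src Q h = i \<and> tgt Q h = j}. c)"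
        using finite_arrows True by (intro sum.mono_neutral_cong_right) auto
      then show ?thesis using True by (simp add: adj_def)
    qed simp
    finally show "moment_map Q v' s' j $$ (x, y) = (moment_map Q v s j + (of_nat (adj Q i j) * c) \<cdot>\<^sub>m 1\<^sub>m (v j)) $$ (x, y)"
      using xy v'[OF j] gd by (simp add: moment_map_def s_eq s'_eq)
  qed (use v'[OF j] in \<open>auto simp: moment_map_def s_eq s'_eq\<close>)
qed

end

section \<open>Covariants seen from one vertex\<close>

locale star_vertex = quiver_double Q for Q :: "('i::finite, 'h) quiver" +
  fixes l :: "'i \<Rightarrow> complex" and d v :: "'i \<Rightarrow> nat" and i :: 'i
begin

abbreviation "fibre \<equiv> moment_fibre Q l d v"
abbreviation "inn \<equiv> star_in Q d v i"
abbreviation "out \<equiv> star_out Q d v i"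
abbreviation "sz \<equiv> star_size Q d v i"

lemma fibre_rep_space: "s \<in> fibre \<Longrightarrow> s \<in> rep_space Q d v"
  by (simp add: moment_fibre_def)

lemma inn_out: "s \<in> fibre \<Longrightarrow> inn s * out s = l i \<cdot>\<^sub>m 1\<^sub>m (v i)"
  by (simp add: moment_fibre_iff)

lemma out_inn_transpose: "s \<in> fibre \<Longrightarrow> (out s)\<^sup>T * (inn s)\<^sup>T = l i \<cdot>\<^sub>m 1\<^sub>m (v i)"
proof -
  assume "s \<in> fibre"
  then have "(out s)\<^sup>T * (inn s)\<^sup>T = (l i \<cdot>\<^sub>m 1\<^sub>m (v i))\<^sup>T"
    using transpose_mult[OF star_carrier(2)[of Q d v i s] star_carrier(1)[of Q d v i s]] inn_out by simp
  also have "\<dots> = l i \<cdot>\<^sub>m 1\<^sub>m (v i)" by (intro eq_matI) auto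
  finally show ?thesis .
qed

text \<open>
  A covariant for the whole gauge group is in particular one for \<open>GL (V i)\<close>, of weight a multiple of
  \<open>m i\<close>. For \<open>m i \<ge> 0\<close> the minors of the map into \<open>V i\<close> have the right sign of weight; this is the
  instance \<open>I\<close>. For \<open>m i \<le> 0\<close> those of the map out of \<open>V i\<close> do; in the instance \<open>O\<close> the maps are
  transposed and the group acts through the inverse transpose, so that weights become non-negative.
\<close>

sublocale I: gl_functions fibre "v i" sz inn out "rest_coordinates d v i" "\<lambda>g. gauge_action Q (gauge_at v i g)"
proof
  fix s g h x assume s: "s \<in> fibre" and gh: "mutually_inverse (v i) g h"
  show "gauge_action Q (gauge_at v i g) s \<in> fibre"
    by (rule gauge_action_moment_fibre[OF gauge_at_gauge_group[where v = v and i = i and g = g, OF gh] s])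
  show "inn (gauge_action Q (gauge_at v i g) s) = g * inn s" "out (gauge_action Q (gauge_at v i g) s) = out s * h"
    using star_in_gauge_at[where v = v and i = i and g = g, OF gh fibre_rep_space[OF s]] star_out_gauge_at[where v = v and i = i and g = g, OF gh fibre_rep_space[OF s]] by auto
  assume "x \<in> rest_coordinates d v i"
  then show "x (gauge_action Q (gauge_at v i g) s) = x s"
    using rest_coordinates_agree agree_off_gauge_at[where v = v and i = i and g = g, OF gh fibre_rep_space[OF s]] by metis
qed auto

sublocale O: gl_functions fibre "v i" sz "\<lambda>s. (out s)\<^sup>T" "\<lambda>s. (inn s)\<^sup>T" "rest_coordinates d v i"
  "\<lambda>g. gauge_action Q (gauge_at v i (matrix_inverse g)\<^sup>T)"
proof
  fix s g h x assume s: "s \<in> fibre" and gh': "mutually_inverse (v i) g h"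
  have h: "matrix_inverse g = h" by (rule matrix_inverse_unique[OF gh'])
  have gh: "mutually_inverse (v i) h\<^sup>T g\<^sup>T" by (rule mutually_inverse_sym[OF mutually_inverse_transpose[OF gh']])
  have c: "g \<in> carrier_mat (v i) (v i)" "h \<in> carrier_mat (v i) (v i)" using gh' by (auto simp: mutually_inverse_def)
  show "gauge_action Q (gauge_at v i (matrix_inverse g)\<^sup>T) s \<in> fibre" unfolding h
    by (rule I.act_X[OF s gh])
  show "(out (gauge_action Q (gauge_at v i (matrix_inverse g)\<^sup>T) s))\<^sup>T = g * (out s)\<^sup>T"
    unfolding h I.a_act[OF s gh] using transpose_mult[OF star_carrier(1)[of Q d v i s], of "g\<^sup>T" "v i"] c by simp
  show "(inn (gauge_action Q (gauge_at v i (matrix_inverse g)\<^sup>T) s))\<^sup>T = (inn s)\<^sup>T * h"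
    unfolding h I.b_act[OF s gh] using transpose_mult[OF _ star_carrier(2)[of Q d v i s], of "h\<^sup>T" "v i"] c by simp
  assume "x \<in> rest_coordinates d v i"
  then show "x (gauge_action Q (gauge_at v i (matrix_inverse g)\<^sup>T) s) = x s" unfolding h
    by (rule I.rest_act[OF s gh])
qed (auto simp: transpose_carrier_mat)

lemma polynomial_in_coordinates:
  assumes "f \<in> polynomial_funs Q d v"
  shows "f \<in> generated_algebra I.coordinates" "f \<in> generated_algebra O.coordinates"
proof -
  show "f \<in> generated_algebra I.coordinates"
    by (rule polynomial_funs_star[OF _ _ _ assms]) (auto simp: I.coordinates_def)
  have e: "(inn s)\<^sup>T $$ (t, c) = inn s $$ (c, t)" "(out s)\<^sup>T $$ (c, t) = out s $$ (t, c)"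
    if "t < sz" "c < v i" for s t c
    using that by (auto simp: star_in_def star_out_def)
  show "f \<in> generated_algebra O.coordinates"
  proof (rule polynomial_funs_star[OF _ _ _ assms])
    fix t c assume tc: "t < sz" "c < v i"
    have "(\<lambda>s. (out s)\<^sup>T $$ (c, t)) \<in> O.coordinates" "(\<lambda>s. (inn s)\<^sup>T $$ (t, c)) \<in> O.coordinates"
      unfolding O.coordinates_def using tc by blast+
    then show "(\<lambda>s. out s $$ (t, c)) \<in> O.coordinates" "(\<lambda>s. inn s $$ (c, t)) \<in> O.coordinates"
      using e[OF tc] by simp_all
  qed (auto simp: O.coordinates_def)
qed

lemma covariantsE:
  assumes "f \<in> covariants Q m l d v k"
  obtains F where "F \<in> polynomial_funs Q d v" "f = (\<lambda>s. if s \<in> fibre then F s else 0)"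
    "\<forall>g\<in>gauge_group v. \<forall>s\<in>fibre. F (gauge_action Q g s) = gauge_character m g ^ k * F s"
proof -
  obtain F where F: "F \<in> polynomial_funs Q d v" "f = (\<lambda>s. if s \<in> fibre then F s else 0)"
    using assms by (auto simp: covariants_def fibre_regular_funs_def)
  have "F (gauge_action Q g s) = gauge_character m g ^ k * F s" if "g \<in> gauge_group v" "s \<in> fibre" for g s
  proof -
    have "f (gauge_action Q g s) = gauge_character m g ^ k * f s"
      using assms that unfolding covariants_def by blast
    then show ?thesis using gauge_action_moment_fibre[OF that] that(2) by (simp add: F(2))
  qed
  then show ?thesis using F by (intro that) blast+
qed

lemma covariant_inE:
  assumes "f \<in> covariants Q m l d v k" "0 \<le> m i"
  obtains F where "I.covariant (k * nat (m i)) F" "f = (\<lambda>s. if s \<in> fibre then F s else 0)"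
proof -
  obtain F where F: "F \<in> polynomial_funs Q d v" "f = (\<lambda>s. if s \<in> fibre then F s else 0)"
    "\<forall>g\<in>gauge_group v. \<forall>s\<in>fibre. F (gauge_action Q g s) = gauge_character m g ^ k * F s"
    using assms(1) by (rule covariantsE)
  have "F (gauge_action Q (gauge_at v i g) s) = Determinant.det g ^ (k * nat (m i)) * F s"
    if "s \<in> fibre" "mutually_inverse (v i) g h" for s g h
  proof -
    have "m i = int (nat (m i))" using assms(2) by simp
    then have "gauge_character m (gauge_at v i g) = Determinant.det g ^ nat (m i)"
      unfolding gauge_character_at by (metis power_int_of_nat)
    then show ?thesis
      using F(3)[rule_format, OF gauge_at_gauge_group[where v = v and i = i and g = g, OF that(2)] that(1)]
      by (simp add: power_mult[symmetric] mult.commute)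
  qed
  then have "I.covariant (k * nat (m i)) F"
    using polynomial_in_coordinates(1)[OF F(1)] unfolding I.covariant_def by blast
  then show ?thesis using that F(2) by blast
qed

lemma covariant_outE:
  assumes "f \<in> covariants Q m l d v k" "m i \<le> 0"
  obtains F where "O.covariant (k * nat (- m i)) F" "f = (\<lambda>s. if s \<in> fibre then F s else 0)"
proof -
  obtain F where F: "F \<in> polynomial_funs Q d v" "f = (\<lambda>s. if s \<in> fibre then F s else 0)"
    "\<forall>g\<in>gauge_group v. \<forall>s\<in>fibre. F (gauge_action Q g s) = gauge_character m g ^ k * F s"
    using assms(1) by (rule covariantsE)
  have "F (gauge_action Q (gauge_at v i (matrix_inverse g)\<^sup>T) s) = Determinant.det g ^ (k * nat (- m i)) * F s"
    if s: "s \<in> fibre" and gh': "mutually_inverse (v i) g h" for s g h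
  proof -
    have h: "matrix_inverse g = h" by (rule matrix_inverse_unique[OF gh'])
    have gh: "mutually_inverse (v i) h\<^sup>T g\<^sup>T" by (rule mutually_inverse_sym[OF mutually_inverse_transpose[OF gh']])
    have c: "h \<in> carrier_mat (v i) (v i)" using gh' by (auto simp: mutually_inverse_def)
    have "m i = - int (nat (- m i))" using assms(2) by simp
    then have "gauge_character m (gauge_at v i h\<^sup>T) = inverse (Determinant.det h) ^ nat (- m i)"
      unfolding gauge_character_at det_transpose[OF c] by (metis power_int_minus power_int_of_nat power_inverse)
    moreover have "inverse (Determinant.det h) = Determinant.det g"
      using det_mutually_inverse[OF gh'] by (simp add: inverse_unique mult.commute)
    ultimately show ?thesis
      unfolding h using F(3)[rule_format, OF gauge_at_gauge_group[where v = v and i = i and g = "h\<^sup>T", OF gh] s]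
      by (simp add: power_mult[symmetric] mult.commute)
  qed
  then have "O.covariant (k * nat (- m i)) F"
    using polynomial_in_coordinates(2)[OF F(1)] unfolding O.covariant_def by blast
  then show ?thesis using that F(2) by blast
qed

text \<open>
  If \<open>l i = 0\<close> the weight is positive, and otherwise there are no points with dependent rows.
\<close>

lemma covariants_vanish_in:
  assumes "f \<in> covariants Q m l d v k" "0 < k" "0 \<le> m i" "m i \<noteq> 0 \<or> l i \<noteq> 0" "I.dependent_rows_at s"
  shows "f s = 0"
proof -
  obtain F where F: "I.covariant (k * nat (m i)) F" "f = (\<lambda>s. if s \<in> fibre then F s else 0)"
    using assms(1,3) by (rule covariant_inE)
  show ?thesis
  proof (cases "l i = 0")
    case True
    then have "0 < k * nat (m i)" using assms by simp
    then show ?thesis using F(2) I.covariant_vanishes[OF F(1) _ _ assms(5)] by simp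
  next
    case False
    then show ?thesis using F(2) I.invertible_independent[OF inn_out False, of s] assms(5) by (cases "s \<in> fibre") simp_all
  qed
qed

lemma covariants_vanish_out:
  assumes "f \<in> covariants Q m l d v k" "0 < k" "m i \<le> 0" "m i \<noteq> 0 \<or> l i \<noteq> 0" "O.dependent_rows_at s"
  shows "f s = 0"
proof -
  obtain F where F: "O.covariant (k * nat (- m i)) F" "f = (\<lambda>s. if s \<in> fibre then F s else 0)"
    using assms(1,3) by (rule covariant_outE)
  show ?thesis
  proof (cases "l i = 0")
    case True
    then have "0 < k * nat (- m i)" using assms by simp
    then show ?thesis using F(2) O.covariant_vanishes[OF F(1) _ _ assms(5)] by simp
  next
    case False
    then show ?thesis using F(2) O.invertible_independent[OF out_inn_transpose False, of s] assms(5) by (cases "s \<in> fibre") simp_all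
  qed
qed

lemma covariants_zero_if_large:
  assumes "sz < v i" "m i \<noteq> 0 \<or> l i \<noteq> 0" "f \<in> covariants Q m l d v k" "0 < k"
  shows "f = (\<lambda>_. 0)"
proof
  fix s
  show "f s = 0"
    using covariants_vanish_in[OF assms(3,4) _ assms(2) I.too_many_rows_dependent[OF assms(1)]]
      covariants_vanish_out[OF assms(3,4) _ assms(2) O.too_many_rows_dependent[OF assms(1)]]
    by (cases "0 \<le> m i") auto
qed

text \<open>
  For \<open>m i > 0\<close> this is \<open>covariant_mult_power_semi\<close>. For \<open>m i = 0\<close> the weight of \<open>h\<close> is zero, but then
  \<open>l i\<close> is not, and both functions are classical by \<open>covariant_semi_if_invertible\<close>.
\<close>

lemma covariants_absorb_in:
  assumes f: "f \<in> covariants Q m l d v k" and h: "h \<in> covariants Q m l d v j"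
    and j: "0 < j" and m: "0 \<le> m i" "m i \<noteq> 0 \<or> l i \<noteq> 0"
  shows "\<exists>M\<ge>1. \<exists>F. I.semi ((k + M * j) * nat (m i)) F \<and> (\<forall>s\<in>fibre. f s * h s ^ M = F s)"
proof -
  obtain F where F: "I.covariant (k * nat (m i)) F" "f = (\<lambda>s. if s \<in> fibre then F s else 0)"
    using f m(1) by (rule covariant_inE)
  obtain H where H: "I.covariant (j * nat (m i)) H" "h = (\<lambda>s. if s \<in> fibre then H s else 0)"
    using h m(1) by (rule covariant_inE)
  have "\<exists>M\<ge>1. I.semi_on ((k + M * j) * nat (m i)) (\<lambda>s. F s * H s ^ M)"
  proof (cases "m i = 0")
    case False
    then have "0 < j * nat (m i)" using j m by simp
    from I.covariant_mult_power_semi[OF F(1) H(1) this] show ?thesis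
      by (simp add: add_mult_distrib mult.assoc)
  next
    case True
    then have "I.semi_on 0 F" "I.semi_on 0 H"
      using I.covariant_semi_if_invertible[OF F(1) _ inn_out] I.covariant_semi_if_invertible[OF H(1) _ inn_out] m by auto
    from I.semi_on_mult[OF this] show ?thesis using True by (intro exI[of _ 1]) simp
  qed
  then obtain M where M: "1 \<le> M" "I.semi_on ((k + M * j) * nat (m i)) (\<lambda>s. F s * H s ^ M)" by blast
  then obtain G where "I.semi ((k + M * j) * nat (m i)) G" "\<forall>s\<in>fibre. F s * H s ^ M = G s"
    unfolding I.semi_on_def by blast
  then show ?thesis using M(1) by (intro exI[of _ M] conjI exI[of _ G]) (simp_all add: F(2) H(2))
qed

lemma covariants_absorb_out:
  assumes f: "f \<in> covariants Q m l d v k" and h: "h \<in> covariants Q m l d v j"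
    and j: "0 < j" and m: "m i \<le> 0" "m i \<noteq> 0 \<or> l i \<noteq> 0"
  shows "\<exists>M\<ge>1. \<exists>F. O.semi ((k + M * j) * nat (- m i)) F \<and> (\<forall>s\<in>fibre. f s * h s ^ M = F s)"
proof -
  obtain F where F: "O.covariant (k * nat (- m i)) F" "f = (\<lambda>s. if s \<in> fibre then F s else 0)"
    using f m(1) by (rule covariant_outE)
  obtain H where H: "O.covariant (j * nat (- m i)) H" "h = (\<lambda>s. if s \<in> fibre then H s else 0)"
    using h m(1) by (rule covariant_outE)
  have "\<exists>M\<ge>1. O.semi_on ((k + M * j) * nat (- m i)) (\<lambda>s. F s * H s ^ M)"
  proof (cases "m i = 0")
    case False
    then have "0 < j * nat (- m i)" using j m by simp
    from O.covariant_mult_power_semi[OF F(1) H(1) this] show ?thesis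
      by (simp add: add_mult_distrib mult.assoc)
  next
    case True
    then have "O.semi_on 0 F" "O.semi_on 0 H"
      using O.covariant_semi_if_invertible[OF F(1) _ out_inn_transpose] O.covariant_semi_if_invertible[OF H(1) _ out_inn_transpose] m by auto
    from O.semi_on_mult[OF this] show ?thesis using True by (intro exI[of _ 1]) simp
  qed
  then obtain M where M: "1 \<le> M" "O.semi_on ((k + M * j) * nat (- m i)) (\<lambda>s. F s * H s ^ M)" by blast
  then obtain G where "O.semi ((k + M * j) * nat (- m i)) G" "\<forall>s\<in>fibre. F s * H s ^ M = G s"
    unfolding O.semi_on_def by blast
  then show ?thesis using M(1) by (intro exI[of _ M] conjI exI[of _ G]) (simp_all add: F(2) H(2))
qed

lemma covariantsI:
  assumes "F \<in> polynomial_funs Q d v"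
    and "\<And>g s. g \<in> gauge_group v \<Longrightarrow> s \<in> fibre \<Longrightarrow> F (gauge_action Q g s) = gauge_character m g ^ k * F s"
  shows "(\<lambda>s. if s \<in> fibre then F s else 0) \<in> covariants Q m l d v k"
  unfolding covariants_def fibre_regular_funs_def
  using assms gauge_action_moment_fibre by auto

lemma graded_algebra_covariants: "graded_algebra (covariants Q m l d v)"
proof -
  have ch: "f \<in> covariants Q m l d v k \<longleftrightarrow> (\<exists>F\<in>polynomial_funs Q d v. f = (\<lambda>s. if s \<in> fibre then F s else 0) \<and>
    (\<forall>g\<in>gauge_group v. \<forall>s\<in>fibre. F (gauge_action Q g s) = gauge_character m g ^ k * F s))" for f k
  proof
    assume "f \<in> covariants Q m l d v k"
    then obtain F where "F \<in> polynomial_funs Q d v" "f = (\<lambda>s. if s \<in> fibre then F s else 0)"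
      "\<forall>g\<in>gauge_group v. \<forall>s\<in>fibre. F (gauge_action Q g s) = gauge_character m g ^ k * F s"
      by (rule covariantsE)
    then show "\<exists>F\<in>polynomial_funs Q d v. f = (\<lambda>s. if s \<in> fibre then F s else 0) \<and>
      (\<forall>g\<in>gauge_group v. \<forall>s\<in>fibre. F (gauge_action Q g s) = gauge_character m g ^ k * F s)"
      by (intro bexI[of _ F]) simp_all
  next
    assume "\<exists>F\<in>polynomial_funs Q d v. f = (\<lambda>s. if s \<in> fibre then F s else 0) \<and>
      (\<forall>g\<in>gauge_group v. \<forall>s\<in>fibre. F (gauge_action Q g s) = gauge_character m g ^ k * F s)"
    then obtain F where F: "F \<in> polynomial_funs Q d v" "f = (\<lambda>s. if s \<in> fibre then F s else 0)"
      "\<forall>g\<in>gauge_group v. \<forall>s\<in>fibre. F (gauge_action Q g s) = gauge_character m g ^ k * F s" by (elim bexE conjE)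
    show "f \<in> covariants Q m l d v k" unfolding F(2) using F(1,3) by (intro covariantsI) simp_all
  qed
  show ?thesis
    unfolding graded_algebra_def
  proof (intro conjI allI ballI)
    fix k show "(\<lambda>_. 0) \<in> covariants Q m l d v k"
      unfolding ch by (intro bexI[of _ "\<lambda>_. 0"]) (auto intro: polynomial_funs.const)
  next
    fix k c f g assume f: "f \<in> covariants Q m l d v k" and g: "g \<in> covariants Q m l d v k"
    from f obtain F where F: "F \<in> polynomial_funs Q d v" "f = (\<lambda>s. if s \<in> fibre then F s else 0)"
      "\<forall>g\<in>gauge_group v. \<forall>s\<in>fibre. F (gauge_action Q g s) = gauge_character m g ^ k * F s"
      by (rule covariantsE)
    from g obtain G where G: "G \<in> polynomial_funs Q d v" "g = (\<lambda>s. if s \<in> fibre then G s else 0)"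
      "\<forall>g\<in>gauge_group v. \<forall>s\<in>fibre. G (gauge_action Q g s) = gauge_character m g ^ k * G s"
      by (rule covariantsE)
    have "(\<lambda>s. if s \<in> fibre then c * F s + G s else 0) \<in> covariants Q m l d v k"
      using F G polynomial_funs.add[OF polynomial_funs.mult[OF polynomial_funs.const F(1)] G(1)]
      by (intro covariantsI) (auto simp: algebra_simps)
    moreover have "(\<lambda>x. c * f x + g x) = (\<lambda>s. if s \<in> fibre then c * F s + G s else 0)" using F G by auto
    ultimately show "(\<lambda>x. c * f x + g x) \<in> covariants Q m l d v k" by simp
  next
    fix j k f g assume f: "f \<in> covariants Q m l d v j" and g: "g \<in> covariants Q m l d v k"
    from f obtain F where F: "F \<in> polynomial_funs Q d v" "f = (\<lambda>s. if s \<in> fibre then F s else 0)"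
      "\<forall>g\<in>gauge_group v. \<forall>s\<in>fibre. F (gauge_action Q g s) = gauge_character m g ^ j * F s"
      by (rule covariantsE)
    from g obtain G where G: "G \<in> polynomial_funs Q d v" "g = (\<lambda>s. if s \<in> fibre then G s else 0)"
      "\<forall>g\<in>gauge_group v. \<forall>s\<in>fibre. G (gauge_action Q g s) = gauge_character m g ^ k * G s"
      by (rule covariantsE)
    have "(\<lambda>s. if s \<in> fibre then F s * G s else 0) \<in> covariants Q m l d v (j + k)"
      using F G polynomial_funs.mult[OF F(1) G(1)]
      by (intro covariantsI) (auto simp: algebra_simps power_add)
    moreover have "(\<lambda>x. f x * g x) = (\<lambda>s. if s \<in> fibre then F s * G s else 0)" using F G by auto
    ultimately show "(\<lambda>x. f x * g x) \<in> covariants Q m l d v (j + k)" by simp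
  qed
qed

text \<open>
  Gauge transformations change the map into \<open>V i\<close> by invertible matrices on both sides.
\<close>

lemma dependent_gauge_in:
  assumes s: "s \<in> fibre" and g: "g \<in> gauge_group v" and dep: "I.dependent_rows_at s"
  shows "I.dependent_rows_at (gauge_action Q g s)"
proof -
  obtain u where u: "u \<in> carrier_vec (v i)" "u \<noteq> 0\<^sub>v (v i)" "(inn s)\<^sup>T *\<^sub>v u = 0\<^sub>v sz"
    using dep unfolding I.dependent_rows_iff by blast
  define T where "T = star_gauge Q d v i (\<lambda>j. matrix_inverse (g j))"
  have T: "T \<in> carrier_mat sz sz" by (simp add: T_def)
  have "mutually_inverse (v i) (g i)\<^sup>T (matrix_inverse (g i))\<^sup>T"
    by (rule mutually_inverse_transpose[OF gauge_group_inverse[OF g]])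
  then have gi: "(g i)\<^sup>T \<in> carrier_mat (v i) (v i)" "(matrix_inverse (g i))\<^sup>T \<in> carrier_mat (v i) (v i)"
    "(g i)\<^sup>T * (matrix_inverse (g i))\<^sup>T = 1\<^sub>m (v i)" by (auto simp: mutually_inverse_def)
  have gc: "g i \<in> carrier_mat (v i) (v i)" using gi(1) by simp
  define w where "w = (matrix_inverse (g i))\<^sup>T *\<^sub>v u"
  have w: "w \<in> carrier_vec (v i)" using gi u by (simp add: w_def)
  have gw: "(g i)\<^sup>T *\<^sub>v w = u"
    unfolding w_def assoc_mult_mat_vec[OF gi(1,2) u(1), symmetric] gi(3) using u(1) by simp
  have "w \<noteq> 0\<^sub>v (v i)"
  proof
    assume "w = 0\<^sub>v (v i)"
    then have "u = 0\<^sub>v (v i)" using gw gi(1) by (auto intro!: eq_vecI simp: scalar_prod_def)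
    then show False using u by simp
  qed
  moreover have "(inn (gauge_action Q g s))\<^sup>T *\<^sub>v w = 0\<^sub>v sz"
  proof -
    have i: "(inn s)\<^sup>T \<in> carrier_mat sz (v i)" by simp
    have "(inn (gauge_action Q g s))\<^sup>T = T\<^sup>T * (g i * inn s)\<^sup>T"
      unfolding star_in_gauge[OF g fibre_rep_space[OF s]] T_def[symmetric]
      by (rule transpose_mult[OF mult_carrier_mat[OF gc star_carrier(2)[of Q d v i s]] T])
    also have "(g i * inn s)\<^sup>T = (inn s)\<^sup>T * (g i)\<^sup>T" by (rule transpose_mult[OF gc star_carrier(2)[of Q d v i s]])
    finally have "(inn (gauge_action Q g s))\<^sup>T *\<^sub>v w = T\<^sup>T *\<^sub>v ((inn s)\<^sup>T *\<^sub>v ((g i)\<^sup>T *\<^sub>v w))"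
      using assoc_mult_mat_vec[of "T\<^sup>T" sz sz "(inn s)\<^sup>T * (g i)\<^sup>T" "v i" w] assoc_mult_mat_vec[OF i gi(1) w] T w mult_carrier_mat[OF i gi(1)] by simp
    also have "\<dots> = 0\<^sub>v sz" unfolding gw u(3) using T by (intro eq_vecI) (auto simp: scalar_prod_def)
    finally show ?thesis .
  qed
  ultimately show ?thesis unfolding I.dependent_rows_iff using w by blast
qed

lemma dependent_gauge_out:
  assumes s: "s \<in> fibre" and g: "g \<in> gauge_group v" and dep: "O.dependent_rows_at s"
  shows "O.dependent_rows_at (gauge_action Q g s)"
proof -
  obtain u where u: "u \<in> carrier_vec (v i)" "u \<noteq> 0\<^sub>v (v i)" "out s *\<^sub>v u = 0\<^sub>v sz"
    using dep unfolding O.dependent_rows_iff by auto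
  define T where "T = star_gauge Q d v i g"
  have T: "T \<in> carrier_mat sz sz" by (simp add: T_def)
  have gi: "g i \<in> carrier_mat (v i) (v i)" "matrix_inverse (g i) \<in> carrier_mat (v i) (v i)"
    "matrix_inverse (g i) * g i = 1\<^sub>m (v i)" 
    using gauge_group_inverse[OF g, of i] by (auto simp: mutually_inverse_def)
  define w where "w = g i *\<^sub>v u"
  have w: "w \<in> carrier_vec (v i)" using gi u by (simp add: w_def)
  have gw: "matrix_inverse (g i) *\<^sub>v w = u"
    unfolding w_def assoc_mult_mat_vec[OF gi(2,1) u(1), symmetric] gi(3) using u(1) by simp
  have "w \<noteq> 0\<^sub>v (v i)"
  proof
    assume "w = 0\<^sub>v (v i)"
    then have "u = 0\<^sub>v (v i)" using gw gi(2) by (auto intro!: eq_vecI simp: scalar_prod_def)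
    then show False using u by simp
  qed
  moreover have "out (gauge_action Q g s) *\<^sub>v w = 0\<^sub>v sz"
  proof -
    have o: "out s \<in> carrier_mat sz (v i)" by simp
    have "out (gauge_action Q g s) *\<^sub>v w = T *\<^sub>v (out s *\<^sub>v (matrix_inverse (g i) *\<^sub>v w))"
      unfolding star_out_gauge[OF g fibre_rep_space[OF s]] T_def[symmetric]
      using assoc_mult_mat_vec[OF mult_carrier_mat[OF T o] gi(2) w] assoc_mult_mat_vec[OF T o, of "matrix_inverse (g i) *\<^sub>v w"] gi w
      by simp
    also have "\<dots> = 0\<^sub>v sz" unfolding gw u(3) using T by (intro eq_vecI) (auto simp: scalar_prod_def)
    finally show ?thesis .
  qed
  ultimately show ?thesis unfolding O.dependent_rows_iff using w by auto
qed

end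

section \<open>Reflection of representations at a vertex\<close>

text \<open>
  Two sets of parameters exchanged by a simple reflection. The case \<open>m i \<ge> 0\<close> is enough, as the
  reflection changes the sign of \<open>m i\<close>.
\<close>

locale reflection = quiver_double Q for Q :: "('i::finite, 'h) quiver" +
  fixes m m' :: "'i \<Rightarrow> int" and l l' :: "'i \<Rightarrow> complex" and d v v' :: "'i \<Rightarrow> nat" and i :: 'i
  assumes v'_off: "j \<noteq> i \<Longrightarrow> v' j = v j" and v'_at: "v i + v' i = star_size Q d v i"
    and m': "m' j = m j - cartan Q i j * m i" and l': "l' j = l j - of_int (cartan Q i j) * l i"
    and m_nonneg: "0 \<le> m i" and nonzero: "m i \<noteq> 0 \<or> l i \<noteq> 0"
begin

sublocale A: star_vertex Q l d v i by unfold_locales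
sublocale B: star_vertex Q l' d v' i by unfold_locales

lemma index_eq: "star_index Q d v' i = star_index Q d v i" by (rule star_index_cong[OF v'_off])

lemma size_eq: "A.sz = v i + v' i" "B.sz = v i + v' i" using v'_at index_eq by simp_all

lemma carriers: "A.out s \<in> carrier_mat (v i + v' i) (v i)" "A.inn s \<in> carrier_mat (v i) (v i + v' i)"
  "B.out s \<in> carrier_mat (v i + v' i) (v' i)" "B.inn s \<in> carrier_mat (v' i) (v i + v' i)"
  using star_carrier(1)[of Q d v i s] star_carrier(2)[of Q d v i s]
    star_carrier(1)[of Q d v' i s] star_carrier(2)[of Q d v' i s] size_eq by simp_all

lemma at_vertex: "m' i = - m i" "l' i = - l i"
  using m'[of i] l'[of i] by (simp_all add: cartan_diagonal)

lemma nonzero': "m' i \<le> 0" "m' i \<noteq> 0 \<or> l' i \<noteq> 0" using m_nonneg nonzero by (simp_all add: at_vertex)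

lemma off_vertex: "j \<noteq> i \<Longrightarrow> l' j = l j + of_nat (adj Q i j) * l i" "j \<noteq> i \<Longrightarrow> m' j = m j + int (adj Q i j) * m i"
  using m'[of j] l'[of j] by (simp_all add: cartan_def)

definition related :: "('i, 'h) rep \<Rightarrow> ('i, 'h) rep \<Rightarrow> bool" where
  "related s s' \<longleftrightarrow> s \<in> A.fibre \<and> s' \<in> B.fibre \<and> agree_off i s s' \<and>
     B.out s' * B.inn s' = A.out s * A.inn s - l i \<cdot>\<^sub>m 1\<^sub>m (v i + v' i)"

text \<open>
  The number \<open>x\<close> is, up to sign, the ratio between maximal minors of the map out of \<open>V' i\<close> and the
  complementary minors of the map into \<open>V i\<close>. It depends on the bases of the two spaces and of \<open>T\<close>;
  \<open>linked_gauge\<close> says how.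
\<close>

definition linked :: "('i, 'h) rep \<Rightarrow> ('i, 'h) rep \<Rightarrow> complex \<Rightarrow> bool" where
  "linked s s' x \<longleftrightarrow> related s s' \<and>
     (\<exists>\<sigma> \<pi>. splitting (v i) (v' i) (A.inn s) \<sigma> (B.out s') \<pi> \<and> x = Determinant.det (hcat (v i) (v' i) \<sigma> (B.out s')))"

lemma linked_related: "linked s s' x \<Longrightarrow> related s s'"
  by (simp add: linked_def)

lemma linked_nonzero: "linked s s' x \<Longrightarrow> x \<noteq> 0"
proof -
  assume "linked s s' x"
  then obtain \<sigma> \<pi> where "splitting (v i) (v' i) (A.inn s) \<sigma> (B.out s') \<pi>"
    "x = Determinant.det (hcat (v i) (v' i) \<sigma> (B.out s'))" by (auto simp: linked_def)
  then have "x * Determinant.det (vcat (v i) (v' i) (A.inn s) \<pi>) = 1" using det_hcat_vcat by metis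
  then show "x \<noteq> 0" by auto
qed

lemma related_fibre: "related s s' \<Longrightarrow> s \<in> A.fibre" "related s s' \<Longrightarrow> s' \<in> B.fibre"
  by (simp_all add: related_def)

text \<open>
  Take for \<open>V' i\<close> the kernel of the map from \<open>T\<close> to \<open>V i\<close>, and for the maps at \<open>V' i\<close> those of
  \<open>splitting_reflect_left\<close>.
\<close>

lemma ex_linked_right:
  assumes s: "s \<in> A.fibre" and indep: "\<not> A.I.dependent_rows_at s"
  shows "\<exists>s' x. linked s s' x"
proof -
  obtain J where J: "J \<in> A.I.tuples" "A.I.minor J s \<noteq> 0" using A.I.minor_or_dependent[of s] indep by blast
  obtain \<sigma> a \<pi> where split: "splitting (v i) (v' i) (A.inn s) \<sigma> a \<pi>"
    using ex_splitting[OF carriers(2), of J s] J unfolding A.I.minor_def size_eq by blast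
  note a = splittingD(3)[OF split]
  define b where "b = \<pi> * (A.out s * A.inn s - l i \<cdot>\<^sub>m 1\<^sub>m (v i + v' i))"
  have b: "b \<in> carrier_mat (v' i) (v i + v' i)" "a * b = A.out s * A.inn s - l i \<cdot>\<^sub>m 1\<^sub>m (v i + v' i)"
     "b * a = (- l i) \<cdot>\<^sub>m 1\<^sub>m (v' i)"
    using splitting_reflect_left[OF split carriers(1) A.inn_out[OF s]] unfolding b_def by auto
  define s' where "s' = replace_star d v' i a b s"
  have star: "B.out s' = a" "B.inn s' = b"
    using replace_star_star[of a d v' i b s] a b(1) size_eq by (simp_all add: s'_def)
  have rep: "s' \<in> rep_space Q d v'"
    unfolding s'_def by (rule replace_star_rep_space[OF A.fibre_rep_space[OF s] v'_off])
  have agree: "agree_off i s s'" unfolding s'_def by (rule replace_star_agree)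
  have "moment_map Q v' s' j = l' j \<cdot>\<^sub>m 1\<^sub>m (v' j)" for j
  proof (cases "j = i")
    case True
    then show ?thesis using moment_map_star[OF rep, of i] b(3) by (simp add: star at_vertex)
  next
    case False
    have "moment_map Q v' s' j = moment_map Q v s j + (of_nat (adj Q i j) * l i) \<cdot>\<^sub>m 1\<^sub>m (v j)"
      by (rule moment_map_off[OF v'_off A.fibre_rep_space[OF s] rep agree _ False])
         (simp_all add: star b(2) v'_at[symmetric])
    also have "moment_map Q v s j = l j \<cdot>\<^sub>m 1\<^sub>m (v j)" using s by (simp add: moment_fibre_def)
    finally show ?thesis using v'_off[OF False] off_vertex(1)[OF False]
      by (simp add: smult_one_add)
  qed
  then have "s' \<in> B.fibre" using rep by (simp add: moment_fibre_def)
  then have "linked s s' (Determinant.det (hcat (v i) (v' i) \<sigma> a))"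
    unfolding linked_def related_def star using s agree b(2) split by blast
  then show ?thesis by blast
qed

lemma ex_linked_left:
  assumes s': "s' \<in> B.fibre" and indep: "\<not> B.O.dependent_rows_at s'"
  shows "\<exists>s x. linked s s' x"
proof -
  obtain J where J: "J \<in> B.O.tuples" "B.O.minor J s' \<noteq> 0" using B.O.minor_or_dependent[of s'] indep by blast
  have c: "(B.out s')\<^sup>T \<in> carrier_mat (v' i) (v' i + v i)" using carriers(3)[of s'] by (simp add: add.commute)
  obtain \<sigma>' a' \<pi>' where split': "splitting (v' i) (v i) (B.out s')\<^sup>T \<sigma>' a' \<pi>'"
    using ex_splitting[OF c, of J] J unfolding B.O.minor_def size_eq add.commute[of "v i"] by blast
  define b where "b = a'\<^sup>T"
  have split: "splitting (v i) (v' i) b \<pi>'\<^sup>T (B.out s') \<sigma>'\<^sup>T"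
    using splitting_transpose[OF split'] by (simp add: b_def)
  have "B.inn s' * B.out s' = (- l i) \<cdot>\<^sub>m 1\<^sub>m (v' i)" using B.inn_out[OF s'] by (simp add: at_vertex)
  from splitting_reflect_right[OF split carriers(4) this] obtain a where
    a: "a \<in> carrier_mat (v i + v' i) (v i)" "a * b = B.out s' * B.inn s' + l i \<cdot>\<^sub>m 1\<^sub>m (v i + v' i)" "b * a = l i \<cdot>\<^sub>m 1\<^sub>m (v i)"
    by blast
  note b = splittingD(1)[OF split]
  define s where "s = replace_star d v i a b s'"
  have star: "A.out s = a" "A.inn s = b"
    using replace_star_star[of a d v i b s'] a b(1) size_eq by (simp_all add: s_def)
  have v_off: "v j = v' j" if "j \<noteq> i" for j using v'_off[OF that] by simp
  have rep: "s \<in> rep_space Q d v"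
    unfolding s_def by (rule replace_star_rep_space[OF B.fibre_rep_space[OF s'] v_off])
  have agree: "agree_off i s' s" unfolding s_def by (rule replace_star_agree)
  have oi: "B.out s' * B.inn s' \<in> carrier_mat (v i + v' i) (v i + v' i)" using carriers(3,4)[of s'] by simp
  have N: "B.out s' * B.inn s' = A.out s * A.inn s - l i \<cdot>\<^sub>m 1\<^sub>m (v i + v' i)"
    unfolding star a(2) using oi by (intro eq_matI) auto
  have "moment_map Q v s j = l j \<cdot>\<^sub>m 1\<^sub>m (v j)" for j
  proof (cases "j = i")
    case True
    then show ?thesis using moment_map_star[OF rep, of i] a(3) by (simp add: star)
  next
    case False
    have "moment_map Q v s j = moment_map Q v' s' j + (of_nat (adj Q i j) * (- l i)) \<cdot>\<^sub>m 1\<^sub>m (v' j)"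
    proof (rule moment_map_off[OF v_off B.fibre_rep_space[OF s'] rep agree _ False])
      show "A.out s * A.inn s = B.out s' * B.inn s' - (- l i) \<cdot>\<^sub>m 1\<^sub>m B.sz"
        unfolding star a(2) size_eq using oi by (intro eq_matI) auto
    qed
    also have "moment_map Q v' s' j = l' j \<cdot>\<^sub>m 1\<^sub>m (v' j)" using s' by (simp add: moment_fibre_def)
    finally show ?thesis using v'_off[OF False] off_vertex(1)[OF False]
      by (simp add: smult_one_add)
  qed
  then have "s \<in> A.fibre" using rep by (simp add: moment_fibre_def)
  then have "linked s s' (Determinant.det (hcat (v i) (v' i) \<pi>'\<^sup>T (B.out s')))"
    unfolding linked_def related_def using s' agree_off_sym[OF agree] N split[folded star(2)] by blast
  then show ?thesis by blast
qed

lemma linked_gauge: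
  assumes link: "linked s s' x" and g: "g \<in> gauge_group v" and g': "g' \<in> gauge_group v'"
    and off: "\<And>j. j \<noteq> i \<Longrightarrow> g' j = g j"
  shows "linked (gauge_action Q g s) (gauge_action Q g' s')
    (Determinant.det (star_gauge Q d v i g) * x * (inverse (Determinant.det (g i)) * inverse (Determinant.det (g' i))))"
proof -
  let ?N = "v i + v' i" and ?h = "\<lambda>j. matrix_inverse (g j)" and ?h' = "\<lambda>j. matrix_inverse (g' j)"
  obtain \<sigma> \<pi> where split: "splitting (v i) (v' i) (A.inn s) \<sigma> (B.out s') \<pi>"
    and x: "x = Determinant.det (hcat (v i) (v' i) \<sigma> (B.out s'))" and rel: "related s s'"
    using link by (auto simp: linked_def)
  note s = related_fibre(1)[OF rel] and s' = related_fibre(2)[OF rel]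
  define T where "T = star_gauge Q d v i g"
  define T' where "T' = star_gauge Q d v i ?h"
  have TB: "star_gauge Q d v' i g' = T" "star_gauge Q d v' i ?h' = T'"
    unfolding T_def T'_def using off by (auto intro!: star_gauge_cong v'_off)
  have "mutually_inverse A.sz T T'"
    unfolding T_def T'_def by (rule star_gauge_inverse[OF gauge_group_inverse[OF g]])
  then have T: "T \<in> carrier_mat ?N ?N" "T' \<in> carrier_mat ?N ?N" "T * T' = 1\<^sub>m ?N" "T' * T = 1\<^sub>m ?N"
    by (simp_all add: mutually_inverse_def size_eq)
  have gi: "g i \<in> carrier_mat (v i) (v i)" "?h i \<in> carrier_mat (v i) (v i)" "g i * ?h i = 1\<^sub>m (v i)" "?h i * g i = 1\<^sub>m (v i)"
    using gauge_group_inverse[OF g, of i] by (auto simp: mutually_inverse_def)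
  have gi': "g' i \<in> carrier_mat (v' i) (v' i)" "?h' i \<in> carrier_mat (v' i) (v' i)" "g' i * ?h' i = 1\<^sub>m (v' i)" "?h' i * g' i = 1\<^sub>m (v' i)"
    using gauge_group_inverse[OF g', of i] by (auto simp: mutually_inverse_def)
  have gA: "A.out (gauge_action Q g s) = T * A.out s * ?h i" "A.inn (gauge_action Q g s) = g i * A.inn s * T'"
    unfolding T_def T'_def
    by (rule star_out_gauge[OF g A.fibre_rep_space[OF s]], rule star_in_gauge[OF g A.fibre_rep_space[OF s]])
  have gB: "B.out (gauge_action Q g' s') = T * B.out s' * ?h' i" "B.inn (gauge_action Q g' s') = g' i * B.inn s' * T'"
    unfolding TB[symmetric]
    by (rule star_out_gauge[OF g' B.fibre_rep_space[OF s']], rule star_in_gauge[OF g' B.fibre_rep_space[OF s']])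
  have conj: "(T * a * h) * (k * b * T') = T * (a * b) * T'"
    if a: "a \<in> carrier_mat ?N p" "b \<in> carrier_mat p ?N" "h \<in> carrier_mat p p" "k \<in> carrier_mat p p" "h * k = 1\<^sub>m p" for a b h k p
  proof -
    have kb: "k * b \<in> carrier_mat p ?N" and bT: "b * T' \<in> carrier_mat p ?N" and Ta: "T * a \<in> carrier_mat ?N p"
      and ab: "a * b \<in> carrier_mat ?N ?N"
      using a T by auto
    have "(T * a * h) * (k * b * T') = T * a * (h * (k * (b * T')))"
      unfolding assoc_mult_mat[OF a(4,2) T(2)] by (rule assoc_mult_mat[OF Ta a(3) mult_carrier_mat[OF a(4) bT]])
    also have "h * (k * (b * T')) = b * T'"
      unfolding assoc_mult_mat[OF a(3,4) bT, symmetric] a(5) by (rule left_mult_one_mat[OF bT])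
    also have "T * a * (b * T') = T * (a * b) * T'"
      unfolding assoc_mult_mat[OF Ta a(2) T(2), symmetric] assoc_mult_mat[OF T(1) a(1,2)] ..
    finally show ?thesis .
  qed
  have N: "B.out (gauge_action Q g' s') * B.inn (gauge_action Q g' s') =
     A.out (gauge_action Q g s) * A.inn (gauge_action Q g s) - l i \<cdot>\<^sub>m 1\<^sub>m ?N"
  proof -
    have AB: "A.out s * A.inn s \<in> carrier_mat ?N ?N" using carriers(1,2)[of s] by simp
    have "B.out (gauge_action Q g' s') * B.inn (gauge_action Q g' s') = T * (A.out s * A.inn s - l i \<cdot>\<^sub>m 1\<^sub>m ?N) * T'"
      unfolding gB conj[OF carriers(3,4) gi'(2,1,4)] using rel by (simp add: related_def)
    also have "T * (A.out s * A.inn s - l i \<cdot>\<^sub>m 1\<^sub>m ?N) = T * (A.out s * A.inn s) - l i \<cdot>\<^sub>m T"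
      using mult_minus_distrib_mat[OF T(1) AB smult_carrier_mat[OF one_carrier_mat]]
        mult_smult_distrib[OF T(1) one_carrier_mat] right_mult_one_mat[OF T(1)] by simp
    also have "(T * (A.out s * A.inn s) - l i \<cdot>\<^sub>m T) * T' = T * (A.out s * A.inn s) * T' - l i \<cdot>\<^sub>m 1\<^sub>m ?N"
      using minus_mult_distrib_mat[OF mult_carrier_mat[OF T(1) AB] smult_carrier_mat[OF T(1)] T(2)]
        mult_smult_assoc_mat[OF T(1,2)] T(3) by simp
    also have "T * (A.out s * A.inn s) * T' = A.out (gauge_action Q g s) * A.inn (gauge_action Q g s)"
      unfolding gA conj[OF carriers(1,2) gi(2,1,4)] ..
    finally show ?thesis .
  qed
  have "Determinant.det (?h i) = inverse (Determinant.det (g i))" "Determinant.det (?h' i) = inverse (Determinant.det (g' i))"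
    using det_mutually_inverse[OF gauge_group_inverse[OF g, of i]] det_mutually_inverse[OF gauge_group_inverse[OF g', of i]]
    by (simp_all add: inverse_unique)
  moreover note splitting_conjugate[OF split T(1,2,4) gi(1,2,3) gi'(1,2,3), folded gA gB]
  moreover have "related (gauge_action Q g s) (gauge_action Q g' s')"
    unfolding related_def
    using gauge_action_moment_fibre[OF g s] gauge_action_moment_fibre[OF g' s'] N off
      agree_off_gauge[of i s s' g g'] rel by (simp add: related_def)
  ultimately show ?thesis unfolding linked_def x T_def by metis
qed

text \<open>
  The character for \<open>m' = s i m\<close> differs from the one for \<open>m\<close> by the \<open>m i\<close>-th power of the character by
  which \<open>linked_gauge\<close> changes the ratio \<open>x\<close>. So multiplication by \<open>x ^ (k * m i)\<close> exchanges the
  covariants of degree \<open>k\<close> for the two characters.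
\<close>

lemma character_transfer:
  assumes g: "g \<in> gauge_group v" and g': "g' \<in> gauge_group v'" and off: "\<And>j. j \<noteq> i \<Longrightarrow> g' j = g j"
  shows "gauge_character m' g' = (Determinant.det (star_gauge Q d v i g) *
     (inverse (Determinant.det (g i)) * inverse (Determinant.det (g' i)))) ^ nat (m i) * gauge_character m g"
proof -
  define D where "D = (\<lambda>j. Determinant.det (g j))"
  have D0: "D j \<noteq> 0" for j using det_mutually_inverse[OF gauge_group_inverse[OF g, of j]] by (auto simp: D_def)
  define D' where "D' = Determinant.det (g' i)"
  have D'0: "D' \<noteq> 0" using det_mutually_inverse[OF gauge_group_inverse[OF g', of i]] by (auto simp: D'_def)
  have mi: "m i = int (nat (m i))" using m_nonneg by simp
  have adj0: "adj Q i i = 0" using cartan_diagonal[of i] by (simp add: cartan_def)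
  have gc: "g j \<in> carrier_mat (v j) (v j)" for j using g by (simp add: gauge_group_def)
  have T: "Determinant.det (star_gauge Q d v i g) = (\<Prod>j\<in>UNIV - {i}. D j ^ adj Q i j)"
  proof -
    have "Determinant.det (star_gauge Q d v i g) = (\<Prod>j\<in>UNIV. D j ^ adj Q j i)"
      using det_star_gauge[OF gc] by (simp add: D_def)
    also have "\<dots> = D i ^ adj Q i i * (\<Prod>j\<in>UNIV - {i}. D j ^ adj Q j i)"
      by (rule prod.remove) simp_all
    also have "\<dots> = (\<Prod>j\<in>UNIV - {i}. D j ^ adj Q i j)"
      by (simp add: adj0, intro prod.cong refl arg_cong2[where f = power] adj_sym)
    finally show ?thesis .
  qed
  have "gauge_character m' g' = D' powi (- m i) * (\<Prod>j\<in>UNIV - {i}. D j powi (m j + int (adj Q i j) * m i))"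
  proof -
    have "gauge_character m' g' = D' powi m' i * (\<Prod>j\<in>UNIV - {i}. Determinant.det (g' j) powi m' j)"
      unfolding gauge_character_def D'_def by (rule prod.remove) simp_all
    also have "(\<Prod>j\<in>UNIV - {i}. Determinant.det (g' j) powi m' j) =
      (\<Prod>j\<in>UNIV - {i}. D j powi (m j + int (adj Q i j) * m i))"
      by (intro prod.cong refl) (simp add: off off_vertex D_def)
    finally show ?thesis by (simp only: at_vertex)
  qed
  also have "(\<Prod>j\<in>UNIV - {i}. D j powi (m j + int (adj Q i j) * m i)) =
    (\<Prod>j\<in>UNIV - {i}. D j powi m j * (D j ^ adj Q i j) ^ nat (m i))"
  proof (intro prod.cong refl)
    fix j
    have "D j powi (int (adj Q i j) * m i) = (D j ^ adj Q i j) ^ nat (m i)"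
      using D0[of j] by (subst mi) (simp only: power_int_mult power_int_of_nat)
    then show "D j powi (m j + int (adj Q i j) * m i) = D j powi m j * (D j ^ adj Q i j) ^ nat (m i)"
      using D0[of j] by (simp add: power_int_add)
  qed
  also have "\<dots> = (\<Prod>j\<in>UNIV - {i}. D j powi m j) * Determinant.det (star_gauge Q d v i g) ^ nat (m i)"
    unfolding T by (simp add: prod.distrib prod_power_distrib)
  also have "D' powi (- m i) = inverse D' ^ nat (m i)"
    by (subst mi) (simp only: power_int_minus power_int_of_nat power_inverse)
  also have "(\<Prod>j\<in>UNIV - {i}. D j powi m j) = gauge_character m g * inverse (D i) ^ nat (m i)"
  proof -
    have "gauge_character m g = D i powi m i * (\<Prod>j\<in>UNIV - {i}. D j powi m j)"
      unfolding gauge_character_def D_def by (rule prod.remove) simp_all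
    moreover have "D i powi m i = D i ^ nat (m i)" by (subst mi) (rule power_int_of_nat)
    ultimately show ?thesis using D0[of i] by (simp add: power_inverse)
  qed
  finally show ?thesis by (simp add: D_def D'_def power_mult_distrib mult_ac)
qed


text \<open>
  Each generator of the classical functions has a counterpart on the other side. Those of the minors
  vanish where no partner exists, which makes the counterpart of a function of positive weight
  covariant at these points as well.
\<close>

lemma transfer_right:
  assumes "A.I.semi w F"
  shows "\<exists>F'\<in>polynomial_funs Q d v'. (\<forall>s s' x. linked s s' x \<longrightarrow> F' s' = x ^ w * F s) \<and>
     (0 < w \<longrightarrow> (\<forall>s'. B.O.dependent_rows_at s' \<longrightarrow> F' s' = 0))"
  using assms unfolding A.I.semi_def
proof induction
  case (zero w)
  show ?case by (rule bexI[of _ "\<lambda>_. 0"]) (auto intro: polynomial_funs.const)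
next
  case (const c)
  show ?case by (rule bexI[of _ "\<lambda>_. c"]) (auto intro: polynomial_funs.const)
next
  case (gen0 F)
  then show ?case
  proof
    assume F: "F \<in> rest_coordinates d v i"
    then have "F \<in> polynomial_funs Q d v'"
      using rest_coordinates_polynomial[of F d v' i] rest_coordinates_cong[OF v'_off, where d = d] by simp
    moreover have "F s' = F s" if "linked s s' x" for s s' x
      using that rest_coordinates_agree[OF F, of s s'] by (simp add: linked_def related_def)
    ultimately show ?thesis by (intro bexI[of _ F]) auto
  next
    assume "F \<in> {\<lambda>s. (A.out s * A.inn s) $$ (t, t') | t t'. t < A.sz \<and> t' < A.sz}"
    then obtain t t' where t: "F = (\<lambda>s. (A.out s * A.inn s) $$ (t, t'))" "t < v i + v' i" "t' < v i + v' i"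
      unfolding size_eq by blast
    define F' where "F' = (\<lambda>s'. (\<Sum>c\<in>{0..<v' i}. B.out s' $$ (t, c) * B.inn s' $$ (c, t')) + (if t = t' then l i else 0))"
    have "F' \<in> polynomial_funs Q d v'"
      unfolding F'_def using t size_eq
      by (intro polynomial_funs.add polynomial_funs_sum polynomial_funs.mult star_out_polynomial star_in_polynomial polynomial_funs.const) auto
    moreover have "F' s' = F s" if "linked s s' x" for s s' x
    proof -
      have "(B.out s' * B.inn s') $$ (t, t') = F s - (if t = t' then l i else 0)"
        using that t carriers[of s] by (simp add: linked_def related_def)
      moreover have "(B.out s' * B.inn s') $$ (t, t') = (\<Sum>c\<in>{0..<v' i}. B.out s' $$ (t, c) * B.inn s' $$ (c, t'))"
        using t carriers[of s'] by (simp add: scalar_prod_def size_eq)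
      ultimately show ?thesis by (simp add: F'_def)
    qed
    ultimately show ?thesis by (intro bexI[of _ F']) auto
  qed
next
  case (gen1 F)
  then obtain J where J: "J \<in> A.I.tuples" "F = A.I.minor J" by blast
  define \<iota> where "\<iota> = Matrix.mat (v i + v' i) (v i) (\<lambda>(t, c). if t = J c then 1 else (0::complex))"
  define F' where "F' = (\<lambda>s'. Determinant.det (hcat (v i) (v' i) \<iota> (B.out s')))"
  have "F' \<in> polynomial_funs Q d v'"
    unfolding F'_def hcat_def
  proof (rule polynomial_funs_det)
    fix t c assume "t < v i + v' i" "c < v i + v' i"
    then show "(\<lambda>s'. if c < v i then \<iota> $$ (t, c) else B.out s' $$ (t, c - v i)) \<in> polynomial_funs Q d v'"
      using star_out_polynomial[of t d v' i "c - v i"] polynomial_funs.const size_eq by (cases "c < v i") simp_all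
  qed
  moreover have "F' s' = x ^ 1 * F s" if link: "linked s s' x" for s s' x
  proof -
    obtain \<sigma> \<pi> where "splitting (v i) (v' i) (A.inn s) \<sigma> (B.out s') \<pi>"
      "x = Determinant.det (hcat (v i) (v' i) \<sigma> (B.out s'))" using link by (auto simp: linked_def)
    then show ?thesis
      using det_hcat_coordinates[of "v i" "v' i" "A.inn s" \<sigma> "B.out s'" \<pi> J] J size_eq
      by (simp add: F'_def \<iota>_def A.I.minor_def)
  qed
  moreover have "F' s' = 0" if dep: "B.O.dependent_rows_at s'" for s'
  proof -
    obtain u where "u \<in> carrier_vec (v' i)" "u \<noteq> 0\<^sub>v (v' i)" "B.out s' *\<^sub>v u = 0\<^sub>v (v i + v' i)"
      using dep unfolding B.O.dependent_rows_iff unfolding size_eq by auto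
    then show ?thesis unfolding F'_def by (rule det_hcat_eq_0[OF carriers(3)])
  qed
  ultimately show ?case by (intro bexI[of _ F']) auto
next
  case (add w F G)
  then obtain F' G' where *: "F' \<in> polynomial_funs Q d v'" "\<forall>s s' x. linked s s' x \<longrightarrow> F' s' = x ^ w * F s"
    "0 < w \<longrightarrow> (\<forall>s'. B.O.dependent_rows_at s' \<longrightarrow> F' s' = 0)"
    "G' \<in> polynomial_funs Q d v'" "\<forall>s s' x. linked s s' x \<longrightarrow> G' s' = x ^ w * G s"
    "0 < w \<longrightarrow> (\<forall>s'. B.O.dependent_rows_at s' \<longrightarrow> G' s' = 0)" by (elim bexE conjE)
  show ?case
    by (intro bexI[of _ "\<lambda>s'. F' s' + G' s'"] polynomial_funs.add *(1,4)) (use * in \<open>auto simp: algebra_simps\<close>)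
next
  case (mult w F w' G)
  then obtain F' G' where *: "F' \<in> polynomial_funs Q d v'" "\<forall>s s' x. linked s s' x \<longrightarrow> F' s' = x ^ w * F s"
    "0 < w \<longrightarrow> (\<forall>s'. B.O.dependent_rows_at s' \<longrightarrow> F' s' = 0)"
    "G' \<in> polynomial_funs Q d v'" "\<forall>s s' x. linked s s' x \<longrightarrow> G' s' = x ^ w' * G s"
    "0 < w' \<longrightarrow> (\<forall>s'. B.O.dependent_rows_at s' \<longrightarrow> G' s' = 0)" by (elim bexE conjE)
  show ?case
    by (intro bexI[of _ "\<lambda>s'. F' s' * G' s'"] polynomial_funs.mult *(1,4)) (use * in \<open>auto simp: power_add\<close>)
qed

lemma transfer_left:
  assumes "B.O.semi w F'"
  shows "\<exists>F\<in>polynomial_funs Q d v. (\<forall>s s' x. linked s s' x \<longrightarrow> F' s' = x ^ w * F s) \<and>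
     (0 < w \<longrightarrow> (\<forall>s. A.I.dependent_rows_at s \<longrightarrow> F s = 0))"
  using assms unfolding B.O.semi_def
proof induction
  case (zero w)
  show ?case by (rule bexI[of _ "\<lambda>_. 0"]) (auto intro: polynomial_funs.const)
next
  case (const c)
  show ?case by (rule bexI[of _ "\<lambda>_. c"]) (auto intro: polynomial_funs.const)
next
  case (gen0 F')
  then show ?case
  proof
    assume "F' \<in> rest_coordinates d v' i"
    then have F: "F' \<in> rest_coordinates d v i" using rest_coordinates_cong[OF v'_off, where d = d] by simp
    moreover have "F' s' = F' s" if "linked s s' x" for s s' x
      using that rest_coordinates_agree[OF F, of s s'] by (simp add: linked_def related_def)
    ultimately show ?thesis using rest_coordinates_polynomial[OF F] by (intro bexI[of _ F']) auto
  next
    assume "F' \<in> {\<lambda>s. ((B.inn s)\<^sup>T * (B.out s)\<^sup>T) $$ (t, t') | t t'. t < B.sz \<and> t' < B.sz}"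
    then obtain t t' where t: "F' = (\<lambda>s. ((B.inn s)\<^sup>T * (B.out s)\<^sup>T) $$ (t, t'))" "t < v i + v' i" "t' < v i + v' i"
      unfolding size_eq by blast
    define F where "F = (\<lambda>s. (\<Sum>c\<in>{0..<v i}. A.out s $$ (t', c) * A.inn s $$ (c, t)) + (if t' = t then - l i else 0))"
    have "F \<in> polynomial_funs Q d v"
      unfolding F_def using t size_eq
      by (intro polynomial_funs.add polynomial_funs_sum polynomial_funs.mult star_out_polynomial star_in_polynomial polynomial_funs.const) auto
    moreover have "F' s' = F s" if "linked s s' x" for s s' x
    proof -
      have "F' s' = (B.out s' * B.inn s') $$ (t', t)"
        unfolding t(1) transpose_mult[OF carriers(3,4), symmetric] using t carriers(3,4)[of s'] by (simp add: size_eq)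
      moreover have "(B.out s' * B.inn s') $$ (t', t) = (A.out s * A.inn s) $$ (t', t) - (if t' = t then l i else 0)"
        using that t carriers[of s] by (simp add: linked_def related_def)
      moreover have "(A.out s * A.inn s) $$ (t', t) = (\<Sum>c\<in>{0..<v i}. A.out s $$ (t', c) * A.inn s $$ (c, t))"
        using t carriers[of s] by (simp add: scalar_prod_def size_eq)
      ultimately show ?thesis by (simp add: F_def)
    qed
    ultimately show ?thesis by (intro bexI[of _ F]) auto
  qed
next
  case (gen1 F')
  then obtain J where J: "J \<in> B.O.tuples" "F' = B.O.minor J" by blast
  define \<kappa> where "\<kappa> = Matrix.mat (v' i) (v i + v' i) (\<lambda>(r, t). if t = J r then 1 else (0::complex))"
  define F where "F = (\<lambda>s. Determinant.det (vcat (v i) (v' i) (A.inn s) \<kappa>))"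
  have "F \<in> polynomial_funs Q d v"
    unfolding F_def vcat_def
  proof (rule polynomial_funs_det)
    fix c t assume "c < v i + v' i" "t < v i + v' i"
    then show "(\<lambda>s. if c < v i then A.inn s $$ (c, t) else \<kappa> $$ (c - v i, t)) \<in> polynomial_funs Q d v"
      using star_in_polynomial[of t d v i c] polynomial_funs.const size_eq by (cases "c < v i") simp_all
  qed
  moreover have "F' s' = x ^ 1 * F s" if link: "linked s s' x" for s s' x
  proof -
    obtain \<sigma> \<pi> where *: "splitting (v i) (v' i) (A.inn s) \<sigma> (B.out s') \<pi>"
      "x = Determinant.det (hcat (v i) (v' i) \<sigma> (B.out s'))" using link by (auto simp: linked_def)
    define M where "M = Matrix.mat (v' i) (v' i) (\<lambda>(k, c). B.out s' $$ (J k, c))"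
    have "Matrix.mat (v' i) (v' i) (\<lambda>(r, k). (B.out s')\<^sup>T $$ (r, J k)) = M\<^sup>T"
      using J(1) carriers(3)[of s'] size_eq by (intro eq_matI) (auto simp: M_def PiE_iff)
    moreover have "M \<in> carrier_mat (v' i) (v' i)" by (simp add: M_def)
    ultimately have "F' s' = Determinant.det M"
      unfolding J(2) B.O.minor_def by (simp add: det_transpose)
    then show ?thesis
      using det_vcat_coordinates[OF *(1), of J] J size_eq *(2)
      by (simp add: F_def \<kappa>_def M_def)
  qed
  moreover have "F s = 0" if dep: "A.I.dependent_rows_at s" for s
  proof -
    obtain u where "u \<in> carrier_vec (v i)" "u \<noteq> 0\<^sub>v (v i)" "(A.inn s)\<^sup>T *\<^sub>v u = 0\<^sub>v (v i + v' i)"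
      using dep unfolding A.I.dependent_rows_iff unfolding size_eq by auto
    then show ?thesis unfolding F_def by (rule det_vcat_eq_0[OF carriers(2)])
  qed
  ultimately show ?case by (intro bexI[of _ F]) auto
next
  case (add w F' G')
  then obtain F G where *: "F \<in> polynomial_funs Q d v" "\<forall>s s' x. linked s s' x \<longrightarrow> F' s' = x ^ w * F s"
    "0 < w \<longrightarrow> (\<forall>s. A.I.dependent_rows_at s \<longrightarrow> F s = 0)"
    "G \<in> polynomial_funs Q d v" "\<forall>s s' x. linked s s' x \<longrightarrow> G' s' = x ^ w * G s"
    "0 < w \<longrightarrow> (\<forall>s. A.I.dependent_rows_at s \<longrightarrow> G s = 0)" by (elim bexE conjE)
  show ?case
    by (intro bexI[of _ "\<lambda>s. F s + G s"] polynomial_funs.add *(1,4)) (use * in \<open>auto simp: algebra_simps\<close>)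
next
  case (mult w F' w' G')
  then obtain F G where *: "F \<in> polynomial_funs Q d v" "\<forall>s s' x. linked s s' x \<longrightarrow> F' s' = x ^ w * F s"
    "0 < w \<longrightarrow> (\<forall>s. A.I.dependent_rows_at s \<longrightarrow> F s = 0)"
    "G \<in> polynomial_funs Q d v" "\<forall>s s' x. linked s s' x \<longrightarrow> G' s' = x ^ w' * G s"
    "0 < w' \<longrightarrow> (\<forall>s. A.I.dependent_rows_at s \<longrightarrow> G s = 0)" by (elim bexE conjE)
  show ?case
    by (intro bexI[of _ "\<lambda>s. F s * G s"] polynomial_funs.mult *(1,4)) (use * in \<open>auto simp: power_add\<close>)
qed

abbreviation "RA \<equiv> covariants Q m l d v"
abbreviation "RB \<equiv> covariants Q m' l' d v'"

text \<open>
  No condition is imposed at points without a partner. Covariants of positive degree vanish there.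
\<close>

definition corresponding :: "nat \<Rightarrow> (('i, 'h) rep \<Rightarrow> complex) \<Rightarrow> (('i, 'h) rep \<Rightarrow> complex) \<Rightarrow> bool" where
  "corresponding k f f' \<longleftrightarrow> (\<forall>s s' x. linked s s' x \<longrightarrow> f' s' = x ^ (k * nat (m i)) * f s)"

text \<open>
  Points without a partner exist only for \<open>l i = 0\<close>, and then \<open>m i\<close> is positive.
\<close>

lemma dependent_weight_positive:
  "0 < k \<Longrightarrow> s \<in> A.fibre \<Longrightarrow> A.I.dependent_rows_at s \<Longrightarrow> 0 < k * nat (m i)"
  "0 < k \<Longrightarrow> s' \<in> B.fibre \<Longrightarrow> B.O.dependent_rows_at s' \<Longrightarrow> 0 < k * nat (m i)"
proof -
  assume "0 < k" "s \<in> A.fibre" "A.I.dependent_rows_at s"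
  then have "l i = 0" using A.I.invertible_independent[OF A.inn_out[of s]] by blast
  then show "0 < k * nat (m i)" using \<open>0 < k\<close> nonzero m_nonneg by simp
next
  assume "0 < k" "s' \<in> B.fibre" "B.O.dependent_rows_at s'"
  then have "l' i = 0" using B.O.invertible_independent[OF B.out_inn_transpose[of s']] by blast
  then show "0 < k * nat (m i)" using \<open>0 < k\<close> nonzero m_nonneg by (simp add: at_vertex)
qed

lemma corresponding_gauge:
  assumes link: "linked s s' x" and g: "g \<in> gauge_group v" and g': "g' \<in> gauge_group v'"
    and off: "\<And>j. j \<noteq> i \<Longrightarrow> g' j = g j"
    and F: "\<And>s s' x. linked s s' x \<Longrightarrow> F' s' = x ^ (k * nat (m i)) * F s"
  shows "F (gauge_action Q g s) = gauge_character m g ^ k * F s \<longleftrightarrow>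
    F' (gauge_action Q g' s') = gauge_character m' g' ^ k * F' s'"
proof -
  define y where "y = Determinant.det (star_gauge Q d v i g) * (inverse (Determinant.det (g i)) * inverse (Determinant.det (g' i)))"
  define w where "w = k * nat (m i)"
  have link': "linked (gauge_action Q g s) (gauge_action Q g' s') (x * y)"
    using linked_gauge[OF link g g' off] by (simp add: y_def mult_ac)
  have xy: "x * y \<noteq> 0" by (rule linked_nonzero[OF link'])
  have "gauge_character m' g' ^ k = y ^ w * gauge_character m g ^ k"
    using character_transfer[OF g g' off]
    by (simp add: y_def w_def power_mult_distrib power_mult[symmetric] mult.commute[of k])
  then have "gauge_character m' g' ^ k * F' s' = (x * y) ^ w * (gauge_character m g ^ k * F s)"
    using F[OF link] by (simp add: w_def power_mult_distrib mult_ac)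
  moreover have "F' (gauge_action Q g' s') = (x * y) ^ w * F (gauge_action Q g s)"
    using F[OF link'] by (simp add: w_def)
  ultimately show ?thesis using xy by simp
qed

text \<open>
  The polynomial supplied by \<open>transfer_right\<close> is covariant at points without a partner because it
  vanishes there, and at the others by \<open>corresponding_gauge\<close>, where a gauge transformation of one
  side is matched with the one on the other side that is the identity at \<open>i\<close>.
\<close>

lemma covariant_transfer_right:
  assumes f: "f \<in> RA k" and k: "0 < k" and F: "A.I.semi (k * nat (m i)) F" "\<forall>s\<in>A.fibre. f s = F s"
  shows "\<exists>f'\<in>RB k. corresponding k f f'"
proof -
  obtain F' where F': "F' \<in> polynomial_funs Q d v'" "\<forall>s s' x. linked s s' x \<longrightarrow> F' s' = x ^ (k * nat (m i)) * F s"
    "0 < k * nat (m i) \<longrightarrow> (\<forall>s'. B.O.dependent_rows_at s' \<longrightarrow> F' s' = 0)" using transfer_right[OF F(1)] by (elim bexE conjE)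
  define f' where "f' = (\<lambda>s'. if s' \<in> B.fibre then F' s' else 0)"
  have "f' \<in> RB k" unfolding f'_def
  proof (rule B.covariantsI[OF F'(1)])
    fix g' s' assume g': "g' \<in> gauge_group v'" and s': "s' \<in> B.fibre"
    show "F' (gauge_action Q g' s') = gauge_character m' g' ^ k * F' s'"
    proof (cases "B.O.dependent_rows_at s'")
      case True
      then have "F' s' = 0" "F' (gauge_action Q g' s') = 0"
        using F'(3) B.dependent_gauge_out[OF s' g' True] dependent_weight_positive(2)[OF k s' True] by blast+
      then show ?thesis by simp
    next
      case False
      then obtain s x where link: "linked s s' x" using ex_linked_left[OF s'] by blast
      note s = related_fibre(1)[OF linked_related[OF link]]
      define g where "g = g'(i := 1\<^sub>m (v i))"
      have "mutually_inverse (v j) (g j) (((\<lambda>j. matrix_inverse (g' j))(i := 1\<^sub>m (v i))) j)" for j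
        using gauge_group_inverse[OF g', of j] v'_off[of j] mutually_inverse_one by (cases "j = i") (simp_all add: g_def)
      then have g: "g \<in> gauge_group v" unfolding gauge_group_iff by blast
      have "f (gauge_action Q g s) = gauge_character m g ^ k * f s" using f g s by (simp add: covariants_def)
      then have "F (gauge_action Q g s) = gauge_character m g ^ k * F s"
        using F(2) s gauge_action_moment_fibre[OF g s] by simp
      then show ?thesis
        using corresponding_gauge[OF link g g', of F' k F] F'(2) by (simp add: g_def)
    qed
  qed
  moreover have "corresponding k f f'"
    unfolding corresponding_def
  proof (intro allI impI)
    fix s s' x assume link: "linked s s' x"
    have "s \<in> A.fibre" "s' \<in> B.fibre" using related_fibre linked_related[OF link] by blast+
    moreover have "F' s' = x ^ (k * nat (m i)) * F s" using F'(2) link by blast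
    ultimately show "f' s' = x ^ (k * nat (m i)) * f s" using F(2) by (simp add: f'_def)
  qed
  ultimately show ?thesis by blast
qed

lemma covariant_transfer_left:
  assumes f': "f' \<in> RB k" and k: "0 < k" and F': "B.O.semi (k * nat (m i)) F'" "\<forall>s\<in>B.fibre. f' s = F' s"
  shows "\<exists>f\<in>RA k. corresponding k f f'"
proof -
  obtain F where F: "F \<in> polynomial_funs Q d v" "\<forall>s s' x. linked s s' x \<longrightarrow> F' s' = x ^ (k * nat (m i)) * F s"
    "0 < k * nat (m i) \<longrightarrow> (\<forall>s. A.I.dependent_rows_at s \<longrightarrow> F s = 0)" using transfer_left[OF F'(1)] by (elim bexE conjE)
  define f where "f = (\<lambda>s. if s \<in> A.fibre then F s else 0)"
  have "f \<in> RA k" unfolding f_def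
  proof (rule A.covariantsI[OF F(1)])
    fix g s assume g: "g \<in> gauge_group v" and s: "s \<in> A.fibre"
    show "F (gauge_action Q g s) = gauge_character m g ^ k * F s"
    proof (cases "A.I.dependent_rows_at s")
      case True
      then have "F s = 0" "F (gauge_action Q g s) = 0"
        using F(3) A.dependent_gauge_in[OF s g True] dependent_weight_positive(1)[OF k s True] by blast+
      then show ?thesis by simp
    next
      case False
      then obtain s' x where link: "linked s s' x" using ex_linked_right[OF s] by blast
      note s' = related_fibre(2)[OF linked_related[OF link]]
      define g' where "g' = g(i := 1\<^sub>m (v' i))"
      have "mutually_inverse (v' j) (g' j) (((\<lambda>j. matrix_inverse (g j))(i := 1\<^sub>m (v' i))) j)" for j
        using gauge_group_inverse[OF g, of j] v'_off[of j] mutually_inverse_one by (cases "j = i") (simp_all add: g'_def)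
      then have g': "g' \<in> gauge_group v'" unfolding gauge_group_iff by blast
      have "f' (gauge_action Q g' s') = gauge_character m' g' ^ k * f' s'" using f' g' s' by (simp add: covariants_def)
      then have "F' (gauge_action Q g' s') = gauge_character m' g' ^ k * F' s'"
        using F'(2) s' gauge_action_moment_fibre[OF g' s'] by simp
      then show ?thesis
        using corresponding_gauge[OF link g g', of F' k F] F(2) by (simp add: g'_def)
    qed
  qed
  moreover have "corresponding k f f'"
    unfolding corresponding_def
  proof (intro allI impI)
    fix s s' x assume link: "linked s s' x"
    have "s \<in> A.fibre" "s' \<in> B.fibre" using related_fibre linked_related[OF link] by blast+
    moreover have "F' s' = x ^ (k * nat (m i)) * F s" using F(2) link by blast
    ultimately show "f' s' = x ^ (k * nat (m i)) * f s" using F'(2) by (simp add: f_def)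
  qed
  ultimately show ?thesis by blast
qed

lemma corresponding_zero:
  assumes "0 < k" "f \<in> RA k" "f' \<in> RB k" "corresponding k f f'"
  shows "f = (\<lambda>_. 0) \<longleftrightarrow> f' = (\<lambda>_. 0)"
proof
  assume f: "f = (\<lambda>_. 0)"
  show "f' = (\<lambda>_. 0)"
  proof
    fix s'
    show "f' s' = 0"
    proof (cases "s' \<in> B.fibre")
      case False
      then show ?thesis using assms(3) by (auto simp: covariants_def fibre_regular_funs_def)
    next
      case True
      show ?thesis
      proof (cases "B.O.dependent_rows_at s'")
        case True
        then show ?thesis using B.covariants_vanish_out[OF assms(3,1)] nonzero' by blast
      next
        case False
        then obtain s x where "linked s s' x" using ex_linked_left[OF True] by blast
        then have "f' s' = x ^ (k * nat (m i)) * f s" using assms(4) unfolding corresponding_def by blast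
        then show ?thesis by (simp add: f)
      qed
    qed
  qed
next
  assume f': "f' = (\<lambda>_. 0)"
  show "f = (\<lambda>_. 0)"
  proof
    fix s
    show "f s = 0"
    proof (cases "s \<in> A.fibre")
      case False
      then show ?thesis using assms(2) by (auto simp: covariants_def fibre_regular_funs_def)
    next
      case True
      show ?thesis
      proof (cases "A.I.dependent_rows_at s")
        case True
        then show ?thesis using A.covariants_vanish_in[OF assms(2,1)] nonzero m_nonneg by blast
      next
        case False
        then obtain s' x where link: "linked s s' x" using ex_linked_right[OF True] by blast
        then have "f' s' = x ^ (k * nat (m i)) * f s" using assms(4) unfolding corresponding_def by blast
        then have "x ^ (k * nat (m i)) * f s = 0" by (simp add: f')
        then show ?thesis using linked_nonzero[OF link] by simp
      qed
    qed
  qed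
qed

text \<open>
  Pairs of corresponding covariants, as functions on the disjoint union of the two representation
  spaces. Degree 0 is replaced by zero: two corresponding functions determine each other only in
  positive degrees, and Proj does not see degree 0.
\<close>

definition common_subring :: "nat \<Rightarrow> (('i, 'h) rep + ('i, 'h) rep \<Rightarrow> complex) set" where
  "common_subring k = (if k = 0 then {\<lambda>_. 0} else {case_sum f f' | f f'. f \<in> RA k \<and> f' \<in> RB k \<and> corresponding k f f'})"

lemma common_subring_iff: "0 < k \<Longrightarrow> t \<in> common_subring k \<longleftrightarrow> t \<circ> Inl \<in> RA k \<and> t \<circ> Inr \<in> RB k \<and> corresponding k (t \<circ> Inl) (t \<circ> Inr)"
proof
  assume "0 < k" "t \<in> common_subring k"
  then show "t \<circ> Inl \<in> RA k \<and> t \<circ> Inr \<in> RB k \<and> corresponding k (t \<circ> Inl) (t \<circ> Inr)"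
    by (auto simp: common_subring_def case_sum_o_inj)
next
  assume "0 < k" "t \<circ> Inl \<in> RA k \<and> t \<circ> Inr \<in> RB k \<and> corresponding k (t \<circ> Inl) (t \<circ> Inr)"
  moreover have "t = case_sum (t \<circ> Inl) (t \<circ> Inr)" by (auto simp: fun_eq_iff split: sum.split)
  ultimately show "t \<in> common_subring k" unfolding common_subring_def by (simp, metis)
qed

lemma graded_algebra_common_subring: "graded_algebra common_subring"
proof -
  have RA: "graded_algebra RA" and RB: "graded_algebra RB"
    by (rule A.graded_algebra_covariants, rule B.graded_algebra_covariants)
  have "(\<lambda>_. 0) \<in> common_subring k" for k
  proof (cases "k = 0")
    case False
    have "(\<lambda>_. 0) \<in> RA k" "(\<lambda>_. 0) \<in> RB k" using RA RB by (simp_all add: graded_algebra_def)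
    then show ?thesis using False by (simp add: common_subring_iff o_def corresponding_def)
  qed (simp add: common_subring_def)
  moreover have "(\<lambda>x. c * t x + u x) \<in> common_subring k" if tu: "t \<in> common_subring k" "u \<in> common_subring k" for t u k c
  proof (cases "k = 0")
    case True
    then show ?thesis using tu by (simp add: common_subring_def)
  next
    case False
    have 1: "(\<lambda>x. c * (t \<circ> Inl) x + (u \<circ> Inl) x) \<in> RA k" "(\<lambda>x. c * (t \<circ> Inr) x + (u \<circ> Inr) x) \<in> RB k"
      using RA RB tu False unfolding graded_algebra_def by (simp_all add: common_subring_iff del: o_apply)
    moreover have "corresponding k (\<lambda>x. c * (t \<circ> Inl) x + (u \<circ> Inl) x) (\<lambda>x. c * (t \<circ> Inr) x + (u \<circ> Inr) x)"
      using tu False by (simp add: common_subring_iff corresponding_def algebra_simps)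
    ultimately show ?thesis using False by (simp add: common_subring_iff o_def)
  qed
  moreover have "(\<lambda>x. t x * u x) \<in> common_subring (j + k)" if tu: "t \<in> common_subring j" "u \<in> common_subring k" for t u j k
  proof (cases "j = 0 \<or> k = 0")
    case True
    then have "(\<lambda>x. t x * u x) = (\<lambda>_. 0)" using tu by (auto simp: common_subring_def)
    then show ?thesis using \<open>\<And>k. (\<lambda>_. 0) \<in> common_subring k\<close> by simp
  next
    case False
    have 1: "(\<lambda>x. (t \<circ> Inl) x * (u \<circ> Inl) x) \<in> RA (j + k)" "(\<lambda>x. (t \<circ> Inr) x * (u \<circ> Inr) x) \<in> RB (j + k)"
      using graded_algebra_mult[OF RA, of "t \<circ> Inl" j "u \<circ> Inl" k] graded_algebra_mult[OF RB, of "t \<circ> Inr" j "u \<circ> Inr" k]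
        tu False by (simp_all add: common_subring_iff del: o_apply)
    moreover have "corresponding (j + k) (\<lambda>x. (t \<circ> Inl) x * (u \<circ> Inl) x) (\<lambda>x. (t \<circ> Inr) x * (u \<circ> Inr) x)"
      using tu False by (simp add: common_subring_iff corresponding_def power_add add_mult_distrib)
    ultimately show ?thesis using False by (simp add: common_subring_iff o_def)
  qed
  ultimately show ?thesis unfolding graded_algebra_def by blast
qed

lemma common_subring_zero:
  assumes "t \<in> common_subring k" "t \<circ> Inl = (\<lambda>_. 0) \<or> t \<circ> Inr = (\<lambda>_. 0)" shows "t = (\<lambda>_. 0)"
proof (cases "k = 0")
  case True
  then show ?thesis using assms by (simp add: common_subring_def)
next
  case False
  then have *: "t \<circ> Inl = (\<lambda>_. 0)" "t \<circ> Inr = (\<lambda>_. 0)"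
    using assms corresponding_zero[of k "t \<circ> Inl" "t \<circ> Inr"] by (auto simp: common_subring_iff)
  have "t (Inl x) = 0" "t (Inr y) = 0" for x y
    using fun_cong[OF *(1), of x] fun_cong[OF *(2), of y] by (simp_all only: o_apply)
  then show ?thesis by (metis sum.exhaust)
qed

sublocale PA: proj_comparison RA common_subring Inl
proof
  show "graded_algebra RA" "graded_algebra common_subring" by (rule A.graded_algebra_covariants, rule graded_algebra_common_subring)
  show "t \<circ> Inl \<in> RA k" if "t \<in> common_subring k" for t k
    using that A.graded_algebra_covariants by (cases "k = 0") (auto simp: common_subring_iff, auto simp: common_subring_def graded_algebra_def o_def)
  show "t = (\<lambda>_. 0)" if "t \<in> common_subring k" "\<And>x. t (Inl x) = 0" for t k
    using common_subring_zero[OF that(1)] that(2) by (simp add: o_def)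
  show "\<exists>M. \<exists>t\<in>common_subring (k + M * j). \<forall>x. t (Inl x) = f x * h x ^ M" if fh: "f \<in> RA k" "h \<in> RA j" "0 < j" for f h k j
  proof -
    obtain M F where M: "1 \<le> M" "A.I.semi ((k + M * j) * nat (m i)) F" "\<forall>s\<in>A.fibre. f s * h s ^ M = F s"
      using A.covariants_absorb_in[OF fh m_nonneg nonzero] by blast
    have pos: "0 < k + M * j" using M(1) fh(3) by simp
    have pow: "(\<lambda>x. f x * h x ^ n) \<in> RA (k + n * j)" for n
      by (rule graded_algebra_mult_power[OF A.graded_algebra_covariants fh(1,2)])
    obtain f' where f': "f' \<in> RB (k + M * j)" "corresponding (k + M * j) (\<lambda>x. f x * h x ^ M) f'"
      using covariant_transfer_right[OF pow pos M(2,3)] by blast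
    have "case_sum (\<lambda>x. f x * h x ^ M) f' \<in> common_subring (k + M * j)"
      using pow f' pos by (simp add: common_subring_iff case_sum_o_inj)
    then show ?thesis by (intro exI[of _ M] bexI) auto
  qed
qed

sublocale PB: proj_comparison RB common_subring Inr
proof
  show "graded_algebra RB" "graded_algebra common_subring" by (rule B.graded_algebra_covariants, rule graded_algebra_common_subring)
  show "t \<circ> Inr \<in> RB k" if "t \<in> common_subring k" for t k
    using that B.graded_algebra_covariants by (cases "k = 0") (auto simp: common_subring_iff, auto simp: common_subring_def graded_algebra_def o_def)
  show "t = (\<lambda>_. 0)" if "t \<in> common_subring k" "\<And>x. t (Inr x) = 0" for t k
    using common_subring_zero[OF that(1)] that(2) by (simp add: o_def)
  show "\<exists>M. \<exists>t\<in>common_subring (k + M * j). \<forall>x. t (Inr x) = f x * h x ^ M" if fh: "f \<in> RB k" "h \<in> RB j" "0 < j" for f h k j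
  proof -
    obtain M F where M: "1 \<le> M" "B.O.semi ((k + M * j) * nat (- m' i)) F" "\<forall>s\<in>B.fibre. f s * h s ^ M = F s"
      using B.covariants_absorb_out[OF fh nonzero'] by blast
    have F: "B.O.semi ((k + M * j) * nat (m i)) F" using M(2) by (simp add: at_vertex)
    have pos: "0 < k + M * j" using M(1) fh(3) by simp
    have pow: "(\<lambda>x. f x * h x ^ n) \<in> RB (k + n * j)" for n
      by (rule graded_algebra_mult_power[OF B.graded_algebra_covariants fh(1,2)])
    obtain f' where f': "f' \<in> RA (k + M * j)" "corresponding (k + M * j) f' (\<lambda>x. f x * h x ^ M)"
      using covariant_transfer_left[OF pow pos F M(3)] by blast
    have "case_sum f' (\<lambda>x. f x * h x ^ M) \<in> common_subring (k + M * j)"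
      using pow f' pos by (simp add: common_subring_iff case_sum_o_inj)
    then show ?thesis by (intro exI[of _ M] bexI) auto
  qed
qed

theorem reflection_isomorphic: "isomorphic_varieties (proj_variety RA) (proj_variety RB)"
  using isomorphic_varieties_trans[OF PA.isomorphic_proj isomorphic_varieties_sym[OF PB.isomorphic_proj]] .

end

section \<open>Simple reflections of quiver varieties\<close>

context quiver_double begin

text \<open>
  A map between \<open>V i\<close> and a space of smaller dimension has no non-zero maximal minors.
\<close>

lemma isomorphic_empty_if_large:
  assumes "star_size Q d v i < v i" "m i \<noteq> 0 \<or> l i \<noteq> 0"
  shows "isomorphic_varieties (proj_variety (covariants Q m l d v)) empty_variety"
proof -
  interpret star_vertex Q l d v i by unfold_locales
  show ?thesis by (intro isomorphic_empty_proj covariants_zero_if_large[where m = m]) (use assms in auto)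
qed

lemma quiver_variety_empty: "d j < 0 \<or> v j < 0 \<Longrightarrow> quiver_variety Q m l (d, v) = empty_variety"
  by (auto simp: quiver_variety_def)

lemma star_size_int:
  assumes "\<And>j. 0 \<le> d j" "\<And>j. j \<noteq> i \<Longrightarrow> 0 \<le> v j"
  shows "int (star_size Q (\<lambda>j. nat (d j)) (\<lambda>j. nat (v j)) i) = d i + (\<Sum>h | h \<in> arrows Q \<and> tgt Q h = i. v (src Q h))"
proof -
  have "int (nat (v (src Q h))) = v (src Q h)" if "h \<in> arrows Q \<and> tgt Q h = i" for h
    using assms(2)[of "src Q h"] that arrow_props(1)[of h] by auto
  then show ?thesis unfolding star_size using assms(1)[of i] by simp
qed

text \<open>
  The case distinction follows the signs of the dimensions at \<open>i\<close>. If one of \<open>v i\<close> and \<open>v' i\<close> is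
  negative, the other one exceeds the dimension \<open>v i + v' i\<close> of \<open>T\<close>, and both varieties are empty. The
  case \<open>m i < 0\<close> is reduced to \<open>m i > 0\<close> by exchanging the two sides. If \<open>m i = l i = 0\<close>, then by
  the last hypothesis both dimensions are zero and the reflection changes nothing, unless a dimension at
  another vertex is negative and both varieties are empty.
\<close>

theorem quiver_variety_reflection:
  fixes d v v' m m' :: "'i \<Rightarrow> int" and l l' :: "'i \<Rightarrow> complex"
  assumes v'_off: "\<And>j. j \<noteq> i \<Longrightarrow> v' j = v j"
    and v'_at: "v i + v' i = d i + (\<Sum>h | h \<in> arrows Q \<and> tgt Q h = i. v (src Q h))"
    and m': "\<And>j. m' j = m j - cartan Q i j * m i" and l': "\<And>j. l' j = l j - of_int (cartan Q i j) * l i"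
    and generic: "m i \<noteq> 0 \<or> l i \<noteq> 0 \<or> v i \<le> 0 \<and> v' i \<le> 0 \<or> (\<exists>j. j \<noteq> i \<and> v j < 0)"
  shows "isomorphic_varieties (quiver_variety Q m l (d, v)) (quiver_variety Q m' l' (d, v'))"
proof (cases "\<exists>j. d j < 0 \<or> j \<noteq> i \<and> v j < 0")
  case True
  then obtain j where j: "d j < 0 \<or> j \<noteq> i \<and> v j < 0" by blast
  then have "d j < 0 \<or> v j < 0" "d j < 0 \<or> v' j < 0" using v'_off[of j] by auto
  then show ?thesis using quiver_variety_empty[of d j] isomorphic_varieties_refl by metis
next
  case False
  then have d0: "0 \<le> d j" and v0: "j \<noteq> i \<Longrightarrow> 0 \<le> v j" for j by (auto simp: not_less)
  have v'0: "j \<noteq> i \<Longrightarrow> 0 \<le> v' j" for j using v0 v'_off by simp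
  let ?d = "\<lambda>j. nat (d j)" and ?v = "\<lambda>j. nat (v j)" and ?v' = "\<lambda>j. nat (v' j)"
  have size: "int (star_size Q ?d ?v i) = v i + v' i"
    using star_size_int[OF d0 v0] v'_at by simp
  have "star_index Q ?d ?v' i = star_index Q ?d ?v i" by (rule star_index_cong) (simp add: v'_off)
  then have size': "int (star_size Q ?d ?v' i) = v i + v' i" using size by simp
  have nonneg: "0 \<le> v i + v' i" using size by (metis of_nat_0_le_iff)
  have at: "m' i = - m i" "l' i = - l i" using m'[of i] l'[of i] by (simp_all add: cartan_diagonal)
  show ?thesis
  proof (cases "m i = 0 \<and> l i = 0")
    case True
    then have "v i = v' i" proof -
      have "v i \<le> 0 \<and> v' i \<le> 0" using generic True v0 by (meson not_less)
      then show ?thesis using nonneg by linarith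
    qed
    then have "v' = v" using v'_off by (metis ext)
    moreover have "m' = m" "l' = l" using True m' l' by (auto simp: fun_eq_iff)
    ultimately show ?thesis using isomorphic_varieties_refl by simp
  next
    case False
    then have nz: "m i \<noteq> 0 \<or> l i \<noteq> 0" "m' i \<noteq> 0 \<or> l' i \<noteq> 0" by (auto simp: at)
    consider "v i < 0" | "v' i < 0" | "0 \<le> v i" "0 \<le> v' i" by linarith
    then show ?thesis
    proof cases
      case 1
      then have "0 \<le> v' j" for j using nonneg v'0[of j] by (cases "j = i") auto
      then have "quiver_variety Q m' l' (d, v') = proj_variety (covariants Q m' l' ?d ?v')"
        using d0 by (auto simp: quiver_variety_def not_less[symmetric])
      moreover have "isomorphic_varieties (proj_variety (covariants Q m' l' ?d ?v')) empty_variety"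
        using 1 size' nonneg nz(2) by (intro isomorphic_empty_if_large[where i = i]) (linarith, assumption)
      moreover have "quiver_variety Q m l (d, v) = empty_variety" using 1 by (intro quiver_variety_empty) auto
      ultimately show ?thesis using isomorphic_varieties_sym by metis
    next
      case 2
      then have "0 \<le> v j" for j using nonneg v0[of j] by (cases "j = i") auto
      then have "quiver_variety Q m l (d, v) = proj_variety (covariants Q m l ?d ?v)"
        using d0 by (auto simp: quiver_variety_def not_less[symmetric])
      moreover have "isomorphic_varieties (proj_variety (covariants Q m l ?d ?v)) empty_variety"
        using 2 size nonneg nz(1) by (intro isomorphic_empty_if_large[where i = i]) (linarith, assumption)
      moreover have "quiver_variety Q m' l' (d, v') = empty_variety" using 2 by (intro quiver_variety_empty) auto
      ultimately show ?thesis by simp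
    next
      case 3
      have "0 \<le> v j" "0 \<le> v' j" for j using 3 v0[of j] v'0[of j] by (cases "j = i"; simp)+
      then have qv: "quiver_variety Q m l (d, v) = proj_variety (covariants Q m l ?d ?v)"
        "quiver_variety Q m' l' (d, v') = proj_variety (covariants Q m' l' ?d ?v')"
        using d0 by (auto simp: quiver_variety_def not_less[symmetric])
      show ?thesis
      proof (cases "0 \<le> m i")
        case True
        interpret reflection Q m m' l l' ?d ?v ?v' i
        proof unfold_locales
          show "nat (v i) + nat (v' i) = star_size Q ?d ?v i" using size 3 by linarith
        qed (use True nz m' l' v'_off in simp_all)
        show ?thesis unfolding qv by (rule reflection_isomorphic)
      next
        case False
        interpret reflection Q m' m l' l ?d ?v' ?v i
        proof unfold_locales
          show "nat (v' i) + nat (v i) = star_size Q ?d ?v' i" using size' 3 by linarith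
          show "m j = m' j - cartan Q i j * m' i" "l j = l' j - of_int (cartan Q i j) * l' i" for j
            unfolding at m'[of j] l'[of j] by simp_all
        qed (use False nz v'_off at in simp_all)
        show ?thesis unfolding qv by (rule isomorphic_varieties_sym[OF reflection_isomorphic])
      qed
    qed
  qed
qed

end

section \<open>The Weyl group action on parameters\<close>

locale doubled_root_datum = quiver_root_datum Q R + quiver_double Q
  for Q :: "('i::finite, 'h) quiver" and R :: "('i, 'x::ab_group_add, 'y::ab_group_add) root_datum"
begin

abbreviation "W \<equiv> weyl_group R"
abbreviation "s \<equiv> simple_reflection R"

lemma simple_simple: "s i \<circ> s i = id"
  using simple_involution[OF Q] by (simp add: fun_eq_iff)

text \<open>
  The Weyl group described without inverses, for inductions that multiply by one simple reflection at a
  time.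
\<close>

inductive_set reflection_products :: "('x \<Rightarrow> 'x) set" where
  one: "id \<in> reflection_products"
| step: "\<sigma> \<in> reflection_products \<Longrightarrow> s i \<circ> \<sigma> \<in> reflection_products"

lemma reflection_products_comp:
  "\<sigma> \<in> reflection_products \<Longrightarrow> \<tau> \<in> reflection_products \<Longrightarrow> \<sigma> \<circ> \<tau> \<in> reflection_products"
proof (induction rule: reflection_products.induct)
  case one
  then show ?case unfolding id_o .
next
  case (step \<sigma> i)
  show ?case unfolding o_assoc[symmetric] by (rule reflection_products.step[OF step.IH[OF step.prems]])
qed

lemma reflection_products_inverse:
  "\<sigma> \<in> reflection_products \<Longrightarrow> \<exists>\<tau>\<in>reflection_products. \<sigma> \<circ> \<tau> = id \<and> \<tau> \<circ> \<sigma> = id"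
proof (induction rule: reflection_products.induct)
  case one
  show ?case by (intro bexI[of _ id] conjI id_o reflection_products.one)
next
  case (step \<sigma> i)
  then obtain \<tau> where \<tau>: "\<tau> \<in> reflection_products" "\<sigma> \<circ> \<tau> = id" "\<tau> \<circ> \<sigma> = id" by blast
  have "\<tau> \<circ> (s i \<circ> id) \<in> reflection_products"
    using \<tau>(1) by (intro reflection_products_comp reflection_products.intros)
  moreover have "(s i \<circ> \<sigma>) \<circ> (\<tau> \<circ> (s i \<circ> id)) = id" "(\<tau> \<circ> (s i \<circ> id)) \<circ> (s i \<circ> \<sigma>) = id"
    using \<tau>(2,3) simple_simple[of i] by (simp_all add: fun_eq_iff)
  ultimately show ?case by blast
qed

lemma weyl_group_eq_products: "W = reflection_products"
proof
  show "W \<subseteq> reflection_products"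
  proof
    fix \<sigma> assume "\<sigma> \<in> W"
    then show "\<sigma> \<in> reflection_products"
    proof induction
      case (simple i)
      show ?case using reflection_products.step[OF reflection_products.one, of i] unfolding o_id .
    next
      case (inverse \<sigma>)
      then obtain \<tau> where "\<tau> \<in> reflection_products" "\<sigma> \<circ> \<tau> = id" "\<tau> \<circ> \<sigma> = id"
        using reflection_products_inverse by blast
      then show ?case using inv_unique_comp[of \<sigma> \<tau>] by metis
    qed (rule reflection_products.one, rule reflection_products_comp)
  qed
  have "\<sigma> \<in> W" if "\<sigma> \<in> reflection_products" for \<sigma>
    using that
    by induction (rule weyl_group.id, rule weyl_group.comp[OF weyl_group.simple])
  then show "reflection_products \<subseteq> W" by blast
qed

lemma weyl_induct [consumes 1, case_names id step]:
  assumes "\<sigma> \<in> W" "P id" "\<And>\<sigma> i. \<sigma> \<in> W \<Longrightarrow> P \<sigma> \<Longrightarrow> P (s i \<circ> \<sigma>)"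
  shows "P \<sigma>"
  using assms(1) unfolding weyl_group_eq_products
  by induction (rule assms(2), rule assms(3)[unfolded weyl_group_eq_products])

lemma pairing_coroot_comb: "pairing R x (coroot_comb R u) = (\<Sum>j\<in>UNIV. u j * pairing R x (coroot R j))"
  by (simp add: coroot_comb_def Modules.additive.sum[OF pairing_right] pairing_zmult_right)

lemma coroot_comb_unit: "coroot_comb R (\<lambda>j. if j = i then 1 else 0) = coroot R i"
  by (simp add: coroot_comb_def if_distrib[of "\<lambda>k. zmult k _"] cong: if_cong)

text \<open>
  The transpose of an element of the Weyl group preserves the lattice spanned by the coroots.
\<close>

lemma ex_adjoint:
  assumes "\<sigma> \<in> W"
  shows "\<exists>u'. \<forall>x. pairing R (\<sigma> x) (coroot_comb R u) = pairing R x (coroot_comb R u')"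
  using assms
proof (induction arbitrary: u rule: weyl_induct)
  case (step \<sigma> i)
  let ?u = "\<lambda>j. u j - (if j = i then pairing R (root R i) (coroot_comb R u) else 0)"
  have "pairing R (s i y) (coroot_comb R u) = pairing R y (coroot_comb R ?u)" for y
  proof -
    have "pairing R y (coroot_comb R ?u) = pairing R y (coroot_comb R u) -
      (\<Sum>j\<in>UNIV. if j = i then pairing R (root R i) (coroot_comb R u) * pairing R y (coroot R j) else 0)"
      unfolding pairing_coroot_comb[of y] sum_subtractf[symmetric] by (intro sum.cong refl) (simp add: left_diff_distrib)
    then show ?thesis
      by (simp add: simple_reflection_def Modules.additive.diff[OF pairing_left] pairing_zmult_left mult.commute)
  qed
  then show ?case using step.IH[of ?u] by simp
qed auto

text \<open>
  By \<open>ex_adjoint\<close>, the class of \<open>\<sigma> x\<close> modulo the annihilator of the coroots depends on the class of \<open>x\<close> only, although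
  the fundamental weights need not span the weight lattice. This is what makes \<open>weight_action\<close>
  multiplicative.
\<close>

lemma pairing_weyl_coroot:
  assumes "\<sigma> \<in> W"
  shows "pairing R (\<sigma> x) (coroot R j) = (\<Sum>i\<in>UNIV. pairing R x (coroot R i) * pairing R (\<sigma> (fweight R i)) (coroot R j))"
proof -
  obtain u where u: "\<And>x. pairing R (\<sigma> x) (coroot R j) = pairing R x (coroot_comb R u)"
    using ex_adjoint[OF assms, of "\<lambda>k. if k = j then 1 else 0"] unfolding coroot_comb_unit by blast
  have "pairing R (fweight R i) (coroot_comb R u) = u i" for i
    by (simp add: pairing_coroot_comb pairing_fweight if_distrib cong: if_cong)
  then show ?thesis unfolding u pairing_coroot_comb[of x] by (simp add: mult.commute)
qed

lemma weight_action_id: "weight_action R id c = c" for c :: "'i \<Rightarrow> 'c::comm_ring_1"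
  by (simp add: weight_action_def fun_eq_iff pairing_fweight if_distrib cong: if_cong)

lemma weight_action_comp:
  fixes c :: "'i \<Rightarrow> 'c::comm_ring_1"
  assumes "\<sigma> \<in> W"
  shows "weight_action R (\<sigma> \<circ> \<tau>) c = weight_action R \<sigma> (weight_action R \<tau> c)"
proof
  fix j
  have "weight_action R (\<sigma> \<circ> \<tau>) c j = (\<Sum>k\<in>UNIV. \<Sum>i\<in>UNIV. c k *
     (of_int (pairing R (\<tau> (fweight R k)) (coroot R i)) * of_int (pairing R (\<sigma> (fweight R i)) (coroot R j))))"
    by (simp add: weight_action_def pairing_weyl_coroot[OF assms, of "\<tau> _"] sum_distrib_left)
  also have "\<dots> = weight_action R \<sigma> (weight_action R \<tau> c) j"
    unfolding weight_action_def by (subst sum.swap) (simp add: sum_distrib_right mult.assoc)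
  finally show "weight_action R (\<sigma> \<circ> \<tau>) c j = weight_action R \<sigma> (weight_action R \<tau> c) j" .
qed

lemma dot_action_id: "dot_action R id d v = v"
  by (rule root_comb_inject) (simp add: dot_action[OF Q weyl_group.id])

lemma dim_action_id: "dim_action R id dv = dv"
  by (cases dv) (simp only: dim_action_def dot_action_id split)

lemma dot_action_comp:
  assumes "\<sigma> \<in> W" "\<tau> \<in> W" shows "dot_action R (\<sigma> \<circ> \<tau>) d v = dot_action R \<sigma> d (dot_action R \<tau> d v)"
  by (rule root_comb_inject) (simp add: dot_action[OF Q] assms weyl_group.comp)

lemma sum_sources: "(\<Sum>h | h \<in> arrows Q \<and> tgt Q h = i. v (src Q h)) = (\<Sum>j\<in>UNIV. int (adj Q j i) * v j)" for v :: "'i \<Rightarrow> int"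
proof -
  let ?A = "{h. h \<in> arrows Q \<and> tgt Q h = i}"
  have "(\<Sum>h\<in>?A. v (src Q h)) = (\<Sum>j\<in>UNIV. \<Sum>h\<in>{h \<in> ?A. src Q h = j}. v (src Q h))"
    using finite_arrows by (subst sum.group) auto
  also have "\<dots> = (\<Sum>j\<in>UNIV. int (adj Q j i) * v j)"
  proof (rule sum.cong[OF refl])
    fix j
    have "{h \<in> ?A. src Q h = j} = {h \<in> arrows Q. src Q h = j \<and> tgt Q h = i}" by auto
    then show "(\<Sum>h\<in>{h \<in> ?A. src Q h = j}. v (src Q h)) = int (adj Q j i) * v j" by (simp add: adj_def)
  qed
  finally show ?thesis .
qed

lemma dot_action_simple:
  "j \<noteq> i \<Longrightarrow> dot_action R (s i) d v j = v j"
  "v i + dot_action R (s i) d v i = d i + (\<Sum>h | h \<in> arrows Q \<and> tgt Q h = i. v (src Q h))"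
proof -
  define c where "c = (\<Sum>j\<in>UNIV. v j * cartan Q j i) - d i"
  have "pairing R (root_comb R v - weight_comb R d) (coroot R i) = c"
    by (simp add: c_def root_comb_def weight_comb_def Modules.additive.diff[OF pairing_left]
        Modules.additive.sum[OF pairing_left] pairing_zmult_left pairing_root pairing_fweight if_distrib cong: if_cong)
  then have "root_comb R (dot_action R (s i) d v) = root_comb R v - zmult c (root R i)"
    by (simp add: dot_action[OF Q weyl_group.simple] simple_reflection_def)
  also have "\<dots> = root_comb R (\<lambda>j. v j - (if j = i then c else 0))"
    by (simp add: root_comb_def zmod.scale_left_diff_distrib sum_subtractf if_distrib[of "\<lambda>k. zmult k _"] cong: if_cong)
  finally have dot: "dot_action R (s i) d v = (\<lambda>j. v j - (if j = i then c else 0))" by (rule root_comb_inject)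
  show "j \<noteq> i \<Longrightarrow> dot_action R (s i) d v j = v j" by (simp add: dot)
  have "(\<Sum>j\<in>UNIV. v j * cartan Q j i) = (\<Sum>j\<in>UNIV. (if j = i then 2 * v j else 0) - int (adj Q j i) * v j)"
    by (intro sum.cong refl) (simp add: cartan_def algebra_simps)
  then show "v i + dot_action R (s i) d v i = d i + (\<Sum>h | h \<in> arrows Q \<and> tgt Q h = i. v (src Q h))"
    unfolding sum_sources by (simp add: dot c_def sum_subtractf)
qed

lemma dual_action_coroot:
  assumes "\<sigma> \<in> W"
  shows "pairing R x (dual_action R \<sigma> (coroot R i)) = pairing R (inv_into UNIV \<sigma> x) (coroot R i)"
proof -
  have "inv_into UNIV \<sigma> \<in> W" using assms by (rule weyl_group.inverse)
  then obtain u where u: "\<And>x. pairing R (inv_into UNIV \<sigma> x) (coroot R i) = pairing R x (coroot_comb R u)"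
    using ex_adjoint[of "inv_into UNIV \<sigma>" "\<lambda>k. if k = i then 1 else 0"] unfolding coroot_comb_unit by blast
  have "dual_action R \<sigma> (coroot R i) = coroot_comb R u"
    unfolding dual_action_def by (rule the_equality) (auto simp: u intro: pairing_nondeg)
  then show ?thesis by (simp add: u)
qed

text \<open>
  The coroot \<open>u'\<close> is the image of \<open>u\<close> under the dual action of the inverse of \<open>\<sigma>\<close>.
\<close>

lemma U_infinity_adjoint:
  assumes \<sigma>: "\<sigma> \<in> W" and u: "u \<in> U_infinity R"
    and u': "\<And>x. pairing R (\<sigma> x) (coroot_comb R u) = pairing R x (coroot_comb R u')"
  shows "u' \<in> U_infinity R"
proof -
  obtain i \<tau> where \<tau>: "\<tau> \<in> W" "coroot_comb R u = dual_action R \<tau> (coroot R i)"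
    using u by (auto simp: U_infinity_def)
  have bij: "bij \<sigma>" "bij \<tau>" using weyl_bij_additive[OF Q] \<sigma> \<tau> by blast+
  have W: "inv_into UNIV \<sigma> \<circ> \<tau> \<in> W" using \<sigma> \<tau> by (intro weyl_group.intros)
  have inv: "inv_into UNIV (inv_into UNIV \<sigma> \<circ> \<tau>) = inv_into UNIV \<tau> \<circ> \<sigma>"
    using bij by (simp add: o_inv_distrib bij_imp_bij_inv inv_inv_eq)
  have "coroot_comb R u' = dual_action R (inv_into UNIV \<sigma> \<circ> \<tau>) (coroot R i)"
  proof (rule pairing_nondeg)
    fix x
    have "pairing R x (coroot_comb R u') = pairing R (inv_into UNIV \<tau> (\<sigma> x)) (coroot R i)"
      using u'[of x] dual_action_coroot[OF \<tau>(1), of "\<sigma> x" i] \<tau>(2) by simp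
    then show "pairing R x (coroot_comb R u') = pairing R x (dual_action R (inv_into UNIV \<sigma> \<circ> \<tau>) (coroot R i))"
      unfolding dual_action_coroot[OF W] inv by simp
  qed
  then show ?thesis unfolding U_infinity_def using W by blast
qed

lemma weight_action_pairing:
  fixes c :: "'i \<Rightarrow> 'c::comm_ring_1"
  assumes "\<And>x. pairing R (\<sigma> x) (coroot_comb R u) = pairing R x (coroot_comb R u')"
  shows "(\<Sum>j\<in>UNIV. weight_action R \<sigma> c j * of_int (u j)) = (\<Sum>i\<in>UNIV. c i * of_int (u' i))"
proof -
  have "u' i = pairing R (\<sigma> (fweight R i)) (coroot_comb R u)" for i
    unfolding assms by (simp add: pairing_coroot_comb pairing_fweight if_distrib cong: if_cong)
  then have "(\<Sum>i\<in>UNIV. c i * of_int (u' i)) =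
     (\<Sum>i\<in>UNIV. \<Sum>j\<in>UNIV. c i * (of_int (u j) * of_int (pairing R (\<sigma> (fweight R i)) (coroot R j))))"
    by (simp add: pairing_coroot_comb sum_distrib_left)
  also have "\<dots> = (\<Sum>j\<in>UNIV. weight_action R \<sigma> c j * of_int (u j))"
    unfolding weight_action_def by (subst sum.swap) (simp add: sum_distrib_right mult.assoc mult.commute[of "of_int (u _)"])
  finally show ?thesis by simp
qed

lemma G2_stable:
  assumes "\<sigma> \<in> W" "(v, m, l) \<in> G2 R"
  shows "(v', weight_action R \<sigma> m, weight_action R \<sigma> l) \<in> G2 R"
proof (rule ccontr)
  assume "(v', weight_action R \<sigma> m, weight_action R \<sigma> l) \<notin> G2 R"
  then obtain u where u: "u \<in> U_infinity R" "(\<Sum>i\<in>UNIV. weight_action R \<sigma> l i * of_int (u i)) = 0"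
    "(\<Sum>i\<in>UNIV. weight_action R \<sigma> m i * u i) = 0" by (auto simp: G2_def hyperplanes_def)
  obtain u' where u': "\<And>x. pairing R (\<sigma> x) (coroot_comb R u) = pairing R x (coroot_comb R u')"
    using ex_adjoint[OF assms(1)] by blast
  have "(\<Sum>i\<in>UNIV. l i * of_int (u' i)) = 0" "(\<Sum>i\<in>UNIV. m i * u' i) = 0"
    using weight_action_pairing[OF u', of l] weight_action_pairing[OF u', of m] u(2,3) by simp_all
  then show False using U_infinity_adjoint[OF assms(1) u(1) u'] assms(2) by (auto simp: G2_def hyperplanes_def)
qed

lemma G1_stable:
  assumes "\<sigma> \<in> W" "(v, m, l) \<in> G1 Q R d"
  shows "(dot_action R \<sigma> d v, weight_action R \<sigma> m, weight_action R \<sigma> l) \<in> G1 Q R d"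
proof -
  have "(weight_action R \<tau> (weight_action R \<sigma> m), weight_action R \<tau> (weight_action R \<sigma> l))
      \<notin> hyperplanes (U_tilde Q (dot_action R \<tau> d (dot_action R \<sigma> d v)))" if "\<tau> \<in> W" for \<tau>
  proof -
    have "(weight_action R (\<tau> \<circ> \<sigma>) m, weight_action R (\<tau> \<circ> \<sigma>) l) \<notin> hyperplanes (U_tilde Q (dot_action R (\<tau> \<circ> \<sigma>) d v))"
      using assms(2) weyl_group.comp[OF that assms(1)] unfolding G1_def generic_finite_def by blast
    then show ?thesis
      unfolding weight_action_comp[OF that, of \<sigma> m] weight_action_comp[OF that, of \<sigma> l] dot_action_comp[OF that assms(1)] .
  qed
  then show ?thesis by (auto simp: G1_def generic_finite_def)
qed

lemma K_const_positive: "1 \<le> K_const Q"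
proof -
  have "finite ((\<lambda>(i, j). (adj Q i j)\<^sup>2) ` UNIV)" by simp
  moreover have "{(adj Q i j)\<^sup>2 | i j. True} = (\<lambda>(i, j). (adj Q i j)\<^sup>2) ` UNIV" by auto
  ultimately show ?thesis unfolding K_const_def by simp
qed

lemma unit_in_U_tilde:
  assumes "0 < v i" "\<And>j. 0 \<le> v j"
  shows "(\<lambda>j. if j = i then 1 else 0) \<in> U_tilde Q v"
proof -
  have "1 * 1 \<le> int (K_const Q) * v i" using K_const_positive assms(1) by (intro mult_mono) auto
  then show ?thesis using assms(2) by (auto simp: U_tilde_def fun_eq_iff)
qed

lemma unit_hyperplane:
  "(\<lambda>j. if j = i then 1 else 0) \<in> A \<Longrightarrow> m i = 0 \<Longrightarrow> l i = 0 \<Longrightarrow> (m, l) \<in> hyperplanes A"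
  unfolding hyperplanes_def by (auto intro!: bexI[of _ "\<lambda>j. if j = i then 1 else 0"] simp: if_distrib cong: if_cong)

text \<open>
  The hyperplane of the \<open>i\<close>-th coroot is among the excluded ones: always for \<open>G2\<close>, and for \<open>G1\<close> as
  soon as the dimension at \<open>i\<close> before or after the reflection is positive and the other dimensions are
  non-negative.
\<close>

lemma G_generic:
  assumes "(v, m, l) \<in> G1 Q R d \<or> (v, m, l) \<in> G2 R"
  shows "m i \<noteq> 0 \<or> l i \<noteq> 0 \<or> v i \<le> 0 \<and> dot_action R (s i) d v i \<le> 0 \<or> (\<exists>j. j \<noteq> i \<and> v j < 0)"
  using assms
proof
  assume "(v, m, l) \<in> G2 R"
  moreover have "(\<lambda>j. if j = i then 1 else 0) \<in> U_infinity R"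
  proof -
    have "coroot R i = dual_action R id (coroot R i)"
      by (rule pairing_nondeg) (simp add: dual_action_coroot[OF weyl_group.id])
    then show ?thesis unfolding U_infinity_def using weyl_group.id coroot_comb_unit by fastforce
  qed
  ultimately show ?thesis using unit_hyperplane[of i "U_infinity R" m l] by (auto simp: G2_def)
next
  assume G: "(v, m, l) \<in> G1 Q R d"
  let ?v = "dot_action R (s i) d v"
  show ?thesis
  proof (rule ccontr)
    assume neg: "\<not> ?thesis"
    then have ml: "m i = 0" "l i = 0" and off: "\<And>j. j \<noteq> i \<Longrightarrow> 0 \<le> v j" by (auto simp: not_less)
    have generic: "(weight_action R \<sigma> m, weight_action R \<sigma> l) \<notin> hyperplanes (U_tilde Q (dot_action R \<sigma> d v))"
      if "\<sigma> \<in> W" for \<sigma> using G that by (auto simp: G1_def generic_finite_def)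
    have ml': "weight_action R (s i) m i = 0" "weight_action R (s i) l i = 0"
      using ml weight_action_simple[of i m i] weight_action_simple[of i l i] by simp_all
    from neg have "0 < v i \<or> 0 < ?v i" by (auto simp: not_le)
    then show False
    proof
      assume "0 < v i"
      then have "(\<lambda>j. if j = i then 1 else 0) \<in> U_tilde Q v" using off by (intro unit_in_U_tilde) (auto, metis less_imp_le)
      from unit_hyperplane[OF this, of m l] ml show False
        using generic[OF weyl_group.id] by (simp add: weight_action_id dot_action_id)
    next
      assume *: "0 < ?v i"
      have "0 \<le> ?v j" for j using * off[of j] dot_action_simple(1)[of j i d v] by (cases "j = i") auto
      with * have "(\<lambda>j. if j = i then 1 else 0) \<in> U_tilde Q ?v" by (intro unit_in_U_tilde) auto
      from unit_hyperplane[OF this, of "weight_action R (s i) m" "weight_action R (s i) l"] ml' show False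
        using generic[OF weyl_group.simple[of R i]] by simp
    qed
  qed
qed

lemma quiver_variety_weyl:
  assumes G: "\<G> = (\<lambda>d. G1 Q R d) \<or> \<G> = (\<lambda>d. G2 R)" and \<sigma>: "\<sigma> \<in> W" and vml: "(v, m, l) \<in> \<G> d"
  shows "(dot_action R \<sigma> d v, weight_action R \<sigma> m, weight_action R \<sigma> l) \<in> \<G> d \<and>
    isomorphic_varieties (quiver_variety Q m l (d, v))
      (quiver_variety Q (weight_action R \<sigma> m) (weight_action R \<sigma> l) (dim_action R \<sigma> (d, v)))"
  using \<sigma>
proof (induction rule: weyl_induct)
  case id
  show ?case
    unfolding weight_action_id dot_action_id dim_action_id using vml isomorphic_varieties_refl by blast
next
  case (step \<sigma> i)
  let ?v = "dot_action R \<sigma> d v" and ?m = "weight_action R \<sigma> m" and ?l = "weight_action R \<sigma> l"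
  have IH: "(?v, ?m, ?l) \<in> \<G> d" "isomorphic_varieties (quiver_variety Q m l (d, v)) (quiver_variety Q ?m ?l (d, ?v))"
    using step.IH by (simp_all add: dim_action_def)
  have stable: "(dot_action R (s i) d ?v, weight_action R (s i) ?m, weight_action R (s i) ?l) \<in> \<G> d"
    using G IH(1) G1_stable[OF weyl_group.simple] G2_stable[OF weyl_group.simple] by auto
  have "(?v, ?m, ?l) \<in> G1 Q R d \<or> (?v, ?m, ?l) \<in> G2 R" using G IH(1) by auto
  from G_generic[OF this, of i]
  have "isomorphic_varieties (quiver_variety Q ?m ?l (d, ?v))
     (quiver_variety Q (weight_action R (s i) ?m) (weight_action R (s i) ?l) (d, dot_action R (s i) d ?v))"
    by (intro quiver_variety_reflection[of i] dot_action_simple) (simp_all add: weight_action_simple)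
  then show ?case
    unfolding dim_action_def split dot_action_comp[OF weyl_group.simple step.hyps]
      weight_action_comp[OF weyl_group.simple, of i \<sigma> m] weight_action_comp[OF weyl_group.simple, of i \<sigma> l]
    using stable isomorphic_varieties_trans[OF IH(2)] by blast
qed

end

section \<open>Coherent families of isomorphisms\<close>

text \<open>
  The values \<open>\<theta> x\<close> of the auxiliary family depend on \<open>x\<close> only, so in a composition the isomorphism to
  the base point and its inverse cancel in the middle.
\<close>

lemma coherent_isomorphisms:
  fixes V :: "'p \<Rightarrow> 'q variety" and act :: "('x \<Rightarrow> 'x) \<Rightarrow> 'p \<Rightarrow> 'p"
  assumes comp: "\<And>\<sigma> \<tau> x. \<sigma> \<in> W \<Longrightarrow> \<tau> \<in> W \<Longrightarrow> \<tau> \<circ> \<sigma> \<in> W \<and> act (\<tau> \<circ> \<sigma>) x = act \<tau> (act \<sigma> x)"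
    and id: "id \<in> W" "\<And>x. act id x = x"
    and inverse: "\<And>\<sigma>. \<sigma> \<in> W \<Longrightarrow> \<exists>\<tau>\<in>W. \<tau> \<circ> \<sigma> = id"
    and iso: "\<And>x \<sigma>. x \<in> S \<Longrightarrow> \<sigma> \<in> W \<Longrightarrow> isomorphic_varieties (V x) (V (act \<sigma> x))"
  shows "\<exists>\<Phi>. \<forall>x\<in>S. \<forall>\<sigma>\<in>W. variety_isomorphism (V x) (V (act \<sigma> x)) (\<Phi> \<sigma> x) \<and>
    (\<forall>\<tau>\<in>W. \<forall>p\<in>topspace (zariski (V x)). \<Phi> \<tau> (act \<sigma> x) (\<Phi> \<sigma> x p) = \<Phi> (\<tau> \<circ> \<sigma>) x p)"
proof -
  define orbit where "orbit = (\<lambda>x. {act \<sigma> x | \<sigma>. \<sigma> \<in> W})"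
  define base where "base = (\<lambda>x. SOME y. y \<in> orbit x)"
  have orbit_act: "orbit (act \<sigma> x) = orbit x" if \<sigma>: "\<sigma> \<in> W" for \<sigma> x
  proof
    show "orbit (act \<sigma> x) \<subseteq> orbit x" unfolding orbit_def using comp[OF \<sigma>] by clarify metis
    obtain \<tau> where \<tau>: "\<tau> \<in> W" "\<tau> \<circ> \<sigma> = id" using inverse[OF \<sigma>] by blast
    have x: "x = act \<tau> (act \<sigma> x)" using comp[OF \<sigma> \<tau>(1), of x] unfolding \<tau>(2) id(2) by simp
    have "act \<rho> x \<in> orbit (act \<sigma> x)" if "\<rho> \<in> W" for \<rho>
      using comp[OF \<tau>(1) that, of "act \<sigma> x"] x[symmetric] unfolding orbit_def mem_Collect_eq by metis
    then show "orbit x \<subseteq> orbit (act \<sigma> x)" unfolding orbit_def by blast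
  qed
  have base: "base x \<in> orbit x" for x
  proof -
    have "act id x \<in> orbit x" unfolding orbit_def using id(1) by blast
    then show ?thesis unfolding base_def by (rule someI)
  qed
  define T where "T = {act \<sigma> x | x \<sigma>. x \<in> S \<and> \<sigma> \<in> W}"
  define to_base where "to_base = (\<lambda>y f. variety_isomorphism (V y) (V (base y)) (fst f) \<and>
     variety_isomorphism (V (base y)) (V y) (snd f) \<and>
     (\<forall>p\<in>topspace (zariski (V (base y))). fst f (snd f p) = p))"
  have "\<exists>f. to_base y f" if y: "y \<in> T" for y
  proof -
    obtain x \<sigma> where x: "x \<in> S" "\<sigma> \<in> W" "y = act \<sigma> x" using y unfolding T_def by blast
    have "base y \<in> orbit x" using base[of y] unfolding x(3) orbit_act[OF x(2)] .
    then obtain \<rho> where \<rho>: "\<rho> \<in> W" "base y = act \<rho> x" unfolding orbit_def by blast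
    have "isomorphic_varieties (V y) (V (base y))"
      unfolding \<rho>(2) unfolding x(3)
      by (rule isomorphic_varieties_trans[OF isomorphic_varieties_sym[OF iso[OF x(1,2)]] iso[OF x(1) \<rho>(1)]])
    then obtain \<theta> \<psi> where "variety_isomorphism (V y) (V (base y)) \<theta>" "variety_morphism (V (base y)) (V y) \<psi>"
      "\<forall>p\<in>topspace (zariski (V y)). \<psi> (\<theta> p) = p" "\<forall>p\<in>topspace (zariski (V (base y))). \<theta> (\<psi> p) = p"
      unfolding isomorphic_varieties_def variety_isomorphism_def by auto
    then have "to_base y (\<theta>, \<psi>)" unfolding to_base_def variety_isomorphism_def by auto
    then show ?thesis by blast
  qed
  then have "\<forall>y\<in>T. \<exists>f. to_base y f" by blast
  from bchoice[OF this] obtain F where F: "\<And>y. y \<in> T \<Longrightarrow> to_base y (F y)" by blast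
  define \<theta> \<psi> where "\<theta> = (\<lambda>y. fst (F y))" and "\<psi> = (\<lambda>y. snd (F y))"
  have to_iso: "variety_isomorphism (V y) (V (base y)) (\<theta> y)"
    and from_iso: "variety_isomorphism (V (base y)) (V y) (\<psi> y)"
    and inv: "p \<in> topspace (zariski (V (base y))) \<Longrightarrow> \<theta> y (\<psi> y p) = p" if "y \<in> T" for y p
    using F[OF that] unfolding to_base_def \<theta>_def \<psi>_def by blast+
  define \<Phi> where "\<Phi> = (\<lambda>\<sigma> x. \<psi> (act \<sigma> x) \<circ> \<theta> x)"
  \<comment> \<open>The base point is chosen from the orbit as a set, hence common to all its points.\<close>
  have base_act: "base (act \<sigma> x) = base x" if "\<sigma> \<in> W" for \<sigma> x
    unfolding base_def orbit_act[OF that] ..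
  have "variety_isomorphism (V x) (V (act \<sigma> x)) (\<Phi> \<sigma> x) \<and>
    (\<forall>\<tau>\<in>W. \<forall>p\<in>topspace (zariski (V x)). \<Phi> \<tau> (act \<sigma> x) (\<Phi> \<sigma> x p) = \<Phi> (\<tau> \<circ> \<sigma>) x p)"
    if x: "x \<in> S" and \<sigma>: "\<sigma> \<in> W" for x \<sigma>
  proof -
    have "act id x \<in> T" unfolding T_def using x id(1) by blast
    then have T: "x \<in> T" "act \<sigma> x \<in> T" unfolding id(2) using x \<sigma> T_def by blast+
    have \<psi>: "variety_isomorphism (V (base x)) (V (act \<sigma> x)) (\<psi> (act \<sigma> x))"
      using from_iso[OF T(2)] unfolding base_act[OF \<sigma>] .
    have "variety_isomorphism (V x) (V (act \<sigma> x)) (\<Phi> \<sigma> x)"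
      unfolding \<Phi>_def by (rule variety_isomorphism_comp[OF to_iso[OF T(1)] \<psi>])
    moreover have "\<Phi> \<tau> (act \<sigma> x) (\<Phi> \<sigma> x p) = \<Phi> (\<tau> \<circ> \<sigma>) x p"
      if \<tau>: "\<tau> \<in> W" and p: "p \<in> topspace (zariski (V x))" for \<tau> p
    proof -
      have "\<theta> x p \<in> topspace (zariski (V (base x)))"
        using to_iso[OF T(1)] p variety_morphism_topspace unfolding variety_isomorphism_def by metis
      then have "\<theta> (act \<sigma> x) (\<psi> (act \<sigma> x) (\<theta> x p)) = \<theta> x p" using inv[OF T(2)] unfolding base_act[OF \<sigma>] by blast
      moreover have "act (\<tau> \<circ> \<sigma>) x = act \<tau> (act \<sigma> x)" using comp[OF \<sigma> \<tau>] by blast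
      ultimately show ?thesis by (simp only: \<Phi>_def o_apply)
    qed
    ultimately show ?thesis by blast
  qed
  then show ?thesis by blast
qed

theorem proposition32:
  fixes Q :: "('i::finite, 'h) quiver"
    and R :: "('i, 'x::ab_group_add, 'y::ab_group_add) root_datum"
    and \<G> :: "('i \<Rightarrow> int) \<Rightarrow> (('i \<Rightarrow> int) \<times> ('i \<Rightarrow> int) \<times> ('i \<Rightarrow> complex)) set"
  assumes "double_quiver Q"
    and "is_root_datum Q R"
    and "\<G> = (\<lambda>d. G1 Q R d) \<or> \<G> = (\<lambda>d. G2 R)"
  shows "\<exists>\<Phi>. \<forall>d v. \<forall>\<sigma>\<in>weyl_group R. \<forall>m l. (v, m, l) \<in> \<G> d \<longrightarrow>
      variety_isomorphism
        (quiver_variety Q m l (d, v))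
        (quiver_variety Q (weight_action R \<sigma> m) (weight_action R \<sigma> l) (dim_action R \<sigma> (d, v)))
        (\<Phi> \<sigma> m l (d, v)) \<and>
      (\<forall>\<tau>\<in>weyl_group R. \<forall>p\<in>topspace (zariski (quiver_variety Q m l (d, v))).
        \<Phi> \<tau> (weight_action R \<sigma> m) (weight_action R \<sigma> l) (dim_action R \<sigma> (d, v))
          (\<Phi> \<sigma> m l (d, v) p)
        = \<Phi> (\<tau> \<circ> \<sigma>) m l (d, v) p)"
proof -
  interpret quiver_root_datum Q R by unfold_locales (rule assms(2))
  interpret quiver_double Q by unfold_locales (rule assms(1))
  interpret doubled_root_datum Q R by unfold_locales
  define act :: "('x \<Rightarrow> 'x) \<Rightarrow> ('i \<Rightarrow> int) \<times> ('i \<Rightarrow> complex) \<times> ('i \<Rightarrow> int) \<times> ('i \<Rightarrow> int) \<Rightarrow> _"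
    where "act = (\<lambda>\<sigma> (m, l, d, v). (weight_action R \<sigma> m, weight_action R \<sigma> l, dim_action R \<sigma> (d, v)))"
  define V where "V = (\<lambda>(m, l, dv). quiver_variety Q m l dv)"
  have "\<exists>\<Phi>. \<forall>x\<in>{(m, l, d, v). (v, m, l) \<in> \<G> d}. \<forall>\<sigma>\<in>W. variety_isomorphism (V x) (V (act \<sigma> x)) (\<Phi> \<sigma> x) \<and>
    (\<forall>\<tau>\<in>W. \<forall>p\<in>topspace (zariski (V x)). \<Phi> \<tau> (act \<sigma> x) (\<Phi> \<sigma> x p) = \<Phi> (\<tau> \<circ> \<sigma>) x p)"
  proof (rule coherent_isomorphisms)
    show "\<tau> \<circ> \<sigma> \<in> W \<and> act (\<tau> \<circ> \<sigma>) x = act \<tau> (act \<sigma> x)" if "\<sigma> \<in> W" "\<tau> \<in> W" for \<sigma> \<tau> x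
      using weyl_group.comp[OF that(2,1)]
      by (cases x) (simp only: act_def dim_action_def split weight_action_comp[OF that(2)] dot_action_comp[OF that(2,1)])
    show "id \<in> W" by (rule weyl_group.id)
    show "act id x = x" for x
      by (cases x) (simp only: act_def weight_action_id dim_action_id split)
    show "\<exists>\<tau>\<in>W. \<tau> \<circ> \<sigma> = id" if "\<sigma> \<in> W" for \<sigma>
      using weyl_group.inverse[OF that] weyl_bij_additive[OF assms(1) that] by (metis bij_is_inj inv_o_cancel)
    show "isomorphic_varieties (V x) (V (act \<sigma> x))" if "x \<in> {(m, l, d, v). (v, m, l) \<in> \<G> d}" "\<sigma> \<in> W" for x \<sigma>
      using that quiver_variety_weyl[OF assms(3) that(2)] by (auto simp: V_def act_def)
  qed
  then obtain \<Phi> where \<Phi>: "\<forall>x\<in>{(m, l, d, v). (v, m, l) \<in> \<G> d}. \<forall>\<sigma>\<in>W. variety_isomorphism (V x) (V (act \<sigma> x)) (\<Phi> \<sigma> x) \<and>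
    (\<forall>\<tau>\<in>W. \<forall>p\<in>topspace (zariski (V x)). \<Phi> \<tau> (act \<sigma> x) (\<Phi> \<sigma> x p) = \<Phi> (\<tau> \<circ> \<sigma>) x p)" by blast
  show ?thesis
  proof (rule exI[of _ "\<lambda>\<sigma> m l dv. \<Phi> \<sigma> (m, l, dv)"], intro allI ballI impI)
    fix d v \<sigma> m l assume \<sigma>: "\<sigma> \<in> W" and G: "(v, m, l) \<in> \<G> d"
    have "(m, l, d, v) \<in> {(m, l, d, v). (v, m, l) \<in> \<G> d}" using G by simp
    from bspec[OF bspec[OF \<Phi> this] \<sigma>]
    show "variety_isomorphism (quiver_variety Q m l (d, v))
        (quiver_variety Q (weight_action R \<sigma> m) (weight_action R \<sigma> l) (dim_action R \<sigma> (d, v)))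
        (\<Phi> \<sigma> (m, l, d, v)) \<and>
      (\<forall>\<tau>\<in>W. \<forall>p\<in>topspace (zariski (quiver_variety Q m l (d, v))).
        \<Phi> \<tau> (weight_action R \<sigma> m, weight_action R \<sigma> l, dim_action R \<sigma> (d, v)) (\<Phi> \<sigma> (m, l, d, v) p)
        = \<Phi> (\<tau> \<circ> \<sigma>) (m, l, d, v) p)"
      by (simp add: V_def act_def)
  qed
qed

end
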